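(* For $m=4,5$ let $\mathfrak{k}_m=\mathcal{L}_m^\perp\cap\mathfrak{p}_m\subset\mathfrak p_m$, where $\mathcal{L}_m^\perp\subset U\mathfrak p_m$ is the joint kernel of the formal polylogs. Then $$\mathfrak{k}_4 = \mathbb{C} X_{\beta \omega}, \qquad \mathfrak{k}_5 = \mathbb{C} X_{\beta \omega} \oplus [\lambda, \lambda] \oplus s(\mathfrak{p}_4),$$ where $\lambda \subset \mathfrak{f}_3$ is the Lie ideal of the free Lie algebra $\mathfrak f_3=\mathfrak f(X_{1\beta},X_{2\beta},X_{\beta\omega})\subset\mathfrak p_5$ spanned by Lie words containing both $X_{1\beta}$ and $X_{2\beta}$.
   Context: The ground field is $\mathbb{C}$; $n\ge1$, $m=n+3$, $\mathcal S=\{\alpha,1,\dots,n,\beta,\omega\}$ (so $n=1$ for $m=4$ and $n=2$ for $m=5$). Lie algebras. $\mathfrak{p}_m$ is the Lie algebra with generators $X_{ab}=X_{ba}$ ($a\ne b$ in $\mathcal S$) and relations $\sum_{b\ne a}X_{ab}=0$ for each $a\in\mathcal S$, and $[X_{ab},X_{cd}]=0$ for $a,b,c,d$ all distinct. It is graded with $\deg X_{ab}=1$; a basis of its degree-one part is $X_{\alpha i},X_{i\beta}$ ($1\le i\le n$), $X_{ij}$ ($1\le i<j\le n$). $\mathfrak{p}_{m-1}$ is defined in the same way with index set $\mathcal S\setminus\{\beta\}=\{\alpha,1,\dots,n,\omega\}$. The map $\pi_\beta:\mathfrak p_m\to\mathfrak p_{m-1}$ sends $X_{\beta v}\mapsto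 0$ and the other generators to the generators of the same name. Its kernel $\mathfrak f_{m-2}=\mathfrak f_{n+1}$ is the free Lie algebra on $X_{1\beta},\dots,X_{n\beta},X_{\beta\omega}$. $\pi_\beta$ has a Lie algebra section $s:\mathfrak{p}_{m-1}\to\mathfrak{p}_m$ determined by $s(X_{\alpha i})=X_{\alpha i}$ ($1\le i\le n-1$), $s(X_{ij})=X_{ij}$ ($1\le i<j\le n$). $U\mathfrak g$ is the universal enveloping algebra, $(U\mathfrak{p}_m)^*$ is the graded dual, and $\varepsilon\in(U\mathfrak p_m)^*$ is the counit. Polylogarithms. Use coordinates $(x_1,\dots,x_n)$, $z_i=x_ix_{i+1}\cdots x_n$, $z_\beta=1$, and $\mathcal D=\{|x_i|<1\ \forall i\}$. For $N\ge 0$, $a=(a_1,\dots,a_N)\in\mathbb Z_{\ge1}^N$ and a non-decreasing $\kappa:\{1,\dots,N\}\to\{1,\dots,n\}$ put $\kappa(N+1):=\beta$, $y_{\kappa,i}=z_{\kappa(i)}/z_{\kappa(i+1)}$ and $$L_{a,\kappa}(x_1,\dots,x_n)=\sum_{0<k_1<\dots<k_N}\frac{y_{\kappa,1}^{k_1}\cdots y_{\kappa,N}^{k_N}}{k_1^{a_1}\cdots k_N^{a_N}},$$ with $L_\emptyset=1$ for $N=0$. Formal polylogs. For $\varphi\in(U\mathfrak p_m)^*$ and $X\in\mathfrak p_m$ of degree one let $\varphi_X(u):=\varphi(Xu)$. Let $\iota:(U\mathfrak p_m)^*\to\mathcal O(\mathcal D)[\log x_1,\dots,\log x_n]$ be the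 (Chen) iterated integral map from the tangential base point at $x=0$ in direction $(1,\dots,1)$, i.e. the unique linear map with $\iota(\varepsilon)=1$, $$d\,\iota(\varphi)=\sum_{i=1}^n\Big(\iota(\varphi_{X_{\alpha i}})\frac{dz_i}{z_i}+\iota(\varphi_{X_{i\beta}})\frac{dz_i}{z_i-1}\Big)+\sum_{i<j}\iota(\varphi_{X_{ij}})\frac{d(z_i-z_j)}{z_i-z_j},$$ and such that for $\varphi$ homogeneous of positive degree the coefficient of $(\log x_1)^0\cdots(\log x_n)^0$ in $\iota(\varphi)$ vanishes at $x=0$. It is known that $\iota$ is injective and that every $L_{a,\kappa}$ is in its image. The formal polylog $l_{a,\kappa}\in(U\mathfrak p_m)^*$ is the unique element with $\iota(l_{a,\kappa})=L_{a,\kappa}$ (so $l_\emptyset=\varepsilon$). $\mathcal L_m\subset(U\mathfrak p_m)^*$ is the span of all $l_{a,\kappa}$ ($N\ge0$), and $\mathcal L_m^\perp=\{u\in U\mathfrak p_m: l(u)=0\ \forall l\in\mathcal L_m\}$. *)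

theory Defs
  imports "HOL-Analysis.Analysis" "HOL-Library.Function_Algebras"
begin

section \<open>Complex vector spaces, Lie algebras and associative algebras\<close>

class cvector = ab_group_add +
  fixes scaleC :: "complex \<Rightarrow> 'a \<Rightarrow> 'a" (infixr "*\<^sub>C" 75)
  assumes scaleC_add_right: "a *\<^sub>C (x + y) = a *\<^sub>C x + a *\<^sub>C y"
    and scaleC_add_left: "(a + b) *\<^sub>C x = a *\<^sub>C x + b *\<^sub>C x"
    and scaleC_scaleC: "a *\<^sub>C b *\<^sub>C x = (a * b) *\<^sub>C x"
    and scaleC_one: "1 *\<^sub>C x = x"

global_interpretation cvec: vector_space "scaleC :: complex \<Rightarrow> 'a \<Rightarrow> 'a::cvector"
  by unfold_locales (rule scaleC_add_right scaleC_add_left scaleC_scaleC scaleC_one)+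

instantiation complex :: cvector
begin
definition scaleC_complex :: "complex \<Rightarrow> complex \<Rightarrow> complex" where "scaleC_complex a x = a * x"
instance by standard (simp_all add: scaleC_complex_def algebra_simps)
end

instantiation "fun" :: (type, cvector) cvector
begin
definition scaleC_fun :: "complex \<Rightarrow> ('a \<Rightarrow> 'b) \<Rightarrow> 'a \<Rightarrow> 'b" where "scaleC_fun a f = (\<lambda>x. a *\<^sub>C f x)"
instance
  by standard (simp_all add: scaleC_fun_def plus_fun_def fun_eq_iff
      scaleC_add_right scaleC_add_left scaleC_scaleC scaleC_one)
end

class lie_algebra = cvector +
  fixes bracket :: "'a \<Rightarrow> 'a \<Rightarrow> 'a"
  assumes bracket_add_left: "bracket (x + y) z = bracket x z + bracket y z"
    and bracket_add_right: "bracket x (y + z) = bracket x y + bracket x z"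
    and bracket_scaleC_left: "bracket (a *\<^sub>C x) y = a *\<^sub>C bracket x y"
    and bracket_scaleC_right: "bracket x (a *\<^sub>C y) = a *\<^sub>C bracket x y"
    and bracket_self: "bracket x x = 0"
    and jacobi: "bracket x (bracket y z) + bracket y (bracket z x) + bracket z (bracket x y) = 0"

class calgebra_1 = cvector + ring_1 +
  assumes mult_scaleC_left: "(a *\<^sub>C x) * y = a *\<^sub>C (x * y)"
    and mult_scaleC_right: "x * (a *\<^sub>C y) = a *\<^sub>C (x * y)"

definition clinear :: "('a::cvector \<Rightarrow> 'b::cvector) \<Rightarrow> bool" where
  "clinear = Vector_Spaces.linear scaleC scaleC"

definition lie_hom :: "('a::lie_algebra \<Rightarrow> 'b::lie_algebra) \<Rightarrow> bool" where
  "lie_hom f \<longleftrightarrow> clinear f \<and> (\<forall>x y. f (bracket x y) = bracket (f x) (f y))"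

definition bracket_space :: "'a::lie_algebra set \<Rightarrow> 'a set \<Rightarrow> 'a set" where
  "bracket_space A B = cvec.span {bracket x y | x y. x \<in> A \<and> y \<in> B}"

definition is_direct_sum3 :: "'a::cvector set \<Rightarrow> 'a set \<Rightarrow> 'a set \<Rightarrow> 'a set \<Rightarrow> bool" where
  "is_direct_sum3 V A B C \<longleftrightarrow>
     cvec.subspace A \<and> cvec.subspace B \<and> cvec.subspace C \<and>
     V = {a + b + c | a b c. a \<in> A \<and> b \<in> B \<and> c \<in> C} \<and>
     (\<forall>a\<in>A. \<forall>b\<in>B. \<forall>c\<in>C. a + b + c = 0 \<longrightarrow> a = 0 \<and> b = 0 \<and> c = 0)"

datatype 'l lie_word = Letter 'l | Word_Br "'l lie_word" "'l lie_word"

primrec eval_word :: "('l \<Rightarrow> 'a::lie_algebra) \<Rightarrow> 'l lie_word \<Rightarrow> 'a" where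
  "eval_word f (Letter l) = f l"
| "eval_word f (Word_Br v w) = bracket (eval_word f v) (eval_word f w)"


section \<open>The Lie algebra on generators \<open>X\<^sub>a\<^sub>b\<close>\<close>

text \<open>
  The Lie algebra presented by generators and relations: formal Lie expressions in the generators,
  modulo the least congruence containing the Lie algebra axioms and the relations.
  The index set is the type \<^typ>\<open>'v\<close>, meant to be finite. It is convenient to have
  generators \<open>X\<^sub>a\<^sub>a\<close> as well; these are set to zero.
\<close>

datatype 'v lie_term =
    TGen 'v 'v
  | TZero
  | TAdd "'v lie_term" "'v lie_term"
  | TScale complex "'v lie_term"
  | TBr "'v lie_term" "'v lie_term"

inductive braid_eq :: "'v lie_term \<Rightarrow> 'v lie_term \<Rightarrow> bool" where
  refl: "braid_eq s s"
| sym: "braid_eq s t \<Longrightarrow> braid_eq t s"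
| trans: "braid_eq s t \<Longrightarrow> braid_eq t u \<Longrightarrow> braid_eq s u"
| cong_add: "braid_eq s s' \<Longrightarrow> braid_eq t t' \<Longrightarrow> braid_eq (TAdd s t) (TAdd s' t')"
| cong_scale: "braid_eq s s' \<Longrightarrow> braid_eq (TScale c s) (TScale c s')"
| cong_br: "braid_eq s s' \<Longrightarrow> braid_eq t t' \<Longrightarrow> braid_eq (TBr s t) (TBr s' t')"
| add_assoc: "braid_eq (TAdd (TAdd s t) u) (TAdd s (TAdd t u))"
| add_comm: "braid_eq (TAdd s t) (TAdd t s)"
| add_zero: "braid_eq (TAdd TZero s) s"
| add_neg: "braid_eq (TAdd (TScale (-1) s) s) TZero"
| scale_add: "braid_eq (TScale c (TAdd s t)) (TAdd (TScale c s) (TScale c t))"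
| add_scale: "braid_eq (TScale (c + d) s) (TAdd (TScale c s) (TScale d s))"
| scale_scale: "braid_eq (TScale c (TScale d s)) (TScale (c * d) s)"
| scale_one: "braid_eq (TScale 1 s) s"
| br_add_left: "braid_eq (TBr (TAdd s t) u) (TAdd (TBr s u) (TBr t u))"
| br_add_right: "braid_eq (TBr s (TAdd t u)) (TAdd (TBr s t) (TBr s u))"
| br_scale_left: "braid_eq (TBr (TScale c s) t) (TScale c (TBr s t))"
| br_scale_right: "braid_eq (TBr s (TScale c t)) (TScale c (TBr s t))"
| br_self: "braid_eq (TBr s s) TZero"
| br_jacobi: "braid_eq (TAdd (TAdd (TBr s (TBr t u)) (TBr t (TBr u s))) (TBr u (TBr s t))) TZero"
| gen_diag: "braid_eq (TGen a a) TZero"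
| gen_sym: "braid_eq (TGen a b) (TGen b a)"
| gen_sum: "distinct bs \<Longrightarrow> set bs = UNIV - {a} \<Longrightarrow>
    braid_eq (foldr (\<lambda>b. TAdd (TGen a b)) bs TZero) TZero"
| gen_comm: "distinct [a, b, c, d] \<Longrightarrow> braid_eq (TBr (TGen a b) (TGen c d)) TZero"

quotient_type 'v braid_lie = "'v lie_term" / braid_eq
  by (intro equivpI reflpI sympI transpI) (auto intro: braid_eq.intros)

lift_definition gen :: "'v \<Rightarrow> 'v \<Rightarrow> 'v braid_lie" is TGen .

instantiation braid_lie :: (type) lie_algebra
begin
lift_definition zero_braid_lie :: "'a braid_lie" is TZero .
lift_definition plus_braid_lie :: "'a braid_lie \<Rightarrow> 'a braid_lie \<Rightarrow> 'a braid_lie" is TAdd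
  by (rule braid_eq.cong_add)
lift_definition uminus_braid_lie :: "'a braid_lie \<Rightarrow> 'a braid_lie" is "TScale (-1)"
  by (rule braid_eq.cong_scale)
lift_definition minus_braid_lie :: "'a braid_lie \<Rightarrow> 'a braid_lie \<Rightarrow> 'a braid_lie"
  is "\<lambda>s t. TAdd s (TScale (-1) t)"
  by (intro braid_eq.cong_add braid_eq.cong_scale)
lift_definition scaleC_braid_lie :: "complex \<Rightarrow> 'a braid_lie \<Rightarrow> 'a braid_lie" is TScale
  by (rule braid_eq.cong_scale)
lift_definition bracket_braid_lie :: "'a braid_lie \<Rightarrow> 'a braid_lie \<Rightarrow> 'a braid_lie" is TBr
  by (rule braid_eq.cong_br)
instance
  by (standard; transfer)
    (rule braid_eq.add_assoc braid_eq.add_comm braid_eq.add_zero braid_eq.add_neg braid_eq.scale_add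
      braid_eq.add_scale braid_eq.scale_scale braid_eq.scale_one braid_eq.br_add_left
      braid_eq.br_add_right braid_eq.br_scale_left braid_eq.br_scale_right braid_eq.br_self
      braid_eq.br_jacobi braid_eq.refl)+
end


section \<open>The universal enveloping algebra\<close>

text \<open>
  The unital associative algebra generated by the elements of a Lie algebra subject to linearity of
  \<open>UIn\<close> and \<open>[x, y] = x y - y x\<close>, again as formal expressions modulo a congruence.
\<close>

datatype 'g assoc_term =
    UIn 'g
  | UZero
  | UOne
  | UAdd "'g assoc_term" "'g assoc_term"
  | UScale complex "'g assoc_term"
  | UMult "'g assoc_term" "'g assoc_term"

inductive env_eq :: "'g::lie_algebra assoc_term \<Rightarrow> 'g assoc_term \<Rightarrow> bool" where
  refl: "env_eq s s"
| sym: "env_eq s t \<Longrightarrow> env_eq t s"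
| trans: "env_eq s t \<Longrightarrow> env_eq t u \<Longrightarrow> env_eq s u"
| cong_add: "env_eq s s' \<Longrightarrow> env_eq t t' \<Longrightarrow> env_eq (UAdd s t) (UAdd s' t')"
| cong_scale: "env_eq s s' \<Longrightarrow> env_eq (UScale c s) (UScale c s')"
| cong_mult: "env_eq s s' \<Longrightarrow> env_eq t t' \<Longrightarrow> env_eq (UMult s t) (UMult s' t')"
| add_assoc: "env_eq (UAdd (UAdd s t) u) (UAdd s (UAdd t u))"
| add_comm: "env_eq (UAdd s t) (UAdd t s)"
| add_zero: "env_eq (UAdd UZero s) s"
| add_neg: "env_eq (UAdd (UScale (-1) s) s) UZero"
| scale_add: "env_eq (UScale c (UAdd s t)) (UAdd (UScale c s) (UScale c t))"
| add_scale: "env_eq (UScale (c + d) s) (UAdd (UScale c s) (UScale d s))"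
| scale_scale: "env_eq (UScale c (UScale d s)) (UScale (c * d) s)"
| scale_one: "env_eq (UScale 1 s) s"
| mult_assoc: "env_eq (UMult (UMult s t) u) (UMult s (UMult t u))"
| one_mult: "env_eq (UMult UOne s) s"
| mult_one: "env_eq (UMult s UOne) s"
| mult_add_left: "env_eq (UMult (UAdd s t) u) (UAdd (UMult s u) (UMult t u))"
| mult_add_right: "env_eq (UMult s (UAdd t u)) (UAdd (UMult s t) (UMult s u))"
| mult_scale_left: "env_eq (UMult (UScale c s) t) (UScale c (UMult s t))"
| mult_scale_right: "env_eq (UMult s (UScale c t)) (UScale c (UMult s t))"
| in_add: "env_eq (UIn (x + y)) (UAdd (UIn x) (UIn y))"
| in_scale: "env_eq (UIn (c *\<^sub>C x)) (UScale c (UIn x))"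
| in_bracket: "env_eq (UIn (bracket x y))
    (UAdd (UMult (UIn x) (UIn y)) (UScale (-1) (UMult (UIn y) (UIn x))))"

quotient_type (overloaded) 'g env = "'g::lie_algebra assoc_term" / env_eq
  by (intro equivpI reflpI sympI transpI) (auto intro: env_eq.intros)

lift_definition emb :: "'g::lie_algebra \<Rightarrow> 'g env" is UIn .

primrec counit_term :: "'g assoc_term \<Rightarrow> complex" where
  "counit_term (UIn x) = 0"
| "counit_term UZero = 0"
| "counit_term UOne = 1"
| "counit_term (UAdd s t) = counit_term s + counit_term t"
| "counit_term (UScale c s) = c * counit_term s"
| "counit_term (UMult s t) = counit_term s * counit_term t"

lemma counit_term_cong: "env_eq s t \<Longrightarrow> counit_term s = counit_term t"
  by (induction rule: env_eq.induct) (simp_all add: algebra_simps)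

lift_definition counit :: "'g::lie_algebra env \<Rightarrow> complex" is counit_term
  by (rule counit_term_cong)

instantiation env :: (lie_algebra) calgebra_1
begin
lift_definition zero_env :: "'a env" is UZero .
lift_definition one_env :: "'a env" is UOne .
lift_definition plus_env :: "'a env \<Rightarrow> 'a env \<Rightarrow> 'a env" is UAdd
  by (rule env_eq.cong_add)
lift_definition uminus_env :: "'a env \<Rightarrow> 'a env" is "UScale (-1)"
  by (rule env_eq.cong_scale)
lift_definition minus_env :: "'a env \<Rightarrow> 'a env \<Rightarrow> 'a env" is "\<lambda>s t. UAdd s (UScale (-1) t)"
  by (intro env_eq.cong_add env_eq.cong_scale)
lift_definition scaleC_env :: "complex \<Rightarrow> 'a env \<Rightarrow> 'a env" is UScale
  by (rule env_eq.cong_scale)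
lift_definition times_env :: "'a env \<Rightarrow> 'a env \<Rightarrow> 'a env" is UMult
  by (rule env_eq.cong_mult)
instance
proof
  show "(0::'a env) \<noteq> 1"
    by transfer (use counit_term_cong in force)
qed (transfer,
    rule env_eq.add_assoc env_eq.add_comm env_eq.add_zero env_eq.add_neg env_eq.scale_add
      env_eq.add_scale env_eq.scale_scale env_eq.scale_one env_eq.mult_assoc env_eq.one_mult
      env_eq.mult_one env_eq.mult_add_left env_eq.mult_add_right env_eq.mult_scale_left
      env_eq.mult_scale_right env_eq.refl)+
end


section \<open>Grading and graded dual\<close>

definition env_deg :: "nat \<Rightarrow> 'v braid_lie env set" where
  "env_deg d = cvec.span {prod_list (map (\<lambda>(a, b). emb (gen a b)) w) | w. length w = d}"

definition graded_dual :: "('v braid_lie env \<Rightarrow> complex) set" where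
  "graded_dual = {\<phi>. clinear \<phi> \<and> (\<exists>d0. \<forall>d>d0. \<forall>u\<in>env_deg d. \<phi> u = 0)}"

definition homogeneous :: "nat \<Rightarrow> ('v braid_lie env \<Rightarrow> complex) \<Rightarrow> bool" where
  "homogeneous d \<phi> \<longleftrightarrow> \<phi> \<in> graded_dual \<and> (\<forall>e. e \<noteq> d \<longrightarrow> (\<forall>u\<in>env_deg e. \<phi> u = 0))"

definition contract :: "'g::lie_algebra \<Rightarrow> ('g env \<Rightarrow> complex) \<Rightarrow> 'g env \<Rightarrow> complex" where
  "contract x \<phi> = (\<lambda>u. \<phi> (emb x * u))"


section \<open>Index sets\<close>

datatype 'n pt = Alpha | Pt 'n | Beta | Omega

datatype 'n pt' = Alpha' | Pt' 'n | Omega'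

text \<open>
  \<^typ>\<open>'n pt\<close> is \<open>{\<alpha>, 1, \<dots>, n, \<beta>, \<omega>}\<close> and \<^typ>\<open>'n pt'\<close> is \<open>{\<alpha>, 1, \<dots>, n, \<omega>}\<close>,
  where a finite linearly ordered type \<^typ>\<open>'n\<close> plays the role of \<open>{1, \<dots>, n}\<close>. So \<open>\<pp>\<^sub>m\<close> is
  \<^typ>\<open>'n pt braid_lie\<close> and \<open>\<pp>\<^sub>m\<^sub>-\<^sub>1\<close> is \<^typ>\<open>'n pt' braid_lie\<close>, with \<open>m = CARD('n) + 3\<close>.
\<close>

definition sect :: "'n::{finite,linorder} pt' braid_lie \<Rightarrow> 'n pt braid_lie" where
  "sect = (THE s. lie_hom s \<and>
     (\<forall>i. i \<noteq> Max UNIV \<longrightarrow> s (gen Alpha' (Pt' i)) = gen Alpha (Pt i)) \<and>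
     (\<forall>i j. i < j \<longrightarrow> s (gen (Pt' i) (Pt' j)) = gen (Pt i) (Pt j)))"

text \<open>
  The Lie ideal of the free Lie subalgebra on \<open>X\<^sub>i\<^sub>\<beta>\<close>, \<open>X\<^sub>j\<^sub>\<beta>\<close>, \<open>X\<^sub>\<beta>\<^sub>\<omega>\<close> spanned by the Lie words
  containing both \<open>X\<^sub>i\<^sub>\<beta>\<close> and \<open>X\<^sub>j\<^sub>\<beta>\<close>; the letter \<open>v\<close> stands for \<open>X\<^sub>v\<^sub>\<beta>\<close>.
\<close>
definition lambda_ideal :: "'n \<Rightarrow> 'n \<Rightarrow> 'n pt braid_lie set" where
  "lambda_ideal i j = cvec.span {eval_word (\<lambda>v. gen v Beta) w | w.
     set_lie_word w \<subseteq> {Pt i, Pt j, Omega} \<and> Pt i \<in> set_lie_word w \<and> Pt j \<in> set_lie_word w}"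


section \<open>Polynomials in logarithms over holomorphic functions\<close>

definition polydisc :: "(complex ^ 'n) set" where
  "polydisc = {x. \<forall>i. norm (x $ i) < 1}"

definition holo :: "(complex ^ 'n::finite \<Rightarrow> complex) \<Rightarrow> bool" where
  "holo f \<longleftrightarrow> (\<forall>x\<in>polydisc. \<exists>c. (f has_derivative (\<lambda>h. \<Sum>i\<in>UNIV. c i * h $ i)) (at x))"

text \<open>
  An element \<open>\<Sum>\<^sub>\<kappa> f\<^sub>\<kappa>(x) \<Prod>\<^sub>k (log x\<^sub>k)\<^bsup>\<kappa>(k)\<^esup>\<close> of \<open>\<O>(\<D>)[log x\<^sub>1, \<dots>, log x\<^sub>n]\<close> is represented by its
  coefficients \<open>P \<kappa> = f\<^sub>\<kappa>\<close>. As functions in HOL are total, coefficients are extended by zero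
  outside the polydisc.
\<close>
type_synonym 'n logpoly = "('n \<Rightarrow> nat) \<Rightarrow> complex ^ 'n \<Rightarrow> complex"

definition logpolys :: "'n::finite logpoly set" where
  "logpolys = {P. finite {\<kappa>. P \<kappa> \<noteq> 0} \<and> (\<forall>\<kappa>. holo (P \<kappa>)) \<and> (\<forall>\<kappa> x. x \<notin> polydisc \<longrightarrow> P \<kappa> x = 0)}"

definition logpoly_of :: "(complex ^ 'n \<Rightarrow> complex) \<Rightarrow> 'n logpoly" where
  "logpoly_of f = (\<lambda>\<kappa> x. if \<kappa> = (\<lambda>_. 0) \<and> x \<in> polydisc then f x else 0)"

text \<open>
  The coefficient at \<open>\<kappa>\<close> of the differential, evaluated at the point \<open>x\<close> (all \<open>x\<^sub>k \<noteq> 0\<close>) and the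
  tangent vector \<open>h\<close>. The second summand comes from \<open>d (log x\<^sub>k) = dx\<^sub>k / x\<^sub>k\<close>.
\<close>
definition d_logpoly :: "'n::finite logpoly \<Rightarrow> ('n \<Rightarrow> nat) \<Rightarrow> complex ^ 'n \<Rightarrow> complex ^ 'n \<Rightarrow> complex" where
  "d_logpoly P \<kappa> x h = frechet_derivative (P \<kappa>) (at x) h
     + (\<Sum>k\<in>UNIV. of_nat (\<kappa> k + 1) * P (\<kappa>(k := \<kappa> k + 1)) x * (h $ k / x $ k))"

definition dlog :: "(complex ^ 'n::finite \<Rightarrow> complex) \<Rightarrow> complex ^ 'n \<Rightarrow> complex ^ 'n \<Rightarrow> complex" where
  "dlog f x h = frechet_derivative f (at x) h / f x"

definition zco :: "'n::{finite,linorder} \<Rightarrow> complex ^ 'n::{finite,linorder} \<Rightarrow> complex" where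
  "zco i x = (\<Prod>k\<in>{i..}. x $ k)"


section \<open>Iterated integrals\<close>

definition is_iterated_integral_map ::
  "(('n::{finite,linorder} pt braid_lie env \<Rightarrow> complex) \<Rightarrow> 'n logpoly) \<Rightarrow> bool" where
  "is_iterated_integral_map \<iota> \<longleftrightarrow>
     (\<forall>\<phi>\<in>graded_dual. \<iota> \<phi> \<in> logpolys) \<and>
     (\<forall>\<phi>\<in>graded_dual. \<forall>\<psi>\<in>graded_dual. \<iota> (\<phi> + \<psi>) = \<iota> \<phi> + \<iota> \<psi>) \<and>
     (\<forall>c. \<forall>\<phi>\<in>graded_dual. \<iota> (c *\<^sub>C \<phi>) = c *\<^sub>C \<iota> \<phi>) \<and>
     \<iota> counit = logpoly_of (\<lambda>_. 1) \<and>
     (\<forall>\<phi>\<in>graded_dual. \<forall>\<kappa> h. \<forall>x\<in>polydisc. (\<forall>k. x $ k \<noteq> 0) \<longrightarrow>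
        d_logpoly (\<iota> \<phi>) \<kappa> x h =
          (\<Sum>i\<in>UNIV. \<iota> (contract (gen Alpha (Pt i)) \<phi>) \<kappa> x * dlog (zco i) x h
                  + \<iota> (contract (gen (Pt i) Beta) \<phi>) \<kappa> x * dlog (\<lambda>x. zco i x - 1) x h)
          + (\<Sum>(i, j)\<in>{(i, j). i < j}.
               \<iota> (contract (gen (Pt i) (Pt j)) \<phi>) \<kappa> x * dlog (\<lambda>x. zco i x - zco j x) x h)) \<and>
     (\<forall>d>0. \<forall>\<phi>. homogeneous d \<phi> \<longrightarrow> \<iota> \<phi> (\<lambda>_. 0) 0 = 0)"

text \<open>The value outside the graded dual is irrelevant; it is fixed to make the map unique.\<close>
definition iter_int :: "('n::{finite,linorder} pt braid_lie env \<Rightarrow> complex) \<Rightarrow> 'n logpoly" where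
  "iter_int = (THE \<iota>. is_iterated_integral_map \<iota> \<and> (\<forall>\<phi>. \<phi> \<notin> graded_dual \<longrightarrow> \<iota> \<phi> = 0))"


section \<open>Polylogarithms and formal polylogarithms\<close>

text \<open>
  Sequences are lists, so the index \<open>i\<close> runs over \<open>0, \<dots>, N - 1\<close>.
  \<open>y_ratio \<kappa> i\<close> is \<open>z\<^bsub>\<kappa>(i)\<^esub> / z\<^bsub>\<kappa>(i+1)\<^esub>\<close> with \<open>z\<^bsub>\<kappa>(N)\<^esub> = z\<^sub>\<beta> = 1\<close>, written as a product of
  coordinates so that it has the right value also where some coordinates vanish.
\<close>
definition y_ratio :: "'n::{finite,linorder} list \<Rightarrow> nat \<Rightarrow> complex ^ 'n::{finite,linorder} \<Rightarrow> complex" where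
  "y_ratio \<kappa> i x = (if i + 1 < length \<kappa> then \<Prod>k\<in>{\<kappa> ! i..<\<kappa> ! (i + 1)}. x $ k else zco (\<kappa> ! i) x)"

definition polylog :: "nat list \<Rightarrow> 'n::{finite,linorder} list \<Rightarrow> complex ^ 'n::{finite,linorder} \<Rightarrow> complex" where
  "polylog a \<kappa> x =
     (\<Sum>\<^sub>\<infinity>ks\<in>{ks. length ks = length a \<and> sorted_wrt (<) ks \<and> (\<forall>k\<in>set ks. 0 < k)}.
        \<Prod>i<length a. y_ratio \<kappa> i x ^ (ks ! i) / of_nat (ks ! i) ^ (a ! i))"

definition polylog_index :: "nat list \<Rightarrow> 'n::{finite,linorder} list \<Rightarrow> bool" where
  "polylog_index a \<kappa> \<longleftrightarrow> length a = length \<kappa> \<and> (\<forall>k\<in>set a. 1 \<le> k) \<and> sorted \<kappa>"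

definition formal_polylog ::
  "nat list \<Rightarrow> 'n::{finite,linorder} list \<Rightarrow> 'n pt braid_lie env \<Rightarrow> complex" where
  "formal_polylog a \<kappa> = (THE l. l \<in> graded_dual \<and> iter_int l = logpoly_of (polylog a \<kappa>))"

definition polylog_space :: "('n::{finite,linorder} pt braid_lie env \<Rightarrow> complex) set" where
  "polylog_space = cvec.span {formal_polylog a \<kappa> | a \<kappa>. polylog_index a \<kappa>}"

definition polylog_perp :: "'n::{finite,linorder} pt braid_lie env set" where
  "polylog_perp = {u. \<forall>l\<in>polylog_space. l u = 0}"

text \<open>The intersection with \<open>\<pp>\<^sub>m\<close> inside the enveloping algebra, as a subset of \<open>\<pp>\<^sub>m\<close>.\<close>
definition k_space :: "'n::{finite,linorder} pt braid_lie set" where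
  "k_space = {x. emb x \<in> polylog_perp}"

end

theory Submission
  imports Defs
begin

text \<open>
  Expanding in powers of \<open>x\<^sub>k\<close> and \<open>log x\<^sub>k\<close>, the differential equation of the iterated integrals becomes
  a recursion for coefficients of polynomial growth, so the iterated integral map exists. It is unique, and it
  is injective because on a suitable line the logarithmic forms have distinct simple poles.

  Write \<open>W = X\<^sub>\<beta>\<^sub>\<omega>\<close>, \<open>D = X\<^sub>2\<^sub>\<beta>\<close>, \<open>E = X\<^sub>1\<^sub>\<beta>\<close>. The Lie algebra \<open>\<pp>\<^sub>5\<close> acts on noncommutative series in
  these letters: the letters by left multiplication, \<open>X\<^sub>\<alpha>\<^sub>1\<close> and \<open>X\<^sub>1\<^sub>2\<close> by derivations. The coefficient of \<open>u \<cdot> 1\<close>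
  at a word \<open>W \<dots> W D \<dots> W \<dots> W D W \<dots> W E \<dots> W \<dots> W E\<close> satisfies the recursion of the nested sums defining the
  polylogarithms and hence is, up to sign, a formal polylogarithm. So \<open>\<kk>\<^sub>5\<close> consists of the \<open>x\<close> for which
  \<open>x \<cdot> 1\<close> has vanishing coefficients at all these words. The image of \<open>s\<close> annihilates \<open>1\<close>. Lie polynomials in
  \<open>W, D\<close> with every term containing \<open>D\<close> are recovered from the coefficients at words ending in \<open>D\<close> by Dynkin's
  operator, similarly for \<open>E\<close>. In a product of two elements of \<open>\<lambda>\<close> some \<open>E\<close> precedes some \<open>D\<close>, so \<open>[\<lambda>, \<lambda>]\<close> is
  annihilated; conversely \<open>\<lambda>\<close> is spanned modulo \<open>[\<lambda>, \<lambda>]\<close> by the elements obtained from \<open>D\<close> by bracketing with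
  several \<open>ad\<^sub>W\<^sup>j E\<close> and then applying \<open>ad\<^sub>W\<close> and \<open>ad\<^sub>D\<close>, and the coefficients determine the element modulo \<open>[\<lambda>, \<lambda>]\<close>.
  For \<open>\<pp>\<^sub>4\<close> only the letters \<open>W, D\<close> occur.
\<close>

text \<open>The integral map, the formal polylogs and the section are definite descriptions, so
  existence, uniqueness and injectivity have to be supplied here. The Lie algebras are quotients of
  formal expressions; neither freeness of the kernel of the projection nor independence of the
  degrees is at hand. The action on series replaces freeness: Lie elements are told apart by what
  they do to the series \<open>1\<close>. Up to completion this is the module induced from the
  trivial module of the image of \<open>s\<close>. Solving the linear relations for five of the ten
  generators leaves six brackets, of X_{\<alpha>1} and X_{12} with \<open>W, D, E\<close>; they
  dictate the derivations. W = X_{\<beta>\<omega>} enters because in the coordinates x it is the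
  residue X_{\<alpha>1} + X_{\<alpha>2} + X_{12} along x_2 = 0. In this basis the connection has one
  form per generator: dx_1/x_1, dx_1/(x_1 - 1), dx_2/x_2, dx_2/(x_2 - 1) and d(x_1 x_2)/(x_1 x_2 -
  1). Flatness is the Arnold relation among these forms together with the six brackets. The sign
  (-1)^N arises since dz/(z - 1) has the negative of a geometric series as coefficient.\<close>

lemma sum_fun_apply: "sum f S x = (\<Sum>i\<in>S. f i x)" for f :: "'i \<Rightarrow> 'a \<Rightarrow> 'b::comm_monoid_add"
  by (induction S rule: infinite_finite_induct) simp_all

section \<open>Linear maps and universal properties\<close>

lemma clinear_iff:
  "clinear f \<longleftrightarrow> (\<forall>x y. f (x + y) = f x + f y) \<and> (\<forall>c x. f (c *\<^sub>C x) = c *\<^sub>C f x)"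
  unfolding clinear_def
  by (auto simp: Vector_Spaces.linear_iff vector_space_def scaleC_add_right scaleC_add_left
      scaleC_scaleC scaleC_one)

lemma clinearI:
  "(\<And>x y. f (x + y) = f x + f y) \<Longrightarrow> (\<And>c x. f (c *\<^sub>C x) = c *\<^sub>C f x) \<Longrightarrow> clinear f"
  by (simp add: clinear_iff)

lemma clinear_add: "clinear f \<Longrightarrow> f (x + y) = f x + f y"
  and clinear_scaleC: "clinear f \<Longrightarrow> f (c *\<^sub>C x) = c *\<^sub>C f x"
  by (simp_all add: clinear_iff)

lemma minus_one_scaleC: "(- 1) *\<^sub>C x = - (x::'a::cvector)"
  by (simp add: cvec.scale_minus_left scaleC_one)

lemma clinear_0: "clinear f \<Longrightarrow> f 0 = 0"
  using clinear_add[of f 0 0] by simp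

lemma clinear_minus: "clinear f \<Longrightarrow> f (- x) = - f x"
  using clinear_scaleC[of f "- 1" x] by (simp add: minus_one_scaleC)

lemma clinear_diff: "clinear f \<Longrightarrow> f (x - y) = f x - f y"
  using clinear_add[of f x "- y"] clinear_minus[of f y] by simp

lemma clinear_sum: "clinear f \<Longrightarrow> f (sum g S) = (\<Sum>i\<in>S. f (g i))"
  by (induction S rule: infinite_finite_induct) (simp_all add: clinear_0 clinear_add)

lemma clinear_compose: "clinear f \<Longrightarrow> clinear g \<Longrightarrow> clinear (\<lambda>x. f (g x))"
  by (simp add: clinear_iff)

lemma clinear_subspace_vimage:
  "clinear f \<Longrightarrow> cvec.subspace S \<Longrightarrow> cvec.subspace {x. f x \<in> S}"
  by (simp add: cvec.subspace_def clinear_0 clinear_add clinear_scaleC)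

lemma clinear_span_mem:
  assumes "clinear f" "cvec.subspace S" "\<And>x. x \<in> B \<Longrightarrow> f x \<in> S" "x \<in> cvec.span B"
  shows "f x \<in> S"
  using cvec.span_minimal[of B "{x. f x \<in> S}"] clinear_subspace_vimage[OF assms(1,2)] assms(3,4)
  by blast

lemma clinear_eq_on_span:
  assumes "clinear f" "clinear g" "\<And>x. x \<in> B \<Longrightarrow> f x = g x" "x \<in> cvec.span B"
  shows "f x = g x"
proof -
  have "clinear (\<lambda>x. f x - g x)"
    using assms(1,2) by (simp add: clinear_iff cvec.scale_right_diff_distrib)
  then have "f x - g x \<in> {0}"
    by (rule clinear_span_mem) (use assms(3,4) in \<open>auto simp: cvec.subspace_def\<close>)
  then show ?thesis by simp
qed

lemma clinear_zero_on_span: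
  "clinear f \<Longrightarrow> (\<And>x. x \<in> B \<Longrightarrow> f x = 0) \<Longrightarrow> x \<in> cvec.span B \<Longrightarrow> f x = 0"
  using clinear_span_mem[of f "{0}"] by (auto simp: cvec.subspace_def)

lemma clinear_fun_apply: "clinear (\<lambda>f. f x)"
  by (simp add: clinear_iff scaleC_fun_def)

lemma scaleC_fun_apply [simp]: "(c *\<^sub>C f) x = c *\<^sub>C f x"
  by (simp add: scaleC_fun_def)

lemma scaleC_complex_eq [simp]: "c *\<^sub>C (x::complex) = c * x"
  by (simp add: scaleC_complex_def)

lemma bracket_clinear_left: "clinear (\<lambda>x. bracket x y)"
  and bracket_clinear_right: "clinear (bracket x)"
  by (simp_all add: clinear_iff bracket_add_left bracket_scaleC_left bracket_add_right
      bracket_scaleC_right)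

lemmas bracket_0_left [simp] = clinear_0[OF bracket_clinear_left]
lemmas bracket_0_right [simp] = clinear_0[OF bracket_clinear_right]
lemmas bracket_minus_left = clinear_minus[OF bracket_clinear_left]
lemmas bracket_minus_right = clinear_minus[OF bracket_clinear_right]
lemmas bracket_diff_left = clinear_diff[OF bracket_clinear_left]
lemmas bracket_diff_right = clinear_diff[OF bracket_clinear_right]
lemma bracket_anti: "bracket x y = - bracket y (x::'a::lie_algebra)"
proof -
  have "bracket (y + x) (y + x) = bracket y y + bracket y x + (bracket x y + bracket x x)"
    by (simp only: bracket_add_left bracket_add_right add_ac)
  then have "bracket y x + bracket x y = 0"
    by (simp add: bracket_self)
  then show ?thesis by (rule minus_unique[symmetric])
qed

text \<open>The Jacobi identity read as \<open>bracket x\<close> being a derivation; inductions over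
  Lie words push a bracket inwards with this form or with the next one, where the adjoint action is
  a representation.\<close>

lemma bracket_bracket: "bracket x (bracket y z) = bracket (bracket x y) z + bracket y (bracket x z)"
proof -
  have "bracket x (bracket y z) + (- bracket y (bracket x z)) + (- bracket (bracket x y) z) = 0"
    using jacobi[of x y z] bracket_anti[of z x] bracket_anti[of z "bracket x y"]
    by (simp add: bracket_minus_right)
  then show ?thesis by (simp add: algebra_simps)
qed

lemma bracket_bracket_left: "bracket (bracket x y) z = bracket x (bracket y z) - bracket y (bracket x z)"
  by (simp add: bracket_bracket[of x y z])

lemma lie_hom_clinear: "lie_hom f \<Longrightarrow> clinear f"
  and lie_hom_bracket: "lie_hom f \<Longrightarrow> f (bracket x y) = bracket (f x) (f y)"
  by (simp_all add: lie_hom_def)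

section \<open>Universal property of the Lie algebra on the generators
  \<open>gen a b\<close>\<close>

definition braid_relations :: "('v \<Rightarrow> 'v \<Rightarrow> 'g::lie_algebra) \<Rightarrow> bool" where
  "braid_relations f \<longleftrightarrow> (\<forall>a. f a a = 0) \<and> (\<forall>a b. f a b = f b a) \<and>
     (\<forall>a. (\<Sum>b\<in>UNIV - {a}. f a b) = 0) \<and>
     (\<forall>a b c d. distinct [a, b, c, d] \<longrightarrow> bracket (f a b) (f c d) = 0)"

primrec eval_lie :: "('v \<Rightarrow> 'v \<Rightarrow> 'g::lie_algebra) \<Rightarrow> 'v lie_term \<Rightarrow> 'g" where
  "eval_lie f (TGen a b) = f a b"
| "eval_lie f TZero = 0"
| "eval_lie f (TAdd s t) = eval_lie f s + eval_lie f t"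
| "eval_lie f (TScale c s) = c *\<^sub>C eval_lie f s"
| "eval_lie f (TBr s t) = bracket (eval_lie f s) (eval_lie f t)"

lemma eval_lie_foldr:
  "distinct bs \<Longrightarrow> eval_lie f (foldr (\<lambda>b. TAdd (TGen a b)) bs TZero) = (\<Sum>b\<in>set bs. f a b)"
  by (induction bs) simp_all

lemma eval_lie_cong:
  assumes "braid_relations f"
  shows "braid_eq s t \<Longrightarrow> eval_lie f s = eval_lie f t"
proof (induction rule: braid_eq.induct)
  case (gen_sum bs a)
  then show ?case
    using assms unfolding braid_relations_def eval_lie_foldr[OF gen_sum(1)]
    by (simp only: eval_lie.simps)
next
  case (gen_sym a b)
  then show ?case using assms by (simp add: braid_relations_def)
next
  case (gen_comm a b c d)
  then show ?case using assms unfolding braid_relations_def eval_lie.simps by blast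
next
  case (gen_diag a)
  then show ?case using assms by (simp add: braid_relations_def)
next
  case (br_jacobi s t u)
  then show ?case using jacobi by simp
qed (simp_all add: add.assoc add.commute scaleC_add_right scaleC_add_left scaleC_scaleC scaleC_one
    bracket_add_left bracket_add_right bracket_scaleC_left bracket_scaleC_right bracket_self
    minus_one_scaleC)

text \<open>Independent of the representative \<open>rep_braid_lie x\<close> under
  \<open>braid_relations f\<close>, so the facts about it carry that hypothesis.\<close>

definition braid_lift :: "('v \<Rightarrow> 'v \<Rightarrow> 'g::lie_algebra) \<Rightarrow> 'v braid_lie \<Rightarrow> 'g" where
  "braid_lift f x = eval_lie f (rep_braid_lie x)"

lemma braid_lift_abs:
  "braid_relations f \<Longrightarrow> braid_lift f (abs_braid_lie t) = eval_lie f t"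
  unfolding braid_lift_def
  by (metis Quotient_braid_lie Quotient_rep_abs_eq eval_lie_cong braid_eq.refl Quotient_rep_abs)

lemma braid_lift_gen: "braid_relations f \<Longrightarrow> braid_lift f (gen a b) = f a b"
  by (simp add: gen.abs_eq braid_lift_abs)

lemma lie_hom_braid_lift:
  assumes "braid_relations f"
  shows "lie_hom (braid_lift f)"
proof -
  have "braid_lift f (x + y) = braid_lift f x + braid_lift f y"
    and "braid_lift f (c *\<^sub>C x) = c *\<^sub>C braid_lift f x"
    and "braid_lift f (bracket x y) = bracket (braid_lift f x) (braid_lift f y)" for x y c
    by (induct x, induct y,
        simp add: plus_braid_lie.abs_eq scaleC_braid_lie.abs_eq bracket_braid_lie.abs_eq
          braid_lift_abs[OF assms])+
  then show ?thesis by (simp add: lie_hom_def clinear_iff)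
qed

lemma braid_lie_induct [case_names gen add scale bracket]:
  assumes gen: "\<And>a b. P (gen a b)"
    and add: "\<And>x y. P x \<Longrightarrow> P y \<Longrightarrow> P (x + y)"
    and scale: "\<And>c x. P x \<Longrightarrow> P (c *\<^sub>C x)"
    and br: "\<And>x y. P x \<Longrightarrow> P y \<Longrightarrow> P (bracket x y)"
  shows "P x"
proof (induct x)
  case (1 t)
  show ?case
  proof (induction t)
    case TZero
    have "P (0 *\<^sub>C gen undefined undefined)" by (intro scale gen)
    then show ?case by (simp add: zero_braid_lie_def)
  qed (use assms in \<open>simp_all add: gen.abs_eq plus_braid_lie.abs_eq[symmetric]
      scaleC_braid_lie.abs_eq[symmetric] bracket_braid_lie.abs_eq[symmetric]\<close>)
qed

lemma lie_hom_eqI: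
  assumes "lie_hom f" "lie_hom g" "\<And>a b. f (gen a b) = g (gen a b)"
  shows "f = g"
proof
  show "f x = g x" for x
    by (induction x rule: braid_lie_induct)
      (simp_all add: assms lie_hom_bracket clinear_add[OF lie_hom_clinear]
        clinear_scaleC[OF lie_hom_clinear])
qed

lemma gen_foldr:
  "abs_braid_lie (foldr (\<lambda>b. TAdd (TGen a b)) bs TZero) = sum_list (map (gen a) bs)"
  by (induction bs) (simp_all add: zero_braid_lie_def plus_braid_lie.abs_eq[symmetric] gen.abs_eq)

text \<open>Finiteness of the index type enters through the row sums: the presentation states them
  for a list that enumerates \<open>UNIV - {a}\<close>.\<close>

lemma braid_relations_gen: "braid_relations (gen :: 'v::finite \<Rightarrow> 'v \<Rightarrow> 'v braid_lie)"
  unfolding braid_relations_def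
proof (intro conjI allI impI)
  fix a b c d :: 'v
  show "gen a a = 0"
    by transfer (rule braid_eq.gen_diag)
  show "gen a b = gen b a"
    by transfer (rule braid_eq.gen_sym)
  obtain bs where bs: "distinct bs" "set bs = UNIV - {a}"
    using finite_distinct_list[of "UNIV - {a}"] by auto
  then have "abs_braid_lie (foldr (\<lambda>b. TAdd (TGen a b)) bs TZero) = abs_braid_lie TZero"
    unfolding braid_lie.abs_eq_iff by (rule braid_eq.gen_sum)
  then show "(\<Sum>b\<in>UNIV - {a}. gen a b) = 0"
    using bs by (simp add: gen_foldr sum_list_distinct_conv_sum_set zero_braid_lie_def)
  assume "distinct [a, b, c, d]"
  then show "bracket (gen a b) (gen c d) = 0"
    by transfer (rule braid_eq.gen_comm)
qed

lemma gen_diag [simp]: "gen (a::'v::finite) a = 0"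
  and gen_sym: "gen (a::'v) b = gen b a"
  and gen_sum: "(\<Sum>b\<in>UNIV - {a::'v}. gen a b) = 0"
  and gen_comm: "distinct [a::'v, b, c, d] \<Longrightarrow> bracket (gen a b) (gen c d) = 0"
  using braid_relations_gen unfolding braid_relations_def by blast+

section \<open>Universal property of the enveloping algebra\<close>

definition alg_hom :: "('a::calgebra_1 \<Rightarrow> 'b::calgebra_1) \<Rightarrow> bool" where
  "alg_hom f \<longleftrightarrow> clinear f \<and> f 1 = 1 \<and> (\<forall>x y. f (x * y) = f x * f y)"

lemma alg_hom_clinear: "alg_hom f \<Longrightarrow> clinear f"
  and alg_hom_1: "alg_hom f \<Longrightarrow> f 1 = 1"
  and alg_hom_mult: "alg_hom f \<Longrightarrow> f (x * y) = f x * f y"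
  by (simp_all add: alg_hom_def)

lemma mult_clinear_left: "clinear (\<lambda>x. x * (y::'a::calgebra_1))"
  and mult_clinear_right: "clinear ((*) (x::'a))"
  by (simp_all add: clinear_iff mult_scaleC_left mult_scaleC_right algebra_simps)

lemma counit_clinear: "clinear counit"
  and counit_1: "counit 1 = 1"
  and counit_mult: "counit (x * y) = counit x * counit y"
  and counit_emb: "counit (emb z) = 0"
  by (simp_all add: clinear_iff) (transfer, simp)+

lemma emb_clinear: "clinear emb"
  by (rule clinearI; transfer) (rule env_eq.in_add env_eq.in_scale)+

lemma emb_bracket: "emb (bracket x y) = emb x * emb y - emb y * emb x"
  by transfer (rule env_eq.in_bracket)

primrec eval_env :: "('g \<Rightarrow> 'e::calgebra_1) \<Rightarrow> 'g assoc_term \<Rightarrow> 'e" where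
  "eval_env f (UIn x) = f x"
| "eval_env f UZero = 0"
| "eval_env f UOne = 1"
| "eval_env f (UAdd s t) = eval_env f s + eval_env f t"
| "eval_env f (UScale c s) = c *\<^sub>C eval_env f s"
| "eval_env f (UMult s t) = eval_env f s * eval_env f t"

text \<open>The target is an associative algebra, so the bracket there is spelled out as a
  commutator instead of asking for an instance of \<open>lie_algebra\<close>.\<close>

definition lie_rep :: "('g::lie_algebra \<Rightarrow> 'e::calgebra_1) \<Rightarrow> bool" where
  "lie_rep f \<longleftrightarrow> clinear f \<and> (\<forall>x y. f (bracket x y) = f x * f y - f y * f x)"

lemma eval_env_cong:
  assumes "lie_rep f"
  shows "env_eq s t \<Longrightarrow> eval_env f s = eval_env f t"
  by (induction rule: env_eq.induct)
    (use assms in \<open>simp_all add: lie_rep_def clinear_iff add.assoc add.commute scaleC_add_right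
      scaleC_add_left scaleC_scaleC scaleC_one mult.assoc distrib_left distrib_right
      mult_scaleC_left mult_scaleC_right minus_one_scaleC\<close>)

definition env_lift :: "('g::lie_algebra \<Rightarrow> 'e::calgebra_1) \<Rightarrow> 'g env \<Rightarrow> 'e" where
  "env_lift f u = eval_env f (rep_env u)"

lemma env_lift_abs: "lie_rep f \<Longrightarrow> env_lift f (abs_env t) = eval_env f t"
  unfolding env_lift_def
  by (metis Quotient_env Quotient_rep_abs eval_env_cong env_eq.refl)

lemma env_lift_emb: "lie_rep f \<Longrightarrow> env_lift f (emb x) = f x"
  by (simp add: emb.abs_eq env_lift_abs)

lemma alg_hom_env_lift:
  assumes "lie_rep f"
  shows "alg_hom (env_lift f)"
proof -
  have "env_lift f (x + y) = env_lift f x + env_lift f y"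
    and "env_lift f (c *\<^sub>C x) = c *\<^sub>C env_lift f x"
    and "env_lift f (x * y) = env_lift f x * env_lift f y" for x y c
    by (induct x, induct y, simp add: plus_env.abs_eq scaleC_env.abs_eq times_env.abs_eq
        env_lift_abs[OF assms])+
  moreover have "env_lift f 1 = 1"
    by (simp add: one_env_def env_lift_abs[OF assms])
  ultimately show ?thesis by (simp add: alg_hom_def clinear_iff)
qed

lemma env_induct [case_names emb one add scale mult]:
  assumes emb: "\<And>x. P (emb x)" and one: "P 1"
    and add: "\<And>x y. P x \<Longrightarrow> P y \<Longrightarrow> P (x + y)"
    and scale: "\<And>c x. P x \<Longrightarrow> P (c *\<^sub>C x)"
    and mult: "\<And>x y. P x \<Longrightarrow> P y \<Longrightarrow> P (x * y)"
  shows "P u"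
proof (induct u)
  case (1 t)
  show ?case
  proof (induction t)
    case UZero
    have "P (0 *\<^sub>C 1)" by (intro scale one)
    then show ?case by (simp add: zero_env_def)
  qed (use assms in \<open>simp_all add: emb.abs_eq one_env_def plus_env.abs_eq[symmetric]
      scaleC_env.abs_eq[symmetric] times_env.abs_eq[symmetric]\<close>)
qed


section \<open>The grading\<close>

abbreviation gen_word :: "('v \<times> 'v) list \<Rightarrow> 'v braid_lie env" where
  "gen_word w \<equiv> prod_list (map (\<lambda>(a, b). emb (gen a b)) w)"

text \<open>The span of the generator words is closed under products, and brackets become
  commutators under \<open>emb\<close>; hence it contains the image of the Lie algebra and
  everything generated by it.\<close>

lemma gen_word_span: "u \<in> cvec.span (range gen_word)" for u :: "'v braid_lie env"
proof -
  let ?S = "cvec.span (range (gen_word :: _ \<Rightarrow> 'v braid_lie env))"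
  have one: "1 \<in> ?S"
    using cvec.span_base[of "gen_word []"] by (metis list.simps(8) prod_list.Nil rangeI)
  have m1: "gen_word v * y \<in> ?S" if "y \<in> ?S" for v y
    by (rule clinear_span_mem[OF mult_clinear_right _ _ that])
      (auto intro!: cvec.span_base simp: cvec.subspace_span prod_list.append[symmetric]
        simp del: prod_list.append map_append simp flip: map_append)
  have mult: "x * y \<in> ?S" if x: "x \<in> ?S" and y: "y \<in> ?S" for x y
    by (rule clinear_span_mem[OF mult_clinear_left _ _ x]) (use m1[OF y] in auto)
  have embS: "emb x \<in> ?S" for x
  proof (induction x rule: braid_lie_induct)
    case (gen a b)
    have "gen_word [(a, b)] \<in> ?S" by (intro cvec.span_base rangeI)
    then show ?case by simp
  qed (simp_all add: clinear_add[OF emb_clinear] clinear_scaleC[OF emb_clinear] emb_bracket mult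
      cvec.span_add cvec.span_scale cvec.span_diff)
  show ?thesis
    by (induction u rule: env_induct) (simp_all add: one mult embS cvec.span_add cvec.span_scale)
qed

lemma gen_word_env_deg: "gen_word w \<in> env_deg (length w)"
  unfolding env_deg_def by (rule cvec.span_base) auto

lemma clinear_eq_on_gen_words:
  "clinear f \<Longrightarrow> clinear g \<Longrightarrow> (\<And>w. f (gen_word w) = g (gen_word w)) \<Longrightarrow> f = g"
  using clinear_eq_on_span[OF _ _ _ gen_word_span, of f g] by blast

lemma env_deg_mult_gen: "u \<in> env_deg d \<Longrightarrow> emb (gen a b) * u \<in> env_deg (Suc d)"
  unfolding env_deg_def
proof (erule clinear_span_mem[OF mult_clinear_right, rotated 2])
  fix x :: "'a braid_lie env" assume "x \<in> {gen_word w |w. length w = d}"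
  then obtain w where "x = gen_word w" "length w = d" by blast
  then show "emb (gen a b) * x \<in> cvec.span {gen_word w |w. length w = Suc d}"
    by (intro cvec.span_base CollectI exI[of _ "(a, b) # w"]) simp
qed (simp add: cvec.subspace_span)

definition degree_one :: "'v braid_lie set" where
  "degree_one = cvec.span (range (\<lambda>(a, b). gen a b))"

lemma gen_degree_one: "gen a b \<in> degree_one"
  unfolding degree_one_def by (rule cvec.span_base) auto

lemma subspace_env_deg: "cvec.subspace (env_deg d)"
  by (simp add: env_deg_def cvec.subspace_span)

lemma env_deg_mult: "x \<in> degree_one \<Longrightarrow> u \<in> env_deg d \<Longrightarrow> emb x * u \<in> env_deg (Suc d)"
  unfolding degree_one_def
  by (erule clinear_span_mem[OF clinear_compose[OF mult_clinear_left emb_clinear] subspace_env_deg,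
        rotated])
    (auto intro: env_deg_mult_gen)

lemma one_env_deg: "1 \<in> env_deg 0"
  using gen_word_env_deg[of "[]"] by simp

lemma graded_dual_clinear: "\<phi> \<in> graded_dual \<Longrightarrow> clinear \<phi>"
  by (simp add: graded_dual_def)

lemma graded_dual_add: "\<phi> \<in> graded_dual \<Longrightarrow> \<psi> \<in> graded_dual \<Longrightarrow> \<phi> + \<psi> \<in> graded_dual"
  unfolding graded_dual_def mem_Collect_eq
proof safe
  fix d e assume *: "\<forall>d'>d. \<forall>u\<in>env_deg d'. \<phi> u = 0" "\<forall>d>e. \<forall>u\<in>env_deg d. \<psi> u = 0"
  then have "\<forall>d'>max d e. \<forall>u\<in>env_deg d'. (\<phi> + \<psi>) u = 0" by auto
  then show "\<exists>d0. \<forall>d>d0. \<forall>u\<in>env_deg d. (\<phi> + \<psi>) u = 0" ..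
qed (simp add: clinear_iff algebra_simps)

lemma graded_dual_scaleC: "\<phi> \<in> graded_dual \<Longrightarrow> c *\<^sub>C \<phi> \<in> graded_dual"
  unfolding graded_dual_def
  by (auto simp: clinear_iff algebra_simps simp del: mult_eq_0_iff) (metis mult_zero_right)

lemma graded_dual_0: "0 \<in> graded_dual"
  unfolding graded_dual_def by (simp add: clinear_iff)

lemma graded_dual_sum: "(\<And>i. i \<in> I \<Longrightarrow> \<phi> i \<in> graded_dual) \<Longrightarrow> sum \<phi> I \<in> graded_dual"
  by (induction I rule: infinite_finite_induct) (simp_all add: graded_dual_0 graded_dual_add)

lemma contract_add: "contract (x + y) \<phi> = contract x \<phi> + contract y \<phi>"
  if "clinear \<phi>"
  using that by (simp add: contract_def fun_eq_iff clinear_add[OF emb_clinear] distrib_right clinear_add)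

lemma clinear_contract: "clinear \<phi> \<Longrightarrow> clinear (contract x \<phi>)"
  unfolding contract_def by (rule clinear_compose[OF _ mult_clinear_right])

lemma contract_graded_dual:
  assumes "x \<in> degree_one" "\<phi> \<in> graded_dual"
  shows "contract x \<phi> \<in> graded_dual"
proof -
  obtain d0 where d0: "\<forall>d>d0. \<forall>u\<in>env_deg d. \<phi> u = 0"
    using assms(2) by (auto simp: graded_dual_def)
  then have "\<forall>d>d0. \<forall>u\<in>env_deg d. contract x \<phi> u = 0"
    using env_deg_mult[OF assms(1)] by (metis contract_def less_Suc_eq)
  then show ?thesis
    using clinear_contract[OF graded_dual_clinear[OF assms(2)]] unfolding graded_dual_def by blast
qed

lemma counit_env_deg: "0 < d \<Longrightarrow> u \<in> env_deg d \<Longrightarrow> counit u = 0"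
  unfolding env_deg_def
proof (erule clinear_zero_on_span[OF counit_clinear, rotated])
  fix x :: "'a braid_lie env" assume "0 < d" "x \<in> {gen_word w |w. length w = d}"
  then obtain w where "x = gen_word w" "w \<noteq> []" by auto
  then show "counit x = 0"
    by (cases w) (auto simp: counit_mult counit_emb)
qed

lemma counit_homogeneous: "homogeneous 0 counit"
  unfolding homogeneous_def graded_dual_def using counit_env_deg counit_clinear by auto

lemma homogeneous_graded_dual: "homogeneous d \<phi> \<Longrightarrow> \<phi> \<in> graded_dual"
  by (simp add: homogeneous_def)

lemmas counit_graded_dual = homogeneous_graded_dual[OF counit_homogeneous]

text \<open>Generator words determine a functional, and the nonempty ones have positive degree,
  where both sides vanish. This starts the induction behind uniqueness of the integral map.\<close>

lemma homogeneous_0_counit: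
  fixes \<phi> :: "'v braid_lie env \<Rightarrow> complex"
  assumes "homogeneous 0 \<phi>"
  shows "\<phi> = \<phi> 1 *\<^sub>C counit"
proof (rule clinear_eq_on_gen_words)
  show lin: "clinear \<phi>" "clinear (\<phi> 1 *\<^sub>C (counit :: 'v braid_lie env \<Rightarrow> complex))"
    by (rule graded_dual_clinear homogeneous_graded_dual[OF assms] graded_dual_scaleC
        counit_graded_dual)+
  show "\<phi> (gen_word w) = (\<phi> 1 *\<^sub>C counit) (gen_word w)" for w
  proof (cases "w = []")
    case False
    then have "0 < length w" by simp
    then have "\<phi> (gen_word w) = 0" "counit (gen_word w) = 0"
      using assms gen_word_env_deg[of w] counit_env_deg[of "length w" "gen_word w"]
      unfolding homogeneous_def by auto
    then show ?thesis by simp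
  qed (simp add: counit_1)
qed

lemma power_inject_two: "(2::complex) ^ m = 2 ^ n \<longleftrightarrow> m = n"
proof
  assume "(2::complex) ^ m = 2 ^ n"
  then have "norm ((2::complex) ^ m) = norm ((2::complex) ^ n)" by simp
  then show "m = n" by (simp add: norm_power)
qed simp

text \<open>The automorphism multiplying every generator by 2 separates the degrees; a functional with
  finitely many degrees is decomposed by splitting off one eigenvalue of it after the other.\<close>

definition double_aut :: "'v::finite braid_lie env \<Rightarrow> 'v braid_lie env" where
  "double_aut = env_lift (\<lambda>x. emb (braid_lift (\<lambda>a b. 2 *\<^sub>C gen a b) x))"

lemma
  fixes a b :: "'v::finite"
  shows alg_hom_double_aut: "alg_hom (double_aut :: 'v braid_lie env \<Rightarrow> _)"
  and double_aut_gen: "double_aut (emb (gen a b)) = 2 *\<^sub>C emb (gen a b)"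
proof -
  have br: "braid_relations (\<lambda>a b. 2 *\<^sub>C gen a (b::'v::finite))"
    unfolding braid_relations_def
    by (intro conjI allI impI)
      (simp_all only: gen_diag gen_sum gen_comm bracket_scaleC_left bracket_scaleC_right
        cvec.scale_sum_right[symmetric] cvec.scale_zero_right, metis gen_sym)
  then have "lie_rep (\<lambda>x. emb (braid_lift (\<lambda>a b. 2 *\<^sub>C gen a (b::'v::finite)) x))"
    using lie_hom_braid_lift[OF br] unfolding lie_rep_def
    by (simp add: clinear_compose[OF emb_clinear] lie_hom_clinear lie_hom_bracket emb_bracket)
  then show "alg_hom (double_aut :: 'v braid_lie env \<Rightarrow> _)"
    and "double_aut (emb (gen a b)) = 2 *\<^sub>C emb (gen a b)"
    unfolding double_aut_def using br
    by (simp_all add: alg_hom_env_lift env_lift_emb braid_lift_gen clinear_scaleC[OF emb_clinear])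
qed

lemma double_aut_env_deg: "u \<in> env_deg d \<Longrightarrow> double_aut u = 2 ^ d *\<^sub>C u"
  unfolding env_deg_def
proof (erule clinear_eq_on_span[OF alg_hom_clinear[OF alg_hom_double_aut], rotated 2])
  have "double_aut (gen_word w) = 2 ^ length w *\<^sub>C gen_word w" for w :: "('a \<times> 'a) list"
    by (induction w) (auto simp: alg_hom_1 alg_hom_mult alg_hom_double_aut double_aut_gen
        scaleC_one scaleC_scaleC mult_scaleC_left mult_scaleC_right)
  then show "double_aut x = 2 ^ d *\<^sub>C x" if "x \<in> {gen_word w |w. length w = d}" for x :: "'a braid_lie env"
    using that by auto
qed (simp add: clinear_iff scaleC_add_right scaleC_scaleC mult.commute)

text \<open>The spaces \<open>env_deg d\<close> are merely known to span, so homogeneous components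
  of a functional cannot be cut out by projections; the eigenvalues of \<open>double_aut\<close>
  produce them.\<close>

lemma graded_dual_homogeneous_induct [consumes 1, case_names homogeneous add]:
  fixes \<phi> :: "'v::finite braid_lie env \<Rightarrow> complex"
  assumes "\<phi> \<in> graded_dual"
    and hom: "\<And>d \<psi>. homogeneous d \<psi> \<Longrightarrow> P \<psi>"
    and add: "\<And>\<psi> \<tau>. \<psi> \<in> graded_dual \<Longrightarrow> \<tau> \<in> graded_dual \<Longrightarrow> P \<psi> \<Longrightarrow> P \<tau> \<Longrightarrow> P (\<psi> + \<tau>)"
  shows "P \<phi>"
proof -
  have hom0: "homogeneous d (0 :: 'v braid_lie env \<Rightarrow> complex)" for d
    by (simp add: homogeneous_def graded_dual_0)
  have sums: "P (sum \<psi> S) \<and> sum \<psi> S \<in> graded_dual"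
    if "finite S" "\<And>s. s \<in> S \<Longrightarrow> homogeneous s (\<psi> s)" for S and \<psi> :: "nat \<Rightarrow> 'v braid_lie env \<Rightarrow> complex"
    using that
    by (induction S) (auto intro!: hom[OF hom0] graded_dual_0 graded_dual_add add[OF _ _ hom]
        intro: homogeneous_graded_dual)
  have decomp: "\<exists>\<psi>. (\<forall>s\<in>S. homogeneous s (\<psi> s)) \<and> \<phi> = sum \<psi> S"
    if "finite S" "clinear \<phi>" "\<And>d u. d \<notin> S \<Longrightarrow> u \<in> env_deg d \<Longrightarrow> \<phi> u = 0"
    for S and \<phi> :: "'v braid_lie env \<Rightarrow> complex"
    using that
  proof (induction S arbitrary: \<phi>)
    case empty
    then have "\<phi> = (\<lambda>_. 0)"
      by (intro clinear_eq_on_gen_words) (use gen_word_env_deg in \<open>auto simp: clinear_iff\<close>)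
    then show ?case by (auto simp: zero_fun_def)
  next
    case (insert e S)
    \<comment> \<open>The eigenvalue \<open>2 ^ e\<close> is removed: \<open>\<psi>\<close> vanishes
      in degree \<open>e\<close>, and in degree \<open>d\<close> it is \<open>\<phi>\<close> times
      \<open>2 ^ d - 2 ^ e\<close>.\<close>
    define \<psi> where "\<psi> = (\<lambda>u. \<phi> (double_aut u) - 2 ^ e * \<phi> u)"
    have "clinear \<psi>"
      unfolding \<psi>_def using insert.prems(1)
        clinear_compose[OF insert.prems(1) alg_hom_clinear[OF alg_hom_double_aut]]
      by (simp add: clinear_iff algebra_simps)
    moreover have \<psi>: "\<psi> u = (2 ^ d - 2 ^ e) * \<phi> u" if "u \<in> env_deg d" for d u
      using insert.prems(1) that
      by (simp add: \<psi>_def double_aut_env_deg clinear_scaleC algebra_simps)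
    then have "\<psi> u = 0" if "d \<notin> S" "u \<in> env_deg d" for d u
      using that insert.prems(2)[of d u] by (cases "d = e") auto
    ultimately obtain \<tau> where \<tau>: "\<forall>s\<in>S. homogeneous s (\<tau> s)" "\<psi> = sum \<tau> S"
      using insert.IH by blast
    \<comment> \<open>Division by \<open>2 ^ s - 2 ^ e\<close>, nonzero because \<open>e\<close> is
      not in \<open>S\<close>, turns the components of \<open>\<psi>\<close> back into those of
      \<open>\<phi>\<close>. The remainder \<open>\<rho>\<close> then lives in degree
      \<open>e\<close> alone.\<close>
    define \<xi> where "\<xi> s = (inverse (2 ^ s - 2 ^ e)) *\<^sub>C \<tau> s" for s
    have \<xi>: "homogeneous s (\<xi> s)" if "s \<in> S" for s
      using \<tau>(1) that by (auto simp: homogeneous_def \<xi>_def graded_dual_scaleC)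
    have \<tau>_deg: "\<tau> s u = (if s = d then \<psi> u else 0)" if "s \<in> S" "d \<in> S" "u \<in> env_deg d" for s d u
    proof (cases "s = d")
      case True
      have "\<psi> u = (\<Sum>s\<in>S. \<tau> s u)" by (simp add: \<tau>(2) sum_fun_apply)
      also have "\<dots> = (\<Sum>s\<in>S. if s = d then \<tau> d u else 0)"
      proof (rule sum.cong)
        fix t assume "t \<in> S"
        then show "\<tau> t u = (if t = d then \<tau> d u else 0)"
          using \<tau>(1) that unfolding homogeneous_def by metis
      qed simp
      finally show ?thesis using insert.hyps that True by simp
    next
      case False
      then show ?thesis using \<tau>(1) that unfolding homogeneous_def by metis
    qed
    define \<rho> where "\<rho> = \<phi> - sum \<xi> S"
    have sum\<xi>: "sum \<xi> S \<in> graded_dual"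
      using \<xi> by (intro graded_dual_sum homogeneous_graded_dual)
    have \<rho>lin: "clinear \<rho>"
      using insert.prems(1) graded_dual_clinear[OF sum\<xi>]
      by (simp add: \<rho>_def clinear_iff algebra_simps)
    have \<rho>0: "\<rho> u = 0" if "d \<noteq> e" "u \<in> env_deg d" for d u
    proof (cases "d \<in> S")
      case True
      have "(\<Sum>s\<in>S. \<xi> s u) = (\<Sum>s\<in>S. if s = d then inverse (2 ^ d - 2 ^ e) * \<psi> u else 0)"
        by (intro sum.cong) (use \<tau>_deg True that in \<open>auto simp: \<xi>_def\<close>)
      also have "\<dots> = \<phi> u"
      proof -
        have "(2::complex) ^ d - 2 ^ e \<noteq> 0" using that(1)
          by (simp add: power_inject_two)
        then show ?thesis using True insert.hyps \<psi>[OF that(2)] by simp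
      qed
      finally show ?thesis by (simp add: \<rho>_def sum_fun_apply)
    next
      case False
      then have "\<phi> u = 0" using insert.prems(2)[of d u] that by auto
      moreover have "\<xi> s u = 0" if "s \<in> S" for s
        using \<xi>[OF that] False \<open>u \<in> env_deg d\<close> that unfolding homogeneous_def by metis
      ultimately show ?thesis by (simp add: \<rho>_def sum_fun_apply)
    qed
    then have "homogeneous e \<rho>"
      unfolding homogeneous_def graded_dual_def using \<rho>lin by (auto intro!: exI[of _ e]) (metis less_irrefl)
    moreover have "(\<Sum>s\<in>insert e S. if s = e then \<rho> else \<xi> s) = \<rho> + sum \<xi> S"
    proof -
      have "(\<Sum>s\<in>S. if s = e then \<rho> else \<xi> s) = sum \<xi> S"
        by (rule sum.cong) (use insert.hyps in auto)
      then show ?thesis using insert.hyps by simp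
    qed
    moreover have "\<phi> = \<rho> + sum \<xi> S" by (simp add: \<rho>_def)
    ultimately show ?case
      using \<xi> by (intro exI[of _ "\<lambda>s. if s = e then \<rho> else \<xi> s"]) auto
  qed
  obtain d0 where "\<forall>d>d0. \<forall>u\<in>env_deg d. \<phi> u = 0" and lin: "clinear \<phi>"
    using assms(1) by (auto simp: graded_dual_def)
  then obtain \<psi> where "\<forall>s\<in>{..d0}. homogeneous s (\<psi> s)" "\<phi> = sum \<psi> {..d0}"
    using decomp[of "{..d0}" \<phi>] by (auto simp: not_le)
  then show ?thesis using sums[of "{..d0}" \<psi>] by simp
qed

section \<open>Power series of polynomial growth\<close>

definition mdeg :: "('n::finite \<Rightarrow> nat) \<Rightarrow> nat" where
  "mdeg e = (\<Sum>k\<in>UNIV. e k)"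

definition monom_at :: "complex ^ 'n::finite \<Rightarrow> ('n \<Rightarrow> nat) \<Rightarrow> complex" where
  "monom_at x e = (\<Prod>k\<in>UNIV. x $ k ^ e k)"

lemma le_mdeg: "e k \<le> mdeg e"
  unfolding mdeg_def by (rule member_le_sum) auto

lemma mdeg_eq_0: "mdeg e = 0 \<longleftrightarrow> e = (\<lambda>_. 0)"
  by (auto simp: mdeg_def fun_eq_iff)

lemma mdeg_add: "mdeg (\<lambda>k. e k + f k) = mdeg e + mdeg f"
  by (simp add: mdeg_def sum.distrib)

lemma mdeg_upd: "mdeg (e(k := Suc (e k))) = Suc (mdeg e)"
proof -
  have "mdeg (e(k := Suc (e k))) = (\<Sum>j\<in>UNIV. e j + (if j = k then 1 else 0))"
    unfolding mdeg_def by (rule sum.cong) auto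
  then show ?thesis by (simp add: mdeg_def sum.distrib)
qed

lemma degree_slice_subset: "{e. mdeg e = d} \<subseteq> PiE UNIV (\<lambda>_. {..d})"
  using le_mdeg by (auto simp: PiE_UNIV_domain)

lemma finite_degree_slice [simp]: "finite {e::'n::finite \<Rightarrow> nat. mdeg e = d}"
  by (rule finite_subset[OF degree_slice_subset]) (simp add: finite_PiE)

lemma card_degree_slice: "card {e::'n::finite \<Rightarrow> nat. mdeg e = d} \<le> Suc d ^ CARD('n)"
proof -
  have "card {e::'n \<Rightarrow> nat. mdeg e = d} \<le> card (PiE (UNIV::'n set) (\<lambda>_. {..d}))"
    by (rule card_mono[OF _ degree_slice_subset]) (simp add: finite_PiE)
  then show ?thesis by (simp add: card_PiE)
qed

text \<open>Growth polynomial in the total degree suffices for convergence on the whole open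
  polydisc, and it is kept by differentiation and by multiplication with monomials and geometric
  series.\<close>

definition poly_growth :: "(('n::finite \<Rightarrow> nat) \<Rightarrow> complex) \<Rightarrow> bool" where
  "poly_growth c \<longleftrightarrow> (\<exists>C M. 0 \<le> C \<and> (\<forall>e. norm (c e) \<le> C * real (Suc (mdeg e)) ^ M))"

lemma poly_growthI:
  assumes "\<And>e. norm (c e) \<le> C * real (Suc (mdeg e)) ^ M"
  shows "poly_growth c"
proof -
  have "norm (c e) \<le> \<bar>C\<bar> * real (Suc (mdeg e)) ^ M" for e
    using assms[of e] by (rule order_trans) (simp add: mult_right_mono)
  then show ?thesis unfolding poly_growth_def by (intro exI[of _ "\<bar>C\<bar>"] exI[of _ M]) simp
qed

lemma poly_growthE:
  assumes "poly_growth c"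
  obtains C M where "0 \<le> C" "\<And>e. norm (c e) \<le> C * real (Suc (mdeg e)) ^ M"
  using assms unfolding poly_growth_def by blast

lemma poly_growth_0: "poly_growth (\<lambda>_. 0)"
  by (rule poly_growthI[of _ 0 0]) simp

lemma poly_growth_add:
  assumes "poly_growth c" "poly_growth c'"
  shows "poly_growth (\<lambda>e. c e + c' e)"
proof -
  obtain C M where c: "0 \<le> C" "norm (c e) \<le> C * real (Suc (mdeg e)) ^ M" for e
    using assms(1) by (rule poly_growthE) auto
  obtain C' M' where c': "0 \<le> C'" "norm (c' e) \<le> C' * real (Suc (mdeg e)) ^ M'" for e
    using assms(2) by (rule poly_growthE) auto
  show ?thesis
  proof (rule poly_growthI[of _ "C + C'" "max M M'"])
    fix e :: "'a \<Rightarrow> nat"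
    have "norm (c e + c' e) \<le> C * real (Suc (mdeg e)) ^ M + C' * real (Suc (mdeg e)) ^ M'"
      using c(2)[of e] c'(2)[of e] norm_triangle_ineq[of "c e" "c' e"] by linarith
    also have "\<dots> \<le> C * real (Suc (mdeg e)) ^ max M M' + C' * real (Suc (mdeg e)) ^ max M M'"
      using c(1) c'(1) by (intro add_mono mult_left_mono power_increasing) auto
    finally show "norm (c e + c' e) \<le> (C + C') * real (Suc (mdeg e)) ^ max M M'"
      by (simp add: algebra_simps)
  qed
qed

lemma poly_growth_cmult:
  assumes "poly_growth c"
  shows "poly_growth (\<lambda>e. a * c e)"
proof -
  obtain C M where c: "norm (c e) \<le> C * real (Suc (mdeg e)) ^ M" for e
    using assms by (rule poly_growthE) auto
  show ?thesis
    by (rule poly_growthI[of _ "norm a * C" M])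
      (use c in \<open>simp add: norm_mult mult.assoc mult_left_mono\<close>)
qed

lemma poly_growth_sum:
  "(\<And>i. i \<in> I \<Longrightarrow> poly_growth (c i)) \<Longrightarrow> poly_growth (\<lambda>e. \<Sum>i\<in>I. c i e)"
  by (induction I rule: infinite_finite_induct) (simp_all add: poly_growth_0 poly_growth_add)

text \<open>One estimate for all operations that read the coefficient at a shifted exponent
  \<open>f e\<close>, at most linearly larger than \<open>e\<close>, and gain at most one factor of
  the degree.\<close>

lemma poly_growth_bound:
  assumes "poly_growth c" "\<And>e. norm (c' e) \<le> norm (c (f e)) * real (Suc (mdeg e))"
    "\<And>e. mdeg (f e) \<le> K * Suc (mdeg e)"
  shows "poly_growth c'"
proof -
  obtain C M where c: "0 \<le> C" "norm (c e) \<le> C * real (Suc (mdeg e)) ^ M" for e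
    using assms(1) by (rule poly_growthE) auto
  show ?thesis
  proof (rule poly_growthI[of _ "C * real (Suc K) ^ M" "Suc M"])
    fix e :: "'b \<Rightarrow> nat"
    have "Suc (mdeg (f e)) \<le> Suc K * Suc (mdeg e)"
      using assms(3)[of e] by simp
    then have "real (Suc (mdeg (f e))) ^ M \<le> (real (Suc K) * real (Suc (mdeg e))) ^ M"
      by (intro power_mono) (metis of_nat_le_iff of_nat_mult, simp)
    then have "norm (c (f e)) \<le> C * (real (Suc K) * real (Suc (mdeg e))) ^ M"
      using c(2)[of "f e"] c(1) by (meson mult_left_mono order_trans)
    then have "norm (c' e) \<le> C * (real (Suc K) * real (Suc (mdeg e))) ^ M * real (Suc (mdeg e))"
      using assms(2)[of e] by (meson mult_right_mono of_nat_0_le_iff order_trans)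
    then show "norm (c' e) \<le> C * real (Suc K) ^ M * real (Suc (mdeg e)) ^ Suc M"
      by (simp add: power_mult_distrib mult_ac del: of_nat_Suc)
  qed
qed

definition slice :: "(('n::finite \<Rightarrow> nat) \<Rightarrow> complex) \<Rightarrow> nat \<Rightarrow> complex ^ 'n \<Rightarrow> complex" where
  "slice c d x = (\<Sum>e | mdeg e = d. c e * monom_at x e)"

text \<open>Grouping by total degree makes every term a finite sum, so that convergence is a
  question about series in one index.\<close>

definition pseries :: "(('n::finite \<Rightarrow> nat) \<Rightarrow> complex) \<Rightarrow> complex ^ 'n \<Rightarrow> complex" where
  "pseries c x = (\<Sum>d. slice c d x)"

lemma norm_monom_at_le:
  assumes "\<And>k. norm (x $ k) \<le> r"
  shows "norm (monom_at x e) \<le> r ^ mdeg e"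
proof -
  have "norm (monom_at x e) = (\<Prod>k\<in>UNIV. norm (x $ k) ^ e k)"
    by (simp add: monom_at_def prod_norm[symmetric] norm_power)
  also have "\<dots> \<le> (\<Prod>k\<in>UNIV. r ^ e k)"
    by (intro prod_mono conjI power_mono assms) auto
  finally show ?thesis by (simp add: mdeg_def power_sum)
qed

text \<open>Induction on \<open>K\<close> by termwise differentiation: the derived series has
  coefficients (n+1) (n+2)^K, which dominate (n+1)^(K+1).\<close>

lemma summable_poly_geometric:
  fixes r :: real
  assumes "0 \<le> r" "r < 1"
  shows "summable (\<lambda>n. real (Suc n) ^ K * r ^ n)"
  using assms
proof (induction K arbitrary: r)
  case (Suc K)
  have "summable (\<lambda>n. diffs (\<lambda>n. real (Suc n) ^ K) n * r ^ n)"
  proof (rule termdiff_converges)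
    show "norm r < 1" using Suc.prems by simp
    show "summable (\<lambda>n. real (Suc n) ^ K * z ^ n)" if "norm z < 1" for z :: real
    proof (rule summable_norm_cancel)
      show "summable (\<lambda>n. norm (real (Suc n) ^ K * z ^ n))"
        using Suc.IH[of "norm z"] that by (simp add: abs_mult power_abs del: of_nat_Suc)
    qed
  qed
  then show ?case
  proof (rule summable_comparison_test')
    fix n
    have "real (Suc n) ^ Suc K \<le> real (Suc n) * real (Suc (Suc n)) ^ K"
      by (simp add: power_mono)
    then show "norm (real (Suc n) ^ Suc K * r ^ n) \<le> diffs (\<lambda>n. real (Suc n) ^ K) n * r ^ n"
      using Suc.prems by (simp add: diffs_def mult_right_mono del: of_nat_Suc power_Suc)
  qed
qed (simp add: summable_geometric)

text \<open>There are at most (d+1)^n exponents of degree \<open>d\<close> in n variables, so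
  passing from coefficients to slices costs a polynomial factor.\<close>

lemma norm_slice_le:
  fixes x :: "complex ^ 'n::finite"
  assumes "\<And>k. norm (x $ k) \<le> r" "0 \<le> C" "\<And>e. norm (c e) \<le> C * real (Suc (mdeg e)) ^ M"
  shows "norm (slice c d x) \<le> C * (real (Suc d) ^ (CARD('n) + M) * r ^ d)"
proof -
  have r: "0 \<le> r" using assms(1) norm_ge_zero order_trans by blast
  have "norm (slice c d x) \<le> (\<Sum>e::'n\<Rightarrow>nat | mdeg e = d. C * real (Suc d) ^ M * r ^ d)"
    unfolding slice_def
    by (rule sum_norm_le)
      (use assms(3) norm_monom_at_le[OF assms(1)] r assms(2) in
        \<open>auto simp: norm_mult intro!: mult_mono\<close>)
  also have "\<dots> = real (card {e::'n\<Rightarrow>nat. mdeg e = d}) * (C * real (Suc d) ^ M * r ^ d)"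
    by simp
  also have "\<dots> \<le> real (Suc d) ^ CARD('n) * (C * real (Suc d) ^ M * r ^ d)"
  proof (rule mult_right_mono)
    show "real (card {e::'n \<Rightarrow> nat. mdeg e = d}) \<le> real (Suc d) ^ CARD('n)"
      using card_degree_slice[where 'n = 'n, of d] by (metis of_nat_le_iff of_nat_power)
  qed (use r assms(2) in simp)
  finally show ?thesis by (simp add: power_add algebra_simps)
qed

lemma polydisc_radius:
  assumes "x \<in> polydisc"
  obtains r where "0 \<le> r" "r < 1" "\<And>k. norm (x $ k) < r"
proof -
  define m where "m = Max (range (\<lambda>k. norm (x $ k)))"
  have le: "norm (x $ k) \<le> m" for k unfolding m_def by (rule Max_ge) auto
  have "m \<in> range (\<lambda>k. norm (x $ k))" unfolding m_def by (rule Max_in) auto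
  then have m1: "m < 1" using assms by (auto simp: polydisc_def)
  have m0: "0 \<le> m" using le[of undefined] norm_ge_zero order_trans by blast
  have "norm (x $ k) < (m + 1) / 2" for k
    by (rule le_less_trans[OF le]) (use m1 in simp)
  then show ?thesis
    using that[of "(m + 1) / 2"] m1 m0 by simp
qed

lemma summable_slice_norm:
  assumes "poly_growth c" "x \<in> polydisc"
  shows "summable (\<lambda>d. norm (slice c d x))"
proof -
  obtain C M where c: "0 \<le> C" "norm (c e) \<le> C * real (Suc (mdeg e)) ^ M" for e
    using assms(1) by (rule poly_growthE) auto
  obtain r where r: "0 \<le> r" "r < 1" "\<And>k. norm (x $ k) < r"
    using assms(2) by (rule polydisc_radius) auto
  show ?thesis
  proof (rule summable_comparison_test')
    show "summable (\<lambda>d. C * (real (Suc d) ^ (CARD('a) + M) * r ^ d))"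
      by (intro summable_mult summable_poly_geometric r)
    show "norm (norm (slice c d x)) \<le> C * (real (Suc d) ^ (CARD('a) + M) * r ^ d)" for d
      using norm_slice_le[OF less_imp_le[OF r(3)] c] by simp
  qed
qed

lemma summable_slice: "poly_growth c \<Longrightarrow> x \<in> polydisc \<Longrightarrow> summable (\<lambda>d. slice c d x)"
  by (rule summable_norm_cancel[OF summable_slice_norm])

lemma pseries_add:
  "poly_growth c \<Longrightarrow> poly_growth c' \<Longrightarrow> x \<in> polydisc \<Longrightarrow>
    pseries (\<lambda>e. c e + c' e) x = pseries c x + pseries c' x"
  unfolding pseries_def
  by (simp add: suminf_add summable_slice) (simp add: slice_def distrib_right sum.distrib)

lemma pseries_cmult:
  "poly_growth c \<Longrightarrow> x \<in> polydisc \<Longrightarrow> pseries (\<lambda>e. a * c e) x = a * pseries c x"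
  unfolding pseries_def
  by (subst suminf_mult[OF summable_slice, symmetric])
    (simp_all add: slice_def sum_distrib_left mult.assoc)

lemma pseries_0 [simp]: "pseries (\<lambda>e. 0) x = 0"
  by (simp add: pseries_def slice_def)

lemma slice_0: "slice c 0 x = c (\<lambda>_. 0)"
proof -
  have "{e::'a \<Rightarrow> nat. mdeg e = 0} = {\<lambda>_. 0}" using mdeg_eq_0 by auto
  then show ?thesis by (simp add: slice_def monom_at_def)
qed

lemma monom_at_0_eq: "monom_at 0 e = (if e = (\<lambda>_. 0) then 1 else 0)"
  by (auto simp: monom_at_def fun_eq_iff)

lemma pseries_at_0: "pseries c 0 = c (\<lambda>_. 0)"
proof -
  have "slice c d 0 = (if d = 0 then c (\<lambda>_. 0) else 0)" for d
    by (cases "d = 0") (auto simp: slice_0, auto simp: slice_def monom_at_0_eq mdeg_def intro!: sum.neutral)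
  then have "pseries c 0 = (\<Sum>d. if d = 0 then c (\<lambda>_. 0) else 0)"
    by (simp add: pseries_def)
  also have "\<dots> = (\<Sum>d\<in>{0::nat}. if d = 0 then c (\<lambda>_. 0) else 0)"
    by (rule suminf_finite) auto
  finally show ?thesis by simp
qed

lemma pseries_const:
  assumes "\<And>e. mdeg e > 0 \<Longrightarrow> c e = 0"
  shows "pseries c x = c (\<lambda>_. 0)"
proof -
  have "slice c d x = (if d = 0 then c (\<lambda>_. 0) else 0)" for d
    by (cases "d = 0") (auto simp: slice_0, auto simp: slice_def assms)
  then have "pseries c x = (\<Sum>d. if d = 0 then c (\<lambda>_. 0) else 0)"
    by (simp add: pseries_def)
  also have "\<dots> = (\<Sum>d\<in>{0::nat}. if d = 0 then c (\<lambda>_. 0) else 0)"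
    by (rule suminf_finite) auto
  finally show ?thesis by simp
qed

subsection \<open>Differentiation\<close>

text \<open>Coefficients of the partial derivative with respect to x_k.\<close>

definition dcoef :: "'n \<Rightarrow> (('n::finite \<Rightarrow> nat) \<Rightarrow> complex) \<Rightarrow> ('n \<Rightarrow> nat) \<Rightarrow> complex" where
  "dcoef k c e = of_nat (Suc (e k)) * c (e(k := Suc (e k)))"

lemma poly_growth_dcoef:
  assumes "poly_growth c"
  shows "poly_growth (dcoef k c)"
proof (rule poly_growth_bound[OF assms])
  show "mdeg (e(k := Suc (e k))) \<le> 2 * Suc (mdeg e)" for e :: "'a \<Rightarrow> nat"
    by (simp add: mdeg_upd)
  show "norm (dcoef k c e) \<le> norm (c (e(k := Suc (e k)))) * real (Suc (mdeg e))" for e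
    using le_mdeg[of e k]
    by (auto simp: dcoef_def norm_mult mult.commute[of "norm (c _)"] simp del: of_nat_Suc
        intro!: mult_right_mono)
qed

text \<open>Raising the exponent of x_k by one is a bijection from degree \<open>d\<close> onto the
  exponents of degree \<open>d + 1\<close> with \<open>e k > 0\<close>; the hypothesis discards the
  others.\<close>

lemma sum_slice_Suc:
  fixes g :: "('n::finite \<Rightarrow> nat) \<Rightarrow> 'a::comm_monoid_add"
  assumes "\<And>e. e k = 0 \<Longrightarrow> g e = 0"
  shows "(\<Sum>e | mdeg e = Suc d. g e) = (\<Sum>e | mdeg e = d. g (e(k := Suc (e k))))"
proof -
  have "(\<Sum>e | mdeg e = Suc d. g e) = (\<Sum>e | mdeg e = Suc d \<and> 0 < e k. g e)"
    by (rule sum.mono_neutral_right) (use assms in auto)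
  also have "\<dots> = (\<Sum>e | mdeg e = d. g (e(k := Suc (e k))))"
  proof (rule sum.reindex_bij_witness[where i = "\<lambda>e. e(k := Suc (e k))" and j = "\<lambda>e. e(k := e k - 1)"])
    fix e :: "'n \<Rightarrow> nat" assume e: "e \<in> {e. mdeg e = Suc d \<and> 0 < e k}"
    then have *: "(e(k := e k - 1))(k := Suc ((e(k := e k - 1)) k)) = e" by auto
    then show "(e(k := e k - 1))(k := Suc ((e(k := e k - 1)) k)) = e" .
    then show "e(k := e k - 1) \<in> {e. mdeg e = d}"
      using e mdeg_upd[of "e(k := e k - 1)" k] by simp
    show "g ((e(k := e k - 1))(k := Suc ((e(k := e k - 1)) k))) = g e"
      by (simp only: *)
  qed (auto simp: mdeg_upd)
  finally show ?thesis .
qed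

lemma monom_at_upd: "monom_at x (e(k := Suc (e k))) = x $ k * monom_at x e"
proof -
  have "monom_at x (e(k := Suc (e k))) = (\<Prod>j\<in>UNIV. (if j = k then x $ k else 1) * x $ j ^ e j)"
    unfolding monom_at_def by (rule prod.cong) auto
  then show ?thesis by (simp add: monom_at_def prod.distrib)
qed

lemma has_derivative_monom_at:
  "((\<lambda>x. monom_at x e) has_derivative
     (\<lambda>h. \<Sum>k\<in>UNIV. h $ k * (of_nat (e k) * monom_at x (e(k := e k - 1))))) (at x within S)"
proof -
  have comp: "((\<lambda>x. x $ k ^ e k) has_derivative (\<lambda>h. of_nat (e k) * h $ k * x $ k ^ (e k - 1))) (at x within S)"
    for k
    using has_derivative_power[OF bounded_linear_imp_has_derivative[OF bounded_linear_vec_nth[of k]],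
        where n = "e k" and S = S and x = x]
    by simp
  have "(\<Prod>j\<in>UNIV - {k}. x $ j ^ e j) * x $ k ^ (e k - 1) = monom_at x (e(k := e k - 1))" for k
  proof -
    have "monom_at x (e(k := e k - 1)) = x $ k ^ (e k - 1) * (\<Prod>j\<in>UNIV - {k}. x $ j ^ (e(k := e k - 1)) j)"
      by (simp add: monom_at_def prod.remove[of UNIV k])
    also have "(\<Prod>j\<in>UNIV - {k}. x $ j ^ (e(k := e k - 1)) j) = (\<Prod>j\<in>UNIV - {k}. x $ j ^ e j)"
      by (rule prod.cong) auto
    finally show ?thesis by (simp only: mult.commute)
  qed
  then have eq: "(of_nat (e k) * h $ k * x $ k ^ (e k - 1)) * (\<Prod>j\<in>UNIV - {k}. x $ j ^ e j)
      = h $ k * (of_nat (e k) * monom_at x (e(k := e k - 1)))" for k and h :: "complex ^ 'a"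
    by (simp add: mult.assoc mult.commute mult.left_commute)
  show ?thesis
    unfolding monom_at_def[of _ e]
    by (rule has_derivative_eq_rhs[OF has_derivative_prod[OF comp]]) (simp only: eq)
qed

lemma has_derivative_slice_Suc:
  "(slice c (Suc d) has_derivative (\<lambda>h. \<Sum>k\<in>UNIV. h $ k * slice (dcoef k c) d x)) (at x within S)"
proof -
  have "(slice c (Suc d) has_derivative (\<lambda>h. \<Sum>e | mdeg e = Suc d.
      c e * (\<Sum>k\<in>UNIV. h $ k * (of_nat (e k) * monom_at x (e(k := e k - 1)))))) (at x within S)"
    unfolding slice_def[abs_def]
    by (intro has_derivative_sum has_derivative_mult_right has_derivative_monom_at)
  moreover have "(\<Sum>e | mdeg e = Suc d. c e * (\<Sum>k\<in>UNIV. h $ k * (of_nat (e k) * monom_at x (e(k := e k - 1)))))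
      = (\<Sum>k\<in>UNIV. h $ k * slice (dcoef k c) d x)" for h
  proof -
    have "(\<Sum>e | mdeg e = Suc d. c e * (of_nat (e k) * monom_at x (e(k := e k - 1)))) = slice (dcoef k c) d x" for k
      by (subst sum_slice_Suc[of k]) (simp_all add: slice_def dcoef_def mult_ac del: of_nat_Suc)
    then have "(\<Sum>k\<in>UNIV. h $ k * slice (dcoef k c) d x)
       = (\<Sum>k\<in>UNIV. h $ k * (\<Sum>e | mdeg e = Suc d. c e * (of_nat (e k) * monom_at x (e(k := e k - 1)))))"
      by simp
    also have "\<dots> = (\<Sum>e | mdeg e = Suc d. \<Sum>k\<in>UNIV. h $ k * (c e * (of_nat (e k) * monom_at x (e(k := e k - 1)))))"
      by (subst sum.swap) (simp add: sum_distrib_left)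
    also have "\<dots> = (\<Sum>e | mdeg e = Suc d. c e * (\<Sum>k\<in>UNIV. h $ k * (of_nat (e k) * monom_at x (e(k := e k - 1)))))"
      by (simp add: sum_distrib_left mult_ac)
    finally show ?thesis by simp
  qed
  ultimately show ?thesis by simp
qed

text \<open>Termwise differentiation needs uniform convergence of the derivatives. It holds on a
  smaller polydisc of radius \<open>r < 1\<close> containing \<open>x\<close>, by the Weierstrass
  test with the bound of \<open>norm_slice_le\<close>.\<close>

lemma has_derivative_pseries:
  fixes x :: "complex ^ 'n::finite"
  assumes "poly_growth c" "x \<in> polydisc"
  shows "(pseries c has_derivative (\<lambda>h. \<Sum>k\<in>UNIV. h $ k * pseries (dcoef k c) x)) (at x)"
proof -
  obtain r where r: "0 \<le> r" "r < 1" "\<And>k. norm (x $ k) < r"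
    using assms(2) by (rule polydisc_radius) auto
  define S where "S = {y :: complex ^ 'n. \<forall>k. norm (y $ k) < r}"
  have xS: "x \<in> S" using r by (simp add: S_def)
  have SD: "S \<subseteq> polydisc" using r by (auto simp: S_def polydisc_def intro: less_trans)
  have "S = (\<Inter>k. {y. norm (y $ k) < r})" by (auto simp: S_def)
  moreover have "open {y :: complex ^ 'n. norm (y $ k) < r}" for k
    by (intro open_Collect_less continuous_intros)
  ultimately have openS: "open S" by auto
  have convS: "convex S"
    unfolding convex_def S_def
  proof (intro ballI allI impI, unfold mem_Collect_eq, intro allI)
    fix y z :: "complex ^ 'n" and u v :: real and k
    assume *: "\<forall>k. norm (y $ k) < r" "\<forall>k. norm (z $ k) < r" and uv: "0 \<le> u" "0 \<le> v" "u + v = 1"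
    have "u *\<^sub>R y $ k + v *\<^sub>R z $ k \<in> ball 0 r"
      using convex_ball[of "0::complex" r] * uv unfolding convex_def by simp
    then show "norm ((u *\<^sub>R y + v *\<^sub>R z) $ k) < r" by simp
  qed
  define f' where "f' d y h = (case d of 0 \<Rightarrow> 0 | Suc d' \<Rightarrow> \<Sum>k\<in>UNIV. h $ k * slice (dcoef k c) d' y)"
    for d and y h :: "complex ^ 'n"
  define g' where "g' y h = (\<Sum>k\<in>UNIV. h $ k * pseries (dcoef k c) y)" for y h :: "complex ^ 'n"
  have tail: "\<exists>B. summable B \<and> (\<forall>d y. y \<in> S \<longrightarrow> norm (slice (dcoef k c) d y) \<le> B d)" for k
  proof -
    obtain C M where c: "0 \<le> C" "norm (dcoef k c e) \<le> C * real (Suc (mdeg e)) ^ M" for e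
      using poly_growth_dcoef[OF assms(1)] by (rule poly_growthE) auto
    have "summable (\<lambda>d. C * (real (Suc d) ^ (CARD('n) + M) * r ^ d))"
      by (intro summable_mult summable_poly_geometric r)
    then show ?thesis
      using norm_slice_le[OF _ c, of _ r] unfolding S_def
      by (intro exI[of _ "\<lambda>d. C * (real (Suc d) ^ (CARD('n) + M) * r ^ d)"])
        (auto simp: less_imp_le simp del: of_nat_Suc)
  qed
  then obtain B where B: "summable (B k)" "\<And>d y. y \<in> S \<Longrightarrow> norm (slice (dcoef k c) d y) \<le> B k d" for k
    by metis
  have unif: "uniform_limit S (\<lambda>n y. \<Sum>d<n. slice (dcoef k c) d y) (pseries (dcoef k c)) sequentially" for k
    unfolding pseries_def[abs_def]
    by (rule Weierstrass_m_test[OF B(2) B(1)])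
  have "\<exists>g. \<forall>y\<in>S. (\<lambda>d. slice c d y) sums g y \<and> (g has_derivative g' y) (at y within S)"
  proof (rule has_derivative_series[OF convS])
    show "x \<in> S" by (rule xS)
    show "(\<lambda>d. slice c d x) sums (\<Sum>d. slice c d x)"
      by (rule summable_sums[OF summable_slice[OF assms]])
    show "(slice c d has_derivative f' d y) (at y within S)" if "y \<in> S" for d y
    proof (cases d)
      case 0
      have "slice c 0 = (\<lambda>_. c (\<lambda>_. 0))" by (simp add: slice_0 fun_eq_iff)
      moreover have "f' 0 y = (\<lambda>h. 0)" by (simp add: f'_def fun_eq_iff)
      ultimately show ?thesis by (simp add: 0)
    next
      case (Suc d')
      then show ?thesis unfolding f'_def by (simp add: has_derivative_slice_Suc)
    qed
    fix \<epsilon> :: real assume \<epsilon>: "0 < \<epsilon>"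
    \<comment> \<open>The derivative is a sum over coordinate directions, each controlled uniformly;
      every direction gets an equal share of \<open>\<epsilon>\<close>.\<close>
    define \<delta> where "\<delta> = \<epsilon> / real CARD('n)"
    have \<delta>: "0 < \<delta>" using \<epsilon> by (simp add: \<delta>_def)
    have "\<forall>\<^sub>F n in sequentially. \<forall>k. \<forall>y\<in>S. dist (\<Sum>d<n. slice (dcoef k c) d y) (pseries (dcoef k c) y) < \<delta>"
      using unif \<delta> by (simp add: uniform_limit_iff eventually_all_finite)
    \<comment> \<open>\<open>Suc n\<close> because the derivative of slice \<open>d + 1\<close>
      consists of slices of degree \<open>d\<close>, while slice 0 is constant.\<close>
    then have "\<forall>\<^sub>F n in sequentially. \<forall>y\<in>S. \<forall>h. norm ((\<Sum>d<Suc n. f' d y h) - g' y h) \<le> \<epsilon> * norm h"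
    proof (eventually_elim, intro ballI allI)
      fix n y and h :: "complex ^ 'n"
      assume *: "\<forall>k. \<forall>y\<in>S. dist (\<Sum>d<n. slice (dcoef k c) d y) (pseries (dcoef k c) y) < \<delta>" and y: "y \<in> S"
      have "(\<Sum>d<Suc n. f' d y h) = (\<Sum>d<n. f' (Suc d) y h)"
        by (subst sum.lessThan_Suc_shift) (simp add: f'_def)
      also have "\<dots> = (\<Sum>k\<in>UNIV. h $ k * (\<Sum>d<n. slice (dcoef k c) d y))"
        by (simp add: f'_def sum_distrib_left) (rule sum.swap)
      finally have "(\<Sum>d<Suc n. f' d y h) - g' y h
          = (\<Sum>k\<in>UNIV. h $ k * ((\<Sum>d<n. slice (dcoef k c) d y) - pseries (dcoef k c) y))"
        by (simp add: g'_def sum_subtractf right_diff_distrib)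
      also have "norm \<dots> \<le> (\<Sum>k\<in>(UNIV::'n set). norm h * \<delta>)"
        using * y by (intro sum_norm_le)
          (auto simp: norm_mult dist_norm less_imp_le intro!: mult_mono Finite_Cartesian_Product.norm_nth_le)
      also have "\<dots> = \<epsilon> * norm h" by (simp add: \<delta>_def)
      finally show "norm ((\<Sum>d<Suc n. f' d y h) - g' y h) \<le> \<epsilon> * norm h" .
    qed
    then show "\<forall>\<^sub>F n in sequentially. \<forall>y\<in>S. \<forall>h. norm ((\<Sum>d<n. f' d y h) - g' y h) \<le> \<epsilon> * norm h"
      by (subst (asm) eventually_sequentially_Suc)
  qed
  then obtain g where g: "\<And>y. y \<in> S \<Longrightarrow> (\<lambda>d. slice c d y) sums g y"
      "\<And>y. y \<in> S \<Longrightarrow> (g has_derivative g' y) (at y within S)" by blast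
  have eq: "pseries c y = g y" if "y \<in> S" for y
    using g(1)[OF that] unfolding pseries_def by (rule sums_unique[symmetric])
  have "(pseries c has_derivative g' x) (at x within S)"
    by (rule has_derivative_transform[OF xS eq g(2)[OF xS]])
  then show ?thesis
    unfolding at_within_open[OF xS openS] g'_def .
qed

lemma poly_growth_coord_mult: "poly_growth c \<Longrightarrow> poly_growth (\<lambda>e. of_nat (e k) * c e)"
  by (rule poly_growth_bound[where f = id and K = 1])
    (auto simp: norm_mult mult.commute[of "norm (c _)"] le_SucI[OF le_mdeg]
      simp del: of_nat_Suc intro!: mult_right_mono)

lemma pseries_euler:
  assumes "poly_growth c" "x \<in> polydisc"
  shows "pseries (\<lambda>e. of_nat (e k) * c e) x = x $ k * pseries (dcoef k c) x"
proof -
  have "slice (\<lambda>e. of_nat (e k) * c e) (Suc d) x = x $ k * slice (dcoef k c) d x" for d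
    unfolding slice_def
    by (subst sum_slice_Suc[of k])
      (simp_all add: dcoef_def monom_at_upd sum_distrib_left mult_ac del: of_nat_Suc)
  moreover have "slice (\<lambda>e. of_nat (e k) * c e) 0 x = 0" by (simp add: slice_0)
  ultimately show ?thesis
    using suminf_split_head[OF summable_slice[OF poly_growth_coord_mult[OF assms(1), of k] assms(2)]]
      suminf_mult[OF summable_slice[OF poly_growth_dcoef[OF assms(1), of k] assms(2)], of "x $ k"]
    by (simp add: pseries_def)
qed

subsection \<open>Multiplication by monomials and by geometric series\<close>

text \<open>Multiplication by the monomial with exponent \<open>\<mu>\<close>. Values lie in any
  complex vector space, so that it applies to scalar series and to series with coefficients in the
  enveloping algebra.\<close>

definition shift_by :: "('n::finite \<Rightarrow> nat) \<Rightarrow> (('n \<Rightarrow> nat) \<Rightarrow> 'u::cvector) \<Rightarrow> ('n \<Rightarrow> nat) \<Rightarrow> 'u" where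
  "shift_by \<mu> c e = (if \<mu> \<le> e then c (\<lambda>k. e k - \<mu> k) else 0)"

text \<open>Multiplication by \<open>m / (m - 1) = - (m + m\<^sup>2 + \<dots>)\<close>, where \<open>m\<close> is the monomial with exponent \<open>\<mu>\<close>.\<close>
definition geom_by :: "('n::finite \<Rightarrow> nat) \<Rightarrow> (('n \<Rightarrow> nat) \<Rightarrow> 'u::cvector) \<Rightarrow> ('n \<Rightarrow> nat) \<Rightarrow> 'u" where
  "geom_by \<mu> c e = - (\<Sum>r = 1..mdeg e. shift_by (\<lambda>k. r * \<mu> k) c e)"

lemma shift_by_shift_by: "shift_by \<mu> (shift_by \<nu> c) = shift_by (\<lambda>k. \<mu> k + \<nu> k) c"
proof
  fix e
  have "(\<mu> \<le> e \<and> \<nu> \<le> (\<lambda>k. e k - \<mu> k)) \<longleftrightarrow> (\<lambda>k. \<mu> k + \<nu> k) \<le> e"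
    unfolding le_fun_def
    by (metis (no_types, lifting) add_leD1 le_diff_conv2 add.commute)
  then show "shift_by \<mu> (shift_by \<nu> c) e = shift_by (\<lambda>k. \<mu> k + \<nu> k) c e"
    by (auto simp: shift_by_def)
qed

lemma shift_by_commute: "shift_by \<mu> (shift_by \<nu> c) = shift_by \<nu> (shift_by \<mu> c)"
  by (simp add: shift_by_shift_by add.commute)

lemma shift_by_add: "shift_by \<mu> (c + c') = shift_by \<mu> c + shift_by \<mu> c'"
  and shift_by_diff: "shift_by \<mu> (c - c') = shift_by \<mu> c - shift_by \<mu> c'"
  and shift_by_minus: "shift_by \<mu> (- c) = - shift_by \<mu> c"
  by (auto simp: shift_by_def fun_eq_iff)

lemma mdeg_mono: "\<mu> \<le> e \<Longrightarrow> mdeg \<mu> \<le> mdeg e"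
  unfolding mdeg_def le_fun_def by (rule sum_mono) auto

lemma mdeg_scale: "mdeg (\<lambda>k. r * \<mu> k) = r * mdeg \<mu>"
  by (simp add: mdeg_def sum_distrib_left)

lemma shift_by_eq_0: "mdeg e < mdeg \<mu> \<Longrightarrow> shift_by \<mu> c e = 0"
  using mdeg_mono[of \<mu> e] by (auto simp: shift_by_def)

text \<open>A power of a nonconstant monomial beyond the degree of \<open>e\<close> cannot divide
  the monomial of \<open>e\<close>, so the upper summation limit may be raised freely.\<close>

lemma geom_by_upto:
  assumes "0 < mdeg \<mu>" "mdeg e \<le> N"
  shows "geom_by \<mu> c e = - (\<Sum>r = 1..N. shift_by (\<lambda>k. r * \<mu> k) c e)"
proof -
  have "(\<Sum>r = 1..N. shift_by (\<lambda>k. r * \<mu> k) c e) = (\<Sum>r = 1..mdeg e. shift_by (\<lambda>k. r * \<mu> k) c e)"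
  proof (rule sum.mono_neutral_right)
    show "\<forall>r\<in>{1..N} - {1..mdeg e}. shift_by (\<lambda>k. r * \<mu> k) c e = 0"
    proof
      fix r assume "r \<in> {1..N} - {1..mdeg e}"
      then have "mdeg e < r * 1" by auto
      also have "\<dots> \<le> r * mdeg \<mu>" using assms(1) by (intro mult_le_mono) auto
      finally show "shift_by (\<lambda>k. r * \<mu> k) c e = 0" by (simp add: shift_by_eq_0 mdeg_scale)
    qed
  qed (use assms in auto)
  then show ?thesis by (simp add: geom_by_def)
qed

text \<open>\<open>g = m / (m - 1)\<close> solves \<open>g = m g - m\<close>; on the sums this is a
  shift of the summation index.\<close>

lemma geom_by_rec:
  fixes c :: "('n::finite \<Rightarrow> nat) \<Rightarrow> 'u::cvector"
  assumes "0 < mdeg \<mu>"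
  shows "geom_by \<mu> c = shift_by \<mu> (geom_by \<mu> c) - shift_by \<mu> c"
proof
  fix e :: "'n \<Rightarrow> nat"
  define N where "N = mdeg e"
  have "shift_by \<mu> (geom_by \<mu> c) e = - (\<Sum>r = 1..N. shift_by (\<lambda>k. Suc r * \<mu> k) c e)"
  proof (cases "\<mu> \<le> e")
    case True
    then have "mdeg (\<lambda>k. e k - \<mu> k) \<le> N"
      unfolding N_def by (intro mdeg_mono) (simp add: le_fun_def)
    then have "shift_by \<mu> (geom_by \<mu> c) e = - (\<Sum>r = 1..N. shift_by \<mu> (shift_by (\<lambda>k. r * \<mu> k) c) e)"
      using True by (simp add: shift_by_def[of \<mu>] geom_by_upto[OF assms])
    then show ?thesis by (simp add: shift_by_shift_by)
  next
    case False
    then have "\<not> (\<lambda>k. Suc r * \<mu> k) \<le> e" for r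
      by (auto simp: le_fun_def) (meson add_leD1)
    then show ?thesis using False by (simp add: shift_by_def)
  qed
  also have "(\<Sum>r = 1..N. shift_by (\<lambda>k. Suc r * \<mu> k) c e) = (\<Sum>r = Suc 1..Suc N. shift_by (\<lambda>k. r * \<mu> k) c e)"
    by (subst sum.shift_bounds_cl_Suc_ivl) simp
  also have "\<dots> = (\<Sum>r = 1..Suc N. shift_by (\<lambda>k. r * \<mu> k) c e) - shift_by \<mu> c e"
    by (subst sum.atLeast_Suc_atMost[of 1]) simp_all
  also have "(\<Sum>r = 1..Suc N. shift_by (\<lambda>k. r * \<mu> k) c e) = - geom_by \<mu> c e"
    by (subst geom_by_upto[OF assms, of e "Suc N"]) (simp_all add: N_def)
  finally show "geom_by \<mu> c e = (shift_by \<mu> (geom_by \<mu> c) - shift_by \<mu> c) e"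
    by simp
qed

text \<open>\<open>1 - m\<close> is no zero divisor: the value at \<open>e\<close> repeats one of
  smaller degree, until \<open>\<mu> \<le> e\<close> fails.\<close>

lemma shift_by_fixed_eq_0:
  assumes "0 < mdeg \<mu>" "f = shift_by \<mu> f"
  shows "f = 0"
proof
  show "f e = 0 e" for e
  proof (induction "mdeg e" arbitrary: e rule: less_induct)
    case less
    show ?case
    proof (cases "\<mu> \<le> e")
      case True
      have "(\<lambda>k. (e k - \<mu> k) + \<mu> k) = e" using True by (auto simp: le_fun_def)
      then have "mdeg (\<lambda>k. e k - \<mu> k) < mdeg e"
        using mdeg_add[of "\<lambda>k. e k - \<mu> k" \<mu>] assms(1) by simp
      then have "f (\<lambda>k. e k - \<mu> k) = 0" using less by simp
      then show ?thesis by (subst assms(2)) (simp add: shift_by_def)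
    qed (subst assms(2), simp add: shift_by_def)
  qed
qed

text \<open>The recursion has a single solution; the algebraic laws below, including the Arnold
  relation, are obtained by checking it instead of rearranging sums.\<close>

lemma geom_by_eqI:
  assumes "0 < mdeg \<mu>" "f = shift_by \<mu> f - shift_by \<mu> c"
  shows "f = geom_by \<mu> c"
proof -
  have "f - geom_by \<mu> c = shift_by \<mu> (f - geom_by \<mu> c)"
    by (subst (1) assms(2), subst (1) geom_by_rec[OF assms(1)]) (simp add: shift_by_diff)
  then have "f - geom_by \<mu> c = 0" by (rule shift_by_fixed_eq_0[OF assms(1)])
  then show ?thesis by simp
qed

lemma geom_by_add:
  assumes "0 < mdeg \<mu>"
  shows "geom_by \<mu> (c + c') = geom_by \<mu> c + geom_by \<mu> c'"
  by (rule geom_by_eqI[OF assms, symmetric], subst (1) geom_by_rec[OF assms],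
      subst (2) geom_by_rec[OF assms]) (simp add: shift_by_add)

lemma geom_by_shift_by:
  assumes "0 < mdeg \<mu>"
  shows "geom_by \<mu> (shift_by \<nu> c) = shift_by \<nu> (geom_by \<mu> c)"
  by (rule geom_by_eqI[OF assms, symmetric], subst (1) geom_by_rec[OF assms])
    (simp add: shift_by_diff shift_by_commute[of \<nu>])

lemma geom_by_minus:
  assumes "0 < mdeg \<mu>"
  shows "geom_by \<mu> (- c) = - geom_by \<mu> c"
  by (rule geom_by_eqI[OF assms, symmetric], subst (1) geom_by_rec[OF assms])
    (simp add: shift_by_minus)

lemma geom_by_diff:
  assumes "0 < mdeg \<mu>"
  shows "geom_by \<mu> (c - c') = geom_by \<mu> c - geom_by \<mu> c'"
  using geom_by_add[OF assms, of c "- c'"] by (simp add: geom_by_minus[OF assms])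

lemma geom_by_commute:
  assumes "0 < mdeg \<mu>" "0 < mdeg \<nu>"
  shows "geom_by \<mu> (geom_by \<nu> c) = geom_by \<nu> (geom_by \<mu> c)"
  by (rule geom_by_eqI[OF assms(1), symmetric], subst (1) geom_by_rec[OF assms(1)])
    (simp add: geom_by_diff geom_by_shift_by assms)

text \<open>With \<open>a = m / (m - 1)\<close>, \<open>b = m' / (m' - 1)\<close> and \<open>e = m m' / (m m' - 1)\<close> this is the identity
  \<open>a b + e = e (a + b)\<close>, i.e. the Arnold relation between the three logarithmic forms.\<close>
lemma geom_by_arnold:
  fixes c :: "('n::finite \<Rightarrow> nat) \<Rightarrow> 'u::cvector"
  assumes "0 < mdeg \<mu>" "0 < mdeg \<nu>"
  defines "\<rho> \<equiv> \<lambda>k. \<mu> k + \<nu> k"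
  shows "geom_by \<mu> (geom_by \<nu> c) + geom_by \<rho> c = geom_by \<rho> (geom_by \<mu> c) + geom_by \<rho> (geom_by \<nu> c)"
proof -
  have \<rho>: "0 < mdeg \<rho>" using assms by (simp add: mdeg_add \<rho>_def)
  have S: "shift_by \<rho> f = shift_by \<mu> (shift_by \<nu> f)" for f :: "('n \<Rightarrow> nat) \<Rightarrow> 'u"
    by (simp add: shift_by_shift_by \<rho>_def)
  define A where "A = geom_by \<mu> c"
  define B where "B = geom_by \<nu> c"
  define G where "G = geom_by \<mu> (geom_by \<nu> c)"
  define s :: "(('n \<Rightarrow> nat) \<Rightarrow> 'u) \<Rightarrow> _" where "s = shift_by \<mu>"
  define t :: "(('n \<Rightarrow> nat) \<Rightarrow> 'u) \<Rightarrow> _" where "t = shift_by \<nu>"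
  have add: "s (f + g) = s f + s g" "t (f + g) = t f + t g" "s (f - g) = s f - s g" "t (f - g) = t f - t g"
    for f g :: "('n \<Rightarrow> nat) \<Rightarrow> 'u"
    by (simp_all add: s_def t_def shift_by_add shift_by_diff shift_by_commute)
  have A: "A = s A - s c" and B: "B = t B - t c"
    unfolding A_def B_def s_def t_def by (rule geom_by_rec, rule assms)+
  have G1: "G = s G - s B"
    unfolding G_def B_def s_def by (rule geom_by_rec[OF assms(1)])
  have G2: "G = t G - t A"
    unfolding G_def A_def t_def geom_by_commute[OF assms(1,2)] by (rule geom_by_rec[OF assms(2)])
  have "s G = s (t G) - s (t A)"
    using arg_cong[OF G2, of s] by (simp only: add)
  moreover have "s B = s (t B) - s (t c)"
    using arg_cong[OF B, of s] by (simp only: add)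
  ultimately have G: "G = s (t G) - s (t A) - s (t B) + s (t c)"
    by (subst G1) simp
  have E: "geom_by \<rho> c = s (t (geom_by \<rho> c)) - s (t c)"
    using geom_by_rec[OF \<rho>, of c] by (simp add: S s_def t_def)
  \<comment> \<open>The terms \<open>s (t c)\<close> cancel, and what is left is the recursion of
    \<open>geom_by \<rho>\<close> for the argument \<open>A + B\<close>.\<close>
  have "G + geom_by \<rho> c = s (t G) - s (t A) - s (t B) + s (t c) + (s (t (geom_by \<rho> c)) - s (t c))"
    by (rule arg_cong2[where f = "(+)", OF G E])
  also have "\<dots> = s (t (G + geom_by \<rho> c)) - s (t (A + B))"
    by (simp only: add(1,2)) simp
  finally have "G + geom_by \<rho> c = geom_by \<rho> (A + B)"
    by (intro geom_by_eqI[OF \<rho>]) (simp only: S s_def t_def)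
  then show ?thesis
    by (simp add: G_def A_def B_def geom_by_add[OF \<rho>])
qed

lemma mdeg_zero [simp]: "mdeg (\<lambda>_. 0) = 0"
  by (simp add: mdeg_def)

lemma poly_growth_shift_by:
  assumes "poly_growth c"
  shows "poly_growth (shift_by \<mu> c)"
proof (rule poly_growth_bound[OF assms])
  show "mdeg (\<lambda>k. e k - \<mu> k) \<le> 1 * Suc (mdeg e)" for e :: "'a \<Rightarrow> nat"
    using mdeg_mono[of "\<lambda>k. e k - \<mu> k" e] by (simp add: le_fun_def)
  show "norm (shift_by \<mu> c e) \<le> norm (c (\<lambda>k. e k - \<mu> k)) * real (Suc (mdeg e))" for e
    using mult_left_mono[of 1 "real (Suc (mdeg e))" "norm (c (\<lambda>k. e k - \<mu> k))"]
    by (auto simp: shift_by_def simp del: of_nat_Suc)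
qed

lemma poly_growth_geom_by:
  assumes "poly_growth c"
  shows "poly_growth (geom_by \<mu> c)"
proof -
  obtain C M where c: "0 \<le> C" "norm (c e) \<le> C * real (Suc (mdeg e)) ^ M" for e
    using assms by (rule poly_growthE) auto
  show ?thesis
  proof (rule poly_growthI[of _ C "Suc M"])
    fix e :: "'a \<Rightarrow> nat"
    have "norm (shift_by \<nu> c e) \<le> C * real (Suc (mdeg e)) ^ M" for \<nu>
    proof (cases "\<nu> \<le> e")
      case True
      have "mdeg (\<lambda>k. e k - \<nu> k) \<le> mdeg e"
        by (rule mdeg_mono) (simp add: le_fun_def)
      then have "C * real (Suc (mdeg (\<lambda>k. e k - \<nu> k))) ^ M \<le> C * real (Suc (mdeg e)) ^ M"
        using c(1) by (intro mult_left_mono power_mono) auto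
      then show ?thesis using True c(2)[of "\<lambda>k. e k - \<nu> k"] by (simp add: shift_by_def)
    qed (use c(1) in \<open>simp add: shift_by_def\<close>)
    then have "norm (geom_by \<mu> c e) \<le> (\<Sum>r = 1..mdeg e. C * real (Suc (mdeg e)) ^ M)"
      unfolding geom_by_def norm_minus_cancel by (intro sum_norm_le)
    also have "\<dots> \<le> real (Suc (mdeg e)) * (C * real (Suc (mdeg e)) ^ M)"
      using c(1) by (simp del: of_nat_Suc) (intro mult_right_mono, auto)
    finally show "norm (geom_by \<mu> c e) \<le> C * real (Suc (mdeg e)) ^ Suc M"
      by (simp only: power_Suc mult_ac)
  qed
qed

lemma monom_at_add: "monom_at x (\<lambda>k. e k + f k) = monom_at x e * monom_at x f"
  by (simp add: monom_at_def power_add prod.distrib)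

lemma slice_shift_by:
  "slice (shift_by \<mu> c) d x = (if mdeg \<mu> \<le> d then monom_at x \<mu> * slice c (d - mdeg \<mu>) x else 0)"
proof (cases "mdeg \<mu> \<le> d")
  case True
  have "slice (shift_by \<mu> c) d x = (\<Sum>e | mdeg e = d \<and> \<mu> \<le> e. shift_by \<mu> c e * monom_at x e)"
    unfolding slice_def by (rule sum.mono_neutral_right) (auto simp: shift_by_def)
  also have "\<dots> = (\<Sum>e | mdeg e = d - mdeg \<mu>. c e * monom_at x (\<lambda>k. e k + \<mu> k))"
  proof (rule sum.reindex_bij_witness[where i = "\<lambda>e k. e k + \<mu> k" and j = "\<lambda>e k. e k - \<mu> k"])
    fix e assume e: "e \<in> {e. mdeg e = d \<and> \<mu> \<le> e}"
    then show *: "(\<lambda>k. (e k - \<mu> k) + \<mu> k) = e" by (auto simp: le_fun_def)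
    then show "(\<lambda>k. e k - \<mu> k) \<in> {e. mdeg e = d - mdeg \<mu>}"
      using e mdeg_add[of "\<lambda>k. e k - \<mu> k" \<mu>] by simp
    show "c (\<lambda>k. e k - \<mu> k) * monom_at x (\<lambda>k. e k - \<mu> k + \<mu> k) = shift_by \<mu> c e * monom_at x e"
      using e by (simp add: * shift_by_def)
  qed (use True in \<open>auto simp: mdeg_add le_fun_def\<close>)
  finally show ?thesis
    using True by (simp add: monom_at_add slice_def sum_distrib_left mult_ac)
next
  case False
  then have "shift_by \<mu> c e = 0" if "mdeg e = d" for e
    using that by (simp add: shift_by_eq_0)
  then show ?thesis using False by (simp add: slice_def)
qed

lemma pseries_shift_by:
  assumes "poly_growth c" "x \<in> polydisc"
  shows "pseries (shift_by \<mu> c) x = monom_at x \<mu> * pseries c x"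
proof -
  have "(\<lambda>d. slice (shift_by \<mu> c) (d + mdeg \<mu>) x) sums (monom_at x \<mu> * pseries c x)"
    unfolding slice_shift_by pseries_def
    by (simp add: sums_mult summable_sums summable_slice assms)
  then have "(\<lambda>d. slice (shift_by \<mu> c) d x) sums
      (monom_at x \<mu> * pseries c x + (\<Sum>d<mdeg \<mu>. slice (shift_by \<mu> c) d x))"
    by (subst (asm) sums_iff_shift)
  then show ?thesis by (simp add: slice_shift_by pseries_def sums_iff)
qed

lemma norm_monom_at_less:
  assumes "x \<in> polydisc" "0 < mdeg \<mu>"
  shows "norm (monom_at x \<mu>) < 1"
proof -
  obtain r where r: "0 \<le> r" "r < 1" "\<And>k. norm (x $ k) < r"
    using assms(1) by (rule polydisc_radius) auto
  have "norm (monom_at x \<mu>) \<le> r ^ mdeg \<mu>"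
    by (rule norm_monom_at_le) (use r(3) less_imp_le in blast)
  also have "\<dots> < 1" using r assms(2) by (simp add: power_less_one_iff)
  finally show ?thesis .
qed

definition geom_factor :: "('n::finite \<Rightarrow> nat) \<Rightarrow> complex ^ 'n \<Rightarrow> complex" where
  "geom_factor \<mu> x = monom_at x \<mu> / (monom_at x \<mu> - 1)"

lemma pseries_geom_by:
  assumes "poly_growth c" "x \<in> polydisc" "0 < mdeg \<mu>"
  shows "pseries (geom_by \<mu> c) x = geom_factor \<mu> x * pseries c x"
proof -
  let ?m = "monom_at x \<mu>" and ?g = "pseries (geom_by \<mu> c) x"
  have "?m \<noteq> 1" using norm_monom_at_less[OF assms(2,3)] by auto
  have "geom_by \<mu> c = (\<lambda>e. shift_by \<mu> (geom_by \<mu> c) e + (- 1) * shift_by \<mu> c e)"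
    by (subst (1) geom_by_rec[OF assms(3)]) (simp add: fun_eq_iff)
  then have "?g = ?m * ?g + (- 1) * (?m * pseries c x)"
    by (metis (no_types) pseries_add pseries_cmult pseries_shift_by poly_growth_geom_by poly_growth_shift_by
        poly_growth_cmult assms(1,2))
  then have "?g * (?m - 1) = ?m * pseries c x" by (simp add: algebra_simps)
  then show ?thesis using \<open>?m \<noteq> 1\<close> by (simp add: geom_factor_def field_simps)
qed

lemma clinear_shift_by: "clinear f \<Longrightarrow> f (shift_by \<mu> g e) = shift_by \<mu> (\<lambda>e. f (g e)) e"
  by (simp add: shift_by_def clinear_0)

lemma clinear_geom_by: "clinear f \<Longrightarrow> f (geom_by \<mu> g e) = geom_by \<mu> (\<lambda>e. f (g e)) e"
  by (simp add: geom_by_def clinear_minus clinear_sum clinear_shift_by)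


lemma sum_list_map_eq_0: "(\<And>x. x \<in> set xs \<Longrightarrow> f x = 0) \<Longrightarrow> sum_list (map f xs) = (0::'a::monoid_add)"
  by (induction xs) auto


lemma sum_sum_list_swap: "(\<Sum>d\<in>D. \<Sum>a\<leftarrow>xs. f d a) = (\<Sum>a\<leftarrow>xs. \<Sum>d\<in>D. f d (a::'a) :: 'b::comm_monoid_add)"
  by (induction xs) (simp_all add: sum.distrib)


section \<open>Formal solution of the differential equation\<close>

type_synonym ('n, 'u) log_array = "('n \<Rightarrow> nat) \<Rightarrow> ('n \<Rightarrow> nat) \<Rightarrow> 'u"

text \<open>\<open>g e \<kappa>\<close> is the coefficient of \<open>x\<^sup>e (log x)\<^sup>\<kappa>\<close>; \<open>euler k\<close> is the operator \<open>x\<^sub>k \<partial>/\<partial>x\<^sub>k\<close>.\<close>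
definition euler :: "'n \<Rightarrow> ('n::finite, 'u::cvector) log_array \<Rightarrow> ('n, 'u) log_array" where
  "euler k g = (\<lambda>e \<kappa>. of_nat (e k) *\<^sub>C g e \<kappa> + of_nat (Suc (\<kappa> k)) *\<^sub>C g e (\<kappa>(k := Suc (\<kappa> k))))"

text \<open>The sum over k of the derivatives with respect to log x_k, at a fixed power of x. It
  lowers the degree in the logarithms, hence is nilpotent on polynomials.\<close>

definition log_euler :: "(('n::finite \<Rightarrow> nat) \<Rightarrow> 'u::cvector) \<Rightarrow> ('n \<Rightarrow> nat) \<Rightarrow> 'u" where
  "log_euler h = (\<lambda>\<kappa>. \<Sum>k\<in>UNIV. of_nat (Suc (\<kappa> k)) *\<^sub>C h (\<kappa>(k := Suc (\<kappa> k))))"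

lemma of_nat_mdeg_scaleC: "of_nat (mdeg e) *\<^sub>C u = (\<Sum>k\<in>UNIV. of_nat (e k) *\<^sub>C u)"
  by (simp add: mdeg_def cvec.scale_sum_left)

lemma sum_euler: "(\<Sum>k\<in>UNIV. euler k g e \<kappa>) = of_nat (mdeg e) *\<^sub>C g e \<kappa> + log_euler (g e) \<kappa>"
  by (simp add: euler_def log_euler_def sum.distrib of_nat_mdeg_scaleC)

lemma euler_diff: "euler k (g - g') = euler k g - euler k g'"
  by (simp add: euler_def fun_eq_iff cvec.scale_right_diff_distrib)

lemma euler_sum: "euler k (\<lambda>e \<kappa>. \<Sum>i\<in>I. g i e \<kappa>) = (\<lambda>e \<kappa>. \<Sum>i\<in>I. euler k (g i) e \<kappa>)"
  by (simp add: euler_def fun_eq_iff cvec.scale_sum_right sum.distrib)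

lemma euler_commute: "euler k (euler l g) = euler l (euler k g)"
proof (cases "k = l")
  case False
  then show ?thesis
    by (simp add: euler_def fun_eq_iff scaleC_add_right scaleC_scaleC mult.commute fun_upd_twist
        add_ac del: of_nat_Suc)
qed simp

lemma euler_shift_by:
  "euler k (shift_by \<mu> g) = shift_by \<mu> (euler k g) + of_nat (\<mu> k) *\<^sub>C shift_by \<mu> g"
proof (intro ext)
  fix e \<kappa> :: "'a \<Rightarrow> nat"
  show "euler k (shift_by \<mu> g) e \<kappa> = (shift_by \<mu> (euler k g) + of_nat (\<mu> k) *\<^sub>C shift_by \<mu> g) e \<kappa>"
  proof (cases "\<mu> \<le> e")
    case True
    then have "of_nat (e k) = (of_nat (e k - \<mu> k) + of_nat (\<mu> k) :: complex)"
      by (simp add: le_fun_def flip: of_nat_add)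
    then show ?thesis
      using True by (simp add: euler_def shift_by_def scaleC_add_left add_ac)
  qed (simp add: euler_def shift_by_def)
qed

text \<open>The Leibniz rule. The derivative of m / (m - 1) is \<open>\<mu> k\<close> times an
  expression that does not depend on \<open>k\<close>; closedness of the connection form rests on
  this.\<close>

lemma euler_geom_by:
  "euler k (geom_by \<mu> g) = geom_by \<mu> (euler k g)
     + of_nat (\<mu> k) *\<^sub>C (\<lambda>e. - (\<Sum>r = 1..mdeg e. of_nat r *\<^sub>C shift_by (\<lambda>k. r * \<mu> k) g e))"
proof (intro ext)
  fix e \<kappa> :: "'a \<Rightarrow> nat"
  have "euler k (geom_by \<mu> g) e \<kappa> = - (\<Sum>r = 1..mdeg e. euler k (shift_by (\<lambda>k. r * \<mu> k) g) e \<kappa>)"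
    by (simp add: euler_def geom_by_def sum_fun_apply cvec.scale_sum_right sum.distrib)
  then show "euler k (geom_by \<mu> g) e \<kappa> = (geom_by \<mu> (euler k g)
     + of_nat (\<mu> k) *\<^sub>C (\<lambda>e. - (\<Sum>r = 1..mdeg e. of_nat r *\<^sub>C shift_by (\<lambda>k. r * \<mu> k) g e))) e \<kappa>"
    by (simp add: euler_shift_by geom_by_def sum_fun_apply cvec.scale_sum_right sum.distrib scaleC_scaleC mult.commute)
qed

text \<open>The factor of a logarithmic form relative to dx_k / x_k: \<open>None\<close> for the
  constant 1, a pole along x_k = 0, and \<open>Some \<mu>\<close> for m / (m - 1).\<close>

definition geom_opt :: "('n::finite \<Rightarrow> nat) option \<Rightarrow> (('n \<Rightarrow> nat) \<Rightarrow> 'u::cvector) \<Rightarrow> ('n \<Rightarrow> nat) \<Rightarrow> 'u" where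
  "geom_opt m g = (case m of None \<Rightarrow> g | Some \<mu> \<Rightarrow> geom_by \<mu> g)"

definition factor_opt :: "('n::finite \<Rightarrow> nat) option \<Rightarrow> complex ^ 'n \<Rightarrow> complex" where
  "factor_opt m x = (case m of None \<Rightarrow> 1 | Some \<mu> \<Rightarrow> geom_factor \<mu> x)"

text \<open>A nonzero scalar plus a nilpotent operator is injective: descend from the top degree in
  the logarithms.\<close>

lemma log_degree_0:
  fixes h :: "('n::finite \<Rightarrow> nat) \<Rightarrow> 'u::cvector"
  assumes "0 < s" "\<And>\<kappa>. B < mdeg \<kappa> \<Longrightarrow> h \<kappa> = 0"
    and eq: "\<And>\<kappa>. of_nat s *\<^sub>C h \<kappa> + log_euler h \<kappa> = 0"
  shows "h \<kappa> = 0"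
proof (induction "Suc B - mdeg \<kappa>" arbitrary: \<kappa> rule: less_induct)
  case less
  show ?case
  proof (cases "B < mdeg \<kappa>")
    case False
    then have "h (\<kappa>(k := Suc (\<kappa> k))) = 0" for k
      using less[of "\<kappa>(k := Suc (\<kappa> k))"] by (simp add: mdeg_upd)
    then have "of_nat s *\<^sub>C h \<kappa> = 0" using eq[of \<kappa>] by (simp add: log_euler_def)
    then show ?thesis using assms(1) by simp
  qed (rule assms(2))
qed

text \<open>The Neumann series for the inverse of \<open>s\<close> plus \<open>log_euler\<close>,
  cut off where the nilpotent part has died out.\<close>

definition log_inverse :: "nat \<Rightarrow> nat \<Rightarrow> (('n::finite \<Rightarrow> nat) \<Rightarrow> 'u::cvector) \<Rightarrow> ('n \<Rightarrow> nat) \<Rightarrow> 'u" where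
  "log_inverse B s h \<kappa> = (\<Sum>r\<le>B. ((- 1) ^ r / of_nat s ^ Suc r) *\<^sub>C (log_euler ^^ r) h \<kappa>)"

lemma log_euler_power_0:
  "(\<And>\<kappa>. B < mdeg \<kappa> \<Longrightarrow> h \<kappa> = 0) \<Longrightarrow> B < mdeg \<kappa> + r \<Longrightarrow> (log_euler ^^ r) h \<kappa> = 0"
proof (induction r arbitrary: \<kappa>)
  case (Suc r)
  then have "(log_euler ^^ r) h (\<kappa>(k := Suc (\<kappa> k))) = 0" for k
    by (intro Suc.IH) (simp_all add: mdeg_upd del: fun_upd_apply)
  then show ?case by (simp add: log_euler_def[of "(log_euler ^^ r) h"])
qed simp

lemma clinear_log_euler: "clinear (log_euler :: (('n::finite \<Rightarrow> nat) \<Rightarrow> 'u::cvector) \<Rightarrow> _)"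
  by (simp add: clinear_iff log_euler_def fun_eq_iff scaleC_add_right sum.distrib
      cvec.scale_sum_right scaleC_scaleC mult.commute)

lemma log_inverse_eq:
  fixes h :: "('n::finite \<Rightarrow> nat) \<Rightarrow> 'u::cvector"
  assumes "0 < s" "\<And>\<kappa>. B < mdeg \<kappa> \<Longrightarrow> h \<kappa> = 0"
  shows "of_nat s *\<^sub>C log_inverse B s h \<kappa> + log_euler (log_inverse B s h) \<kappa> = h \<kappa>"
proof -
  define t where "t r = ((- 1) ^ r / of_nat s ^ r) *\<^sub>C (log_euler ^^ r) h \<kappa>" for r
  have inv: "log_inverse B s h = (\<Sum>r\<le>B. ((- 1) ^ r / of_nat s ^ Suc r) *\<^sub>C (log_euler ^^ r) h)"
    by (simp add: fun_eq_iff log_inverse_def sum_fun_apply)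
  have "of_nat s *\<^sub>C log_inverse B s h \<kappa> = (\<Sum>r\<le>B. t r)"
    using assms(1) by (simp add: log_inverse_def t_def cvec.scale_sum_right scaleC_scaleC)
  moreover have "log_euler (log_inverse B s h) \<kappa> = - (\<Sum>r\<le>B. t (Suc r))"
    unfolding inv clinear_sum[OF clinear_log_euler] clinear_scaleC[OF clinear_log_euler]
    by (simp add: sum_fun_apply t_def flip: sum_negf cvec.scale_minus_left)
  moreover have "(\<Sum>r\<le>B. t r) - (\<Sum>r\<le>B. t (Suc r)) = t 0 - t (Suc B)"
    by (simp add: sum_telescope flip: sum_subtractf)
  moreover have "(log_euler ^^ Suc B) h \<kappa> = 0"
    by (rule log_euler_power_0[OF assms(2)]) (assumption, presburger)
  then have "t (Suc B) = 0"
    unfolding t_def by (simp only: cvec.scale_zero_right)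
  moreover have "t 0 = h \<kappa>" by (simp add: t_def scaleC_one)
  ultimately show ?thesis by simp
qed

lemma geom_opt_sum:
  fixes c :: "'i \<Rightarrow> ('n::finite \<Rightarrow> nat) \<Rightarrow> 'u::cvector"
  shows "geom_opt m (\<lambda>e. \<Sum>d\<in>D. c d e) e = (\<Sum>d\<in>D. geom_opt m (c d) e)"
proof -
  have "shift_by \<mu> (\<lambda>e. \<Sum>d\<in>D. c d e) e = (\<Sum>d\<in>D. shift_by \<mu> (c d) e)" for \<mu>
    by (simp add: shift_by_def)
  then have "geom_by \<mu> (\<lambda>e. \<Sum>d\<in>D. c d e) e = (\<Sum>d\<in>D. geom_by \<mu> (c d) e)" for \<mu>
    unfolding geom_by_def sum_negf by (subst sum.swap) simp
  then show ?thesis by (simp add: geom_opt_def split: option.split)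
qed

text \<open>\<open>Om k\<close> is the component along dx_k / x_k of a connection form acting by
  left multiplication. \<open>closed\<close> and \<open>commute\<close> are the two halves of
  flatness, a closed form with vanishing wedge square; they separate because one is of degree one
  and the other of degree two in the letters. \<open>Z\<close> gives the part constant in x: the
  expansion of the exponentials of residues times logarithms.\<close>

locale connection =
  fixes letters :: "'n::finite \<Rightarrow> ('v braid_lie \<times> ('n \<Rightarrow> nat) option) list"
    and Om :: "'n \<Rightarrow> ('n, 'v braid_lie env) log_array \<Rightarrow> ('n, 'v braid_lie env) log_array"
    and Z :: "('n \<Rightarrow> nat) \<Rightarrow> 'v braid_lie env"
  defines "Om \<equiv> \<lambda>k g e \<kappa>. \<Sum>(x, m)\<leftarrow>letters k. emb x * geom_opt m g e \<kappa>"
  assumes deg1: "(x, m) \<in> set (letters k) \<Longrightarrow> x \<in> degree_one"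
    and pos: "(x, Some \<mu>) \<in> set (letters k) \<Longrightarrow> 0 < mdeg \<mu>"
    and closed: "euler l (Om k g) - Om k (euler l g) = euler k (Om l g) - Om l (euler k g)"
    and commute: "Om k (Om l g) = Om l (Om k g)"
    and Z_0: "Z (\<lambda>_. 0) = 1"
    and Z_deg: "Z \<kappa> \<in> env_deg (mdeg \<kappa>)"
    and Z_Suc: "of_nat (Suc (\<kappa> k)) *\<^sub>C Z (\<kappa>(k := Suc (\<kappa> k))) =
      (\<Sum>(x, m)\<leftarrow>letters k. if m = None then emb x * Z \<kappa> else 0)"
begin

lemma geom_opt_log_degree:
  "(\<And>e \<kappa>. d < mdeg \<kappa> \<Longrightarrow> g e \<kappa> = 0) \<Longrightarrow> d < mdeg \<kappa> \<Longrightarrow> geom_opt m g e \<kappa> = 0"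
  by (auto simp: geom_opt_def geom_by_def shift_by_def sum_fun_apply split: option.split
      intro!: sum.neutral)

lemma Om_log_degree:
  "(\<And>e \<kappa>. d < mdeg \<kappa> \<Longrightarrow> g e \<kappa> = 0) \<Longrightarrow> d < mdeg \<kappa> \<Longrightarrow> Om k g e \<kappa> = 0"
  unfolding Om_def by (rule sum_list_map_eq_0) (auto simp: geom_opt_log_degree[of d g])

lemma geom_opt_env_deg:
  "(\<And>e \<kappa>. g e \<kappa> \<in> env_deg d) \<Longrightarrow> geom_opt m g e \<kappa> \<in> env_deg d"
  using cvec.subspace_0[OF subspace_env_deg]
  by (auto simp: geom_opt_def geom_by_def shift_by_def sum_fun_apply split: option.split
      intro!: cvec.subspace_neg[OF subspace_env_deg] cvec.subspace_sum[OF subspace_env_deg])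

lemma sum_list_env_deg: "(\<And>u. u \<in> set us \<Longrightarrow> u \<in> env_deg d) \<Longrightarrow> sum_list us \<in> env_deg d"
  by (induction us) (simp_all add: cvec.subspace_0[OF subspace_env_deg]
      cvec.subspace_add[OF subspace_env_deg])

lemma Om_env_deg:
  "(\<And>e \<kappa>. g e \<kappa> \<in> env_deg d) \<Longrightarrow> Om k g e \<kappa> \<in> env_deg (Suc d)"
  unfolding Om_def
  by (rule sum_list_env_deg) (auto intro: env_deg_mult deg1 geom_opt_env_deg)

text \<open>The part of degree \<open>d\<close> of the solution. Only the sum over \<open>k\<close>
  of the equations is solved: at exponent \<open>e\<close> it is multiplication by
  \<open>mdeg e\<close> plus a nilpotent operator, invertible unless \<open>e = 0\<close>, where
  \<open>Z\<close> is prescribed. The single equations follow from flatness in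
  \<open>sol_euler\<close>.\<close>

primrec sol :: "nat \<Rightarrow> ('n, 'v braid_lie env) log_array" where
  "sol 0 = (\<lambda>e \<kappa>. if mdeg e = 0 \<and> mdeg \<kappa> = 0 then 1 else 0)"
| "sol (Suc d) = (\<lambda>e \<kappa>. if mdeg e = 0 then if mdeg \<kappa> = Suc d then Z \<kappa> else 0
     else log_inverse d (mdeg e) (\<lambda>\<kappa>. \<Sum>k\<in>UNIV. Om k (sol d) e \<kappa>) \<kappa>)"

lemma sol_at_0: "mdeg e = 0 \<Longrightarrow> sol d e \<kappa> = (if mdeg \<kappa> = d then Z \<kappa> else 0)"
  by (cases d) (auto simp: mdeg_eq_0 Z_0)

lemma log_inverse_0:
  "(\<And>\<kappa>. B < mdeg \<kappa> \<Longrightarrow> h \<kappa> = 0) \<Longrightarrow> B < mdeg \<kappa> \<Longrightarrow> log_inverse B s h \<kappa> = 0"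
  unfolding log_inverse_def
  by (intro sum.neutral ballI) (subst log_euler_power_0, auto)

lemma sol_log_degree: "d < mdeg \<kappa> \<Longrightarrow> sol d e \<kappa> = 0"
proof (induction d arbitrary: e \<kappa>)
  case (Suc d)
  then have "(\<Sum>k\<in>UNIV. Om k (sol d) e \<kappa>) = 0" if "d < mdeg \<kappa>" for \<kappa>
    using that by (intro sum.neutral ballI Om_log_degree) auto
  then show ?case using Suc.prems by (simp add: log_inverse_0)
qed simp

lemma log_euler_env_deg: "(\<And>\<kappa>. h \<kappa> \<in> env_deg d) \<Longrightarrow> (log_euler ^^ r) h \<kappa> \<in> env_deg d"
  by (induction r arbitrary: \<kappa>)
    (simp_all add: log_euler_def[of "(log_euler ^^ _) h"] cvec.subspace_sum[OF subspace_env_deg]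
      cvec.subspace_scale[OF subspace_env_deg])

lemma sol_env_deg: "sol d e \<kappa> \<in> env_deg d"
proof (induction d arbitrary: e \<kappa>)
  case (Suc d)
  have "(\<Sum>k\<in>UNIV. Om k (sol d) e \<kappa>) \<in> env_deg (Suc d)" for \<kappa>
    by (intro cvec.subspace_sum[OF subspace_env_deg] Om_env_deg Suc.IH)
  then have "log_inverse d (mdeg e) (\<lambda>\<kappa>. \<Sum>k\<in>UNIV. Om k (sol d) e \<kappa>) \<kappa> \<in> env_deg (Suc d)"
    unfolding log_inverse_def
    by (intro cvec.subspace_sum[OF subspace_env_deg] cvec.subspace_scale[OF subspace_env_deg],
        intro log_euler_env_deg)
  then show ?case
    using Z_deg[of \<kappa>] cvec.subspace_0[OF subspace_env_deg] by auto
qed (auto simp: one_env_deg cvec.subspace_0[OF subspace_env_deg])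

lemma Om_at_0:
  assumes "mdeg e = 0"
  shows "Om k g e \<kappa> = (\<Sum>(x, m)\<leftarrow>letters k. if m = None then emb x * g e \<kappa> else 0)"
proof -
  have "geom_opt m g e \<kappa> = (if m = None then g e \<kappa> else 0)" for m
    using assms by (auto simp: geom_opt_def geom_by_def split: option.split)
  then show ?thesis
    unfolding Om_def by (intro arg_cong[of _ _ sum_list] map_cong) (auto split: prod.split)
qed

lemma sol_euler_at_0: "mdeg e = 0 \<Longrightarrow> euler k (sol (Suc d)) e \<kappa> = Om k (sol d) e \<kappa>"
proof -
  assume e: "mdeg e = 0"
  then have ek: "e k = 0" using le_mdeg[of e k] by simp
  show ?thesis
  proof (cases "mdeg \<kappa> = d")
    case True
    then have "sol d e \<kappa> = Z \<kappa>" "sol (Suc d) e \<kappa> = 0"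
      "sol (Suc d) e (\<kappa>(k := Suc (\<kappa> k))) = Z (\<kappa>(k := Suc (\<kappa> k)))"
      by (simp_all only: sol_at_0[OF e] mdeg_upd) simp_all
    then show ?thesis
      using Z_Suc[of \<kappa> k] ek by (simp only: euler_def Om_at_0[OF e]) simp
  next
    case False
    then have "sol d e \<kappa> = 0" "sol (Suc d) e (\<kappa>(k := Suc (\<kappa> k))) = 0"
      by (simp_all only: sol_at_0[OF e] mdeg_upd) simp_all
    moreover have "(\<Sum>(x, m)\<leftarrow>letters k. if m = None then emb x * 0 else 0) = (0 :: 'v braid_lie env)"
      by (rule sum_list_map_eq_0) auto
    ultimately show ?thesis
      using ek by (simp only: euler_def Om_at_0[OF e]) simp
  qed
qed

lemma sol_sum_euler: "(\<Sum>k\<in>UNIV. euler k (sol (Suc d)) e \<kappa>) = (\<Sum>k\<in>UNIV. Om k (sol d) e \<kappa>)"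
proof (cases "mdeg e = 0")
  case False
  let ?h = "\<lambda>\<kappa>. \<Sum>k\<in>UNIV. Om k (sol d) e \<kappa>"
  have "sol (Suc d) e = log_inverse d (mdeg e) ?h" using False by (simp add: fun_eq_iff)
  moreover have "?h \<kappa> = 0" if "d < mdeg \<kappa>" for \<kappa>
    using that by (intro sum.neutral ballI Om_log_degree[of d]) (auto simp: sol_log_degree)
  ultimately show ?thesis
    using log_inverse_eq[of "mdeg e" d ?h \<kappa>] False by (simp add: sum_euler del: sol.simps)
qed (simp add: sol_euler_at_0 del: sol.simps)

lemma euler_sol_0: "euler k (sol 0) = 0"
  by (auto simp: euler_def fun_eq_iff mdeg_upd mdeg_eq_0)

lemma Om_0: "Om k 0 = 0"
proof -
  have "geom_opt m 0 e \<kappa> = (0 :: 'v braid_lie env)" for m :: "('n \<Rightarrow> nat) option" and e \<kappa> :: "'n \<Rightarrow> nat"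
    by (auto simp: geom_opt_def geom_by_def shift_by_def sum_fun_apply split: option.split
        intro!: sum.neutral)
  then have "Om k 0 e \<kappa> = 0" for e \<kappa>
    unfolding Om_def by (intro sum_list_map_eq_0) auto
  then show ?thesis by (simp add: fun_eq_iff)
qed

text \<open>The defect \<open>\<delta>\<close> of one equation is killed by the sum of all
  \<open>euler l\<close>, by flatness in degree \<open>d\<close>. So it vanishes at
  \<open>e \<noteq> 0\<close> by \<open>log_degree_0\<close>; at \<open>e = 0\<close> the equation
  is \<open>Z_Suc\<close>.\<close>

theorem sol_euler: "euler k (sol (Suc d)) = Om k (sol d)"
proof (induction d arbitrary: k rule: less_induct)
  case (less d)
  \<comment> \<open>Closedness moves \<open>euler\<close> past \<open>Om\<close>, the equation in
    lower degree replaces \<open>euler l (sol d)\<close>, and \<open>commute\<close> exchanges the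
    two forms.\<close>
  have flat: "euler k (Om l (sol d)) = euler l (Om k (sol d))" for k l
  proof (cases d)
    case 0
    then show ?thesis using closed[of l k "sol 0"] by (simp add: euler_sol_0 Om_0 del: sol.simps)
  next
    case (Suc d')
    then show ?thesis
      using closed[of l k "sol d"] less[of d'] commute[of l k "sol d'"] by (simp del: sol.simps)
  qed
  define \<delta> where "\<delta> = euler k (sol (Suc d)) - Om k (sol d)"
  have "(\<Sum>l\<in>UNIV. euler l \<delta> e \<kappa>) = 0" for e \<kappa>
  proof -
    have "(\<Sum>l\<in>UNIV. euler l \<delta> e \<kappa>)
        = (\<Sum>l\<in>UNIV. euler k (euler l (sol (Suc d))) e \<kappa>) - (\<Sum>l\<in>UNIV. euler l (Om k (sol d)) e \<kappa>)"
      by (simp add: \<delta>_def euler_diff sum_subtractf euler_commute[of _ k] del: sol.simps)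
    also have "(\<Sum>l\<in>UNIV. euler k (euler l (sol (Suc d))) e \<kappa>)
        = euler k (\<lambda>e \<kappa>. \<Sum>l\<in>UNIV. Om l (sol d) e \<kappa>) e \<kappa>"
      by (simp only: euler_sum sol_sum_euler[symmetric])
    also have "\<dots> = (\<Sum>l\<in>UNIV. euler k (Om l (sol d)) e \<kappa>)"
      by (simp only: euler_sum)
    finally show ?thesis by (simp only: flat[of k] diff_self)
  qed
  then have eq: "of_nat (mdeg e) *\<^sub>C \<delta> e \<kappa> + log_euler (\<delta> e) \<kappa> = 0" for e \<kappa>
    by (simp add: sum_euler)
  have supp: "\<delta> e \<kappa> = 0" if "Suc d < mdeg \<kappa>" for e \<kappa>
    using that Om_log_degree[of d "sol d" \<kappa> k e] sol_log_degree
    by (simp add: \<delta>_def euler_def mdeg_upd del: sol.simps)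
  have "\<delta> e \<kappa> = 0" for e \<kappa>
  proof (cases "mdeg e = 0")
    case False
    then have "0 < mdeg e" by simp
    then show ?thesis by (rule log_degree_0[where h = "\<delta> e", OF _ supp eq])
  qed (simp add: \<delta>_def sol_euler_at_0 del: sol.simps)
  then show ?case by (simp add: \<delta>_def fun_eq_iff del: sol.simps)
qed

section \<open>Functionals applied to the formal solution\<close>

definition degs :: "('v braid_lie env \<Rightarrow> complex) \<Rightarrow> nat set" where
  "degs \<phi> = {d. \<exists>u\<in>env_deg d. \<phi> u \<noteq> 0}"

lemma finite_degs: "\<phi> \<in> graded_dual \<Longrightarrow> finite (degs \<phi>)"
proof -
  assume "\<phi> \<in> graded_dual"
  then obtain d0 where "\<forall>d>d0. \<forall>u\<in>env_deg d. \<phi> u = 0" by (auto simp: graded_dual_def)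
  then have "degs \<phi> \<subseteq> {..d0}" by (auto simp: degs_def not_le intro: leI)
  then show ?thesis by (rule finite_subset) simp
qed

lemma sol_degs: "d \<notin> degs \<phi> \<Longrightarrow> \<phi> (sol d e \<kappa>) = 0"
  using sol_env_deg by (auto simp: degs_def)

text \<open>The functional applied to the infinite sum of all \<open>sol d\<close>, restricted to
  the finitely many degrees that it can see.\<close>

definition coef :: "('v braid_lie env \<Rightarrow> complex) \<Rightarrow> ('n \<Rightarrow> nat) \<Rightarrow> ('n \<Rightarrow> nat) \<Rightarrow> complex" where
  "coef \<phi> \<kappa> e = (\<Sum>d\<in>degs \<phi>. \<phi> (sol d e \<kappa>))"

lemma coef_superset: "finite D \<Longrightarrow> degs \<phi> \<subseteq> D \<Longrightarrow> coef \<phi> \<kappa> e = (\<Sum>d\<in>D. \<phi> (sol d e \<kappa>))"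
  unfolding coef_def by (rule sum.mono_neutral_left) (auto simp: sol_degs)

lemma coef_add:
  assumes "\<phi> \<in> graded_dual" "\<psi> \<in> graded_dual"
  shows "coef (\<phi> + \<psi>) \<kappa> e = coef \<phi> \<kappa> e + coef \<psi> \<kappa> e"
proof -
  let ?D = "degs (\<phi> + \<psi>) \<union> degs \<phi> \<union> degs \<psi>"
  have "finite ?D" using assms by (simp add: finite_degs graded_dual_add)
  then show ?thesis
    using coef_superset[of ?D] by (simp add: sum.distrib Un_assoc le_supI1 le_supI2)
qed

lemma coef_scaleC:
  assumes "\<phi> \<in> graded_dual"
  shows "coef (c *\<^sub>C \<phi>) \<kappa> e = c * coef \<phi> \<kappa> e"
proof -
  have "finite (degs \<phi>)" "degs (c *\<^sub>C \<phi>) \<subseteq> degs \<phi>"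
    using assms by (auto simp: finite_degs, auto simp: degs_def)
  then show ?thesis
    using coef_superset[of "degs \<phi>" "c *\<^sub>C \<phi>"] by (simp add: coef_def sum_distrib_left)
qed

lemma clinear_sum_list: "clinear f \<Longrightarrow> f (sum_list us) = (\<Sum>u\<leftarrow>us. f u)"
  by (induction us) (simp_all add: clinear_0 clinear_add)

text \<open>Left multiplication by \<open>emb x\<close> under \<open>\<phi>\<close> is contraction
  of \<open>\<phi>\<close>; this turns the equation for \<open>sol\<close> into the one demanded of
  the integral map.\<close>

lemma clinear_Om:
  assumes "clinear \<phi>"
  shows "\<phi> (Om k g e \<kappa>) = (\<Sum>(x, m)\<leftarrow>letters k. geom_opt m (\<lambda>e. contract x \<phi> (g e \<kappa>)) e)"
proof -
  have "\<phi> (emb x * geom_opt m g e \<kappa>) = geom_opt m (\<lambda>e. contract x \<phi> (g e \<kappa>)) e" for x m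
    using clinear_geom_by[OF clinear_compose[OF clinear_contract[OF assms, of x] clinear_fun_apply[of \<kappa>]], of _ g e]
    by (simp add: geom_opt_def contract_def split: option.split)
  then show ?thesis
    unfolding Om_def clinear_sum_list[OF assms]
    by (intro arg_cong[of _ _ sum_list]) (auto simp: o_def)
qed

lemma poly_growth_geom_opt: "poly_growth c \<Longrightarrow> poly_growth (geom_opt m c)"
  by (simp add: geom_opt_def poly_growth_geom_by split: option.split)

lemma pseries_geom_opt:
  "poly_growth c \<Longrightarrow> x \<in> polydisc \<Longrightarrow> (\<And>\<mu>. m = Some \<mu> \<Longrightarrow> 0 < mdeg \<mu>) \<Longrightarrow>
    pseries (geom_opt m c) x = factor_opt m x * pseries c x"
  by (cases m) (simp_all add: geom_opt_def factor_opt_def pseries_geom_by)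

lemma poly_growth_sum_list:
  "(\<And>y. y \<in> set ys \<Longrightarrow> poly_growth (c y)) \<Longrightarrow> poly_growth (\<lambda>e. \<Sum>y\<leftarrow>ys. c y e)"
  by (induction ys) (simp_all add: poly_growth_0 poly_growth_add)

lemma pseries_sum_list:
  "(\<And>y. y \<in> set ys \<Longrightarrow> poly_growth (c y)) \<Longrightarrow> x \<in> polydisc \<Longrightarrow>
    pseries (\<lambda>e. \<Sum>y\<leftarrow>ys. c y e) x = (\<Sum>y\<leftarrow>ys. pseries (c y) x)"
  by (induction ys) (simp_all add: pseries_add poly_growth_sum_list)

lemma poly_growth_log_euler:
  "(\<And>\<kappa>. poly_growth (\<lambda>e. h e \<kappa>)) \<Longrightarrow> poly_growth (\<lambda>e. (log_euler ^^ r) (h e) \<kappa>)"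
  by (induction r arbitrary: \<kappa>)
    (simp_all add: log_euler_def[of "(log_euler ^^ _) _"] poly_growth_sum poly_growth_cmult del: of_nat_Suc)

text \<open>Induction for all functionals at once: a functional of \<open>Om k (sol d)\<close> is
  built from contracted functionals of \<open>sol d\<close>.\<close>

lemma poly_growth_sol: "clinear \<phi> \<Longrightarrow> poly_growth (\<lambda>e. \<phi> (sol d e \<kappa>))"
proof (induction d arbitrary: \<phi> \<kappa>)
  case 0
  show ?case
    by (rule poly_growthI[of _ "norm (\<phi> 1)" 0]) (simp add: clinear_0[OF 0])
next
  case (Suc d)
  define h where "h e \<kappa> = (\<Sum>k\<in>UNIV. \<phi> (Om k (sol d) e \<kappa>))" for e \<kappa>
  have "poly_growth (\<lambda>e. \<phi> (Om k (sol d) e \<kappa>))" for k \<kappa>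
    unfolding clinear_Om[OF Suc.prems]
    by (rule poly_growth_sum_list)
      (auto intro!: poly_growth_geom_opt Suc.IH clinear_contract Suc.prems)
  then have h: "poly_growth (\<lambda>e. h e \<kappa>)" for \<kappa>
    unfolding h_def by (rule poly_growth_sum)
  have lin: "\<phi> ((log_euler ^^ r) g \<kappa>) = (log_euler ^^ r) (\<lambda>\<kappa>. \<phi> (g \<kappa>)) \<kappa>" for r g \<kappa>
  proof (induction r arbitrary: \<kappa>)
    case (Suc r)
    then show ?case
      using \<open>clinear \<phi>\<close>
      by (simp add: log_euler_def[of "(log_euler ^^ _) _"] clinear_sum clinear_scaleC del: fun_upd_apply)
  qed simp
  \<comment> \<open>The Neumann series of \<open>log_inverse\<close>; the powers of
    \<open>mdeg e\<close> in the denominator do no harm. At \<open>e = 0\<close> \<open>sol\<close>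
    is defined differently, hence the correction term below.\<close>
  define P where "P e = (\<Sum>r\<le>d. (- 1) ^ r * (log_euler ^^ r) (h e) \<kappa>
      * inverse (of_nat (mdeg e) ^ Suc r))" for e
  have "poly_growth P"
    unfolding P_def
  proof (rule poly_growth_sum)
    fix r
    have "poly_growth (\<lambda>e. (- 1) ^ r * (log_euler ^^ r) (h e) \<kappa>)"
      by (intro poly_growth_cmult poly_growth_log_euler h)
    then show "poly_growth (\<lambda>e. (- 1) ^ r * (log_euler ^^ r) (h e) \<kappa> * inverse (of_nat (mdeg e) ^ Suc r))"
    proof (rule poly_growth_bound[where f = id and K = 1])
      fix e :: "'n \<Rightarrow> nat"
      have "norm (inverse (of_nat (mdeg e) ^ Suc r) :: complex) \<le> 1"
        by (cases "mdeg e") (simp_all add: norm_inverse norm_power inverse_le_1_iff del: of_nat_Suc power_Suc)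
      also have "\<dots> \<le> real (Suc (mdeg e))" by simp
      finally show "norm ((- 1) ^ r * (log_euler ^^ r) (h e) \<kappa> * inverse (of_nat (mdeg e) ^ Suc r))
          \<le> norm ((- 1) ^ r * (log_euler ^^ r) (h (id e)) \<kappa>) * real (Suc (mdeg e))"
        unfolding norm_mult[of _ "inverse _"] by (simp only: id_apply mult_left_mono norm_ge_zero)
    qed simp
  qed
  then have "poly_growth (\<lambda>e. P e + (if mdeg e = 0 then \<phi> (sol (Suc d) e \<kappa>) - P e else 0))"
  proof (rule poly_growth_add)
    show "poly_growth (\<lambda>e. if mdeg e = 0 then \<phi> (sol (Suc d) e \<kappa>) - P e else 0)"
      by (rule poly_growthI[of _ "norm (\<phi> (sol (Suc d) (\<lambda>_. 0) \<kappa>) - P (\<lambda>_. 0))" 0])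
        (simp add: mdeg_eq_0 del: sol.simps)
  qed
  moreover have "\<phi> (sol (Suc d) e \<kappa>) = P e" if "mdeg e \<noteq> 0" for e
    using that Suc.prems
    by (simp add: log_inverse_def clinear_sum clinear_scaleC lin P_def h_def[abs_def] divide_inverse mult_ac)
  then have "(\<lambda>e. P e + (if mdeg e = 0 then \<phi> (sol (Suc d) e \<kappa>) - P e else 0)) = (\<lambda>e. \<phi> (sol (Suc d) e \<kappa>))"
    by (auto simp del: sol.simps)
  ultimately show ?case by simp
qed

lemma poly_growth_coef: "\<phi> \<in> graded_dual \<Longrightarrow> poly_growth (coef \<phi> \<kappa>)"
  unfolding coef_def[abs_def]
  by (intro poly_growth_sum poly_growth_sol graded_dual_clinear)

lemma coef_euler:
  assumes "\<phi> \<in> graded_dual"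
  shows "of_nat (e k) * coef \<phi> \<kappa> e + of_nat (Suc (\<kappa> k)) * coef \<phi> (\<kappa>(k := Suc (\<kappa> k))) e
    = (\<Sum>(x, m)\<leftarrow>letters k. geom_opt m (coef (contract x \<phi>) \<kappa>) e)"
proof -
  have lin: "clinear \<phi>" using assms by (rule graded_dual_clinear)
  \<comment> \<open>All degrees where \<open>\<phi>\<close> is nonzero, and those of its
    contractions raised by one, since contraction lowers the degree. The bound \<open>B\<close> then
    allows the two sums to be matched by an index shift.\<close>
  define D where "D = insert 0 (Suc ` (\<Union>(x, m)\<in>set (letters k). degs (contract x \<phi>)) \<union> degs \<phi>)"
  obtain B where B: "D \<subseteq> {..B}"
  proof -
    have "finite D" unfolding D_def using assms
      by (auto intro!: finite_degs contract_graded_dual deg1)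
    then have "D \<subseteq> {..Max D}" by auto
    then show ?thesis by (rule that)
  qed
  have "of_nat (e k) * coef \<phi> \<kappa> e + of_nat (Suc (\<kappa> k)) * coef \<phi> (\<kappa>(k := Suc (\<kappa> k))) e
      = (\<Sum>d\<le>Suc B. \<phi> (euler k (sol d) e \<kappa>))"
    using B D_def
    by (subst (1 2) coef_superset[of "{..Suc B}"])
      (auto simp: euler_def lin clinear_add clinear_scaleC sum.distrib sum_distrib_left
        simp del: of_nat_Suc sol.simps sum.atMost_Suc)
  also have "\<dots> = (\<Sum>d\<le>B. \<phi> (Om k (sol d) e \<kappa>))"
    by (subst sum.atMost_Suc_shift) (simp add: euler_sol_0 sol_euler clinear_0[OF lin] del: sol.simps)
  also have "\<dots> = (\<Sum>(x, m)\<leftarrow>letters k. \<Sum>d\<le>B. geom_opt m (\<lambda>e. contract x \<phi> (sol d e \<kappa>)) e)"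
    unfolding clinear_Om[OF lin] by (simp add: split_def sum_sum_list_swap)
  also have "\<dots> = (\<Sum>(x, m)\<leftarrow>letters k. geom_opt m (coef (contract x \<phi>) \<kappa>) e)"
  proof (intro arg_cong[of _ _ sum_list] map_cong)
    fix xm assume "xm \<in> set (letters k)"
    moreover obtain x m where xm_eq: "xm = (x, m)" by (cases xm)
    ultimately have xm: "(x, m) \<in> set (letters k)" by simp
    then have "Suc ` degs (contract x \<phi>) \<subseteq> D" by (auto simp: D_def)
    then have "degs (contract x \<phi>) \<subseteq> {..B}" using B by (auto simp: image_subset_iff)
    then have "coef (contract x \<phi>) \<kappa> = (\<lambda>e. \<Sum>d\<le>B. contract x \<phi> (sol d e \<kappa>))"
      by (auto simp: coef_superset[of "{..B}"])
    then show "(case xm of (x, m) \<Rightarrow> \<Sum>d\<le>B. geom_opt m (\<lambda>e. contract x \<phi> (sol d e \<kappa>)) e)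
        = (case xm of (x, m) \<Rightarrow> geom_opt m (coef (contract x \<phi>) \<kappa>) e)"
      by (simp only: geom_opt_sum xm_eq prod.case)
  qed simp
  finally show ?thesis .
qed

definition formal_int :: "('v braid_lie env \<Rightarrow> complex) \<Rightarrow> 'n logpoly" where
  "formal_int \<phi> = (\<lambda>\<kappa> x. if \<phi> \<in> graded_dual \<and> x \<in> polydisc then pseries (coef \<phi> \<kappa>) x else 0)"

lemma open_polydisc: "open (polydisc :: (complex ^ 'n) set)"
proof -
  have eq: "(polydisc :: (complex ^ 'n) set) = (\<Inter>k. {y. norm (y $ k) < 1})"
    by (auto simp: polydisc_def)
  show ?thesis
    unfolding eq by (intro open_INT ballI open_Collect_less continuous_intros) auto
qed

lemma has_derivative_formal_int:
  assumes "\<phi> \<in> graded_dual" "x \<in> polydisc"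
  shows "(formal_int \<phi> \<kappa> has_derivative (\<lambda>h. \<Sum>k\<in>UNIV. h $ k * pseries (dcoef k (coef \<phi> \<kappa>)) x)) (at x)"
  by (rule has_derivative_transform_within_open[OF
        has_derivative_pseries[OF poly_growth_coef[OF assms(1)] assms(2)] open_polydisc assms(2)])
    (simp add: formal_int_def assms(1))

lemma formal_int_logpolys:
  assumes "\<phi> \<in> graded_dual"
  shows "formal_int \<phi> \<in> logpolys"
proof -
  let ?B = "{\<kappa>. mdeg \<kappa> \<in> {..Max (insert 0 (degs \<phi>))}}"
  have "formal_int \<phi> \<kappa> = 0" if "\<kappa> \<notin> ?B" for \<kappa>
  proof -
    have "coef \<phi> \<kappa> e = 0" for e
      unfolding coef_def
    proof (intro sum.neutral ballI)
      fix d assume "d \<in> degs \<phi>"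
      then have "d \<le> Max (insert 0 (degs \<phi>))" using assms by (intro Max_ge) (auto simp: finite_degs)
      then have "d < mdeg \<kappa>" using that by simp
      then show "\<phi> (sol d e \<kappa>) = 0"
        by (simp add: sol_log_degree clinear_0[OF graded_dual_clinear[OF assms]])
    qed
    then have "coef \<phi> \<kappa> = (\<lambda>e. 0)" by auto
    then show ?thesis by (intro ext) (simp only: formal_int_def pseries_0 zero_fun_apply if_cancel)
  qed
  then have "{\<kappa>. formal_int \<phi> \<kappa> \<noteq> 0} \<subseteq> ?B" by auto
  moreover have B: "?B = (\<Union>d\<in>{..Max (insert 0 (degs \<phi>))}. {\<kappa>. mdeg \<kappa> = d})" by auto
  have "finite ?B" by (subst B) (intro finite_UN_I finite_atMost finite_degree_slice)
  ultimately have "finite {\<kappa>. formal_int \<phi> \<kappa> \<noteq> 0}" by (rule finite_subset)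
  moreover have "holo (formal_int \<phi> \<kappa>)" for \<kappa>
    unfolding holo_def
    using has_derivative_formal_int[OF assms] by (auto simp: mult.commute intro!: exI)
  ultimately show ?thesis by (simp add: logpolys_def formal_int_def)
qed

lemma formal_int_add:
  assumes "\<phi> \<in> graded_dual" "\<psi> \<in> graded_dual"
  shows "formal_int (\<phi> + \<psi>) = formal_int \<phi> + formal_int \<psi>"
proof (intro ext)
  fix \<kappa> x
  have "coef (\<phi> + \<psi>) \<kappa> = (\<lambda>e. coef \<phi> \<kappa> e + coef \<psi> \<kappa> e)" by (intro ext coef_add assms)
  then show "formal_int (\<phi> + \<psi>) \<kappa> x = (formal_int \<phi> + formal_int \<psi>) \<kappa> x"
    using pseries_add[OF poly_growth_coef[OF assms(1)] poly_growth_coef[OF assms(2)]]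
    by (simp add: formal_int_def assms graded_dual_add)
qed

lemma formal_int_scaleC:
  assumes "\<phi> \<in> graded_dual"
  shows "formal_int (c *\<^sub>C \<phi>) = c *\<^sub>C formal_int \<phi>"
proof (intro ext)
  fix \<kappa> x
  have "coef (c *\<^sub>C \<phi>) \<kappa> = (\<lambda>e. c * coef \<phi> \<kappa> e)" by (intro ext coef_scaleC assms)
  then show "formal_int (c *\<^sub>C \<phi>) \<kappa> x = (c *\<^sub>C formal_int \<phi>) \<kappa> x"
    using pseries_cmult[OF poly_growth_coef[OF assms]]
    by (simp add: formal_int_def assms graded_dual_scaleC)
qed

lemma formal_int_at_0: "\<phi> \<in> graded_dual \<Longrightarrow> formal_int \<phi> (\<lambda>_. 0) 0 = \<phi> 1"
proof -
  assume \<phi>: "\<phi> \<in> graded_dual"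
  have "\<phi> (sol d (\<lambda>_. 0) (\<lambda>_. 0)) = (if d = 0 then \<phi> 1 else 0)" for d
    using sol_at_0[of "\<lambda>_. 0" d "\<lambda>_. 0"] Z_0 clinear_0[OF graded_dual_clinear[OF \<phi>]]
    by simp
  then have "coef \<phi> (\<lambda>_. 0) (\<lambda>_. 0) = \<phi> 1"
    using coef_superset[of "insert 0 (degs \<phi>)" \<phi> "\<lambda>_. 0" "\<lambda>_. 0"] finite_degs[OF \<phi>]
    by (simp add: sum.delta subset_insertI)
  then show ?thesis
    using \<phi> by (simp add: formal_int_def pseries_at_0 polydisc_def)
qed

lemma formal_int_counit: "formal_int counit = logpoly_of (\<lambda>_. 1)"
proof (intro ext)
  fix \<kappa> :: "'n \<Rightarrow> nat" and x :: "complex ^ 'n"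
  have "counit (sol d e \<kappa>) = (if d = 0 then if mdeg e = 0 \<and> mdeg \<kappa> = 0 then 1 else 0 else 0)" for d e
    by (cases "d = 0") (auto simp: counit_1 clinear_0[OF counit_clinear]
        intro: counit_env_deg[OF _ sol_env_deg] simp del: sol.simps(2))
  then have "coef counit \<kappa> e = (if mdeg e = 0 \<and> mdeg \<kappa> = 0 then 1 else 0)" for e
    using coef_superset[of "insert 0 (degs counit)" counit \<kappa> e] finite_degs[OF counit_graded_dual]
    by (simp add: sum.delta subset_insertI)
  then have "pseries (coef counit \<kappa>) x = (if mdeg \<kappa> = 0 then 1 else 0)"
    by (subst pseries_const) (auto simp: mdeg_eq_0)
  then show "formal_int counit \<kappa> x = logpoly_of (\<lambda>_. 1) \<kappa> x"
    by (auto simp: formal_int_def logpoly_of_def counit_graded_dual mdeg_eq_0)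
qed

theorem d_formal_int:
  assumes \<phi>: "\<phi> \<in> graded_dual" and x: "x \<in> polydisc" "\<And>k. x $ k \<noteq> 0"
  shows "d_logpoly (formal_int \<phi>) \<kappa> x h = (\<Sum>k\<in>UNIV. h $ k / x $ k *
      (\<Sum>(y, m)\<leftarrow>letters k. factor_opt m x * formal_int (contract y \<phi>) \<kappa> x))"
proof -
  have pg: "poly_growth (coef \<phi> \<kappa>)" for \<kappa> by (rule poly_growth_coef[OF \<phi>])
  have "x $ k * pseries (dcoef k (coef \<phi> \<kappa>)) x + of_nat (Suc (\<kappa> k)) * pseries (coef \<phi> (\<kappa>(k := Suc (\<kappa> k)))) x
      = (\<Sum>(y, m)\<leftarrow>letters k. factor_opt m x * formal_int (contract y \<phi>) \<kappa> x)" for k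
  proof -
    have "x $ k * pseries (dcoef k (coef \<phi> \<kappa>)) x + of_nat (Suc (\<kappa> k)) * pseries (coef \<phi> (\<kappa>(k := Suc (\<kappa> k)))) x
        = pseries (\<lambda>e. of_nat (e k) * coef \<phi> \<kappa> e + of_nat (Suc (\<kappa> k)) * coef \<phi> (\<kappa>(k := Suc (\<kappa> k))) e) x"
      by (simp only: pseries_euler[OF pg x(1), symmetric] pseries_cmult[OF pg x(1), symmetric]
          pseries_add[OF poly_growth_coord_mult[OF pg] poly_growth_cmult[OF pg] x(1)])
    also have "\<dots> = pseries (\<lambda>e. \<Sum>ym\<leftarrow>letters k. geom_opt (snd ym) (coef (contract (fst ym) \<phi>) \<kappa>) e) x"
      by (simp only: coef_euler[OF \<phi>] split_def)
    also have "\<dots> = (\<Sum>ym\<leftarrow>letters k. pseries (geom_opt (snd ym) (coef (contract (fst ym) \<phi>) \<kappa>)) x)"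
      by (rule pseries_sum_list[OF _ x(1)])
        (auto intro!: poly_growth_geom_opt poly_growth_coef contract_graded_dual deg1 \<phi>)
    also have "\<dots> = (\<Sum>(y, m)\<leftarrow>letters k. factor_opt m x * formal_int (contract y \<phi>) \<kappa> x)"
    proof (intro arg_cong[of _ _ sum_list] map_cong refl)
      fix ym assume "ym \<in> set (letters k)"
      moreover obtain y m where ym_eq: "ym = (y, m)" by (cases ym)
      ultimately have ym: "(y, m) \<in> set (letters k)" by simp
      have gd: "contract y \<phi> \<in> graded_dual" by (rule contract_graded_dual[OF deg1[OF ym] \<phi>])
      show "pseries (geom_opt (snd ym) (coef (contract (fst ym) \<phi>) \<kappa>)) x
          = (case ym of (y, m) \<Rightarrow> factor_opt m x * formal_int (contract y \<phi>) \<kappa> x)"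
        using pseries_geom_opt[OF poly_growth_coef[OF gd] x(1), of m \<kappa>] pos[of y _ k] ym gd x(1)
        by (auto simp: formal_int_def ym_eq)
    qed simp
    finally show ?thesis .
  qed
  then have *: "(\<Sum>(y, m)\<leftarrow>letters k. factor_opt m x * formal_int (contract y \<phi>) \<kappa> x)
     = x $ k * pseries (dcoef k (coef \<phi> \<kappa>)) x + of_nat (Suc (\<kappa> k)) * formal_int \<phi> (\<kappa>(k := Suc (\<kappa> k))) x" for k
    using \<phi> x by (simp add: formal_int_def)
  have "frechet_derivative (formal_int \<phi> \<kappa>) (at x) h = (\<Sum>k\<in>UNIV. h $ k * pseries (dcoef k (coef \<phi> \<kappa>)) x)"
    by (simp only: frechet_derivative_at[OF has_derivative_formal_int[OF \<phi> x(1)], symmetric])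
  then have "d_logpoly (formal_int \<phi>) \<kappa> x h = (\<Sum>k\<in>UNIV. h $ k * pseries (dcoef k (coef \<phi> \<kappa>)) x
      + of_nat (Suc (\<kappa> k)) * formal_int \<phi> (\<kappa>(k := Suc (\<kappa> k))) x * (h $ k / x $ k))"
    by (simp only: d_logpoly_def sum.distrib Suc_eq_plus1)
  also have "\<dots> = (\<Sum>k\<in>UNIV. h $ k / x $ k * (x $ k * pseries (dcoef k (coef \<phi> \<kappa>)) x
      + of_nat (Suc (\<kappa> k)) * formal_int \<phi> (\<kappa>(k := Suc (\<kappa> k))) x))"
    by (rule sum.cong) (use x(2) in \<open>simp_all add: distrib_left del: of_nat_Suc\<close>)
  finally show ?thesis by (simp only: *)
qed

end

instance pt :: (finite) finite
proof
  have "x \<in> {Alpha, Beta, Omega} \<union> range Pt" for x :: "'a pt" by (cases x) auto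
  then show "finite (UNIV :: 'a pt set)"
    by (intro finite_subset[of UNIV "{Alpha, Beta, Omega} \<union> range Pt"]) auto
qed

instance pt' :: (finite) finite
proof
  have "x \<in> {Alpha', Omega'} \<union> range Pt'" for x :: "'a pt'" by (cases x) auto
  then show "finite (UNIV :: 'a pt' set)"
    by (intro finite_subset[of UNIV "{Alpha', Omega'} \<union> range Pt'"]) auto
qed

section \<open>Uniqueness of the iterated integral map\<close>

lemma open_polydisc: "open (polydisc :: (complex ^ 'n::finite) set)"
proof -
  have eq: "(polydisc :: (complex ^ 'n) set) = (\<Inter>k. {y. norm (y $ k) < 1})"
    by (auto simp: polydisc_def)
  show ?thesis
    unfolding eq by (intro open_INT ballI open_Collect_less continuous_intros) auto
qed

lemma convex_polydisc: "convex (polydisc :: (complex ^ 'n::finite) set)"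
  unfolding convex_def polydisc_def
proof (intro ballI allI impI, unfold mem_Collect_eq, intro allI)
  fix y z :: "complex ^ 'n" and u v :: real and k
  assume *: "\<forall>k. norm (y $ k) < 1" "\<forall>k. norm (z $ k) < 1" and uv: "0 \<le> u" "0 \<le> v" "u + v = 1"
  have "u *\<^sub>R y $ k + v *\<^sub>R z $ k \<in> ball 0 1"
    using convex_ball[of "0::complex" 1] * uv unfolding convex_def by simp
  then show "norm ((u *\<^sub>R y + v *\<^sub>R z) $ k) < 1" by simp
qed

lemma frechet_derivative_worksI:
  "(f has_derivative f') F \<Longrightarrow> F = at x \<Longrightarrow> (f has_derivative frechet_derivative f (at x)) (at x)"
  by (simp add: differentiableI flip: frechet_derivative_works)

lemma holo_has_frechet_derivative:
  "holo f \<Longrightarrow> x \<in> polydisc \<Longrightarrow> (f has_derivative frechet_derivative f (at x)) (at x)"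
  unfolding holo_def using frechet_derivative_worksI by blast

lemma holo_frechet_derivative_scaleC:
  assumes "holo f" "x \<in> polydisc"
  shows "frechet_derivative f (at x) (\<chi> k. a * h $ k) = a * frechet_derivative f (at x) h"
proof -
  obtain c where "(f has_derivative (\<lambda>h. \<Sum>i\<in>UNIV. c i * h $ i)) (at x)"
    using assms by (auto simp: holo_def)
  then have "frechet_derivative f (at x) = (\<lambda>h. \<Sum>i\<in>UNIV. c i * h $ i)"
    by (rule frechet_derivative_at[symmetric])
  then show ?thesis by (simp add: sum_distrib_left mult_ac)
qed

text \<open>The segment from any point to \<open>(1/2, \<dots>, 1/2)\<close> meets the coordinate hyperplanes only finitely often.\<close>
lemma polydisc_constant:
  fixes f :: "complex ^ 'n::finite \<Rightarrow> complex"
  assumes "\<And>x. x \<in> polydisc \<Longrightarrow> f differentiable (at x)"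
    and zero: "\<And>x h. x \<in> polydisc \<Longrightarrow> (\<And>k. x $ k \<noteq> 0) \<Longrightarrow> frechet_derivative f (at x) h = 0"
    and x: "x \<in> polydisc"
  shows "f x = f (\<chi> k. 1/2)"
proof -
  define p :: "complex ^ 'n" where "p = (\<chi> k. 1/2)"
  have p: "p \<in> polydisc" by (simp add: p_def polydisc_def)
  define \<gamma> where "\<gamma> t = p + t *\<^sub>R (x - p)" for t :: real
  have \<gamma>: "\<gamma> t \<in> polydisc" if "t \<in> {0..1}" for t
  proof -
    have "\<gamma> t = (1 - t) *\<^sub>R p + t *\<^sub>R x" by (simp add: \<gamma>_def algebra_simps)
    then show ?thesis using convexD[OF convex_polydisc p x, of "1 - t" t] that by simp
  qed
  define K where "K = (\<Union>k. {t. \<gamma> t $ k = 0})"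
  have "finite {t. \<gamma> t $ k = 0}" for k
  proof -
    \<comment> \<open>Each coordinate is affine along the segment and nonzero at \<open>p\<close>,
      so it has at most one zero.\<close>
    have "t = u" if "\<gamma> t $ k = 0" "\<gamma> u $ k = 0" for t u
    proof (rule ccontr)
      assume "t \<noteq> u"
      have "(t - u) *\<^sub>R ((x - p) $ k) = \<gamma> t $ k - \<gamma> u $ k"
        by (simp add: \<gamma>_def scaleR_left_diff_distrib)
      then have "(x - p) $ k = 0" using \<open>t \<noteq> u\<close> that by simp
      then have "\<gamma> t $ k = p $ k"
        by (simp only: \<gamma>_def vector_add_component vector_scaleR_component scaleR_zero_right add_0_right)
      then show False using that(1) by (simp add: p_def)
    qed
    then show ?thesis
      by (cases "\<exists>t. \<gamma> t $ k = 0") (auto intro: finite_subset[of _ "{_}"])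
  qed
  then have finK: "finite K" by (simp add: K_def)
  have D\<gamma>: "(\<gamma> has_derivative (\<lambda>t. t *\<^sub>R (x - p))) (at t within S)" for t S
    unfolding \<gamma>_def by (auto intro!: derivative_eq_intros)
  have Df: "(f has_derivative frechet_derivative f (at y)) (at y)" if "y \<in> polydisc" for y
    using assms(1)[OF that] by (simp add: frechet_derivative_works)
  have comp: "((\<lambda>t. f (\<gamma> t)) has_derivative (\<lambda>t'. frechet_derivative f (at (\<gamma> t)) (t' *\<^sub>R (x - p)))) (at t within {0..1})"
    if "t \<in> {0..1}" for t
    using has_derivative_compose[OF D\<gamma> Df[OF \<gamma>[OF that]]] by simp
  have "f (\<gamma> 1) = f (\<gamma> 0)"
  proof (rule has_derivative_zero_unique_strong_convex[of "{0..1}" K])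
    show "continuous_on {0..1} (\<lambda>t. f (\<gamma> t))"
      using comp has_derivative_continuous continuous_on_eq_continuous_within by blast
    show "((\<lambda>t. f (\<gamma> t)) has_derivative (\<lambda>h. 0)) (at t within {0..1})" if "t \<in> {0..1} - K" for t
    proof -
      have "frechet_derivative f (at (\<gamma> t)) h = 0" for h
        using that by (intro zero \<gamma>) (auto simp: K_def)
      then show ?thesis using comp[of t] that by simp
    qed
  qed (use finK in auto)
  then show ?thesis by (simp add: \<gamma>_def p_def)
qed

text \<open>Continuity keeps \<open>g\<close> bounded near 0, whereas c times ln t is unbounded
  unless c = 0.\<close>

lemma no_log_derivative:
  fixes g :: "real \<Rightarrow> complex"
  assumes cont: "continuous_on {0..<1} g"
    and der: "\<And>t. 0 < t \<Longrightarrow> t < 1 \<Longrightarrow> (g has_vector_derivative c / of_real t) (at t)"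
  shows "c = 0"
proof (rule ccontr)
  assume "c \<noteq> 0"
  define f where "f t = g t - c * of_real (ln t)" for t
  have "(f has_vector_derivative 0) (at t within {0<..<1})" if "t \<in> {0<..<1}" for t
  proof -
    have "((\<lambda>t. c * of_real (ln t)) has_vector_derivative c * of_real (1 / t)) (at t)"
      using that by (intro has_vector_derivative_mult_right has_vector_derivative_of_real
          has_real_derivative_iff_has_vector_derivative[THEN iffD1] DERIV_ln_divide) auto
    from has_vector_derivative_diff[OF der this] that
    have "(f has_vector_derivative 0) (at t)" by (simp add: f_def[abs_def])
    then show ?thesis by (rule has_vector_derivative_at_within)
  qed
  then obtain a where a: "f t = a" if "t \<in> {0<..<1}" for t
    using has_vector_derivative_zero_constant[of "{0<..<1}" f] by (metis convex_real_interval(8))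
  have "compact (g ` {0..1/2})"
    by (intro compact_continuous_image continuous_on_subset[OF cont]) auto
  then have "bounded (g ` {0..1/2})" by (rule compact_imp_bounded)
  then obtain B where "\<forall>y\<in>g ` {0..1/2}. norm y \<le> B" unfolding bounded_iff by blast
  then have B: "norm (g t) \<le> B" if "t \<in> {0..1/2}" for t using that by blast
  \<comment> \<open>Chosen so that at \<open>t = exp (- M)\<close> the logarithm beats the bound:
    \<open>norm c * M\<close> exceeds \<open>B + norm a\<close> by \<open>norm c\<close>.\<close>
  define M where "M = (B + norm a) / norm c + 1"
  have "0 \<le> B" by (rule order_trans[OF norm_ge_zero B[of 0]]) simp
  then have "0 \<le> (B + norm a) / norm c" by (intro divide_nonneg_nonneg add_nonneg_nonneg norm_ge_zero)
  then have M: "1 \<le> M" by (simp add: M_def)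
  let ?t = "exp (- M)"
  have "exp (- M) \<le> exp (- 1)" using M by simp
  also have "exp (- 1) \<le> (1/2 :: real)"
    using exp_ge_add_one_self[of 1] by (simp add: exp_minus field_simps)
  finally have t: "?t \<in> {0..1/2}" "?t \<in> {0<..<1}" using M by auto
  have "c * of_real (- M) = g ?t - a" by (simp add: a[OF t(2), symmetric] f_def)
  then have "norm (c * of_real (- M)) = norm (g ?t - a)" by (rule arg_cong)
  then have "norm c * M = norm (g ?t - a)"
    using M by (simp add: norm_mult)
  also have "\<dots> \<le> B + norm a" using B[OF t(1)] norm_triangle_ineq4[of "g ?t" a] by linarith
  finally have "norm c * M \<le> B + norm a" .
  moreover have "norm c * M = B + norm a + norm c"
    using \<open>c \<noteq> 0\<close> by (simp add: M_def distrib_left del: times_divide_eq_right)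
      (simp add: field_simps)
  ultimately have "norm c \<le> 0" by simp
  then show False using \<open>c \<noteq> 0\<close> by simp
qed

text \<open>Descending induction on the degree in the logarithms. Once the higher coefficients of
  the difference vanish, a coefficient is constant; if it stands at a positive power of log x_k, the
  coefficient one step lower has derivative constant / x_k along a path to x_k = 0, which
  \<open>no_log_derivative\<close> forbids.\<close>

lemma logpolys_eq_up_to_constant:
  fixes P Q :: "'n::finite logpoly"
  assumes P: "P \<in> logpolys" and Q: "Q \<in> logpolys"
    and eq: "\<And>\<kappa> x h. x \<in> polydisc \<Longrightarrow> (\<And>k. x $ k \<noteq> 0) \<Longrightarrow> d_logpoly P \<kappa> x h = d_logpoly Q \<kappa> x h"
  shows "\<exists>c. P = Q + logpoly_of (\<lambda>_. c)"
proof -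
  define R where "R \<kappa> x = P \<kappa> x - Q \<kappa> x" for \<kappa> x
  have DP: "(P \<kappa> has_derivative frechet_derivative (P \<kappa>) (at x)) (at x)"
    and DQ: "(Q \<kappa> has_derivative frechet_derivative (Q \<kappa>) (at x)) (at x)"
    if "x \<in> polydisc" for \<kappa> x
    using P Q that by (auto simp: logpolys_def holo_has_frechet_derivative)
  have DR: "(R \<kappa> has_derivative (\<lambda>h. frechet_derivative (P \<kappa>) (at x) h - frechet_derivative (Q \<kappa>) (at x) h)) (at x)"
    if "x \<in> polydisc" for \<kappa> x
    unfolding R_def by (intro has_derivative_diff DP DQ that)
  have dR: "frechet_derivative (R \<kappa>) (at x) h
      = - (\<Sum>k\<in>UNIV. of_nat (\<kappa> k + 1) * R (\<kappa>(k := \<kappa> k + 1)) x * (h $ k / x $ k))"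
    if x: "x \<in> polydisc" "\<And>k. x $ k \<noteq> 0" for \<kappa> x h
  proof -
    have "frechet_derivative (R \<kappa>) (at x) h = frechet_derivative (P \<kappa>) (at x) h - frechet_derivative (Q \<kappa>) (at x) h"
      using frechet_derivative_at[OF DR[OF x(1)]] by metis
    moreover have "(\<Sum>k\<in>UNIV. of_nat (\<kappa> k + 1) * R (\<kappa>(k := \<kappa> k + 1)) x * (h $ k / x $ k))
        = (\<Sum>k\<in>UNIV. of_nat (\<kappa> k + 1) * P (\<kappa>(k := \<kappa> k + 1)) x * (h $ k / x $ k))
        - (\<Sum>k\<in>UNIV. of_nat (\<kappa> k + 1) * Q (\<kappa>(k := \<kappa> k + 1)) x * (h $ k / x $ k))"
      by (simp only: R_def right_diff_distrib left_diff_distrib sum_subtractf)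
    moreover have "a + p = b + q \<Longrightarrow> a - b = - (p - q)" for a b p q :: complex
      by (simp add: algebra_simps)
    ultimately show ?thesis
      using eq[OF x, of \<kappa> h] unfolding d_logpoly_def by presburger
  qed
  have const: "R \<kappa> x = R \<kappa> (\<chi> k. 1/2)" if "\<And>k y. R (\<kappa>(k := \<kappa> k + 1)) y = 0" "x \<in> polydisc" for \<kappa> x
    using dR[of _ \<kappa>] that
    by (intro polydisc_constant) (auto intro: differentiableI[OF DR])
  have out: "R \<kappa> x = 0" if "x \<notin> polydisc" for \<kappa> x
    using P Q that by (auto simp: R_def logpolys_def)
  define B where "B = Max (insert 0 (mdeg ` ({\<kappa>. P \<kappa> \<noteq> 0} \<union> {\<kappa>. Q \<kappa> \<noteq> 0})))"
  have B: "R \<kappa> x = 0" if "B < mdeg \<kappa>" for \<kappa> x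
  proof -
    have "P \<kappa> = 0 \<and> Q \<kappa> = 0"
    proof (rule ccontr)
      assume "\<not> ?thesis"
      then have "mdeg \<kappa> \<in> insert 0 (mdeg ` ({\<kappa>. P \<kappa> \<noteq> 0} \<union> {\<kappa>. Q \<kappa> \<noteq> 0}))" by auto
      then have "mdeg \<kappa> \<le> B" unfolding B_def using P Q by (intro Max_ge) (auto simp: logpolys_def)
      then show False using that by simp
    qed
    then show ?thesis by (simp add: R_def)
  qed
  have zero: "R \<kappa> x = 0" if "0 < mdeg \<kappa>" for \<kappa> x
    using that
  proof (induction "Suc B - mdeg \<kappa>" arbitrary: \<kappa> x rule: less_induct)
    case less
    show ?case
    proof (cases "B < mdeg \<kappa>")
      case False
      have up: "R (\<kappa>(k := \<kappa> k + 1)) y = 0" for k y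
        using False by (intro less.hyps) (simp_all add: mdeg_upd del: fun_upd_apply)
      define a where "a = R \<kappa> (\<chi> k. 1/2)"
      have a: "R \<kappa> y = a" if "y \<in> polydisc" for y
        unfolding a_def using const[OF up that] .
      obtain k where k: "0 < \<kappa> k"
        using less.prems by (metis mdeg_eq_0 gr0I less_irrefl)
      \<comment> \<open>One logarithm less: in the equation for \<open>\<kappa>'\<close> the
        constant \<open>a\<close> is the coefficient of dx_k / x_k.\<close>
      define \<kappa>' where "\<kappa>' = \<kappa>(k := \<kappa> k - 1)"
      have \<kappa>: "\<kappa>'(k := \<kappa>' k + 1) = \<kappa>" using k by (auto simp: \<kappa>'_def)
      \<comment> \<open>A path into the hyperplane x_k = 0 that stays in the polydisc and off the
        other hyperplanes.\<close>
      define pt where "pt t = (\<chi> j. if j = k then complex_of_real t else 1/2)" for t :: real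
      have pt: "pt t \<in> polydisc" if "t \<in> {0..<1}" for t
        using that by (auto simp: pt_def polydisc_def)
      have Dpt: "(pt has_derivative (\<lambda>s. s *\<^sub>R axis k 1)) (at t within S)" for t S
      proof -
        have "pt = (\<lambda>t. t *\<^sub>R axis k 1 + (\<chi> j. if j = k then 0 else 1/2))"
          by (auto simp: pt_def fun_eq_iff vec_eq_iff axis_def scaleR_conv_of_real[where 'a = complex])
        then show ?thesis by (auto intro!: derivative_eq_intros)
      qed
      have comp: "((\<lambda>t. R \<kappa>' (pt t)) has_derivative (\<lambda>s. frechet_derivative (R \<kappa>') (at (pt t)) (s *\<^sub>R axis k 1))) (at t within S)"
        if "t \<in> {0..<1}" for t S
      proof -
        have "(R \<kappa>' has_derivative frechet_derivative (R \<kappa>') (at (pt t))) (at (pt t))"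
          using differentiableI[OF DR[OF pt[OF that]]] by (simp add: frechet_derivative_works)
        from has_derivative_compose[OF Dpt this] show ?thesis .
      qed
      have "- (of_nat (\<kappa> k) * a) = 0"
      proof (rule no_log_derivative)
        show "continuous_on {0..<1} (\<lambda>t. R \<kappa>' (pt t))"
          using comp has_derivative_continuous continuous_on_eq_continuous_within by blast
        fix t :: real assume t: "0 < t" "t < 1"
        have nz: "pt t $ j \<noteq> 0" for j using t by (simp add: pt_def)
        have "frechet_derivative (R \<kappa>') (at (pt t)) (s *\<^sub>R axis k 1) = s *\<^sub>R (- (of_nat (\<kappa> k) * a) / of_real t)" for s
        proof -
          have "(\<Sum>j\<in>UNIV. of_nat (\<kappa>' j + 1) * R (\<kappa>'(j := \<kappa>' j + 1)) (pt t) * ((s *\<^sub>R axis k 1) $ j / pt t $ j))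
              = (\<Sum>j\<in>UNIV. if j = k then of_nat (\<kappa>' k + 1) * R (\<kappa>'(k := \<kappa>' k + 1)) (pt t) * (of_real s / of_real t) else 0)"
            by (intro sum.cong) (auto simp: axis_def pt_def scaleR_conv_of_real[where 'a = complex])
          also have "\<dots> = of_nat (\<kappa>' k + 1) * R \<kappa> (pt t) * (of_real s / of_real t)"
            using \<kappa> by (simp del: fun_upd_apply)
          also have "\<dots> = of_nat (\<kappa> k) * a * (of_real s / of_real t)"
            using k a[OF pt, of t] t by (simp add: \<kappa>'_def)
          finally show ?thesis
            using dR[OF pt nz, of \<kappa>' "s *\<^sub>R axis k 1"] t by (simp add: scaleR_conv_of_real[where 'a = complex])
        qed
        then show "((\<lambda>t. R \<kappa>' (pt t)) has_vector_derivative - (of_nat (\<kappa> k) * a) / of_real t) (at t)"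
          using comp[of t UNIV] t by (simp add: has_vector_derivative_def)
      qed
      then have "a = 0" using k by simp
      then show ?thesis using a out by (cases "x \<in> polydisc") auto
    qed (rule B)
  qed
  define c where "c = R (\<lambda>_. 0) (\<chi> k. 1/2)"
  have R0: "R (\<lambda>_. 0) x = c" if "x \<in> polydisc" for x
    unfolding c_def
  proof (rule const[OF _ that])
    show "R ((\<lambda>_. 0)(k := 0 + 1)) y = 0" for k y
      by (rule zero) (use le_mdeg[of "(\<lambda>_. 0)(k := 0 + 1)" k] in simp)
  qed
  have "P \<kappa> x = Q \<kappa> x + logpoly_of (\<lambda>_. c) \<kappa> x" for \<kappa> x
  proof (cases "\<kappa> = (\<lambda>_. 0)")
    case True
    then show ?thesis using R0[of x] out[of x \<kappa>] by (auto simp: R_def logpoly_of_def diff_eq_eq)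
  next
    case False
    then have "0 < mdeg \<kappa>" using mdeg_eq_0[of \<kappa>] by blast
    then show ?thesis using zero[of \<kappa> x] False by (simp add: R_def logpoly_of_def)
  qed
  then show ?thesis by (intro exI[of _ c]) (simp add: fun_eq_iff)
qed

lemma contract_homogeneous:
  assumes "homogeneous (Suc d) \<phi>" "x \<in> degree_one"
  shows "homogeneous d (contract x \<phi>)"
  using assms contract_graded_dual[OF assms(2)] env_deg_mult[OF assms(2)]
  unfolding homogeneous_def contract_def by fastforce

lemma is_iterated_integral_mapD:
  fixes \<iota> :: "('n::{finite,linorder} pt braid_lie env \<Rightarrow> complex) \<Rightarrow> 'n logpoly"
  assumes "is_iterated_integral_map \<iota>"
  shows "\<phi> \<in> graded_dual \<Longrightarrow> \<iota> \<phi> \<in> logpolys"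
    and "\<phi> \<in> graded_dual \<Longrightarrow> \<psi> \<in> graded_dual \<Longrightarrow> \<iota> (\<phi> + \<psi>) = \<iota> \<phi> + \<iota> \<psi>"
    and "\<phi> \<in> graded_dual \<Longrightarrow> \<iota> (c *\<^sub>C \<phi>) = c *\<^sub>C \<iota> \<phi>"
    and "\<iota> counit = logpoly_of (\<lambda>_. 1)"
    and "\<phi> \<in> graded_dual \<Longrightarrow> x \<in> polydisc \<Longrightarrow> \<forall>k. x $ k \<noteq> 0 \<Longrightarrow> d_logpoly (\<iota> \<phi>) \<kappa> x h =
          (\<Sum>i\<in>UNIV. \<iota> (contract (gen Alpha (Pt i)) \<phi>) \<kappa> x * dlog (zco i) x h
                  + \<iota> (contract (gen (Pt i) Beta) \<phi>) \<kappa> x * dlog (\<lambda>x. zco i x - 1) x h)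
          + (\<Sum>(i, j)\<in>{(i, j). i < j}.
               \<iota> (contract (gen (Pt i) (Pt j)) \<phi>) \<kappa> x * dlog (\<lambda>x. zco i x - zco j x) x h)"
    and "0 < d \<Longrightarrow> homogeneous d \<phi> \<Longrightarrow> \<iota> \<phi> (\<lambda>_. 0) 0 = 0"
  using assms unfolding is_iterated_integral_map_def by simp_all

text \<open>Induction on the degree of a homogeneous functional: contractions have lower degree, so
  the differentials agree, the values differ by a constant, and the normalisation at 0 removes
  it.\<close>

lemma is_iterated_integral_map_unique:
  fixes \<iota> \<iota>' :: "('n::{finite,linorder} pt braid_lie env \<Rightarrow> complex) \<Rightarrow> 'n logpoly"
  assumes \<iota>: "is_iterated_integral_map \<iota>" and \<iota>': "is_iterated_integral_map \<iota>'" and "\<phi> \<in> graded_dual"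
  shows "\<iota> \<phi> = \<iota>' \<phi>"
  using assms(3)
proof (induction \<phi> rule: graded_dual_homogeneous_induct)
  case (homogeneous d \<phi>)
  then show ?case
  proof (induction d arbitrary: \<phi>)
    case 0
    have "\<iota> (\<phi> 1 *\<^sub>C counit) = \<iota>' (\<phi> 1 *\<^sub>C counit)"
      by (simp only: is_iterated_integral_mapD(3,4)[OF \<iota>] is_iterated_integral_mapD(3,4)[OF \<iota>']
          counit_graded_dual)
    then show ?case unfolding homogeneous_0_counit[OF 0, symmetric] .
  next
    case (Suc d)
    have gd: "\<phi> \<in> graded_dual" using Suc.prems by (rule homogeneous_graded_dual)
    have IH: "\<iota> (contract (gen a b) \<phi>) = \<iota>' (contract (gen a b) \<phi>)" for a b
      by (rule Suc.IH[OF contract_homogeneous[OF Suc.prems gen_degree_one]])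
    have "\<exists>c. \<iota> \<phi> = \<iota>' \<phi> + logpoly_of (\<lambda>_. c)"
    proof (rule logpolys_eq_up_to_constant)
      show "\<iota> \<phi> \<in> logpolys" "\<iota>' \<phi> \<in> logpolys"
        using gd \<iota> \<iota>' by (simp_all only: is_iterated_integral_mapD(1))
      fix \<kappa> and x h :: "(complex, 'n) vec" assume "x \<in> polydisc" "\<And>k. x $ k \<noteq> 0"
      then have x: "x \<in> polydisc" "\<forall>k. x $ k \<noteq> 0" by blast+
      show "d_logpoly (\<iota> \<phi>) \<kappa> x h = d_logpoly (\<iota>' \<phi>) \<kappa> x h"
        unfolding is_iterated_integral_mapD(5)[OF \<iota> gd x] is_iterated_integral_mapD(5)[OF \<iota>' gd x] IH ..
    qed
    then obtain c where c: "\<iota> \<phi> = \<iota>' \<phi> + logpoly_of (\<lambda>_. c)" by blast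
    have "\<iota> \<phi> (\<lambda>_. 0) 0 = 0" "\<iota>' \<phi> (\<lambda>_. 0) 0 = 0"
      by (rule is_iterated_integral_mapD(6)[OF \<iota> zero_less_Suc Suc.prems]
          is_iterated_integral_mapD(6)[OF \<iota>' zero_less_Suc Suc.prems])+
    then have "c = 0" unfolding c by (simp add: logpoly_of_def polydisc_def)
    then show ?case unfolding c by (auto simp: fun_eq_iff logpoly_of_def)
  qed
next
  case (add \<psi> \<xi>)
  then show ?case
    by (simp only: is_iterated_integral_mapD(2)[OF \<iota>] is_iterated_integral_mapD(2)[OF \<iota>'])
qed

lemma iter_int_eq:
  fixes \<iota> :: "('n::{finite,linorder} pt braid_lie env \<Rightarrow> complex) \<Rightarrow> 'n logpoly"
  assumes \<iota>: "is_iterated_integral_map \<iota>" "\<And>\<phi>. \<phi> \<notin> graded_dual \<Longrightarrow> \<iota> \<phi> = 0"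
  shows "iter_int = \<iota>"
  unfolding iter_int_def
proof (rule the_equality)
  fix \<iota>' :: "('n pt braid_lie env \<Rightarrow> complex) \<Rightarrow> 'n logpoly"
  assume *: "is_iterated_integral_map \<iota>' \<and> (\<forall>\<phi>. \<phi> \<notin> graded_dual \<longrightarrow> \<iota>' \<phi> = 0)"
  show "\<iota>' = \<iota>"
  proof
    show "\<iota>' \<phi> = \<iota> \<phi>" for \<phi>
      using * \<iota> is_iterated_integral_map_unique[of \<iota>' \<iota> \<phi>] by (cases "\<phi> \<in> graded_dual") auto
  qed
qed (use \<iota> in auto)


section \<open>Linear independence over polynomials\<close>

text \<open>At a point where \<open>p\<close> is nonzero, subtract the multiple of \<open>p\<close>
  that makes the difference \<open>r\<close> vanish. The relation passes to \<open>r\<close>, but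
  \<open>p * pderiv r\<close> would vanish there to one order less than
  \<open>pderiv p * r\<close>.\<close>

lemma wronskian_zero:
  fixes p q :: "complex poly"
  assumes "p \<noteq> 0" "p * pderiv q = pderiv p * q"
  shows "\<exists>c. q = smult c p"
proof -
  have "finite {s. poly p s = 0}" using assms(1) by (rule poly_roots_finite)
  then obtain s0 where s0: "poly p s0 \<noteq> 0"
    using infinite_UNIV_char_0[where 'a = complex] by (metis (mono_tags) finite_subset mem_Collect_eq subsetI)
  define c where "c = poly q s0 / poly p s0"
  define r where "r = q - smult c p"
  have r0: "poly r s0 = 0" using s0 by (simp add: r_def c_def)
  have wr: "p * pderiv r = pderiv p * r"
    using assms(2) by (simp add: r_def pderiv_diff pderiv_smult algebra_simps)
  have "r = 0"
  proof (rule ccontr)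
    assume "r \<noteq> 0"
    have op: "order s0 p = 0" using s0 by (simp add: order_0I)
    have or0: "order s0 r \<noteq> 0" using r0 \<open>r \<noteq> 0\<close> by (simp add: order_root)
    have "pderiv r \<noteq> 0"
      using \<open>r \<noteq> 0\<close> r0 pderiv_iszero[of r] by fastforce
    then have 1: "order s0 (p * pderiv r) = order s0 r - 1"
      using op order_pderiv[of r s0] or0 r0 \<open>r \<noteq> 0\<close> assms(1) order_mult[of p "pderiv r" s0] by simp
    have "pderiv p * r \<noteq> 0" using wr \<open>pderiv r \<noteq> 0\<close> assms(1) by (metis mult_eq_0_iff)
    then have "order s0 (pderiv p * r) \<ge> order s0 r" by (simp add: order_mult)
    then show False using 1 wr or0 by simp
  qed
  then show ?thesis by (auto simp: r_def)
qed

text \<open>The derivative of the rational function \<open>q / p\<close> cannot be \<open>g / \<delta>\<close>, which has a simple pole at \<open>a\<close>.\<close>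
lemma no_simple_pole_derivative:
  fixes p q g \<delta> :: "complex poly"
  assumes p: "p \<noteq> 0" and \<delta>: "\<delta> = [:- a, 1:] * \<delta>'" "poly \<delta>' a \<noteq> 0" and g: "poly g a \<noteq> 0"
    and eq: "\<delta> * (p * pderiv q - pderiv p * q) = p * p * g"
  shows False
proof -
  define L where "L = [:- a, 1:]"
  obtain p0 where p0: "p = L ^ order a p * p0" "\<not> L dvd p0"
    using order_decomp[OF p, of a] unfolding L_def by blast
  define r where "r = order a p"
  have pr: "p = L ^ r * p0" using p0(1) by (simp only: r_def)
  have p0a: "poly p0 a \<noteq> 0" using p0(2) by (simp add: L_def poly_eq_0_iff_dvd)
  have La: "poly L a = 0" by (simp add: L_def)
  have Lnz: "L \<noteq> 0" by (simp add: L_def)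
  have dL: "pderiv L = 1" by (simp add: L_def pderiv_pCons)
  have main: False if "\<delta> * (p * pderiv q - pderiv p * q) = p * p * g" "order a q \<noteq> r" for q
  proof -
    have pg: "p * p * g \<noteq> 0" using p g by auto
    then have q: "q \<noteq> 0" using that(1) by auto
    define t where "t = order a q"
    obtain q0 where q0: "q = L ^ t * q0" "\<not> L dvd q0"
      using order_decomp[OF q, of a] unfolding L_def t_def by blast
    have q0a: "poly q0 a \<noteq> 0" using q0(2) by (simp add: L_def poly_eq_0_iff_dvd)
    \<comment> \<open>\<open>L\<close> times the Wronskian of \<open>L ^ r * p0\<close> and
      \<open>L ^ t * q0\<close> is \<open>L ^ (r + t) * w\<close>; at \<open>a\<close> the first
      term of \<open>w\<close> alone survives, and it is nonzero when
      \<open>t \<noteq> r\<close>.\<close>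
    define w where "w = smult (of_nat t - of_nat r) (p0 * q0) + L * (p0 * pderiv q0 - pderiv p0 * q0)"
    have pd: "L * pderiv (L ^ n * f) = L ^ n * (smult (of_nat n) f + L * pderiv f)" for n and f :: "complex poly"
      by (cases n) (simp_all add: pderiv_mult pderiv_power_Suc dL algebra_simps del: power_Suc, simp_all add: algebra_simps)
    have "L * (p * pderiv q - pderiv p * q) = p * (L * pderiv q) - (L * pderiv p) * q"
      by (simp add: algebra_simps)
    also have "\<dots> = L ^ (r + t) * w"
      unfolding p0(1)[folded r_def] q0(1) pd
      by (simp add: w_def power_add algebra_simps smult_diff_left)
    finally have "\<delta>' * (L ^ (r + t) * w) = \<delta> * (p * pderiv q - pderiv p * q)"
      unfolding \<delta>(1) L_def[symmetric] by (metis mult.assoc mult.commute)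
    also have "\<dots> = p * p * g" by (rule that(1))
    also have "\<dots> = L ^ (r + r) * (p0 * p0 * g)"
      unfolding p0(1)[folded r_def] by (simp add: power_add mult_ac)
    finally have "\<delta>' * (L ^ (r + t) * w) = L ^ (r + r) * (p0 * p0 * g)" .
    then have "L ^ (r + t) * (\<delta>' * w) = L ^ (r + r) * (p0 * p0 * g)" by (simp add: mult_ac)
    moreover have "poly (\<delta>' * w) a \<noteq> 0"
      using \<delta>(2) p0a q0a that(2) by (simp add: w_def La t_def)
    moreover have "poly (p0 * p0 * g) a \<noteq> 0" using p0a g by simp
    ultimately have "r + t = r + r"
      using order_power_n_n[of a] order_mult[of "L ^ (r + t)" "\<delta>' * w" a] order_mult[of "L ^ (r + r)" "p0 * p0 * g" a]
      unfolding L_def by (metis (no_types, lifting) add.right_neutral mult_eq_0_iff order_0I poly_0 power_not_zero pCons_eq_0_iff one_neq_zero)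
    then show False using that(2) by (simp add: t_def)
  qed
  show False
  proof (cases "order a q = r \<and> q \<noteq> 0")
    case False
    show False
    proof (cases "q = 0")
      case True
      then show False using eq p g by auto
    next
      case False
      then show False using main[OF eq] \<open>\<not> (order a q = r \<and> q \<noteq> 0)\<close> by blast
    qed
  next
    case True
    then obtain q0 where q0: "q = L ^ r * q0" "\<not> L dvd q0"
      using order_decomp[of q a] unfolding L_def by blast
    \<comment> \<open>Equal orders: subtracting the multiple of \<open>p\<close> with the same
      leading behaviour at \<open>a\<close> leaves the Wronskian unchanged and raises the order of
      \<open>q\<close>.\<close>
    define c where "c = poly q0 a / poly p0 a"
    define q' where "q' = q - smult c p"
    have eq': "\<delta> * (p * pderiv q' - pderiv p * q') = p * p * g"
      using eq by (simp add: q'_def pderiv_diff pderiv_smult algebra_simps)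
    have "q' \<noteq> 0" using eq' p g by auto
    have "q' = L ^ r * (q0 - smult c p0)"
      unfolding q'_def q0(1) by (subst pr) (simp add: algebra_simps)
    moreover have "L dvd q0 - smult c p0"
      unfolding L_def using p0a by (simp add: poly_eq_0_iff_dvd[symmetric] c_def)
    ultimately have "L ^ Suc r dvd q'" by (simp add: mult_dvd_mono mult.commute)
    then have "order a q' \<noteq> r"
      using \<open>q' \<noteq> 0\<close> order_divides[of a "Suc r" q'] unfolding L_def by auto
    then show False using main[OF eq'] by blast
  qed
qed

lemma poly_sum_upto: "degree f \<le> N \<Longrightarrow> poly (f :: complex poly) s = (\<Sum>n\<le>N. coeff f n * s ^ n)"
  unfolding poly_altdef by (rule sum.mono_neutral_left) (auto simp: coeff_eq_0)

text \<open>The criterion that iterated integrals are linearly independent over rational functions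
  if no nonzero combination of the forms \<rho> / \<delta> ds is the differential of a rational
  function; \<open>not_exact\<close> is this condition for q / p, with denominators cleared.\<close>

locale polynomial_independence =
  fixes xs :: "('v::finite braid_lie \<times> complex poly) list" and \<delta> :: "complex poly"
    and F :: "('v braid_lie env \<Rightarrow> complex) \<Rightarrow> complex \<Rightarrow> complex" and S :: "complex set"
  assumes deg1: "\<And>x \<rho>. (x, \<rho>) \<in> set xs \<Longrightarrow> x \<in> degree_one"
    and spanning: "\<And>a b. gen a b \<in> cvec.span (fst ` set xs)"
    and S: "open S" "S \<noteq> {}"
    and \<delta>_S: "\<And>s. s \<in> S \<Longrightarrow> poly \<delta> s \<noteq> 0"
    and F_deriv: "\<And>\<phi> s. \<phi> \<in> graded_dual \<Longrightarrow> s \<in> S \<Longrightarrow> (F \<phi> has_field_derivative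
        (\<Sum>(x, \<rho>)\<leftarrow>xs. poly \<rho> s / poly \<delta> s * F (contract x \<phi>) s)) (at s)"
    and F_add: "\<And>\<phi> \<psi> s. \<phi> \<in> graded_dual \<Longrightarrow> \<psi> \<in> graded_dual \<Longrightarrow> F (\<phi> + \<psi>) s = F \<phi> s + F \<psi> s"
    and F_scale: "\<And>\<phi> c s. \<phi> \<in> graded_dual \<Longrightarrow> F (c *\<^sub>C \<phi>) s = c * F \<phi> s"
    and F_counit: "\<And>s. s \<in> S \<Longrightarrow> F counit s = 1"
    and not_exact: "\<And>p q c x. p \<noteq> 0 \<Longrightarrow>
        \<delta> * (p * pderiv q - pderiv p * q) + p * p * (\<Sum>(x, \<rho>)\<leftarrow>xs. smult (c x) \<rho>) = 0 \<Longrightarrow>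
        x \<in> fst ` set xs \<Longrightarrow> c x = 0"
begin

text \<open>A list of pairs stands for an element of polynomials tensor graded dual.
  \<open>fmap\<close> reads it as a polynomial-valued functional, whose vanishing is independent of
  the chosen list; \<open>fval\<close> is the corresponding function on the line.\<close>

abbreviation "fmap \<Phi> u \<equiv> (\<Sum>(f, \<phi>)\<leftarrow>\<Phi>. smult (\<phi> u) f)"
abbreviation "fval \<Phi> s \<equiv> (\<Sum>(f, \<phi>)\<leftarrow>\<Phi>. poly f s * F \<phi> s)"

definition word :: "'v braid_lie list \<Rightarrow> 'v braid_lie env" where
  "word w = prod_list (map emb w)"

definition words :: "nat \<Rightarrow> 'v braid_lie list set" where
  "words d = {w. set w \<subseteq> fst ` set xs \<and> length w = d}"

lemma finite_words: "finite (words d)"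
  unfolding words_def by (rule finite_lists_length_eq) simp

lemma word_env_deg: "w \<in> words d \<Longrightarrow> word w \<in> env_deg d"
proof (induction d arbitrary: w)
  case 0
  then show ?case by (simp add: words_def word_def one_env_deg)
next
  case (Suc d)
  then obtain x w' where w: "w = x # w'" by (cases w) (auto simp: words_def)
  then have "x \<in> degree_one" "w' \<in> words d" using Suc.prems deg1 by (auto simp: words_def)
  then show ?case using Suc.IH w by (simp add: word_def env_deg_mult)
qed

lemma env_deg_span_words: "env_deg d \<subseteq> cvec.span (word ` words d)"
proof -
  have "gen_word w \<in> cvec.span (word ` words (length w))" for w :: "('v \<times> 'v) list"
  proof (induction w)
    case Nil
    show ?case by (rule cvec.span_base) (auto simp: words_def word_def intro!: rev_image_eqI[of "[]"])
  next
    case (Cons ab w)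
    obtain a b where ab: "ab = (a, b)" by (cases ab)
    have "emb x * u \<in> cvec.span (word ` words (Suc (length w)))"
      if "x \<in> fst ` set xs" "u \<in> cvec.span (word ` words (length w))" for x u
    proof (rule clinear_span_mem[OF mult_clinear_right cvec.subspace_span _ that(2)])
      fix v assume "v \<in> word ` words (length w)"
      then obtain w' where "w' \<in> words (length w)" "v = word w'" by blast
      then show "emb x * v \<in> cvec.span (word ` words (Suc (length w)))"
        using that(1) by (intro cvec.span_base image_eqI[of _ _ "x # w'"]) (auto simp: word_def words_def)
    qed
    then have "emb (gen a b) * gen_word w \<in> cvec.span (word ` words (Suc (length w)))"
      using clinear_span_mem[OF clinear_compose[OF mult_clinear_left emb_clinear] cvec.subspace_span _ spanning]
        Cons.IH by blast
    then show ?case by (simp add: ab)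
  qed
  then show ?thesis unfolding env_deg_def by (intro cvec.span_minimal cvec.subspace_span) auto
qed

lemma fmap_vanish_span:
  assumes "\<And>f \<phi>. (f, \<phi>) \<in> set \<Phi> \<Longrightarrow> \<phi> \<in> graded_dual" "\<And>u. u \<in> B \<Longrightarrow> fmap \<Phi> u = 0" "u \<in> cvec.span B"
  shows "fmap \<Phi> u = 0"
proof -
  have "coeff (fmap \<Phi> u) n = 0" for n
  proof (rule clinear_zero_on_span[OF _ _ assms(3)])
    have "clinear (\<lambda>u. coeff (fmap \<Psi> u) n)" if "set \<Psi> \<subseteq> set \<Phi>" for \<Psi>
      using that
    proof (induction \<Psi>)
      case Nil
      show ?case by (simp add: clinear_iff)
    next
      case (Cons f\<phi> \<Psi>)
      obtain f \<phi> where f\<phi>: "f\<phi> = (f, \<phi>)" by (cases f\<phi>)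
      have "clinear \<phi>" using assms(1) Cons.prems f\<phi> by (intro graded_dual_clinear) auto
      then have "clinear (\<lambda>u. \<phi> u * coeff f n + coeff (fmap \<Psi> u) n)"
        using Cons.IH Cons.prems by (simp add: clinear_iff distrib_left distrib_right)
      then show ?case by (simp add: f\<phi>)
    qed
    then show "clinear (\<lambda>u. coeff (fmap \<Phi> u) n)" by blast
  qed (simp add: assms(2))
  then show ?thesis by (simp add: poly_eq_iff)
qed

text \<open>If \<open>\<Phi>\<close> stands for the function G, this stands for \<delta> (p G' - p'
  G), that is \<delta> p^2 times the derivative of G / p.\<close>

definition derived :: "complex poly \<Rightarrow> (complex poly \<times> ('v braid_lie env \<Rightarrow> complex)) list
    \<Rightarrow> (complex poly \<times> ('v braid_lie env \<Rightarrow> complex)) list" where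
  "derived p \<Phi> = map (\<lambda>(f, \<phi>). (\<delta> * p * pderiv f, \<phi>)) \<Phi> @ map (\<lambda>(f, \<phi>). (- \<delta> * pderiv p * f, \<phi>)) \<Phi>
     @ concat (map (\<lambda>(x, \<rho>). map (\<lambda>(f, \<phi>). (p * \<rho> * f, contract x \<phi>)) \<Phi>) xs)"

lemma pderiv_fmap: "pderiv (fmap \<Phi> u) = (\<Sum>(f, \<phi>)\<leftarrow>\<Phi>. smult (\<phi> u) (pderiv f))"
  by (induction \<Phi>) (auto simp: pderiv_add pderiv_smult)

lemma fmap_map_mult: "fmap (map (\<lambda>(f, \<phi>). (g * h f, k \<phi>)) \<Phi>) u = g * (\<Sum>(f, \<phi>)\<leftarrow>\<Phi>. smult (k \<phi> u) (h f))"
  by (induction \<Phi>) (auto simp: algebra_simps)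

lemma fval_map_mult: "fval (map (\<lambda>(f, \<phi>). (g * h f, k \<phi>)) \<Phi>) s = poly g s * (\<Sum>(f, \<phi>)\<leftarrow>\<Phi>. poly (h f) s * F (k \<phi>) s)"
  by (induction \<Phi>) (auto simp: algebra_simps)

lemma fmap_contracted:
  "fmap (concat (map (\<lambda>(x, \<rho>). map (\<lambda>(f, \<phi>). (p * \<rho> * f, contract x \<phi>)) \<Phi>) ys)) u
    = (\<Sum>(x, \<rho>)\<leftarrow>ys. p * \<rho> * fmap \<Phi> (emb x * u))"
proof (induction ys)
  case (Cons y ys)
  then show ?case
    using fmap_map_mult[where g = "p * snd y" and h = "\<lambda>f. f" and k = "contract (fst y)" and \<Phi> = \<Phi> and u = u]
    by (cases y) (simp add: contract_def)
qed simp

lemma fval_contracted: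
  "fval (concat (map (\<lambda>(x, \<rho>). map (\<lambda>(f, \<phi>). (p * \<rho> * f, contract x \<phi>)) \<Phi>) ys)) s
    = (\<Sum>(x, \<rho>)\<leftarrow>ys. poly (p * \<rho>) s * (\<Sum>(f, \<phi>)\<leftarrow>\<Phi>. poly f s * F (contract x \<phi>) s))"
proof (induction ys)
  case (Cons y ys)
  then show ?case
    using fval_map_mult[where g = "p * snd y" and h = "\<lambda>f. f" and k = "contract (fst y)" and \<Phi> = \<Phi> and s = s]
    by (cases y) simp
qed simp

lemma fmap_derived:
  "fmap (derived p \<Phi>) u = \<delta> * (p * pderiv (fmap \<Phi> u) - pderiv p * fmap \<Phi> u)
     + (\<Sum>(x, \<rho>)\<leftarrow>xs. p * \<rho> * fmap \<Phi> (emb x * u))"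
proof -
  have "fmap (derived p \<Phi>) u = \<delta> * p * pderiv (fmap \<Phi> u) + (- \<delta> * pderiv p) * fmap \<Phi> u
      + (\<Sum>(x, \<rho>)\<leftarrow>xs. p * \<rho> * fmap \<Phi> (emb x * u))"
    unfolding derived_def pderiv_fmap map_append sum_list_append fmap_contracted
    using fmap_map_mult[where g = "\<delta> * p" and h = pderiv and k = "\<lambda>\<phi>. \<phi>" and \<Phi> = \<Phi> and u = u]
      fmap_map_mult[where g = "- \<delta> * pderiv p" and h = "\<lambda>f. f" and k = "\<lambda>\<phi>. \<phi>" and \<Phi> = \<Phi> and u = u]
    by simp
  then show ?thesis by (simp add: algebra_simps)
qed

lemma fval_derived:
  assumes gd: "\<And>f \<phi>. (f, \<phi>) \<in> set \<Phi> \<Longrightarrow> \<phi> \<in> graded_dual"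
    and zero: "\<And>s. s \<in> S \<Longrightarrow> fval \<Phi> s = 0" and s: "s \<in> S"
  shows "fval (derived p \<Phi>) s = 0"
proof -
  define D where "D \<Psi> = (\<Sum>(f, \<phi>)\<leftarrow>\<Psi>. poly (pderiv f) s * F \<phi> s
      + poly f s * (\<Sum>(x, \<rho>)\<leftarrow>xs. poly \<rho> s / poly \<delta> s * F (contract x \<phi>) s))" for \<Psi>
  have "((\<lambda>s. fval \<Psi> s) has_field_derivative D \<Psi>) (at s)" if "set \<Psi> \<subseteq> set \<Phi>" for \<Psi>
    using that
  proof (induction \<Psi>)
    case (Cons f\<phi> \<Psi>)
    obtain f \<phi> where f\<phi>: "f\<phi> = (f, \<phi>)" by (cases f\<phi>)
    have "\<phi> \<in> graded_dual" using gd Cons.prems f\<phi> by auto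
    then have "((\<lambda>s. poly f s * F \<phi> s + fval \<Psi> s) has_field_derivative
       (poly (pderiv f) s * F \<phi> s + poly f s * (\<Sum>(x, \<rho>)\<leftarrow>xs. poly \<rho> s / poly \<delta> s * F (contract x \<phi>) s)) + D \<Psi>) (at s)"
      using Cons.IH Cons.prems
      by (intro DERIV_add) (auto intro!: derivative_eq_intros F_deriv s)
    then show ?case by (simp add: f\<phi> D_def)
  qed (simp add: D_def)
  then have "((\<lambda>s. fval \<Phi> s) has_field_derivative D \<Phi>) (at s)" by blast
  moreover have "((\<lambda>s. fval \<Phi> s) has_field_derivative 0) (at s)"
    by (rule has_field_derivative_transform_within_open[OF DERIV_const S(1) s]) (simp add: zero)
  ultimately have D0: "D \<Phi> = 0" by (rule DERIV_unique)
  have "poly \<delta> s * D \<Phi> = poly \<delta> s * (\<Sum>(f, \<phi>)\<leftarrow>\<Phi>. poly (pderiv f) s * F \<phi> s)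
     + (\<Sum>(x, \<rho>)\<leftarrow>xs. poly \<rho> s * (\<Sum>(f, \<phi>)\<leftarrow>\<Phi>. poly f s * F (contract x \<phi>) s))"
  proof -
    have "(\<Sum>(x, \<rho>)\<leftarrow>xs. poly \<rho> s * (\<Sum>(f, \<phi>)\<leftarrow>\<Phi>. poly f s * F (contract x \<phi>) s))
       = (\<Sum>(f, \<phi>)\<leftarrow>\<Phi>. poly f s * (\<Sum>(x, \<rho>)\<leftarrow>xs. poly \<rho> s * F (contract x \<phi>) s))"
      by (induction \<Phi>) (auto simp: split_def sum_list_addf sum_list_const_mult[symmetric] algebra_simps)
    moreover have "poly \<delta> s * (\<Sum>(x, \<rho>)\<leftarrow>xs. poly \<rho> s / poly \<delta> s * F (contract x \<phi>) s)
       = (\<Sum>(x, \<rho>)\<leftarrow>xs. poly \<rho> s * F (contract x \<phi>) s)" for \<phi>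
      using \<delta>_S[OF s] by (simp add: split_def sum_list_const_mult[symmetric])
    then have "poly \<delta> s * D \<Psi> = poly \<delta> s * (\<Sum>(f, \<phi>)\<leftarrow>\<Psi>. poly (pderiv f) s * F \<phi> s)
        + (\<Sum>(f, \<phi>)\<leftarrow>\<Psi>. poly f s * (\<Sum>(x, \<rho>)\<leftarrow>xs. poly \<rho> s * F (contract x \<phi>) s))" for \<Psi>
      unfolding D_def by (induction \<Psi>) (auto simp: distrib_left mult.left_commute[of "poly \<delta> s"])
    ultimately show ?thesis by simp
  qed
  moreover have "fval (derived p \<Phi>) s = poly (\<delta> * p) s * (\<Sum>(f, \<phi>)\<leftarrow>\<Phi>. poly (pderiv f) s * F \<phi> s)
     + (poly (- \<delta> * pderiv p) s * fval \<Phi> s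
     + (\<Sum>(x, \<rho>)\<leftarrow>xs. poly (p * \<rho>) s * (\<Sum>(f, \<phi>)\<leftarrow>\<Phi>. poly f s * F (contract x \<phi>) s)))"
    unfolding derived_def map_append sum_list_append fval_contracted
    using fval_map_mult[where g = "\<delta> * p" and h = pderiv and k = "\<lambda>\<phi>. \<phi>" and \<Phi> = \<Phi> and s = s]
      fval_map_mult[where g = "- \<delta> * pderiv p" and h = "\<lambda>f. f" and k = "\<lambda>\<phi>. \<phi>" and \<Phi> = \<Phi> and s = s]
    by simp
  moreover have "(\<Sum>(x, \<rho>)\<leftarrow>xs. poly (p * \<rho>) s * (\<Sum>(f, \<phi>)\<leftarrow>\<Phi>. poly f s * F (contract x \<phi>) s))
     = poly p s * (\<Sum>(x, \<rho>)\<leftarrow>xs. poly \<rho> s * (\<Sum>(f, \<phi>)\<leftarrow>\<Phi>. poly f s * F (contract x \<phi>) s))"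
    by (simp add: split_def sum_list_const_mult[symmetric] mult.assoc)
  ultimately have "fval (derived p \<Phi>) s = poly p s * (poly \<delta> s * D \<Phi>) + poly (- \<delta> * pderiv p) s * fval \<Phi> s"
    by (simp add: algebra_simps)
  then show ?thesis using D0 zero[OF s] by simp
qed

text \<open>Outer induction on the degree, inner on the number of words of top degree with nonzero
  polynomial. Dividing by one such polynomial \<open>p\<close> and differentiating removes its word
  and creates no new one, so the derived relation vanishes by the inner hypothesis; this forces all
  top coefficients to be constant multiples of \<open>p\<close>.\<close>

theorem independence:
  assumes "\<And>f \<phi>. (f, \<phi>) \<in> set \<Phi> \<Longrightarrow> \<phi> \<in> graded_dual"
    and "\<And>s. s \<in> S \<Longrightarrow> fval \<Phi> s = 0" and "\<And>e u. d \<le> e \<Longrightarrow> u \<in> env_deg e \<Longrightarrow> fmap \<Phi> u = 0"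
  shows "fmap \<Phi> u = 0"
  using assms
proof (induction d arbitrary: \<Phi> u)
  case 0
  show ?case
    by (rule fmap_vanish_span[OF 0(1) _ gen_word_span]) (auto intro: 0(3) gen_word_env_deg)
next
  case (Suc d)
  note outer = Suc.IH
  show ?case
    using Suc.prems
  proof (induction "card {w \<in> words d. fmap \<Phi> (word w) \<noteq> 0}" arbitrary: \<Phi> u rule: less_induct)
    case less
    note gd = less.prems(1) and zero = less.prems(2) and top = less.prems(3)
    show ?case
    proof (cases "\<exists>w\<in>words d. fmap \<Phi> (word w) \<noteq> 0")
      case False
      have "fmap \<Phi> v = 0" if "v \<in> env_deg d" for v
      proof (rule fmap_vanish_span[OF gd])
        show "v \<in> cvec.span (word ` words d)" using that env_deg_span_words by blast
        show "fmap \<Phi> u = 0" if "u \<in> word ` words d" for u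
          using that False by blast
      qed
      then have low: "fmap \<Phi> v = 0" if "d \<le> e" "v \<in> env_deg e" for e v
        using that top[of e v] by (cases "d = e") auto
      show ?thesis
        by (rule outer) (use gd zero low in blast)+
    next
      case True
      then obtain w0 where w0: "w0 \<in> words d" "fmap \<Phi> (word w0) \<noteq> 0" by blast
      define p where "p = fmap \<Phi> (word w0)"
      have p: "p \<noteq> 0" using w0 by (simp add: p_def)
      have gd': "\<phi> \<in> graded_dual" if "(f, \<phi>) \<in> set (derived p \<Phi>)" for f \<phi>
        using that gd deg1 by (auto simp: derived_def intro: contract_graded_dual)
      have xtop: "(\<Sum>(x, \<rho>)\<leftarrow>xs. p * \<rho> * fmap \<Phi> (emb x * v)) = 0" if "v \<in> env_deg e" "d \<le> e" for e v
        by (rule sum_list_map_eq_0) (use that env_deg_mult[OF deg1 that(1)] top[of "Suc e"] in auto)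
      have der: "fmap (derived p \<Phi>) v = \<delta> * (p * pderiv (fmap \<Phi> v) - pderiv p * fmap \<Phi> v)"
        if "v \<in> env_deg e" "d \<le> e" for e v
        using xtop[OF that] by (simp add: fmap_derived)
      have dz: "fmap (derived p \<Phi>) v = 0" for v
      proof (rule less.hyps)
        have "{w \<in> words d. fmap (derived p \<Phi>) (word w) \<noteq> 0} \<subset> {w \<in> words d. fmap \<Phi> (word w) \<noteq> 0}"
        proof
          show "{w \<in> words d. fmap (derived p \<Phi>) (word w) \<noteq> 0} \<subseteq> {w \<in> words d. fmap \<Phi> (word w) \<noteq> 0}"
            using der[OF word_env_deg] by auto
          have "fmap (derived p \<Phi>) (word w0) = 0"
            using der[OF word_env_deg[OF w0(1)] order_refl] by (simp add: p_def[symmetric])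
          then show "{w \<in> words d. fmap (derived p \<Phi>) (word w) \<noteq> 0} \<noteq> {w \<in> words d. fmap \<Phi> (word w) \<noteq> 0}"
            using w0 by blast
        qed
        then show "card {w \<in> words d. fmap (derived p \<Phi>) (word w) \<noteq> 0} < card {w \<in> words d. fmap \<Phi> (word w) \<noteq> 0}"
          by (rule psubset_card_mono[rotated]) (simp add: finite_words)
        show "fmap (derived p \<Phi>) v = 0" if "Suc d \<le> e" "v \<in> env_deg e" for e v
          using der[OF that(2)] top[OF that] that(1) by simp
      qed (use gd' fval_derived[OF gd zero] in auto)
      have \<delta>0: "\<delta> \<noteq> 0" using \<delta>_S S(2) by fastforce
      have "\<exists>c. fmap \<Phi> v = smult c p" if "v \<in> env_deg d" for v
      proof (rule wronskian_zero[OF p])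
        show "p * pderiv (fmap \<Phi> v) = pderiv p * fmap \<Phi> v"
          using der[OF that order_refl] dz[of v] \<delta>0 by simp
      qed
      then obtain c where c: "fmap \<Phi> v = smult (c v) p" if "v \<in> env_deg d" for v by metis
      have False
      proof (cases d)
        case 0
        \<comment> \<open>With degree 0 alone left, the relation is \<open>p\<close> times the
          constant function 1, so \<open>p\<close> vanishes on the open set
          \<open>S\<close>.\<close>
        have "fmap \<Phi> v = smult (counit v) p" for v
        proof -
          have "fmap ((- p, counit) # \<Phi>) v = 0"
          proof (rule fmap_vanish_span[OF _ _ gen_word_span])
            fix u assume "u \<in> range (gen_word :: _ \<Rightarrow> 'v braid_lie env)"
            then obtain w where u: "u = gen_word w" by blast
            show "fmap ((- p, counit) # \<Phi>) u = 0"
            proof (cases "w = []")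
              case True
              then show ?thesis using w0(1) 0 by (simp add: u p_def words_def word_def counit_1)
            next
              case False
              then have "fmap \<Phi> u = 0" "counit u = 0"
                using gen_word_env_deg[of w] top[of "length w" u] counit_env_deg[of "length w" u]
                by (auto simp: u 0 Suc_le_eq)
              then show ?thesis by simp
            qed
          qed (use gd counit_graded_dual in auto)
          then show ?thesis by simp
        qed
        \<comment> \<open>\<open>F\<close> is linear over scalars only, so the relation is evaluated
          separately for each coefficient of the polynomials.\<close>
        have "(\<Sum>(f, \<phi>)\<leftarrow>\<Phi>. coeff f n * F \<phi> s) = coeff p n" if "s \<in> S" for n s
        proof -
          let ?\<psi> = "\<lambda>\<Psi>. sum_list (map (\<lambda>(f, \<phi>). coeff f n *\<^sub>C \<phi>) \<Psi>)"
          have gdl: "?\<psi> \<Psi> \<in> graded_dual \<and> F (?\<psi> \<Psi>) s = (\<Sum>(f, \<phi>)\<leftarrow>\<Psi>. coeff f n * F \<phi> s)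
              \<and> ?\<psi> \<Psi> v = coeff (fmap \<Psi> v) n"
            if "set \<Psi> \<subseteq> set \<Phi>" for \<Psi> v
            using that
          proof (induction \<Psi>)
            case Nil
            have "F 0 s = 0" using F_scale[OF graded_dual_0, of 0 s] by simp
            then show ?case by (simp add: graded_dual_0 flip: zero_fun_def)
          next
            case (Cons f\<phi> \<Psi>)
            obtain f \<phi> where f\<phi>: "f\<phi> = (f, \<phi>)" by (cases f\<phi>)
            have g: "\<phi> \<in> graded_dual" using gd Cons.prems f\<phi> by auto
            have IH: "?\<psi> \<Psi> \<in> graded_dual" "F (?\<psi> \<Psi>) s = (\<Sum>(f, \<phi>)\<leftarrow>\<Psi>. coeff f n * F \<phi> s)"
              "?\<psi> \<Psi> v = coeff (fmap \<Psi> v) n"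
              using Cons by (simp_all only: list.set insert_subset)
            have eq: "?\<psi> (f\<phi> # \<Psi>) = coeff f n *\<^sub>C \<phi> + ?\<psi> \<Psi>"
              by (simp only: f\<phi> list.map sum_list.Cons prod.case)
            have "?\<psi> (f\<phi> # \<Psi>) \<in> graded_dual"
              unfolding eq by (intro graded_dual_add graded_dual_scaleC g IH(1))
            moreover have "F (?\<psi> (f\<phi> # \<Psi>)) s = (\<Sum>(f, \<phi>)\<leftarrow>f\<phi> # \<Psi>. coeff f n * F \<phi> s)"
              unfolding eq F_add[OF graded_dual_scaleC[OF g] IH(1)] F_scale[OF g] IH(2) by (simp add: f\<phi>)
            moreover have "?\<psi> (f\<phi> # \<Psi>) v = coeff (fmap (f\<phi> # \<Psi>) v) n"
              unfolding eq plus_fun_apply IH(3) by (simp add: f\<phi>)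
            ultimately show ?case by blast
          qed
          have "?\<psi> \<Phi> = coeff p n *\<^sub>C counit"
            using gdl[OF order_refl] \<open>\<And>v. fmap \<Phi> v = smult (counit v) p\<close> by (auto simp: fun_eq_iff)
          then show ?thesis
            using gdl[OF order_refl] that by (metis F_scale F_counit counit_graded_dual mult.right_neutral)
        qed
        then have "fval \<Phi> s = poly p s" if s: "s \<in> S" for s
        proof -
          define N where "N = Max (degree ` insert p (fst ` set \<Phi>))"
          have N: "degree f \<le> N" if "f \<in> insert p (fst ` set \<Phi>)" for f
            unfolding N_def using that by (intro Max_ge) auto
          have "fval \<Psi> s = (\<Sum>n\<le>N. (\<Sum>(f, \<phi>)\<leftarrow>\<Psi>. coeff f n * F \<phi> s) * s ^ n)"
            if "set \<Psi> \<subseteq> set \<Phi>" for \<Psi>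
            using that
          proof (induction \<Psi>)
            case (Cons f\<phi> \<Psi>)
            obtain f \<phi> where f\<phi>: "f\<phi> = (f, \<phi>)" by (cases f\<phi>)
            have "degree f \<le> N" using Cons.prems f\<phi> by (intro N) force
            then have "poly f s * F \<phi> s = (\<Sum>n\<le>N. coeff f n * F \<phi> s * s ^ n)"
              by (simp add: poly_sum_upto[of f N] sum_distrib_right sum_distrib_left mult_ac)
            then show ?case
              using Cons by (simp add: f\<phi> distrib_right sum.distrib)
          qed simp
          then have "fval \<Phi> s = (\<Sum>n\<le>N. coeff p n * s ^ n)"
            using \<open>\<And>s n. s \<in> S \<Longrightarrow> (\<Sum>(f, \<phi>)\<leftarrow>\<Phi>. coeff f n * F \<phi> s) = coeff p n\<close>[OF s] by simp
          then show ?thesis using poly_sum_upto[of p N s] N by simp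
        qed
        then have "poly p s = 0" if "s \<in> S" for s using zero that by simp
        then have "S \<subseteq> {s. poly p s = 0}" by auto
        then have "finite S" using poly_roots_finite[OF p] finite_subset by blast
        then show False using S finite_imp_not_open by blast
      next
        case (Suc d')
        obtain x w' where w: "w0 = x # w'" using w0(1) Suc by (cases w0) (auto simp: words_def)
        then have xw: "x \<in> fst ` set xs" "w' \<in> words d'" using w0(1) Suc by (auto simp: words_def)
        define v where "v = word w'"
        have v: "v \<in> env_deg d'" using word_env_deg[OF xw(2)] by (simp add: v_def)
        \<comment> \<open>At a word of degree one less, \<open>derived\<close> consists of the
          Wronskian of \<open>p\<close> with \<open>fmap \<Phi> v\<close> and of the forms weighted
          by the constants \<open>c\<close>; its vanishing is an exactness relation as in
          \<open>not_exact\<close>.\<close>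
        have "(\<Sum>(x, \<rho>)\<leftarrow>xs. p * \<rho> * fmap \<Phi> (emb x * v)) = p * p * (\<Sum>(x, \<rho>)\<leftarrow>xs. smult (c (emb x * v)) \<rho>)"
        proof -
          have "map (\<lambda>(x, \<rho>). p * \<rho> * fmap \<Phi> (emb x * v)) xs = map (\<lambda>(x, \<rho>). p * p * smult (c (emb x * v)) \<rho>) xs"
            using env_deg_mult[OF deg1 v] c Suc by (auto simp: mult_ac)
          then have "(\<Sum>(x, \<rho>)\<leftarrow>xs. p * \<rho> * fmap \<Phi> (emb x * v))
              = (\<Sum>(x, \<rho>)\<leftarrow>xs. p * p * smult (c (emb x * v)) \<rho>)"
            by (rule arg_cong)
          then show ?thesis by (simp only: split_def sum_list_const_mult)
        qed
        then have "c (emb x * v) = 0"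
          using fmap_derived[where p = p and \<Phi> = \<Phi> and u = v] dz[of v]
          by (intro not_exact[OF p _ xw(1), of "fmap \<Phi> v" "\<lambda>x. c (emb x * v)"]) simp
        moreover have "emb x * v = word w0" by (simp add: w v_def word_def)
        ultimately show False
          using c[OF word_env_deg[OF w0(1)]] p by (simp add: p_def[symmetric])
      qed
      then show ?thesis ..
    qed
  qed
qed

theorem injective:
  assumes "\<phi> \<in> graded_dual" "\<And>s. s \<in> S \<Longrightarrow> F \<phi> s = 0"
  shows "\<phi> = 0"
proof
  fix u
  obtain d0 where "\<forall>d>d0. \<forall>u\<in>env_deg d. \<phi> u = 0" using assms(1) by (auto simp: graded_dual_def)
  then have d0: "\<phi> u = 0" if "Suc d0 \<le> e" "u \<in> env_deg e" for e u
    using that by (simp add: Suc_le_eq)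
  have "fmap [(1, \<phi>)] u = 0"
  proof (rule independence)
    show "fmap [(1, \<phi>)] u = 0" if "Suc d0 \<le> e" "u \<in> env_deg e" for e u
      using d0[OF that] by simp
  qed (simp_all add: assms)
  then show "\<phi> u = 0 u" by simp
qed

end

section \<open>The Lie algebra on five points\<close>

text \<open>The arguments are the images of a basis of the degree-one part; the other five values
  are solved from the vanishing row sums.\<close>

definition edge5 :: "'n \<Rightarrow> 'n \<Rightarrow> 'g::lie_algebra \<Rightarrow> 'g \<Rightarrow> 'g \<Rightarrow> 'g \<Rightarrow> 'g \<Rightarrow> 'n pt \<Rightarrow> 'n pt \<Rightarrow> 'g" where
  "edge5 i j A C W D E a b =
    (if {a, b} = {Alpha, Pt i} then A else if {a, b} = {Alpha, Pt j} then W - A - C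
     else if {a, b} = {Pt i, Pt j} then C else if {a, b} = {Alpha, Beta} then - (E + D + W)
     else if {a, b} = {Pt i, Beta} then E else if {a, b} = {Pt j, Beta} then D
     else if {a, b} = {Beta, Omega} then W else if {a, b} = {Alpha, Omega} then C + E + D
     else if {a, b} = {Pt i, Omega} then - (A + C + E) else if {a, b} = {Pt j, Omega} then A - W - D
     else 0)"

text \<open>What the commutation relations become after this elimination: the action of
  \<open>A\<close> and \<open>C\<close> on \<open>W\<close>, \<open>D\<close>, \<open>E\<close>.
  Nothing is imposed between \<open>A\<close> and \<open>C\<close> or among \<open>W\<close>,
  \<open>D\<close>, \<open>E\<close>, as fits a semidirect product of free Lie algebras on two and
  three letters.\<close>

definition relations5 :: "'g::lie_algebra \<Rightarrow> 'g \<Rightarrow> 'g \<Rightarrow> 'g \<Rightarrow> 'g \<Rightarrow> bool" where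
  "relations5 A C W D E \<longleftrightarrow> bracket A D = 0 \<and> bracket A W = 0 \<and> bracket C W = 0 \<and>
     bracket C E = bracket E D \<and> bracket C D = bracket D E \<and> bracket A E = bracket (D + W) E"

lemma UNIV_pt: "(UNIV :: 'n pt set) = {Alpha, Beta, Omega} \<union> range Pt"
proof -
  have "x \<in> {Alpha, Beta, Omega} \<union> range Pt" for x :: "'n pt" by (cases x) auto
  then show ?thesis by auto
qed

lemma UNIV_pt': "(UNIV :: 'n pt' set) = {Alpha', Omega'} \<union> range Pt'"
proof -
  have "x \<in> {Alpha', Omega'} \<union> range Pt'" for x :: "'n pt'" by (cases x) auto
  then show ?thesis by auto
qed

locale two_points =
  fixes i1 i2 :: "'n::{finite,linorder}"
  assumes UNIV_n: "(UNIV :: 'n set) = {i1, i2}" and less: "i1 < i2"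
begin

lemma neq: "i1 \<noteq> i2" "i2 \<noteq> i1"
  using less by auto

lemma n_cases: "i = i1 \<or> i = i2"
  using UNIV_n by auto

lemma all_n: "(\<forall>k. P k) \<longleftrightarrow> P i1 \<and> P i2"
  using n_cases by metis

lemma sum_n: "(\<Sum>k\<in>UNIV. f k) = f i1 + f i2"
  by (simp add: UNIV_n neq)

lemma UNIV_pt5: "(UNIV :: 'n pt set) = {Alpha, Pt i1, Pt i2, Beta, Omega}"
  by (auto simp: UNIV_pt UNIV_n)

lemma all_pt5: "(\<forall>a. P a) \<longleftrightarrow> P Alpha \<and> P (Pt i1) \<and> P (Pt i2) \<and> P Beta \<and> P (Omega :: 'n pt)"
proof -
  have "(\<forall>a. P a) \<longleftrightarrow> (\<forall>a\<in>UNIV. P a)" by simp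
  also have "\<dots> \<longleftrightarrow> P Alpha \<and> P (Pt i1) \<and> P (Pt i2) \<and> P Beta \<and> P Omega"
    unfolding UNIV_pt5 by simp
  finally show ?thesis .
qed

lemma UNIV_pt4: "(UNIV :: 'n pt' set) = {Alpha', Pt' i1, Pt' i2, Omega'}"
  by (auto simp: UNIV_pt' UNIV_n)

lemma braid_relations_edge5:
  fixes A C W D E :: "'g::lie_algebra"
  assumes rel: "relations5 A C W D E"
  shows "braid_relations (edge5 i1 i2 A C W D E)"
proof -
  let ?f = "edge5 i1 i2 A C W D E"
  have swap: "bracket x y = 0 \<Longrightarrow> bracket y x = 0" for x y :: 'g
    using bracket_anti[of y x] by simp
  note rels = rel[unfolded relations5_def]
  have anti: "bracket D A = 0" "bracket W A = 0" "bracket W C = 0" "bracket E C = - bracket E D"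
    "bracket D C = bracket E D" "bracket C D = - bracket E D" "bracket C E = bracket E D"
    "bracket E A = bracket E D + bracket E W" "bracket A E = - bracket E D - bracket E W"
    "bracket D E = - bracket E D" "bracket W E = - bracket E W" "bracket W D = - bracket D W"
    "bracket C A = - bracket A C"
    using rels bracket_anti[of D A] bracket_anti[of W A] bracket_anti[of W C] bracket_anti[of E C]
      bracket_anti[of D C] bracket_anti[of E A] bracket_anti[of D E] bracket_anti[of W E] bracket_anti[of W D]
      bracket_anti[of C A]
    by (simp_all add: bracket_add_left)
  \<comment> \<open>The fifteen pairs of disjoint edges of the complete graph on five
    points.\<close>
  have c: "bracket A D = 0" "bracket A (A - W - D) = 0" "bracket A W = 0"
    "bracket (W - A - C) E = 0" "bracket (W - A - C) (- (A + C + E)) = 0" "bracket (W - A - C) W = 0"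
    "bracket C (- (E + D + W)) = 0" "bracket C (C + E + D) = 0" "bracket C W = 0"
    "bracket (- (E + D + W)) (- (A + C + E)) = 0" "bracket (- (E + D + W)) (A - W - D) = 0"
    "bracket E (C + E + D) = 0" "bracket E (A - W - D) = 0"
    "bracket D (C + E + D) = 0" "bracket D (- (A + C + E)) = 0"
    using rels
    by (simp_all add: bracket_add_left bracket_add_right bracket_diff_left bracket_diff_right
        bracket_minus_left bracket_minus_right bracket_self anti)
  note c' = c c[THEN swap]
  have val: "?f Alpha (Pt i1) = A" "?f Alpha (Pt i2) = W - A - C" "?f (Pt i1) (Pt i2) = C"
    "?f Alpha Beta = - (E + D + W)" "?f (Pt i1) Beta = E" "?f (Pt i2) Beta = D" "?f Beta Omega = W"
    "?f Alpha Omega = C + E + D" "?f (Pt i1) Omega = - (A + C + E)" "?f (Pt i2) Omega = A - W - D"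
    by (simp_all add: edge5_def doubleton_eq_iff neq)
  have sym: "?f a b = ?f b a" for a b by (simp add: edge5_def insert_commute)
  note val' = val val[THEN HOL.trans[OF sym]]
  have diag: "?f a a = 0" for a
    by (auto simp: edge5_def neq doubleton_eq_iff insert_commute)
  show ?thesis
    unfolding braid_relations_def
  proof (intro conjI)
    show "\<forall>a. ?f a a = 0" "\<forall>a b. ?f a b = ?f b a" using diag sym by blast+
    show "\<forall>a. (\<Sum>b\<in>UNIV - {a}. ?f a b) = 0"
      unfolding all_pt5 UNIV_pt5 by (simp add: insert_Diff_if neq val')
    show "\<forall>a b c d. distinct [a, b, c, d] \<longrightarrow> bracket (?f a b) (?f c d) = 0"
      unfolding all_pt5
      by (simp only: val' c' distinct.simps set_simps insert_iff empty_iff pt.distinct pt.inject neq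
          simp_thms)
  qed
qed

abbreviation (input) "XA \<equiv> gen Alpha (Pt i1)"
abbreviation (input) "XC \<equiv> gen (Pt i1) (Pt i2)"
abbreviation (input) "XW \<equiv> gen Beta (Omega :: 'n pt)"
abbreviation (input) "XD \<equiv> gen (Pt i2) Beta"
abbreviation (input) "XE \<equiv> gen (Pt i1) Beta"

lemma gen_rows:
  shows "gen Alpha (Pt i2) = XW - XA - XC"
    and "gen Alpha Beta = - (XE + XD + XW)"
    and "gen Alpha Omega = XC + XE + XD"
    and "gen (Pt i1) Omega = - (XA + XC + XE)"
    and "gen (Pt i2) Omega = XA - XW - XD"
proof -
  let ?p = "gen Alpha (Pt i2)" and ?q = "gen Alpha Beta" and ?r = "gen Alpha (Omega :: 'n pt)"
    and ?s = "gen (Pt i1) Omega" and ?t = "gen (Pt i2) Omega"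
  have ra: "XA + ?p + ?q + ?r = 0"
    using gen_sum[of "Alpha :: 'n pt", unfolded UNIV_pt5] by (simp add: insert_Diff_if add.assoc neq)
  have r1: "XA + XC + XE + ?s = 0"
    using gen_sum[of "Pt i1", unfolded UNIV_pt5] by (simp add: insert_Diff_if add.assoc gen_sym[of _ Alpha] neq)
  have r2: "?p + XC + XD + ?t = 0"
    using gen_sum[of "Pt i2", unfolded UNIV_pt5]
    by (simp add: insert_Diff_if add.assoc gen_sym[of _ Alpha] gen_sym[of "Pt i2" "Pt i1"] neq)
  have rb: "?q + XE + XD + XW = 0"
    using gen_sum[of "Beta :: 'n pt", unfolded UNIV_pt5]
    by (simp add: insert_Diff_if add.assoc gen_sym[of Beta Alpha] gen_sym[of Beta "Pt _"] neq)
  have ro: "?r + ?s + ?t + XW = 0"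
    using gen_sum[of "Omega :: 'n pt", unfolded UNIV_pt5]
    by (simp add: insert_Diff_if add.assoc gen_sym[of Omega] neq)
  \<comment> \<open>Rows \<alpha>, 1, 2 minus rows \<beta>, \<omega>: edges between the two groups
    cancel and edges inside a group count twice.\<close>
  have "(XA + ?p + ?q + ?r) + (XA + XC + XE + ?s) + (?p + XC + XD + ?t)
      - (?q + XE + XD + XW) - (?r + ?s + ?t + XW) = 0"
    by (simp only: ra r1 r2 rb ro) simp
  then have "2 *\<^sub>C (XA + ?p + XC - XW) = 0"
    using scaleC_add_left[of 1 1 "XA + ?p + XC - XW"] by (simp add: scaleC_one algebra_simps)
  then have "XA + ?p + XC = XW" by simp
  then show p: "?p = XW - XA - XC" by (simp add: algebra_simps)
  show q: "?q = - (XE + XD + XW)" by (subst eq_neg_iff_add_eq_0) (use rb in \<open>simp only: add.assoc\<close>)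
  have "?r = - (XA + ?p + ?q)" using ra by (simp only: add_eq_0_iff)
  then show "?r = XC + XE + XD" unfolding p q by simp
  show "?s = - (XA + XC + XE)" using r1 by (subst eq_neg_iff_add_eq_0) (simp only: add_ac)
  have "?t = - (?p + XC + XD)" using r2 by (simp only: add_eq_0_iff)
  then show "?t = XA - XW - XD" unfolding p by simp
qed

text \<open>Three of the relations are commutation relations themselves; the other three come from
  pairs with a dependent generator, expanded by \<open>gen_rows\<close>.\<close>

lemma relations5_gen: "relations5 XA XC XW XD XE"
proof -
  have 1: "bracket XA XD = 0" "bracket XA XW = 0" "bracket XC XW = 0" "bracket XC (gen Alpha Beta) = 0"
    "bracket XE (gen (Pt i2) Omega) = 0" "bracket XE (gen Alpha (Pt i2)) = 0"
    by (rule gen_comm, simp add: neq)+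
  have "bracket XC XE + bracket XC XD = 0"
    using 1(4) by (simp add: gen_rows bracket_minus_right bracket_add_right bracket_diff_right 1 neg_eq_iff_add_eq_0)
  moreover have EA: "bracket XE XA = bracket XE XW + bracket XE XD"
    using 1(5) by (simp add: gen_rows bracket_diff_right diff_eq_eq add.commute)
  moreover have "bracket XE XW - bracket XE XA - bracket XE XC = 0"
    using 1(6) by (simp add: gen_rows bracket_diff_right)
  then have "bracket XE XC = - bracket XE XD" by (simp add: EA)
  then have CE: "bracket XC XE = bracket XE XD" using bracket_anti[of XC XE] by simp
  ultimately have "bracket XC XD = - bracket XE XD"
    by (metis add.commute eq_neg_iff_add_eq_0)
  moreover have "bracket XA XE = - (bracket XE XW + bracket XE XD)"
    using bracket_anti[of XA XE] EA by simp
  ultimately show ?thesis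
    using CE 1 bracket_anti[of XD XE] bracket_anti[of XW XE]
    by (simp add: relations5_def bracket_add_left)
qed

lemma gen_span5: "gen a b \<in> cvec.span {XA, XC, XW, XD, XE}" for a b :: "'n pt"
proof -
  let ?S = "cvec.span {XA, XC, XW, XD, XE}"
  have b: "XA \<in> ?S" "XC \<in> ?S" "XW \<in> ?S" "XD \<in> ?S" "XE \<in> ?S" "0 \<in> ?S"
    by (auto intro: cvec.span_base cvec.span_zero)
  have r: "gen Alpha (Pt i2) \<in> ?S" "gen Alpha Beta \<in> ?S" "gen Alpha (Omega :: 'n pt) \<in> ?S"
    "gen (Pt i1) Omega \<in> ?S" "gen (Pt i2) Omega \<in> ?S"
    unfolding gen_rows using b by (auto intro!: cvec.span_add cvec.span_diff cvec.span_neg)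
  have swap: "gen a b \<in> ?S \<Longrightarrow> gen b a \<in> ?S" for a b :: "'n pt"
    by (subst gen_sym)
  have "\<forall>a b. gen a b \<in> ?S"
    unfolding all_pt5 using b r b(1-5)[THEN swap] r[THEN swap] by simp
  then show ?thesis by blast
qed

end

section \<open>The connections for one and two variables\<close>

definition lmult :: "'g::lie_algebra \<Rightarrow> ('n, 'g env) log_array \<Rightarrow> ('n::finite, 'g env) log_array" where
  "lmult x g = (\<lambda>e \<kappa>. emb x * g e \<kappa>)"

lemma clinear_lmult_at: "clinear (\<lambda>h \<kappa>. emb x * h \<kappa>)"
  by (simp add: clinear_iff fun_eq_iff distrib_left mult_scaleC_right)

lemma geom_by_lmult: "geom_by \<mu> (lmult x g) = lmult x (geom_by \<mu> g)"
  using clinear_geom_by[OF clinear_lmult_at, of x \<mu> g] by (simp add: lmult_def fun_eq_iff)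

lemma euler_lmult: "euler k (lmult x g) = lmult x (euler k g)"
  by (simp add: euler_def lmult_def fun_eq_iff distrib_left mult_scaleC_right)

lemma lmult_add: "lmult x (g + h) = lmult x g + lmult x h"
  by (simp add: lmult_def fun_eq_iff distrib_left)

lemma emb_power_env_deg: "x \<in> degree_one \<Longrightarrow> u \<in> env_deg d \<Longrightarrow> emb x ^ n * u \<in> env_deg (n + d)"
  by (induction n) (simp_all add: mult.assoc env_deg_mult)

context two_points
begin

definition expo1 :: "'n \<Rightarrow> nat" where "expo1 k = (if k = i1 then 1 else 0)"
definition expo2 :: "'n \<Rightarrow> nat" where "expo2 k = (if k = i2 then 1 else 0)"
definition expo12 :: "'n \<Rightarrow> nat" where "expo12 k = 1"

lemma mdeg_n: "mdeg e = e i1 + e i2"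
  by (simp add: mdeg_def sum_n)

lemma expo_pos: "0 < mdeg expo1" "0 < mdeg expo2" "0 < mdeg expo12"
  by (simp_all add: mdeg_n expo1_def expo2_def expo12_def neq)

text \<open>With z_1 = x_1 x_2 and z_2 = x_2 one has dz_1/z_1 = dx_1/x_1 + dx_2/x_2 and d(z_1 -
  z_2)/(z_1 - z_2) = dx_1/(x_1 - 1) + dx_2/x_2, so dx_2/x_2 collects X_{\<alpha>1} + X_{\<alpha>2} +
  X_{12} = \<open>XW\<close>. Relative to dx_1/x_1 the form dx_1/(x_1 - 1) has the factor x_1/(x_1 -
  1), which \<open>Some expo1\<close> encodes; similarly for the others.\<close>

definition letters2 :: "'n \<Rightarrow> ('n pt braid_lie \<times> ('n \<Rightarrow> nat) option) list" where
  "letters2 k = (if k = i1 then [(XA, None), (XC, Some expo1), (XE, Some expo12)]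
     else [(XW, None), (XD, Some expo2), (XE, Some expo12)])"

text \<open>Coefficients of exp(XA log x_1) exp(XW log x_2). Both partial equations hold because
  \<open>XA\<close> and \<open>XW\<close> commute.\<close>

definition init2 :: "('n \<Rightarrow> nat) \<Rightarrow> 'n pt braid_lie env" where
  "init2 \<kappa> = (1 / (fact (\<kappa> i1) * fact (\<kappa> i2))) *\<^sub>C (emb XA ^ \<kappa> i1 * emb XW ^ \<kappa> i2)"

lemma emb_relations:
  "emb XA * emb XD = emb XD * emb XA"
  "emb XA * emb XW = emb XW * emb XA"
  "emb XC * emb XW = emb XW * emb XC"
  "emb XC * emb XE = emb XE * emb XC + emb XE * emb XD - emb XD * emb XE"
  "emb XC * emb XD = emb XD * emb XC + emb XD * emb XE - emb XE * emb XD"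
  "emb XA * emb XE = emb XE * emb XA + emb XD * emb XE - emb XE * emb XD + emb XW * emb XE - emb XE * emb XW"
proof -
  note r = relations5_gen[unfolded relations5_def]
  have e: "bracket x y = z \<Longrightarrow> emb x * emb y = emb y * emb x + emb z" for x y z :: "'n pt braid_lie"
    using emb_bracket[of x y] by (simp add: algebra_simps)
  have "bracket XA XE = bracket XD XE + bracket XW XE" using r by (simp add: bracket_add_left)
  from e[OF this] show "emb XA * emb XE
      = emb XE * emb XA + emb XD * emb XE - emb XE * emb XD + emb XW * emb XE - emb XE * emb XW"
    by (simp add: clinear_add[OF emb_clinear] emb_bracket algebra_simps)
  show "emb XA * emb XD = emb XD * emb XA" "emb XA * emb XW = emb XW * emb XA"
    "emb XC * emb XW = emb XW * emb XC"
    using e[of XA XD 0] e[of XA XW 0] e[of XC XW 0] r by (simp_all add: clinear_0[OF emb_clinear])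
  show "emb XC * emb XE = emb XE * emb XC + emb XE * emb XD - emb XD * emb XE"
    "emb XC * emb XD = emb XD * emb XC + emb XD * emb XE - emb XE * emb XD"
    using e[of XC XE "bracket XE XD"] e[of XC XD "bracket XD XE"] r by (simp_all add: emb_bracket)
qed

lemma emb_XW_power: "emb XW * (emb XA ^ n * u) = emb XA ^ n * (emb XW * u)"
proof (induction n)
  case (Suc n)
  have "emb XW * (emb XA ^ Suc n * u) = emb XA * (emb XW * (emb XA ^ n * u))"
    using emb_relations(2) by (simp add: mult.assoc[symmetric])
  then show ?case using Suc by (simp add: mult.assoc)
qed simp

definition Om2 :: "'n \<Rightarrow> ('n, 'n pt braid_lie env) log_array \<Rightarrow> ('n, 'n pt braid_lie env) log_array" where
  "Om2 k g = (\<lambda>e \<kappa>. \<Sum>(x, m)\<leftarrow>letters2 k. emb x * geom_opt m g e \<kappa>)"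

lemma Om2_eq:
  "Om2 i1 g = lmult XA g + lmult XC (geom_by expo1 g) + lmult XE (geom_by expo12 g)"
  "Om2 i2 g = lmult XW g + lmult XD (geom_by expo2 g) + lmult XE (geom_by expo12 g)"
  by (simp_all add: Om2_def letters2_def fun_eq_iff lmult_def geom_opt_def neq add.assoc)

text \<open>The wedge square of the connection vanishes: the Arnold relation rewrites the product of
  the geometric series in x_1 and x_2, after which the brackets of \<open>emb_relations\<close>
  cancel everything.\<close>

lemma Om2_commute: "Om2 i1 (Om2 i2 g) = Om2 i2 (Om2 i1 g)"
proof (intro ext)
  fix e \<kappa> :: "'n \<Rightarrow> nat"
  let ?a = "geom_by expo1" and ?b = "geom_by expo2" and ?e = "geom_by expo12"
  have e12: "expo12 = (\<lambda>k. expo1 k + expo2 k)"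
    using n_cases by (auto simp: expo1_def expo2_def expo12_def fun_eq_iff neq)
  have arnold: "?a (?b g) e \<kappa> = ?e (?a g) e \<kappa> + ?e (?b g) e \<kappa> - ?e g e \<kappa>"
  proof -
    have "?a (?b g) + ?e g = ?e (?a g) + ?e (?b g)"
      unfolding e12 by (rule geom_by_arnold) (use expo_pos in simp_all)
    from arg_cong[OF this, of "\<lambda>h. h e \<kappa>"]
    have "?a (?b g) e \<kappa> + ?e g e \<kappa> = ?e (?a g) e \<kappa> + ?e (?b g) e \<kappa>"
      by (simp only: plus_fun_apply)
    then show ?thesis by (simp add: algebra_simps)
  qed
  have com: "?b (?a g) = ?a (?b g)" "?a (?e g) = ?e (?a g)" "?b (?e g) = ?e (?b g)"
    by (intro geom_by_commute expo_pos)+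
  have assoc: "emb x * emb y = w \<Longrightarrow> emb x * (emb y * u) = w * u" for x y :: "'n pt braid_lie" and w u
    by (simp add: mult.assoc[symmetric])
  show "Om2 i1 (Om2 i2 g) e \<kappa> = Om2 i2 (Om2 i1 g) e \<kappa>"
    unfolding Om2_eq geom_by_add[OF expo_pos(1)] geom_by_add[OF expo_pos(2)] geom_by_add[OF expo_pos(3)]
      geom_by_lmult lmult_add com
    by (simp add: lmult_def assoc[OF emb_relations(1)] assoc[OF emb_relations(2)] assoc[OF emb_relations(3)]
        assoc[OF emb_relations(4)] assoc[OF emb_relations(5)] assoc[OF emb_relations(6)] arnold algebra_simps)
qed

text \<open>By \<open>euler_geom_by\<close> the derivative of a factor is proportional to its
  exponent: \<open>expo1\<close> and \<open>expo2\<close> involve a single coordinate, and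
  \<open>expo12\<close> occurs in both components with equal exponents.\<close>

lemma Om2_closed: "euler l (Om2 k g) - Om2 k (euler l g) = euler k (Om2 l g) - Om2 l (euler k g)"
proof -
  have add: "euler k (g + h) = euler k g + euler k h" for k and g h :: "('n, 'n pt braid_lie env) log_array"
    by (simp add: euler_def fun_eq_iff scaleC_add_right add_ac)
  have "euler i2 (Om2 i1 g) - Om2 i1 (euler i2 g) = euler i1 (Om2 i2 g) - Om2 i2 (euler i1 g)"
    unfolding Om2_eq add euler_lmult euler_geom_by lmult_add
    by (simp add: expo1_def expo2_def expo12_def neq lmult_def fun_eq_iff)
  then show ?thesis using n_cases[of k] n_cases[of l] by auto
qed

sublocale two: connection letters2 "\<lambda>k g e \<kappa>. \<Sum>(x, m)\<leftarrow>letters2 k. emb x * geom_opt m g e \<kappa>" init2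
proof (unfold_locales, fold Om2_def)
  show "x \<in> degree_one" if "(x, m) \<in> set (letters2 k)" for x m k
    using that by (auto simp: letters2_def gen_degree_one split: if_splits)
  show "0 < mdeg \<mu>" if "(x, Some \<mu>) \<in> set (letters2 k)" for x \<mu> k
    using that expo_pos by (auto simp: letters2_def split: if_splits)
  show "euler l (Om2 k g) - Om2 k (euler l g) = euler k (Om2 l g) - Om2 l (euler k g)" for k l g
    by (rule Om2_closed)
  show "Om2 k (Om2 l g) = Om2 l (Om2 k g)" for k l g
    using n_cases[of k] n_cases[of l] Om2_commute by metis
  show "init2 (\<lambda>_. 0) = 1" by (simp add: init2_def scaleC_one)
  show "init2 \<kappa> \<in> env_deg (mdeg \<kappa>)" for \<kappa>
    unfolding init2_def mdeg_n
    using emb_power_env_deg[OF gen_degree_one one_env_deg, where n = "\<kappa> i2"]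
    by (intro cvec.subspace_scale[OF subspace_env_deg] emb_power_env_deg gen_degree_one) simp
  fix \<kappa> :: "'n \<Rightarrow> nat" and k
  show "of_nat (Suc (\<kappa> k)) *\<^sub>C init2 (\<kappa>(k := Suc (\<kappa> k))) =
      (\<Sum>(x, m)\<leftarrow>letters2 k. if m = None then emb x * init2 \<kappa> else 0)"
    using n_cases[of k]
    by (auto simp: init2_def letters2_def neq scaleC_scaleC mult_scaleC_right mult.assoc emb_XW_power
        simp del: of_nat_Suc)
qed

end

section \<open>Four points\<close>

context
  fixes a b c d :: "'v::finite"
  assumes four: "(UNIV :: 'v set) = {a, b, c, d}" and dist: "distinct [a, b, c, d]"
begin

lemma all_four: "(\<forall>x. P x) \<longleftrightarrow> P a \<and> P b \<and> P c \<and> P d"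
proof -
  have "(\<forall>x. P x) \<longleftrightarrow> (\<forall>x\<in>UNIV. P x)" by simp
  also have "\<dots> \<longleftrightarrow> P a \<and> P b \<and> P c \<and> P d" unfolding four by simp
  finally show ?thesis .
qed

lemma four_neq:
  "a \<noteq> b" "a \<noteq> c" "a \<noteq> d" "b \<noteq> c" "b \<noteq> d" "c \<noteq> d"
  "b \<noteq> a" "c \<noteq> a" "d \<noteq> a" "c \<noteq> b" "d \<noteq> b" "d \<noteq> c"
  using dist by auto

text \<open>Rows a and b minus rows c and d leave twice the difference of the opposite edges ab and
  cd. So opposite edges agree, and two generators remain.\<close>

lemma gen_four:
  shows "gen c d = gen a b" "gen a d = gen b c"
    and "gen a c = - (gen a b + gen b c)" "gen b d = - (gen a b + gen b c)"
proof -
  let ?YW = "gen a b" and ?YD = "gen b c" and ?q = "gen a c" and ?r = "gen a d" and ?s = "gen b d" and ?w = "gen c d"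
  have ra: "?YW + ?q + ?r = 0"
    using gen_sum[of a, unfolded four] by (simp add: insert_Diff_if four_neq add.assoc)
  have r1: "?YW + ?YD + ?s = 0"
    using gen_sum[of b, unfolded four] by (simp add: insert_Diff_if four_neq add.assoc gen_sym[of _ a])
  have rb: "?q + ?YD + ?w = 0"
    using gen_sum[of c, unfolded four]
    by (simp add: insert_Diff_if four_neq add.assoc gen_sym[of c a] gen_sym[of c b])
  have ro: "?r + ?s + ?w = 0"
    using gen_sum[of d, unfolded four]
    by (simp add: insert_Diff_if four_neq add.assoc gen_sym[of d])
  have "(?YW + ?q + ?r) + (?YW + ?YD + ?s) - (?q + ?YD + ?w) - (?r + ?s + ?w) = 0"
    by (simp only: ra r1 rb ro) simp
  then have "2 *\<^sub>C (?YW - ?w) = 0"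
    using scaleC_add_left[of 1 1 "?YW - ?w"] by (simp add: scaleC_one algebra_simps)
  then show w: "?w = ?YW" by simp
  show q: "?q = - (?YW + ?YD)"
    by (subst eq_neg_iff_add_eq_0) (use rb in \<open>simp add: w add_ac\<close>)
  show "?s = - (?YW + ?YD)"
    by (subst eq_neg_iff_add_eq_0) (use r1 in \<open>simp add: add_ac\<close>)
  show "?r = ?YD" using ra unfolding q by (simp add: algebra_simps)
qed

lemma gen_span_four: "gen x y \<in> cvec.span {gen a b, gen b c}"
proof -
  let ?S = "cvec.span {gen a b, gen b c}"
  have base: "gen a b \<in> ?S" "gen b c \<in> ?S" "0 \<in> ?S" by (auto intro: cvec.span_base cvec.span_zero)
  then have "- (gen a b + gen b c) \<in> ?S" by (intro cvec.span_neg cvec.span_add)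
  then have r: "gen c d \<in> ?S" "gen a d \<in> ?S" "gen a c \<in> ?S" "gen b d \<in> ?S"
    unfolding gen_four using base by simp_all
  have swap: "gen x y \<in> ?S \<Longrightarrow> gen y x \<in> ?S" for x y by (subst gen_sym)
  have "\<forall>x y. gen x y \<in> ?S"
    unfolding all_four using base r base(1,2)[THEN swap] r[THEN swap] by simp
  then show ?thesis by blast
qed

lemma lie_hom_eq_four:
  assumes "lie_hom f" "lie_hom g" "f (gen a b) = g (gen a b)" "f (gen b c) = g (gen b c)"
  shows "f = g"
proof (rule lie_hom_eqI[OF assms(1,2)])
  show "f (gen x y) = g (gen x y)" for x y
    by (rule clinear_eq_on_span[OF lie_hom_clinear[OF assms(1)] lie_hom_clinear[OF assms(2)] _ gen_span_four])
      (use assms(3,4) in auto)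
qed

text \<open>Opposite edges share a value and the three values add up to zero, so the relations hold
  for arbitrary \<open>U\<close> and \<open>V\<close>: the Lie algebra on four points is free on two
  generators.\<close>

definition edge_four :: "'g::lie_algebra \<Rightarrow> 'g \<Rightarrow> 'v \<Rightarrow> 'v \<Rightarrow> 'g" where
  "edge_four U V x y = (if x = y then 0 else if {x, y} = {a, b} \<or> {x, y} = {c, d} then U
    else if {x, y} = {b, c} \<or> {x, y} = {a, d} then V else - (U + V))"

lemma braid_relations_edge_four: "braid_relations (edge_four U V)"
proof -
  have "\<forall>x. (\<Sum>y\<in>UNIV - {x}. edge_four U V x y) = 0"
    unfolding all_four four by (simp add: insert_Diff_if edge_four_def doubleton_eq_iff four_neq)
  moreover have "\<forall>p q r s. distinct [p, q, r, s] \<longrightarrow> bracket (edge_four U V p q) (edge_four U V r s) = 0"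
    unfolding all_four by (simp add: edge_four_def doubleton_eq_iff four_neq bracket_self)
  ultimately show ?thesis
    unfolding braid_relations_def by (simp add: edge_four_def insert_commute)
qed

lemma braid_lift_edge_four:
  "braid_lift (edge_four U V) (gen a b) = U" "braid_lift (edge_four U V) (gen b c) = V"
  by (simp_all add: braid_lift_gen[OF braid_relations_edge_four] edge_four_def doubleton_eq_iff four_neq)

end

locale one_point =
  fixes i0 :: "'n::{finite,linorder}"
  assumes UNIV_n: "(UNIV :: 'n set) = {i0}"
begin

lemma n_eq: "i = i0"
  using UNIV_n by auto

lemma UNIV_pt4: "(UNIV :: 'n pt set) = {Alpha, Pt i0, Beta, Omega}"
  by (auto simp: UNIV_pt UNIV_n)

abbreviation (input) "YW \<equiv> gen Alpha (Pt i0)"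
abbreviation (input) "YD \<equiv> gen (Pt i0) Beta"

definition expo :: "'n \<Rightarrow> nat" where "expo k = 1"

text \<open>\<open>YW\<close> is X_{\<alpha>1}, the residue at x = 0; on four points it equals its
  opposite edge X_{\<beta>\<omega>}, so it plays the role of \<open>W\<close>.\<close>

definition letters1 :: "'n \<Rightarrow> ('n pt braid_lie \<times> ('n \<Rightarrow> nat) option) list" where
  "letters1 k = [(YW, None), (YD, Some expo)]"

definition init1 :: "('n \<Rightarrow> nat) \<Rightarrow> 'n pt braid_lie env" where
  "init1 \<kappa> = (1 / fact (\<kappa> i0)) *\<^sub>C (emb YW ^ \<kappa> i0)"

definition Om1 :: "'n \<Rightarrow> ('n, 'n pt braid_lie env) log_array \<Rightarrow> ('n, 'n pt braid_lie env) log_array" where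
  "Om1 k g = (\<lambda>e \<kappa>. \<Sum>(x, m)\<leftarrow>letters1 k. emb x * geom_opt m g e \<kappa>)"

sublocale one: connection letters1 "\<lambda>k g e \<kappa>. \<Sum>(x, m)\<leftarrow>letters1 k. emb x * geom_opt m g e \<kappa>" init1
proof (unfold_locales, fold Om1_def)
  show "x \<in> degree_one" if "(x, m) \<in> set (letters1 k)" for x m k
    using that by (auto simp: letters1_def gen_degree_one)
  show "0 < mdeg \<mu>" if "(x, Some \<mu>) \<in> set (letters1 k)" for x \<mu> k
    using that by (auto simp: letters1_def expo_def mdeg_def UNIV_n)
  show "init1 (\<lambda>_. 0) = 1" by (simp add: init1_def scaleC_one)
  show "init1 \<kappa> \<in> env_deg (mdeg \<kappa>)" for \<kappa>
    unfolding init1_def using emb_power_env_deg[OF gen_degree_one one_env_deg, where n = "\<kappa> i0"]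
    by (intro cvec.subspace_scale[OF subspace_env_deg]) (simp add: mdeg_def UNIV_n)
  fix \<kappa> :: "'n \<Rightarrow> nat" and k
  show "of_nat (Suc (\<kappa> k)) *\<^sub>C init1 (\<kappa>(k := Suc (\<kappa> k))) =
      (\<Sum>(x, m)\<leftarrow>letters1 k. if m = None then emb x * init1 \<kappa> else 0)"
    unfolding n_eq[of k]
    by (simp add: init1_def letters1_def scaleC_scaleC mult_scaleC_right del: of_nat_Suc)
next
  fix k l and g
  show "euler l (Om1 k g) - Om1 k (euler l g) = euler k (Om1 l g) - Om1 l (euler k g)"
    "Om1 k (Om1 l g) = Om1 l (Om1 k g)"
    unfolding n_eq[of k] n_eq[of l] by (rule HOL.refl)+
qed

lemma gen_rows4:
  shows "gen Beta (Omega :: 'n pt) = YW" "gen Alpha Omega = YD"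
    and "gen Alpha Beta = - (YW + YD)" "gen (Pt i0) Omega = - (YW + YD)"
  by (simp_all add: gen_four[OF UNIV_pt4])

end

section \<open>Evaluation of polynomials in logarithms along a line\<close>

lemma has_derivative_vec:
  fixes f :: "'n::finite \<Rightarrow> 'a::real_normed_vector \<Rightarrow> 'b::euclidean_space"
  assumes "\<And>k. (f k has_derivative f' k) (at x)"
  shows "((\<lambda>x. \<chi> k. f k x) has_derivative (\<lambda>h. \<chi> k. f' k h)) (at x)"
  unfolding has_derivative_componentwise_within[of "\<lambda>x. \<chi> k. f k x"]
proof
  fix u :: "'b ^ 'n" assume "u \<in> Basis"
  then obtain k b where u: "u = axis k b" by (auto simp: Basis_vec_def)
  show "((\<lambda>x. (\<chi> k. f k x) \<bullet> u) has_derivative (\<lambda>h. (\<chi> k. f' k h) \<bullet> u)) (at x)"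
    unfolding u inner_axis vec_lambda_beta by (intro has_derivative_inner_left assms)
qed

definition log_vec :: "complex ^ 'n::finite \<Rightarrow> complex ^ 'n" where
  "log_vec x = (\<chi> k. Ln (x $ k))"

text \<open>Inserting the principal branch for each log x_k turns injectivity of the integral map
  into a statement about functions of one complex variable.\<close>

definition eval_log :: "'n::finite logpoly \<Rightarrow> complex ^ 'n \<Rightarrow> complex" where
  "eval_log P x = (\<Sum>\<kappa> | P \<kappa> \<noteq> 0. P \<kappa> x * monom_at (log_vec x) \<kappa>)"

definition log_bound :: "'n::finite logpoly \<Rightarrow> nat \<Rightarrow> bool" where
  "log_bound P M \<longleftrightarrow> (\<forall>\<kappa>. M < mdeg \<kappa> \<longrightarrow> P \<kappa> = 0)"

lemma logpolys_bound:
  assumes "P \<in> logpolys"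
  obtains M where "log_bound P M"
proof
  have fin: "finite (mdeg ` {\<kappa>. P \<kappa> \<noteq> 0})" using assms by (simp add: logpolys_def)
  show "log_bound P (Max (mdeg ` {\<kappa>. P \<kappa> \<noteq> 0}))"
    unfolding log_bound_def
  proof (intro allI impI, rule ccontr)
    fix \<kappa> assume *: "Max (mdeg ` {\<kappa>. P \<kappa> \<noteq> 0}) < mdeg \<kappa>" "P \<kappa> \<noteq> 0"
    then have "mdeg \<kappa> \<le> Max (mdeg ` {\<kappa>. P \<kappa> \<noteq> 0})" by (intro Max_ge fin) auto
    then show False using * by simp
  qed
qed

lemma log_bound_mono: "log_bound P M \<Longrightarrow> M \<le> N \<Longrightarrow> log_bound P N"
  by (auto simp: log_bound_def)

lemma eval_log_slices:
  assumes "log_bound P M"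
  shows "eval_log P x = (\<Sum>d\<le>M. \<Sum>\<kappa> | mdeg \<kappa> = d. P \<kappa> x * monom_at (log_vec x) \<kappa>)"
proof -
  have "{\<kappa>. P \<kappa> \<noteq> 0} \<subseteq> (\<Union>d\<in>{..M}. {\<kappa>. mdeg \<kappa> = d})"
    using assms by (auto simp: log_bound_def intro: leI)
  moreover have "finite (\<Union>d\<in>{..M}. {\<kappa> :: 'a \<Rightarrow> nat. mdeg \<kappa> = d})"
    by (intro finite_UN_I finite_atMost finite_degree_slice)
  ultimately have "eval_log P x = (\<Sum>\<kappa>\<in>(\<Union>d\<in>{..M}. {\<kappa>. mdeg \<kappa> = d}). P \<kappa> x * monom_at (log_vec x) \<kappa>)"
    unfolding eval_log_def by (intro sum.mono_neutral_left) auto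
  also have "\<dots> = (\<Sum>d\<le>M. \<Sum>\<kappa> | mdeg \<kappa> = d. P \<kappa> x * monom_at (log_vec x) \<kappa>)"
    by (rule sum.UNION_disjoint) auto
  finally show ?thesis .
qed

lemma eval_log_add:
  assumes "P \<in> logpolys" "Q \<in> logpolys"
  shows "eval_log (P + Q) x = eval_log P x + eval_log Q x"
proof -
  obtain M N where "log_bound P M" "log_bound Q N"
    using assms logpolys_bound by metis
  then have b: "log_bound P (max M N)" "log_bound Q (max M N)" by (auto intro: log_bound_mono)
  then have "log_bound (P + Q) (max M N)" by (simp add: log_bound_def)
  then show ?thesis
    using b by (simp add: eval_log_slices[of _ "max M N"] distrib_right sum.distrib)
qed

lemma eval_log_scaleC:
  assumes "P \<in> logpolys"
  shows "eval_log (c *\<^sub>C P) x = c * eval_log P x"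
proof -
  obtain M where M: "log_bound P M" using assms logpolys_bound by metis
  then have "log_bound (c *\<^sub>C P) M" by (simp add: log_bound_def)
  then show ?thesis
    using M by (simp add: eval_log_slices[of _ M] sum_distrib_left mult.assoc)
qed

lemma eval_log_const: "x \<in> polydisc \<Longrightarrow> eval_log (logpoly_of (\<lambda>_. 1)) x = 1"
proof -
  assume x: "x \<in> polydisc"
  have "log_bound (logpoly_of (\<lambda>_. 1) :: 'a logpoly) 0"
    by (auto simp: log_bound_def logpoly_of_def fun_eq_iff mdeg_def)
  moreover have "{\<kappa> :: 'a \<Rightarrow> nat. mdeg \<kappa> = 0} = {\<lambda>_. 0}" by (auto simp: mdeg_eq_0)
  ultimately show ?thesis
    using x by (simp add: eval_log_slices[of _ 0] logpoly_of_def monom_at_def)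
qed

text \<open>Along an affine line off the cut of \<open>Ln\<close> the formal differential becomes
  the ordinary derivative, after an index shift in the degree of the logarithms.\<close>

lemma eval_log_deriv:
  fixes P :: "'n::finite logpoly" and a b :: "complex ^ 'n"
  defines "X \<equiv> \<lambda>s. \<chi> k. a $ k + s * b $ k"
  assumes P: "P \<in> logpolys" and M: "log_bound P M"
    and s: "X s \<in> polydisc" "\<And>k. X s $ k \<notin> \<real>\<^sub>\<le>\<^sub>0"
  shows "((\<lambda>s. eval_log P (X s)) has_field_derivative
    (\<Sum>d\<le>M. \<Sum>\<kappa> | mdeg \<kappa> = d. d_logpoly P \<kappa> (X s) b * monom_at (log_vec (X s)) \<kappa>)) (at s)"
proof -
  define y where "y = log_vec (X s)"
  define q where "q k = b $ k / X s $ k" for k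
  have nz: "X s $ k \<noteq> 0" for k using s(2)[of k] by auto
  have DX: "(X has_derivative (\<lambda>t. \<chi> k. t * b $ k)) (at s)"
    unfolding X_def by (rule has_derivative_vec) (auto intro!: derivative_eq_intros)
  have DP: "((\<lambda>s. P \<kappa> (X s)) has_field_derivative frechet_derivative (P \<kappa>) (at (X s)) b) (at s)" for \<kappa>
  proof -
    have h: "holo (P \<kappa>)" using P by (simp add: logpolys_def)
    have "((\<lambda>s. P \<kappa> (X s)) has_derivative (\<lambda>t. frechet_derivative (P \<kappa>) (at (X s)) (\<chi> k. t * b $ k))) (at s)"
      by (rule has_derivative_compose[OF DX holo_has_frechet_derivative[OF h s(1)]])
    then show ?thesis
      unfolding holo_frechet_derivative_scaleC[OF h s(1)] has_field_derivative_def
      by (rule has_derivative_eq_rhs) (simp add: fun_eq_iff)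
  qed
  have Dlog: "((\<lambda>s. log_vec (X s)) has_derivative (\<lambda>t. \<chi> k. t * q k)) (at s)"
    unfolding log_vec_def
  proof (rule has_derivative_vec)
    fix k
    have "((\<lambda>s. a $ k + s * b $ k) has_field_derivative b $ k) (at s)"
      by (auto intro!: derivative_eq_intros)
    then have "((\<lambda>s. Ln (a $ k + s * b $ k)) has_field_derivative inverse (a $ k + s * b $ k) * b $ k) (at s)"
      using s(2)[of k] by (intro DERIV_chain2[OF has_field_derivative_Ln]) (auto simp: X_def)
    then show "((\<lambda>s. Ln (X s $ k)) has_derivative (\<lambda>t. t * q k)) (at s)"
      unfolding has_field_derivative_def X_def q_def vec_lambda_beta
      by (rule has_derivative_eq_rhs) (simp add: fun_eq_iff divide_inverse mult_ac)
  qed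
  have Dm: "((\<lambda>s. monom_at (log_vec (X s)) \<kappa>) has_field_derivative
      (\<Sum>k\<in>UNIV. q k * (of_nat (\<kappa> k) * monom_at y (\<kappa>(k := \<kappa> k - 1))))) (at s)" for \<kappa>
  proof -
    have "((\<lambda>s. monom_at (log_vec (X s)) \<kappa>) has_derivative (\<lambda>t. \<Sum>k\<in>UNIV. (\<chi> k. t * q k) $ k
        * (of_nat (\<kappa> k) * monom_at y (\<kappa>(k := \<kappa> k - 1))))) (at s)"
      using has_derivative_compose[OF Dlog has_derivative_monom_at] by (simp only: y_def)
    then show ?thesis
      unfolding has_field_derivative_def vec_lambda_beta
      by (rule has_derivative_eq_rhs) (simp add: fun_eq_iff sum_distrib_right sum_distrib_left mult_ac)
  qed
  \<comment> \<open>One more degree on the left, since differentiating a logarithm monomial of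
    degree \<open>d + 1\<close> yields degree \<open>d\<close>; the coefficients in degree
    \<open>M + 1\<close> are zero.\<close>
  have M': "log_bound P (Suc M)" using M by (rule log_bound_mono) simp
  have "((\<lambda>s. eval_log P (X s)) has_field_derivative (\<Sum>d\<le>Suc M. \<Sum>\<kappa> | mdeg \<kappa> = d.
      frechet_derivative (P \<kappa>) (at (X s)) b * monom_at y \<kappa>
      + (\<Sum>k\<in>UNIV. q k * (of_nat (\<kappa> k) * monom_at y (\<kappa>(k := \<kappa> k - 1)))) * P \<kappa> (X s))) (at s)"
    unfolding eval_log_slices[OF M'] y_def
    by (intro DERIV_sum DERIV_mult DP Dm[unfolded y_def])
  moreover have "(\<Sum>d\<le>Suc M. \<Sum>\<kappa> | mdeg \<kappa> = d. frechet_derivative (P \<kappa>) (at (X s)) b * monom_at y \<kappa>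
      + (\<Sum>k\<in>UNIV. q k * (of_nat (\<kappa> k) * monom_at y (\<kappa>(k := \<kappa> k - 1)))) * P \<kappa> (X s))
    = (\<Sum>d\<le>M. \<Sum>\<kappa> | mdeg \<kappa> = d. d_logpoly P \<kappa> (X s) b * monom_at y \<kappa>)"
  proof -
    have "frechet_derivative (P \<kappa>) (at (X s)) b = 0" if "mdeg \<kappa> = Suc M" for \<kappa>
    proof -
      have "P \<kappa> = (\<lambda>_. 0)" using M that by (simp add: log_bound_def zero_fun_def)
      then show ?thesis by (simp add: frechet_derivative_const)
    qed
    then have 1: "(\<Sum>d\<le>Suc M. \<Sum>\<kappa> | mdeg \<kappa> = d. frechet_derivative (P \<kappa>) (at (X s)) b * monom_at y \<kappa>)
        = (\<Sum>d\<le>M. \<Sum>\<kappa> | mdeg \<kappa> = d. frechet_derivative (P \<kappa>) (at (X s)) b * monom_at y \<kappa>)"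
      by (simp add: sum.neutral)
    have "(\<Sum>\<kappa> | mdeg \<kappa> = Suc d. q k * (of_nat (\<kappa> k) * monom_at y (\<kappa>(k := \<kappa> k - 1))) * P \<kappa> (X s))
        = (\<Sum>\<kappa> | mdeg \<kappa> = d. of_nat (\<kappa> k + 1) * P (\<kappa>(k := \<kappa> k + 1)) (X s) * q k * monom_at y \<kappa>)" for d k
      by (subst sum_slice_Suc[of k]) (simp_all add: mult_ac)
    then have "(\<Sum>\<kappa> | mdeg \<kappa> = Suc d. (\<Sum>k\<in>UNIV. q k * (of_nat (\<kappa> k) * monom_at y (\<kappa>(k := \<kappa> k - 1)))) * P \<kappa> (X s))
        = (\<Sum>\<kappa> | mdeg \<kappa> = d. (\<Sum>k\<in>UNIV. of_nat (\<kappa> k + 1) * P (\<kappa>(k := \<kappa> k + 1)) (X s) * q k) * monom_at y \<kappa>)" for d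
      unfolding sum_distrib_right by (subst (1 2) sum.swap) simp
    moreover have "(\<Sum>\<kappa> | mdeg \<kappa> = 0. (\<Sum>k\<in>UNIV. q k * (of_nat (\<kappa> k) * monom_at y (\<kappa>(k := \<kappa> k - 1)))) * P \<kappa> (X s)) = 0"
      by (intro sum.neutral) (auto simp: mdeg_eq_0)
    ultimately have 2: "(\<Sum>d\<le>Suc M. \<Sum>\<kappa> | mdeg \<kappa> = d. (\<Sum>k\<in>UNIV. q k * (of_nat (\<kappa> k) * monom_at y (\<kappa>(k := \<kappa> k - 1)))) * P \<kappa> (X s))
        = (\<Sum>d\<le>M. \<Sum>\<kappa> | mdeg \<kappa> = d. (\<Sum>k\<in>UNIV. of_nat (\<kappa> k + 1) * P (\<kappa>(k := \<kappa> k + 1)) (X s) * q k) * monom_at y \<kappa>)"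
      by (subst sum.atMost_Suc_shift) simp
    show ?thesis
      unfolding sum.distrib 1 2 d_logpoly_def q_def[symmetric] distrib_right ..
  qed
  ultimately show ?thesis by (simp only: y_def)
qed

lemma dlogI: "(f has_derivative f') (at x) \<Longrightarrow> dlog f x h = f' h / f x"
  unfolding dlog_def by (simp add: frechet_derivative_at[symmetric])

lemma coord_neq_1: "x \<in> polydisc \<Longrightarrow> x $ k \<noteq> 1"
  by (auto simp: polydisc_def dest!: spec[of _ k])

lemma coord_mult_neq_1: "x \<in> polydisc \<Longrightarrow> x $ k * x $ l \<noteq> 1"
proof
  assume "x \<in> polydisc" "x $ k * x $ l = 1"
  then have "norm (x $ k) < 1" "norm (x $ l) < 1" "norm (x $ k) * norm (x $ l) = 1"
    by (auto simp: polydisc_def norm_mult[symmetric])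
  then show False
    using mult_strict_mono'[of "norm (x $ k)" 1 "norm (x $ l)" 1] by simp
qed

text \<open>Restricted to a suitable line the forms get distinct simple poles, which makes them linearly
  independent modulo exact rational forms.\<close>
definition test_ball :: "complex set" where
  "test_ball = ball (1/2) (1/4)"

lemma test_ball_D:
  assumes "s \<in> test_ball"
  shows "1/4 < Re s" "norm s < 3/4" "s \<noteq> 0" "s \<noteq> 1" "s \<noteq> -2" "s \<noteq> 6" "s \<noteq> 2" "s \<noteq> -4"
proof -
  have d: "norm (1/2 - s) < 1/4" using assms by (simp add: test_ball_def dist_norm)
  have "\<bar>Re (1/2 - s)\<bar> \<le> norm (1/2 - s)" by (rule abs_Re_le_cmod)
  then show re: "1/4 < Re s" using d by simp
  have "norm s \<le> norm (1/2 :: complex) + norm (1/2 - s)"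
    using norm_triangle_ineq4[of "1/2" "1/2 - s"] by simp
  then show n: "norm s < 3/4" using d by simp
  show "s \<noteq> 0" "s \<noteq> 1" "s \<noteq> -2" "s \<noteq> 6" "s \<noteq> 2" "s \<noteq> -4" using re n by auto
qed

section \<open>The integral map in one variable and its injectivity\<close>

context one_point
begin

lemma zco_eq: "zco i0 = (\<lambda>x. x $ i0)" for x
proof -
  have "{i0..} = {i0}" using n_eq by auto
  then show ?thesis by (simp add: zco_def fun_eq_iff)
qed

lemma monom_expo: "monom_at x expo = x $ i0"
  by (simp add: monom_at_def UNIV_n expo_def)

lemma d_formal_int1:
  assumes "\<phi> \<in> graded_dual" "x \<in> polydisc" "x $ i0 \<noteq> 0"
  shows "d_logpoly (one.formal_int \<phi>) \<kappa> x h = one.formal_int (contract YW \<phi>) \<kappa> x * (h $ i0 / x $ i0)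
    + one.formal_int (contract YD \<phi>) \<kappa> x * (h $ i0 / (x $ i0 - 1))"
proof -
  have "x $ k \<noteq> 0" for k using assms(3) n_eq[of k] by simp
  from one.d_formal_int[OF assms(1,2) this] show ?thesis
    using assms(3) by (simp add: UNIV_n letters1_def factor_opt_def geom_factor_def monom_expo field_simps)
qed

lemma is_iterated_integral_map1: "is_iterated_integral_map one.formal_int"
  unfolding is_iterated_integral_map_def
proof (intro conjI ballI allI impI)
  fix \<phi> :: "'n pt braid_lie env \<Rightarrow> complex" and \<kappa> h and x :: "(complex, 'n) vec"
  assume \<phi>: "\<phi> \<in> graded_dual" and x: "x \<in> polydisc" "\<forall>k. x $ k \<noteq> 0"
  have "\<not> i < j" for i j :: 'n unfolding n_eq[of i] n_eq[of j] by simp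
  then have pairs: "{(i, j). i < (j :: 'n)} = {}" by simp
  have "((\<lambda>x :: (complex, 'n) vec. x $ i0) has_derivative (\<lambda>h. h $ i0)) (at x)"
    by (rule bounded_linear_imp_has_derivative[OF bounded_linear_vec_nth])
  moreover have "((\<lambda>x :: (complex, 'n) vec. x $ i0 - 1) has_derivative (\<lambda>h. h $ i0)) (at x)"
    by (auto intro!: derivative_eq_intros bounded_linear_imp_has_derivative[OF bounded_linear_vec_nth])
  ultimately show "d_logpoly (one.formal_int \<phi>) \<kappa> x h =
          (\<Sum>i\<in>UNIV. one.formal_int (contract (gen Alpha (Pt i)) \<phi>) \<kappa> x * dlog (zco i) x h
                  + one.formal_int (contract (gen (Pt i) Beta) \<phi>) \<kappa> x * dlog (\<lambda>x. zco i x - 1) x h)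
          + (\<Sum>(i, j)\<in>{(i, j). i < j}.
               one.formal_int (contract (gen (Pt i) (Pt j)) \<phi>) \<kappa> x * dlog (\<lambda>x. zco i x - zco j x) x h)"
    unfolding pairs UNIV_n using \<phi> x by (simp add: d_formal_int1 zco_eq dlogI)
next
  fix d :: nat and \<phi> :: "'n pt braid_lie env \<Rightarrow> complex"
  assume "0 < d" "homogeneous d \<phi>"
  then have "\<phi> \<in> graded_dual" "\<phi> 1 = 0"
    using one_env_deg by (auto simp: homogeneous_def)
  then show "one.formal_int \<phi> (\<lambda>_. 0) 0 = 0" by (simp add: one.formal_int_at_0)
qed (simp_all add: one.formal_int_logpolys one.formal_int_add one.formal_int_scaleC one.formal_int_counit)

lemma iter_int1: "iter_int = one.formal_int"
  by (rule iter_int_eq[OF is_iterated_integral_map1]) (auto simp: one.formal_int_def fun_eq_iff)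

lemma formal_int1_injective:
  assumes "\<phi> \<in> graded_dual" "one.formal_int \<phi> = 0"
  shows "\<phi> = 0"
proof -
  \<comment> \<open>Along x = s the two forms are ds / s and ds / (s - 1), brought to a common
    denominator.\<close>
  define \<delta> :: "complex poly" where "\<delta> = [:0, 1:] * [:- 1, 1:]"
  define \<rho> :: "(('n pt) braid_lie \<times> complex poly) list" where "\<rho> = [(YW, [:- 1, 1:]), (YD, [:0, 1:])]"
  define X :: "complex \<Rightarrow> (complex, 'n) vec" where "X s = (\<chi> k. 0 $ k + s * (\<chi> k. 1) $ k)" for s
  have X: "X s $ k = s" for s k by (simp add: X_def)
  interpret polynomial_independence \<rho> \<delta> "\<lambda>\<phi> s. eval_log (one.formal_int \<phi>) (X s)" test_ball
  proof
    show "x \<in> degree_one" if "(x, r) \<in> set \<rho>" for x r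
      using that by (auto simp: \<rho>_def gen_degree_one)
    have span: "YW \<in> cvec.span {YW, YD}" "YD \<in> cvec.span {YW, YD}" "0 \<in> cvec.span {YW, YD}"
      by (auto intro: cvec.span_base cvec.span_zero)
    have "\<forall>a\<in>UNIV. \<forall>b\<in>UNIV. gen a (b :: 'n pt) \<in> cvec.span {YW, YD}"
      unfolding UNIV_pt4 using span
      by (simp add: gen_rows4 gen_sym[of _ Alpha] gen_sym[of Omega] gen_sym[of Beta "Pt _"]
          cvec.span_add cvec.span_neg cvec.span_diff)
    then show "gen a b \<in> cvec.span (fst ` set \<rho>)" for a b by (simp add: \<rho>_def)
    show "open test_ball" "test_ball \<noteq> {}" by (simp_all add: test_ball_def)
    show "poly \<delta> s \<noteq> 0" if "s \<in> test_ball" for s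
      using test_ball_D[OF that] by (simp add: \<delta>_def)
    fix \<phi> :: "'n pt braid_lie env \<Rightarrow> complex" and s
    assume \<phi>: "\<phi> \<in> graded_dual" and s: "s \<in> test_ball"
    have Xs: "X s \<in> polydisc" using test_ball_D(2)[OF s] by (simp add: polydisc_def X)
    have gd: "contract YW \<phi> \<in> graded_dual" "contract YD \<phi> \<in> graded_dual"
      by (intro contract_graded_dual gen_degree_one \<phi>)+
    obtain M1 M2 M3 where "log_bound (one.formal_int \<phi>) M1" "log_bound (one.formal_int (contract YW \<phi>)) M2"
      "log_bound (one.formal_int (contract YD \<phi>)) M3"
      using logpolys_bound one.formal_int_logpolys \<phi> gd by metis
    then obtain M where M: "log_bound (one.formal_int \<phi>) M" "log_bound (one.formal_int (contract YW \<phi>)) M"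
      "log_bound (one.formal_int (contract YD \<phi>)) M"
      using log_bound_mono[of _ _ "M1 + M2 + M3"] by (meson le_add1 le_add2 trans_le_add1)
    have "((\<lambda>s. eval_log (one.formal_int \<phi>) (X s)) has_field_derivative
      (\<Sum>d\<le>M. \<Sum>\<kappa> | mdeg \<kappa> = d. d_logpoly (one.formal_int \<phi>) \<kappa> (X s) (\<chi> k. 1) * monom_at (log_vec (X s)) \<kappa>)) (at s)"
      using test_ball_D[OF s] Xs
      unfolding X_def
      by (intro eval_log_deriv one.formal_int_logpolys \<phi> M(1)) (auto simp: complex_nonpos_Reals_iff)
    moreover have "(\<Sum>d\<le>M. \<Sum>\<kappa> | mdeg \<kappa> = d. d_logpoly (one.formal_int \<phi>) \<kappa> (X s) (\<chi> k. 1) * monom_at (log_vec (X s)) \<kappa>)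
       = (1 / s) * eval_log (one.formal_int (contract YW \<phi>)) (X s)
        + (1 / (s - 1)) * eval_log (one.formal_int (contract YD \<phi>)) (X s)"
      unfolding eval_log_slices[OF M(2)] eval_log_slices[OF M(3)] sum_distrib_left sum.distrib[symmetric]
      using test_ball_D(3)[OF s]
      by (intro sum.cong HOL.refl) (simp add: d_formal_int1[OF \<phi> Xs] X algebra_simps)
    ultimately show "((\<lambda>s. eval_log (one.formal_int \<phi>) (X s)) has_field_derivative
        (\<Sum>(x, r)\<leftarrow>\<rho>. poly r s / poly \<delta> s * eval_log (one.formal_int (contract x \<phi>)) (X s))) (at s)"
      using test_ball_D(3,4)[OF s] by (simp add: \<rho>_def \<delta>_def)
  next
    fix \<phi> \<psi> :: "'n pt braid_lie env \<Rightarrow> complex" and s c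
    assume \<phi>: "\<phi> \<in> graded_dual"
    then show "eval_log (one.formal_int (c *\<^sub>C \<phi>)) (X s) = c * eval_log (one.formal_int \<phi>) (X s)"
      by (simp only: one.formal_int_scaleC eval_log_scaleC one.formal_int_logpolys)
    assume "\<psi> \<in> graded_dual"
    then show "eval_log (one.formal_int (\<phi> + \<psi>)) (X s) = eval_log (one.formal_int \<phi>) (X s) + eval_log (one.formal_int \<psi>) (X s)"
      using \<phi> by (simp only: one.formal_int_add eval_log_add one.formal_int_logpolys)
  next
    fix s assume "s \<in> test_ball"
    then have "X s \<in> polydisc" using test_ball_D(2)[of s] by (simp add: polydisc_def X)
    then show "eval_log (one.formal_int counit) (X s) = 1"
      by (simp add: one.formal_int_counit eval_log_const)
  next
    fix p q :: "complex poly" and c :: "'n pt braid_lie \<Rightarrow> complex" and x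
    assume p: "p \<noteq> 0" and eq: "\<delta> * (p * pderiv q - pderiv p * q) + p * p * (\<Sum>(x, r)\<leftarrow>\<rho>. smult (c x) r) = 0"
      and x: "x \<in> fst ` set \<rho>"
    define g where "g = - (\<Sum>(x, r)\<leftarrow>\<rho>. smult (c x) r)"
    have eq': "\<delta> * (p * pderiv q - pderiv p * q) = p * p * g"
      using eq by (simp add: g_def eq_neg_iff_add_eq_0)
    have "c YW = 0"
    proof (rule ccontr)
      assume "c YW \<noteq> 0"
      show False
        by (rule no_simple_pole_derivative[OF p _ _ _ eq', of 0 "[:- 1, 1:]"])
          (use \<open>c YW \<noteq> 0\<close> in \<open>simp_all add: g_def \<rho>_def \<delta>_def\<close>)
    qed
    moreover have "c YD = 0"
    proof (rule ccontr)
      assume "c YD \<noteq> 0"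
      show False
        by (rule no_simple_pole_derivative[OF p _ _ _ eq', of 1 "[:0, 1:]"])
          (use \<open>c YD \<noteq> 0\<close> in \<open>simp_all add: g_def \<rho>_def \<delta>_def\<close>)
    qed
    ultimately show "c x = 0" using x by (auto simp: \<rho>_def)
  qed
  show ?thesis
    by (rule injective[OF assms(1)]) (simp add: assms(2) eval_log_def)
qed

end

section \<open>The integral map in two variables and its injectivity\<close>

context two_points
begin

lemma zco_eq: "zco i1 = (\<lambda>x. x $ i1 * x $ i2)" "zco i2 = (\<lambda>x. x $ i2)"
proof -
  have "{i1..} = {i1, i2}" "{i2..} = {i2}"
    using n_cases less by (auto simp: set_eq_iff) (metis leD order.order_iff_strict)+
  then show "zco i1 = (\<lambda>x. x $ i1 * x $ i2)" "zco i2 = (\<lambda>x. x $ i2)"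
    by (simp_all add: zco_def fun_eq_iff neq)
qed

lemma monom_at_n: "monom_at x e = x $ i1 ^ e i1 * x $ i2 ^ e i2"
  by (simp add: monom_at_def UNIV_n neq)

lemma monom_expo: "monom_at x expo1 = x $ i1" "monom_at x expo2 = x $ i2" "monom_at x expo12 = x $ i1 * x $ i2"
  by (simp_all add: monom_at_n expo1_def expo2_def expo12_def neq)

lemma d_formal_int2:
  assumes "\<phi> \<in> graded_dual" "x \<in> polydisc" "x $ i1 \<noteq> 0" "x $ i2 \<noteq> 0"
  shows "d_logpoly (two.formal_int \<phi>) \<kappa> x h =
      two.formal_int (contract XA \<phi>) \<kappa> x * (h $ i1 / x $ i1)
    + two.formal_int (contract XC \<phi>) \<kappa> x * (h $ i1 / (x $ i1 - 1))
    + two.formal_int (contract XW \<phi>) \<kappa> x * (h $ i2 / x $ i2)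
    + two.formal_int (contract XD \<phi>) \<kappa> x * (h $ i2 / (x $ i2 - 1))
    + two.formal_int (contract XE \<phi>) \<kappa> x * ((h $ i1 * x $ i2 + x $ i1 * h $ i2) / (x $ i1 * x $ i2 - 1))"
proof -
  have nz: "x $ k \<noteq> 0" for k using assms(3,4) n_cases[of k] by auto
  have n1: "x $ i1 - 1 \<noteq> 0" "x $ i2 - 1 \<noteq> 0" "x $ i1 * x $ i2 - 1 \<noteq> 0"
    using coord_neq_1[OF assms(2)] coord_mult_neq_1[OF assms(2)] by auto
  let ?F = "\<lambda>y. two.formal_int (contract y \<phi>) \<kappa> x"
  have "d_logpoly (two.formal_int \<phi>) \<kappa> x h =
      h $ i1 / x $ i1 * (?F XA + x $ i1 / (x $ i1 - 1) * ?F XC + x $ i1 * x $ i2 / (x $ i1 * x $ i2 - 1) * ?F XE)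
    + h $ i2 / x $ i2 * (?F XW + x $ i2 / (x $ i2 - 1) * ?F XD + x $ i1 * x $ i2 / (x $ i1 * x $ i2 - 1) * ?F XE)"
    using two.d_formal_int[OF assms(1,2) nz]
    by (simp add: sum_n letters2_def neq factor_opt_def geom_factor_def monom_expo add.assoc)
  also have "\<dots> = ?F XA * (h $ i1 / x $ i1) + ?F XC * ((h $ i1 / x $ i1) * (x $ i1 / (x $ i1 - 1)))
      + ?F XW * (h $ i2 / x $ i2) + ?F XD * ((h $ i2 / x $ i2) * (x $ i2 / (x $ i2 - 1)))
      + ?F XE * ((h $ i1 / x $ i1 + h $ i2 / x $ i2) * (x $ i1 * x $ i2 / (x $ i1 * x $ i2 - 1)))"
    by (simp only: algebra_simps)
  also have "(h $ i1 / x $ i1) * (x $ i1 / (x $ i1 - 1)) = h $ i1 / (x $ i1 - 1)"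
    using assms(3) by simp
  also have "(h $ i2 / x $ i2) * (x $ i2 / (x $ i2 - 1)) = h $ i2 / (x $ i2 - 1)"
    using assms(4) by simp
  also have "(h $ i1 / x $ i1 + h $ i2 / x $ i2) * (x $ i1 * x $ i2 / (x $ i1 * x $ i2 - 1))
      = (h $ i1 * x $ i2 + x $ i1 * h $ i2) / (x $ i1 * x $ i2 - 1)"
    using assms(3,4) by (simp add: add_divide_eq_iff divide_add_eq_iff add_frac_eq mult_ac)
  finally show ?thesis .
qed

lemma is_iterated_integral_map2: "is_iterated_integral_map two.formal_int"
  unfolding is_iterated_integral_map_def
proof (intro conjI ballI allI impI)
  fix \<phi> :: "'n pt braid_lie env \<Rightarrow> complex" and \<kappa> h and x :: "(complex, 'n) vec"
  assume \<phi>: "\<phi> \<in> graded_dual" and x: "x \<in> polydisc" "\<forall>k. x $ k \<noteq> 0"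
  have "\<not> i2 < i1" using less by simp
  then have pairs: "{(i, j). i < (j :: 'n)} = {(i1, i2)}"
    using less n_cases by (auto simp: set_eq_iff) (metis less_irrefl)+
  let ?F = "\<lambda>y. two.formal_int (contract y \<phi>) \<kappa> x" and ?P = "gen Alpha (Pt i2)"
  have gd: "contract y \<phi> \<in> graded_dual" if "y \<in> degree_one" for y
    by (rule contract_graded_dual[OF that \<phi>])
  \<comment> \<open>The defining equation is stated with X_{\<alpha>2}; splitting \<open>XW\<close>
    distributes dx_2/x_2 over the forms of z_1, z_2 and z_1 - z_2.\<close>
  have "XW = ?P + (XA + XC)" by (simp add: gen_rows)
  then have W: "?F XW = ?F ?P + (?F XA + ?F XC)"
    by (simp add: contract_add[OF graded_dual_clinear[OF \<phi>]] two.formal_int_add gd gen_degree_one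
        graded_dual_add del: gen_rows)
  have n1: "x $ i1 - 1 \<noteq> 0" using coord_neq_1[OF x(1)] by auto
  have D: "((\<lambda>x :: (complex, 'n) vec. x $ k) has_derivative (\<lambda>h. h $ k)) (at x)" for k
    by (rule bounded_linear_imp_has_derivative[OF bounded_linear_vec_nth])
  have "((\<lambda>x :: (complex, 'n) vec. x $ i1 * x $ i2) has_derivative (\<lambda>h. x $ i1 * h $ i2 + h $ i1 * x $ i2)) (at x)"
    by (rule has_derivative_mult[OF D D])
  note dl = dlogI[OF this] dlogI[OF has_derivative_diff[OF this has_derivative_const[of 1]]]
    dlogI[OF D] dlogI[OF has_derivative_diff[OF D has_derivative_const[of 1]]]
    dlogI[OF has_derivative_diff[OF this D]]
  have Cf: "(x $ i1 * h $ i2 + h $ i1 * x $ i2 - h $ i2) / (x $ i1 * x $ i2 - x $ i2)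
      = h $ i1 / (x $ i1 - 1) + h $ i2 / x $ i2"
  proof -
    have "x $ i1 * x $ i2 - x $ i2 = (x $ i1 - 1) * x $ i2" by (simp add: algebra_simps)
    then show ?thesis using n1 x(2) by (simp add: add_frac_eq) (simp add: algebra_simps)
  qed
  have Af: "(x $ i1 * h $ i2 + h $ i1 * x $ i2) / (x $ i1 * x $ i2) = h $ i1 / x $ i1 + h $ i2 / x $ i2"
    using x(2) by (simp add: add_frac_eq algebra_simps)
  show "d_logpoly (two.formal_int \<phi>) \<kappa> x h =
          (\<Sum>i\<in>UNIV. two.formal_int (contract (gen Alpha (Pt i)) \<phi>) \<kappa> x * dlog (zco i) x h
                  + two.formal_int (contract (gen (Pt i) Beta) \<phi>) \<kappa> x * dlog (\<lambda>x. zco i x - 1) x h)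
          + (\<Sum>(i, j)\<in>{(i, j). i < j}.
               two.formal_int (contract (gen (Pt i) (Pt j)) \<phi>) \<kappa> x * dlog (\<lambda>x. zco i x - zco j x) x h)"
    unfolding d_formal_int2[OF \<phi> x(1) spec[OF x(2)] spec[OF x(2)]] pairs sum_n zco_eq dl W
    by (simp add: zco_eq dl Cf Af) (simp add: algebra_simps add_divide_distrib)
next
  fix d :: nat and \<phi> :: "'n pt braid_lie env \<Rightarrow> complex"
  assume "0 < d" "homogeneous d \<phi>"
  then have "\<phi> \<in> graded_dual" "\<phi> 1 = 0"
    using one_env_deg by (auto simp: homogeneous_def)
  then show "two.formal_int \<phi> (\<lambda>_. 0) 0 = 0" by (simp add: two.formal_int_at_0)
qed (simp_all add: two.formal_int_logpolys two.formal_int_add two.formal_int_scaleC two.formal_int_counit)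

lemma iter_int2: "iter_int = two.formal_int"
  by (rule iter_int_eq[OF is_iterated_integral_map2]) (auto simp: two.formal_int_def fun_eq_iff)

lemma formal_int2_injective:
  assumes "\<phi> \<in> graded_dual" "two.formal_int \<phi> = 0"
  shows "\<phi> = 0"
proof -
  \<comment> \<open>Factors of the poles along x_1 = s, x_2 = (s + 2) / 8: s and s - 1 from x_1, s +
    2 and s - 6 from x_2, and x_1 x_2 - 1 = (s - 2) (s + 4) / 8. The line is chosen so that the six
    zeros are distinct.\<close>
  define lA lC lW lD lE lF :: "complex poly" where l:
    "lA = [:0, 1:]" "lC = [:-1, 1:]" "lW = [:2, 1:]" "lD = [:-6, 1:]" "lE = [:-2, 1:]" "lF = [:4, 1:]"
  define \<delta> where "\<delta> = lA * (lC * (lW * (lD * (lE * lF))))"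
  define \<rho> where "\<rho> = [(XA, lC * (lW * (lD * (lE * lF)))), (XC, lA * (lW * (lD * (lE * lF)))),
    (XW, lA * (lC * (lD * (lE * lF)))), (XD, lA * (lC * (lW * (lE * lF)))),
    (XE, lA * (lC * (lW * lD)) * (lE + lF))]"
  define a b :: "(complex, 'n) vec" where "a = (\<chi> k. if k = i1 then 0 else 1/4)"
    and "b = (\<chi> k. if k = i1 then 1 else 1/8)"
  define X :: "complex \<Rightarrow> (complex, 'n) vec" where "X s = (\<chi> k. a $ k + s * b $ k)" for s
  have X: "X s $ i1 = s" "X s $ i2 = (s + 2) / 8" for s
    by (simp_all add: X_def a_def b_def neq)
  have b: "b $ i1 = 1" "b $ i2 = 1/8" by (simp_all add: b_def neq)
  have Xpoly: "X s \<in> polydisc" if "s \<in> test_ball" for s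
  proof -
    have "norm ((s + 2) / 8) \<le> (norm s + norm (2::complex)) / 8"
      unfolding norm_divide by (simp add: norm_triangle_ineq[of s 2, simplified])
    then have "norm ((s + 2) / 8) < 1" using test_ball_D(2)[OF that] by simp
    then show ?thesis
      using test_ball_D(2)[OF that] unfolding polydisc_def mem_Collect_eq all_n X by simp
  qed
  interpret polynomial_independence \<rho> \<delta> "\<lambda>\<phi> s. eval_log (two.formal_int \<phi>) (X s)" test_ball
  proof
    show "x \<in> degree_one" if "(x, r) \<in> set \<rho>" for x r
      using that by (auto simp: \<rho>_def gen_degree_one)
    show "gen a b \<in> cvec.span (fst ` set \<rho>)" for a b using gen_span5[of a b] by (simp add: \<rho>_def)
    show "open test_ball" "test_ball \<noteq> {}" by (simp_all add: test_ball_def)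
    show "poly \<delta> s \<noteq> 0" if "s \<in> test_ball" for s
      using test_ball_D[OF that] unfolding \<delta>_def poly_mult mult_eq_0_iff de_Morgan_disj
      by (simp add: l add_eq_0_iff eq_neg_iff_add_eq_0[symmetric])
    fix \<phi> :: "'n pt braid_lie env \<Rightarrow> complex" and s
    assume \<phi>: "\<phi> \<in> graded_dual" and s: "s \<in> test_ball"
    have Xs: "X s \<in> polydisc" by (rule Xpoly[OF s])
    let ?F = "\<lambda>y. eval_log (two.formal_int (contract y \<phi>)) (X s)"
    have gd: "contract XA \<phi> \<in> graded_dual" "contract XC \<phi> \<in> graded_dual" "contract XW \<phi> \<in> graded_dual"
      "contract XD \<phi> \<in> graded_dual" "contract XE \<phi> \<in> graded_dual"
      by (intro contract_graded_dual gen_degree_one \<phi>)+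
    have "\<exists>M. log_bound (two.formal_int \<psi>) M" if "\<psi> \<in> graded_dual" for \<psi>
      using logpolys_bound two.formal_int_logpolys[OF that] by blast
    then obtain m where m: "log_bound (two.formal_int \<psi>) (m \<psi>)" if "\<psi> \<in> graded_dual" for \<psi> by metis
    define M where "M = m \<phi> + m (contract XA \<phi>) + m (contract XC \<phi>) + m (contract XW \<phi>)
      + m (contract XD \<phi>) + m (contract XE \<phi>)"
    have M: "log_bound (two.formal_int \<phi>) M" "log_bound (two.formal_int (contract XA \<phi>)) M"
      "log_bound (two.formal_int (contract XC \<phi>)) M" "log_bound (two.formal_int (contract XW \<phi>)) M"
      "log_bound (two.formal_int (contract XD \<phi>)) M" "log_bound (two.formal_int (contract XE \<phi>)) M"
      by (rule log_bound_mono[OF m[OF \<phi>]] log_bound_mono[OF m[OF gd(1)]] log_bound_mono[OF m[OF gd(2)]]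
          log_bound_mono[OF m[OF gd(3)]] log_bound_mono[OF m[OF gd(4)]] log_bound_mono[OF m[OF gd(5)]],
          simp add: M_def)+
    have nn: "X s $ k \<notin> \<real>\<^sub>\<le>\<^sub>0" for k
      using test_ball_D(1)[OF s] n_cases[of k] by (auto simp: X complex_nonpos_Reals_iff)
    have nz: "X s $ i1 \<noteq> 0" "X s $ i2 \<noteq> 0"
      using nn[of i1] nn[of i2] by auto
    have "((\<lambda>s. eval_log (two.formal_int \<phi>) (X s)) has_field_derivative
      (\<Sum>d\<le>M. \<Sum>\<kappa> | mdeg \<kappa> = d. d_logpoly (two.formal_int \<phi>) \<kappa> (X s) b * monom_at (log_vec (X s)) \<kappa>)) (at s)"
      using nn Xs unfolding X_def
      by (intro eval_log_deriv two.formal_int_logpolys \<phi> M(1))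
    moreover have "(\<Sum>d\<le>M. \<Sum>\<kappa> | mdeg \<kappa> = d. d_logpoly (two.formal_int \<phi>) \<kappa> (X s) b * monom_at (log_vec (X s)) \<kappa>)
       = (b $ i1 / X s $ i1) * ?F XA + (b $ i1 / (X s $ i1 - 1)) * ?F XC + (b $ i2 / X s $ i2) * ?F XW
        + (b $ i2 / (X s $ i2 - 1)) * ?F XD
        + ((b $ i1 * X s $ i2 + X s $ i1 * b $ i2) / (X s $ i1 * X s $ i2 - 1)) * ?F XE"
      unfolding eval_log_slices[OF M(2)] eval_log_slices[OF M(3)] eval_log_slices[OF M(4)]
        eval_log_slices[OF M(5)] eval_log_slices[OF M(6)] sum_distrib_left sum.distrib[symmetric]
      unfolding d_formal_int2[OF \<phi> Xs nz]
      by (intro sum.cong HOL.refl) (simp only: distrib_right distrib_left mult_ac)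
    moreover have "b $ i1 / X s $ i1 = poly (lC * (lW * (lD * (lE * lF)))) s / poly \<delta> s"
      "b $ i1 / (X s $ i1 - 1) = poly (lA * (lW * (lD * (lE * lF)))) s / poly \<delta> s"
      "b $ i2 / X s $ i2 = poly (lA * (lC * (lD * (lE * lF)))) s / poly \<delta> s"
      "b $ i2 / (X s $ i2 - 1) = poly (lA * (lC * (lW * (lE * lF)))) s / poly \<delta> s"
      "(b $ i1 * X s $ i2 + X s $ i1 * b $ i2) / (X s $ i1 * X s $ i2 - 1)
        = poly (lA * (lC * (lW * lD)) * (lE + lF)) s / poly \<delta> s"
    proof -
      have ne: "poly lA s \<noteq> 0" "poly lC s \<noteq> 0" "poly lW s \<noteq> 0" "poly lD s \<noteq> 0" "poly lE s \<noteq> 0" "poly lF s \<noteq> 0"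
        using test_ball_D[OF s] by (simp_all add: l add_eq_0_iff eq_neg_iff_add_eq_0[symmetric])
      have "b $ i1 / X s $ i1 = 1 / poly lA s" "b $ i1 / (X s $ i1 - 1) = 1 / poly lC s"
        "b $ i2 / X s $ i2 = 1 / poly lW s"
        by (simp_all add: X b l add.commute)
      moreover have "b $ i2 / (X s $ i2 - 1) = 1 / poly lD s"
      proof -
        have "X s $ i2 - 1 = poly lD s / 8" by (simp add: X l field_simps)
        then show ?thesis by (simp only: b) simp
      qed
      moreover have "(b $ i1 * X s $ i2 + X s $ i1 * b $ i2) / (X s $ i1 * X s $ i2 - 1)
        = poly (lE + lF) s / (poly lE s * poly lF s)"
      proof -
        have 1: "X s $ i1 * X s $ i2 - 1 = poly lE s * poly lF s / 8" by (simp add: X l field_simps)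
        have 2: "b $ i1 * X s $ i2 + X s $ i1 * b $ i2 = poly (lE + lF) s / 8"
          by (simp add: X b l field_simps)
        have "(p / 8) / (q / 8) = p / q" for p q :: complex by simp
        then show ?thesis unfolding 1 2 .
      qed
      ultimately show "b $ i1 / X s $ i1 = poly (lC * (lW * (lD * (lE * lF)))) s / poly \<delta> s"
        "b $ i1 / (X s $ i1 - 1) = poly (lA * (lW * (lD * (lE * lF)))) s / poly \<delta> s"
        "b $ i2 / X s $ i2 = poly (lA * (lC * (lD * (lE * lF)))) s / poly \<delta> s"
        "b $ i2 / (X s $ i2 - 1) = poly (lA * (lC * (lW * (lE * lF)))) s / poly \<delta> s"
        "(b $ i1 * X s $ i2 + X s $ i1 * b $ i2) / (X s $ i1 * X s $ i2 - 1)
        = poly (lA * (lC * (lW * lD)) * (lE + lF)) s / poly \<delta> s"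
        using ne by (simp_all add: \<delta>_def)
    qed
    ultimately show "((\<lambda>s. eval_log (two.formal_int \<phi>) (X s)) has_field_derivative
        (\<Sum>(x, r)\<leftarrow>\<rho>. poly r s / poly \<delta> s * eval_log (two.formal_int (contract x \<phi>)) (X s))) (at s)"
      by (simp only: \<rho>_def list.map sum_list.Cons sum_list.Nil prod.case add_0_right add.assoc)
  next
    fix \<phi> \<psi> :: "'n pt braid_lie env \<Rightarrow> complex" and s c
    assume \<phi>: "\<phi> \<in> graded_dual"
    then show "eval_log (two.formal_int (c *\<^sub>C \<phi>)) (X s) = c * eval_log (two.formal_int \<phi>) (X s)"
      by (simp only: two.formal_int_scaleC eval_log_scaleC two.formal_int_logpolys)
    assume "\<psi> \<in> graded_dual"
    then show "eval_log (two.formal_int (\<phi> + \<psi>)) (X s) = eval_log (two.formal_int \<phi>) (X s) + eval_log (two.formal_int \<psi>) (X s)"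
      using \<phi> by (simp only: two.formal_int_add eval_log_add two.formal_int_logpolys)
  next
    fix s assume "s \<in> test_ball"
    then show "eval_log (two.formal_int counit) (X s) = 1"
      by (simp add: two.formal_int_counit eval_log_const Xpoly)
  next
    fix p q :: "complex poly" and c :: "'n pt braid_lie \<Rightarrow> complex" and x
    assume p: "p \<noteq> 0" and eq: "\<delta> * (p * pderiv q - pderiv p * q) + p * p * (\<Sum>(x, r)\<leftarrow>\<rho>. smult (c x) r) = 0"
      and x: "x \<in> fst ` set \<rho>"
    define g where "g = - (\<Sum>(x, r)\<leftarrow>\<rho>. smult (c x) r)"
    have eq': "\<delta> * (p * pderiv q - pderiv p * q) = p * p * g"
      using eq by (simp add: g_def eq_neg_iff_add_eq_0)
    note no_pole = no_simple_pole_derivative[OF p _ _ _ eq']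
    have "c XA = 0" "c XC = 0" "c XW = 0" "c XD = 0" "c XE = 0"
    proof (rule_tac [1-5] ccontr)
      show "False" if "c XA \<noteq> 0"
        by (rule no_pole[of 0 "lC * (lW * (lD * (lE * lF)))"])
          (use that in \<open>simp_all add: g_def \<rho>_def \<delta>_def l del: mult_pCons_left mult_pCons_right\<close>)
      show "False" if "c XC \<noteq> 0"
        by (rule no_pole[of 1 "lA * (lW * (lD * (lE * lF)))"])
          (use that in \<open>simp_all add: g_def \<rho>_def \<delta>_def l mult.left_commute del: mult_pCons_left mult_pCons_right\<close>)
      show "False" if "c XW \<noteq> 0"
        by (rule no_pole[of "- 2" "lA * (lC * (lD * (lE * lF)))"])
          (use that in \<open>simp_all add: g_def \<rho>_def \<delta>_def l mult.left_commute del: mult_pCons_left mult_pCons_right\<close>)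
      show "False" if "c XD \<noteq> 0"
        by (rule no_pole[of 6 "lA * (lC * (lW * (lE * lF)))"])
          (use that in \<open>simp_all add: g_def \<rho>_def \<delta>_def l mult.left_commute del: mult_pCons_left mult_pCons_right\<close>)
      \<comment> \<open>The form of \<open>XE\<close> has poles at 2 and -4; the one at 2 isolates
        its coefficient.\<close>
      show "False" if "c XE \<noteq> 0"
        by (rule no_pole[of 2 "lA * (lC * (lW * (lD * lF)))"])
          (use that in \<open>simp_all add: g_def \<rho>_def \<delta>_def l mult.left_commute del: mult_pCons_left mult_pCons_right\<close>)
    qed
    then show "c x = 0" using x by (auto simp: \<rho>_def)
  qed
  show ?thesis
    by (rule injective[OF assms(1)]) (simp add: assms(2) eval_log_def)
qed

end

section \<open>Words and endomorphisms\<close>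

text \<open>The letters \<open>W, D, E\<close> stand for \<open>X\<^sub>\<beta>\<^sub>\<omega>, X\<^sub>2\<^sub>\<beta>, X\<^sub>1\<^sub>\<beta>\<close>; a noncommutative power series is the function
  of its coefficients.\<close>
datatype letter = LW | LD | LE

lemma UNIV_letter: "UNIV = {LW, LD, LE}"
proof -
  have "x \<in> {LW, LD, LE}" for x by (cases x) auto
  then show ?thesis by auto
qed

instance letter :: finite
  by standard (simp add: UNIV_letter)

type_synonym word_series = "letter list \<Rightarrow> complex"

text \<open>Linear endomorphisms form a type of their own, which can be an instance both of
  \<open>lie_algebra\<close>, the target of \<open>braid_lift\<close>, and of
  \<open>calgebra_1\<close>, the target of \<open>env_lift\<close>.\<close>

typedef endo = "{f :: word_series \<Rightarrow> word_series. clinear f}"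
  morphisms app Endo
proof
  show "(\<lambda>_. 0) \<in> {f :: word_series \<Rightarrow> word_series. clinear f}" by (simp add: clinear_iff)
qed

setup_lifting type_definition_endo

lemma clinear_app: "clinear (app f)"
  using app[of f] by simp

instantiation endo :: "{lie_algebra, calgebra_1}"
begin
lift_definition zero_endo :: endo is "\<lambda>_. 0" by (simp add: clinear_iff)
lift_definition one_endo :: endo is "\<lambda>x. x" by (simp add: clinear_iff)
lift_definition plus_endo :: "endo \<Rightarrow> endo \<Rightarrow> endo" is "\<lambda>f g x. f x + g x"
  by (simp add: clinear_iff scaleC_add_right)
lift_definition uminus_endo :: "endo \<Rightarrow> endo" is "\<lambda>f x. - f x"
  by (simp add: clinear_iff)
lift_definition minus_endo :: "endo \<Rightarrow> endo \<Rightarrow> endo" is "\<lambda>f g x. f x - g x"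
  by (simp add: clinear_iff cvec.scale_right_diff_distrib)
lift_definition scaleC_endo :: "complex \<Rightarrow> endo \<Rightarrow> endo" is "\<lambda>c f x. c *\<^sub>C f x"
  by (simp add: clinear_iff scaleC_add_right scaleC_scaleC mult.commute)
lift_definition times_endo :: "endo \<Rightarrow> endo \<Rightarrow> endo" is "\<lambda>f g x. f (g x)"
  by (simp add: clinear_iff)
definition bracket_endo :: "endo \<Rightarrow> endo \<Rightarrow> endo" where "bracket_endo f g = f * g - g * f"
instance
proof
  fix a b c :: endo and x y :: complex
  show "a + b + c = a + (b + c)" by transfer (simp add: add.assoc)
  show "a + b = b + a" by transfer (simp add: add.commute)
  show "0 + a = a" by transfer simp
  show "- a + a = 0" by transfer simp
  show "a - b = a + - b" by transfer simp
  show scale_add: "x *\<^sub>C (a + b) = x *\<^sub>C a + x *\<^sub>C b" by transfer (simp add: scaleC_add_right)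
  show "(x + y) *\<^sub>C a = x *\<^sub>C a + y *\<^sub>C a" by transfer (simp add: scaleC_add_left)
  show "x *\<^sub>C y *\<^sub>C a = (x * y) *\<^sub>C a" by transfer (simp add: scaleC_scaleC)
  show "1 *\<^sub>C a = a" by transfer (simp add: scaleC_one)
  show assoc: "a * b * c = a * (b * c)" for a b c :: endo by transfer simp
  show "1 * a = a" "a * 1 = a" by (transfer, simp)+
  show dr: "(a + b) * c = a * c + b * c" for a b c :: endo by transfer simp
  show dl: "a * (b + c) = a * b + a * c" for a b c :: endo by transfer (simp add: clinear_add)
  show sl: "(x *\<^sub>C a) * b = x *\<^sub>C (a * b)" for a b :: endo by transfer simp
  show sr: "a * (x *\<^sub>C b) = x *\<^sub>C (a * b)" for a b :: endo by transfer (simp add: clinear_scaleC)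
  show "(0::endo) \<noteq> 1"
  proof
    assume "(0::endo) = 1"
    then have "app 0 (\<lambda>_. 1) [] = app 1 (\<lambda>_. 1) []" by simp
    then show False by (simp add: zero_endo.rep_eq one_endo.rep_eq)
  qed
  have minus: "(a - b) * c = a * c - b * c" "a * (b - c) = a * b - a * c" for a b c :: endo
    by (transfer, simp add: clinear_diff)+
  have pm: "a + b - (c + d) = (a - c) + (b - d)" for a b c d :: endo by transfer (simp add: algebra_simps)
  have sm: "x *\<^sub>C a - x *\<^sub>C b = x *\<^sub>C (a - b)" for a b :: endo
    by transfer (simp add: cvec.scale_right_diff_distrib)
  show "bracket (a + b) c = bracket a c + bracket b c" "bracket a (b + c) = bracket a b + bracket a c"
    "bracket (x *\<^sub>C a) b = x *\<^sub>C bracket a b" "bracket a (x *\<^sub>C b) = x *\<^sub>C bracket a b"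
    by (simp_all only: bracket_endo_def dl dr sl sr pm sm)
  show "bracket a a = 0" unfolding bracket_endo_def by transfer simp
  show "bracket a (bracket b c) + bracket b (bracket c a) + bracket c (bracket a b) = 0"
    unfolding bracket_endo_def minus assoc by transfer (simp add: algebra_simps)
qed
end

lemma app_simps [simp]:
  "app 0 f = 0" "app 1 f = f" "app (a + b) f = app a f + app b f" "app (- a) f = - app a f"
  "app (a - b) f = app a f - app b f" "app (c *\<^sub>C a) f = c *\<^sub>C app a f" "app (a * b) f = app a (app b f)"
  by (transfer, simp add: zero_fun_def)+

lemma endo_eqI: "(\<And>f w. app a f w = app b f w) \<Longrightarrow> a = b"
  by (metis app_inject ext)

lemma clinear_app_at: "clinear (\<lambda>a. app a f)"
  by (simp add: clinear_iff)

primrec lmul_fun :: "letter \<Rightarrow> word_series \<Rightarrow> letter list \<Rightarrow> complex" where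
  "lmul_fun c f [] = 0"
| "lmul_fun c f (b # w) = (if b = c then f w else 0)"

lift_definition lmul :: "letter \<Rightarrow> endo" is lmul_fun
proof -
  have "lmul_fun c (f + g) w = lmul_fun c f w + lmul_fun c g w"
    "lmul_fun c (a *\<^sub>C f) w = a * lmul_fun c f w" for c a f g w
    by (cases w; simp)+
  then show "clinear (lmul_fun c)" for c by (simp add: clinear_iff fun_eq_iff)
qed

lemma app_lmul [simp]: "app (lmul c) f [] = 0" "app (lmul c) f (b # w) = (if b = c then f w else 0)"
  by (simp_all add: lmul.rep_eq)

text \<open>The derivation of the free algebra that sends the letter \<open>c\<close> to \<open>\<Sum> K c a b \<cdot> a b\<close>, on coefficients.\<close>
primrec der_fun :: "(letter \<Rightarrow> letter \<Rightarrow> letter \<Rightarrow> complex) \<Rightarrow> letter list \<Rightarrow> word_series \<Rightarrow> complex" where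
  "der_fun K [] f = 0"
| "der_fun K (a # w) f = (case w of [] \<Rightarrow> 0 | b # v \<Rightarrow> \<Sum>c\<in>UNIV. K c a b * f (c # v))
     + der_fun K w (\<lambda>v. f (a # v))"

lemma der_fun_linear:
  "der_fun K w (\<lambda>v. f v + g v) = der_fun K w f + der_fun K w g"
  "der_fun K w (\<lambda>v. x * f v) = x * der_fun K w f"
  by (induction w arbitrary: f g)
    (auto simp: sum.distrib sum_distrib_left distrib_left mult_ac split: list.split)

lift_definition der :: "(letter \<Rightarrow> letter \<Rightarrow> letter \<Rightarrow> complex) \<Rightarrow> endo" is "\<lambda>K f w. der_fun K w f"
  by (simp add: clinear_iff fun_eq_iff plus_fun_def scaleC_fun_def der_fun_linear)

lemma app_der: "app (der K) f w = der_fun K w f"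
  by (simp add: der.rep_eq)

text \<open>The Leibniz rule: in the commutator only the term that differentiates the first letter
  survives.\<close>

lemma der_lmul:
  "bracket (der K) (lmul c) = (\<Sum>a\<in>UNIV. \<Sum>b\<in>UNIV. K c a b *\<^sub>C (lmul a * lmul b))"
proof (rule endo_eqI)
  fix f w
  have app_sum: "app (sum h S) f v = (\<Sum>i\<in>S. app (h i) f v)" for h :: "letter \<Rightarrow> endo" and S v
    using clinear_sum[OF clinear_compose[OF clinear_fun_apply clinear_app_at]] .
  have split: "(if P then x else 0) = x * (if P then 1 else (0::complex))" for P x by simp
  show "app (bracket (der K) (lmul c)) f w
      = app (\<Sum>a\<in>UNIV. \<Sum>b\<in>UNIV. K c a b *\<^sub>C (lmul a * lmul b)) f w"
  proof (cases w)
    case Nil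
    then show ?thesis by (simp add: bracket_endo_def app_der app_sum)
  next
    case (Cons a w')
    have der_app: "der_fun K w' (\<lambda>v. app (lmul c) f (a # v)) = (if a = c then der_fun K w' f else 0)"
      using der_fun_linear(2)[of K w' 0] by simp
    show ?thesis
    proof (cases w')
      case Nil
      then show ?thesis using Cons by (cases a; cases c; simp add: bracket_endo_def app_der app_sum UNIV_letter)
    next
      case (Cons b v)
      then show ?thesis
        using \<open>w = a # w'\<close> der_app
        by (cases a; cases b; cases c; simp add: bracket_endo_def app_der app_sum UNIV_letter)
    qed
  qed
qed

text \<open>The derivation E -> [D + W, E], W -> 0, D -> 0 that \<open>relations5\<close> prescribes
  for \<open>A\<close>.\<close>

definition KA :: "letter \<Rightarrow> letter \<Rightarrow> letter \<Rightarrow> complex" where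
  "KA c a b = (if c = LE then if b = LE \<and> a \<noteq> LE then 1 else if a = LE \<and> b \<noteq> LE then - 1 else 0 else 0)"

text \<open>The derivation E -> [E, D], D -> [D, E], W -> 0 that \<open>relations5\<close>
  prescribes for \<open>C\<close>.\<close>

definition KC :: "letter \<Rightarrow> letter \<Rightarrow> letter \<Rightarrow> complex" where
  "KC c a b = (if a = LE \<and> b = LD then if c = LE then 1 else if c = LD then - 1 else 0
     else if a = LD \<and> b = LE then if c = LE then - 1 else if c = LD then 1 else 0 else 0)"

lemma relations5_endo: "relations5 (der KA) (der KC) (lmul LW) (lmul LD) (lmul LE)"
  unfolding relations5_def der_lmul
  by (simp add: UNIV_letter KA_def KC_def bracket_endo_def minus_one_scaleC scaleC_one algebra_simps)

definition delta :: "letter list \<Rightarrow> word_series" where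
  "delta w = (\<lambda>v. if v = w then 1 else 0)"

lemma app_lmul_delta: "app (lmul c) (delta w) = delta (c # w)"
proof
  show "app (lmul c) (delta w) v = delta (c # w) v" for v
    by (cases v) (auto simp: delta_def)
qed

lemma der_fun_delta_Nil: "der_fun K w (delta []) = 0"
proof -
  have "der_fun K w (\<lambda>v. delta [] (a # v)) = 0" for a w
    using der_fun_linear(2)[of K w 0] by (simp add: delta_def)
  then show ?thesis by (cases w) (auto simp: delta_def split: list.split)
qed

lemma app_der_delta_Nil: "app (der K) (delta []) = 0"
  by (simp add: fun_eq_iff app_der der_fun_delta_Nil)

text \<open>Every generator raises the word length by one; this is what makes the coefficient at a
  word a homogeneous functional.\<close>

definition supp_len :: "nat \<Rightarrow> word_series \<Rightarrow> bool" where
  "supp_len d f \<longleftrightarrow> (\<forall>w. length w \<noteq> d \<longrightarrow> f w = 0)"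

lemma supp_len_lmul: "supp_len d f \<Longrightarrow> supp_len (Suc d) (app (lmul c) f)"
  unfolding supp_len_def
proof (intro allI impI)
  fix w :: "letter list" assume "\<forall>w. length w \<noteq> d \<longrightarrow> f w = 0" "length w \<noteq> Suc d"
  then show "app (lmul c) f w = 0" by (cases w) auto
qed

lemma der_fun_supp: "(\<And>v. Suc (length v) = length w \<Longrightarrow> f v = 0) \<Longrightarrow> der_fun K w f = 0"
proof (induction w arbitrary: f)
  case (Cons a w)
  have "der_fun K w (\<lambda>v. f (a # v)) = 0" by (intro Cons.IH Cons.prems) simp
  then show ?case using Cons.prems by (auto split: list.split)
qed simp

lemma supp_len_der: "supp_len d f \<Longrightarrow> supp_len (Suc d) (app (der K) f)"
  unfolding supp_len_def app_der by (intro allI impI der_fun_supp) auto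

lemma supp_len_linear:
  "supp_len d f \<Longrightarrow> supp_len d g \<Longrightarrow> supp_len d (f + g)" "supp_len d f \<Longrightarrow> supp_len d g \<Longrightarrow> supp_len d (f - g)"
  "supp_len d f \<Longrightarrow> supp_len d (- f)" "supp_len d f \<Longrightarrow> supp_len d (c *\<^sub>C f)" "supp_len d 0"
  by (simp_all add: supp_len_def)


section \<open>Functionals given by coefficients of words\<close>

text \<open>A representation \<open>f\<close> of \<open>\<pp>\<^sub>m\<close> on series; the coefficient at a word of \<open>u \<cdot> 1\<close> is a functional of \<open>u\<close>.\<close>
locale word_rep =
  fixes f :: "'v::finite \<Rightarrow> 'v \<Rightarrow> endo"
  assumes rel: "braid_relations f"
    and raise: "\<And>a b d g. supp_len d g \<Longrightarrow> supp_len (Suc d) (app (f a b) g)"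
begin

definition act :: "'v braid_lie env \<Rightarrow> endo" where
  "act = env_lift (braid_lift f)"

lemma lie_rep_braid_lift: "lie_rep (braid_lift f)"
  using lie_hom_braid_lift[OF rel] by (simp add: lie_rep_def lie_hom_clinear lie_hom_bracket bracket_endo_def)

lemma alg_hom_act: "alg_hom act"
  unfolding act_def by (rule alg_hom_env_lift[OF lie_rep_braid_lift])

lemma act_emb: "act (emb x) = braid_lift f x"
  unfolding act_def by (rule env_lift_emb[OF lie_rep_braid_lift])

lemma act_gen: "act (emb (gen a b)) = f a b"
  by (simp add: act_emb braid_lift_gen rel)

lemmas act_linear = alg_hom_clinear[OF alg_hom_act] and act_mult = alg_hom_mult[OF alg_hom_act]
  and act_1 = alg_hom_1[OF alg_hom_act]

definition wc :: "letter list \<Rightarrow> 'v braid_lie env \<Rightarrow> complex" where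
  "wc w u = app (act u) (delta []) w"

lemma clinear_wc: "clinear (wc w)"
  unfolding wc_def
  by (rule clinear_compose[OF clinear_fun_apply clinear_compose[OF clinear_app_at act_linear]])

lemma supp_len_gen_word: "supp_len (length w) (app (act (gen_word w)) (delta []))"
proof (induction w)
  case Nil
  show ?case by (simp add: act_1 supp_len_def delta_def)
next
  case (Cons ab w)
  then show ?case by (cases ab) (simp add: act_mult act_gen raise)
qed

lemma wc_env_deg: "u \<in> env_deg d \<Longrightarrow> d \<noteq> length w \<Longrightarrow> wc w u = 0"
  unfolding env_deg_def
proof (erule clinear_zero_on_span[OF clinear_wc, rotated])
  fix u :: "'v braid_lie env" assume "d \<noteq> length w" "u \<in> {gen_word v |v. length v = d}"
  then obtain v where v: "u = gen_word v" "length v = d" by blast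
  show "wc w u = 0"
    using supp_len_gen_word[of v] v \<open>d \<noteq> length w\<close> by (auto simp: supp_len_def wc_def)
qed

lemma wc_homogeneous: "homogeneous (length w) (wc w)"
proof -
  have "\<forall>d>length w. \<forall>u\<in>env_deg d. wc w u = 0" by (auto intro: wc_env_deg)
  then have "wc w \<in> graded_dual" unfolding graded_dual_def using clinear_wc by blast
  then show ?thesis unfolding homogeneous_def by (auto intro: wc_env_deg)
qed

lemma wc_Nil: "wc [] = counit"
proof -
  have "wc [] 1 = 1" by (simp add: wc_def act_1 delta_def)
  then show ?thesis using homogeneous_0_counit[of "wc []"] wc_homogeneous[of "[]"] by (simp add: scaleC_one)
qed

lemma contract_wc: "contract x (wc w) u = app (braid_lift f x) (app (act u) (delta [])) w"
  by (simp add: contract_def wc_def act_mult act_emb)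

text \<open>The contracted element acts last, so a letter strips the first letter of the
  word.\<close>

lemma contract_wc_lmul:
  assumes "braid_lift f x = lmul c"
  shows "contract x (wc (b # w)) = (if b = c then wc w else 0)"
  by (auto simp: fun_eq_iff contract_wc assms wc_def)

end

context two_points
begin

sublocale r5: word_rep "edge5 i1 i2 (der KA) (der KC) (lmul LW) (lmul LD) (lmul LE)"
proof
  show "braid_relations (edge5 i1 i2 (der KA) (der KC) (lmul LW) (lmul LD) (lmul LE))"
    by (rule braid_relations_edge5[OF relations5_endo])
  show "supp_len (Suc d) (app (edge5 i1 i2 (der KA) (der KC) (lmul LW) (lmul LD) (lmul LE) a b) g)"
    if "supp_len d g" for a b d g
    using that by (simp add: edge5_def supp_len_linear supp_len_lmul supp_len_der)
qed

lemma rep5_gens: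
  "braid_lift (edge5 i1 i2 (der KA) (der KC) (lmul LW) (lmul LD) (lmul LE)) XA = der KA"
  "braid_lift (edge5 i1 i2 (der KA) (der KC) (lmul LW) (lmul LD) (lmul LE)) XC = der KC"
  "braid_lift (edge5 i1 i2 (der KA) (der KC) (lmul LW) (lmul LD) (lmul LE)) XW = lmul LW"
  "braid_lift (edge5 i1 i2 (der KA) (der KC) (lmul LW) (lmul LD) (lmul LE)) XD = lmul LD"
  "braid_lift (edge5 i1 i2 (der KA) (der KC) (lmul LW) (lmul LD) (lmul LE)) XE = lmul LE"
  by (simp_all add: braid_lift_gen[OF r5.rel] edge5_def doubleton_eq_iff neq)

end

context one_point
begin

abbreviation edge4 :: "'n pt \<Rightarrow> 'n pt \<Rightarrow> endo" where
  "edge4 \<equiv> edge_four Alpha (Pt i0) Beta Omega (lmul LW) (lmul LD)"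

sublocale r4: word_rep edge4
proof
  show "braid_relations edge4" by (rule braid_relations_edge_four[OF UNIV_pt4]) simp
  show "supp_len (Suc d) (app (edge4 a b) g)" if "supp_len d g" for a b d g
    using that by (simp add: edge_four_def[OF UNIV_pt4] supp_len_linear supp_len_lmul)
qed

lemma rep4_gens: "braid_lift edge4 YW = lmul LW" "braid_lift edge4 YD = lmul LD"
  by (rule braid_lift_edge_four[OF UNIV_pt4], simp)+

end

section \<open>Nested sums\<close>

text \<open>Index lists are stored last index first, so that the outermost summation comes first.\<close>
primrec nested :: "nat list \<Rightarrow> nat \<Rightarrow> nat \<Rightarrow> complex" where
  "nested [] i j = (if i = j then 1 else 0)"
| "nested (b # bs) i j = (\<Sum>k<j. nested bs i k) / of_nat j ^ b"

lemma nested_0: "bs \<noteq> [] \<Longrightarrow> nested bs i 0 = 0"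
  by (cases bs) auto

lemma nested_lower: "2 \<le> b \<Longrightarrow> of_nat j * nested (b # bs) i j = nested ((b - 1) # bs) i j"
proof -
  assume "2 \<le> b"
  then obtain c where "b = Suc c" "c \<noteq> 0" by (cases b) auto
  then show ?thesis by (cases "j = 0") auto
qed

lemma nested_one: "of_nat j * nested (1 # bs) i j = (\<Sum>k<j. nested bs i k)"
  by (cases "j = 0") auto

text \<open>Raising the lower bound by one loses exactly the chains whose innermost index is
  \<open>Suc i\<close>.\<close>

lemma nested_snoc_diff:
  "nested (bs @ [b]) i j - nested (bs @ [b]) (Suc i) j = nested bs (Suc i) j / of_nat (Suc i) ^ b"
proof (induction bs arbitrary: j)
  case Nil
  have *: "(\<Sum>k<j. if i = k then 1 else 0 :: complex) = (if i < j then 1 else 0)" for i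
    by (simp add: sum.delta)
  show ?case unfolding append_Nil nested.simps * by (auto simp: not_less le_Suc_eq)
next
  case (Cons c bs)
  have "nested ((c # bs) @ [b]) i j - nested ((c # bs) @ [b]) (Suc i) j
      = (\<Sum>k<j. nested (bs @ [b]) i k - nested (bs @ [b]) (Suc i) k) / of_nat j ^ c"
    by (simp add: sum_subtractf diff_divide_distrib)
  then show ?case unfolding Cons.IH by (simp add: sum_divide_distrib mult.commute)
qed

text \<open>Summation by parts in the index that separates the two groups of summation indices; it
  becomes the equation in x_1 at a word where \<open>D\<close> and \<open>E\<close> meet.\<close>

lemma nested_junction:
  "(\<Sum>k<i. nested as 0 k * nested (bs @ [b]) k j) - (\<Sum>k<i. nested (b # as) 0 k * nested bs k j)
     - nested (b # as) 0 i * nested bs i j = (\<Sum>k<i. nested as 0 k) * nested (bs @ [b]) i j"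
proof (induction i)
  case (Suc i)
  have "nested (bs @ [b]) (Suc i) j = nested (bs @ [b]) i j - nested bs (Suc i) j / of_nat (Suc i) ^ b"
    using nested_snoc_diff[of bs b i j] by (simp add: algebra_simps)
  moreover have "nested (b # as) 0 (Suc i) = ((\<Sum>k<i. nested as 0 k) + nested as 0 i) / of_nat (Suc i) ^ b"
    by simp
  ultimately show ?case
    using Suc by (simp only: sum.lessThan_Suc) (simp add: algebra_simps)
qed simp


section \<open>The words of polylogarithms\<close>

definition block_word :: "letter \<Rightarrow> nat list \<Rightarrow> letter list" where
  "block_word c as = concat (map (\<lambda>a. replicate (a - 1) LW @ [c]) as)"

lemma block_word_simps [simp]:
  "block_word c [] = []" "block_word c (a # as) = replicate (a - 1) LW @ c # block_word c as"
  "block_word c (as @ bs) = block_word c as @ block_word c bs"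
  by (simp_all add: block_word_def)

lemma set_block_word: "set (block_word c as) \<subseteq> {LW, c}"
  by (induction as) (auto simp: set_replicate_conv_if)

lemma der_no_E: "LE \<notin> set w \<Longrightarrow> der_fun KA w f = 0"
  by (induction w arbitrary: f) (auto simp: KA_def UNIV_letter split: list.split)

lemma der_KC_no_E: "LE \<notin> set w \<Longrightarrow> der_fun KC w f = 0"
  by (induction w arbitrary: f) (auto simp: KC_def UNIV_letter split: list.split)

lemma der_KC_no_D: "LD \<notin> set w \<Longrightarrow> der_fun KC w f = 0"
  by (induction w arbitrary: f) (auto simp: KC_def UNIV_letter split: list.split)

text \<open>A nonzero entry of \<open>KA\<close> or \<open>KC\<close> needs an \<open>E\<close>
  among the two adjacent letters, so nothing happens before the letter \<open>x\<close>, whose right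
  neighbour may be an \<open>E\<close>.\<close>

lemma der_prefix:
  assumes "LE \<notin> set pre" "x \<noteq> LE"
  shows "der_fun KA (pre @ x # v) f = der_fun KA (x # v) (\<lambda>u. f (pre @ u))"
    and "der_fun KC (pre @ x # v) f = der_fun KC (x # v) (\<lambda>u. f (pre @ u))"
  using assms(1)
proof (induction pre arbitrary: f)
  case (Cons a pre)
  {
    case 1
    have "(\<Sum>c\<in>UNIV. KA c a b * h c) = 0" if "b \<noteq> LE" for b h
      using that 1 by (auto simp: KA_def)
    then have "(case pre @ x # v of [] \<Rightarrow> 0 | b # u \<Rightarrow> \<Sum>c\<in>UNIV. KA c a b * f (c # u)) = 0"
      using 1 assms(2) by (cases pre) auto
    then show ?case using Cons.IH(1)[of "\<lambda>v. f (a # v)"] 1 by simp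
  next
    case 2
    have "(\<Sum>c\<in>UNIV. KC c a b * h c) = 0" if "b \<noteq> LE" for b h
      using that 2 by (auto simp: KC_def)
    then have "(case pre @ x # v of [] \<Rightarrow> 0 | b # u \<Rightarrow> \<Sum>c\<in>UNIV. KC c a b * f (c # u)) = 0"
      using 2 assms(2) by (cases pre) auto
    then show ?case using Cons.IH(2)[of "\<lambda>v. f (a # v)"] 2 by simp
  }
qed simp_all

text \<open>Pairs of \<open>W\<close> contribute nothing; the first contribution is \<open>E\<close>
  absorbing the last \<open>W\<close> on its left.\<close>

lemma der_KA_W_E:
  "der_fun KA (replicate (Suc n) LW @ LE # v) f
    = f (replicate n LW @ LE # v) + der_fun KA (LE # v) (\<lambda>u. f (replicate (Suc n) LW @ u))"
proof (induction n arbitrary: f)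
  case 0
  show ?case by (simp add: KA_def UNIV_letter)
next
  case (Suc n)
  have "der_fun KA (replicate (Suc (Suc n)) LW @ LE # v) f
      = der_fun KA (replicate (Suc n) LW @ LE # v) (\<lambda>u. f (LW # u))"
    by (simp add: KA_def)
  then show ?case unfolding Suc.IH by simp
qed

lemma der_KA_E_W: "der_fun KA (LE # LW # v) f = - f (LE # v) + der_fun KA (LW # v) (\<lambda>u. f (LE # u))"
  by (simp add: KA_def UNIV_letter)

text \<open>The terms where an \<open>E\<close> absorbs a neighbouring \<open>W\<close> from the left and from the right cancel.\<close>
lemma der_KA_E: "der_fun KA (LE # block_word LE as) f = 0"
proof (induction as arbitrary: f)
  case (Cons a as)
  show ?case
  proof (cases "a - 1")
    case 0
    then show ?thesis using Cons.IH by (simp add: KA_def)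
  next
    case (Suc n)
    have "der_fun KA (LE # block_word LE (a # as)) f
      = - f (LE # replicate n LW @ LE # block_word LE as)
        + der_fun KA (replicate (Suc n) LW @ LE # block_word LE as) (\<lambda>u. f (LE # u))"
      unfolding block_word_simps Suc replicate_Suc append_Cons by (rule der_KA_E_W)
    then show ?thesis unfolding der_KA_W_E Cons.IH by simp
  qed
qed simp

text \<open>As \<kappa> is nondecreasing, z_2 belongs to the larger summation indices; with lists
  stored last index first, its block, written with \<open>D\<close>, comes first.\<close>

definition polylog_word :: "nat list \<Rightarrow> nat list \<Rightarrow> letter list" where
  "polylog_word as bs = block_word LD bs @ block_word LE as"

lemma no_E_block_D: "LE \<notin> set (block_word LD bs)"
  using set_block_word[of LD bs] by auto

lemma no_D_block_E: "LD \<notin> set (block_word LE bs)"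
  using set_block_word[of LE bs] by auto

text \<open>The surviving term is the first \<open>E\<close> of the word absorbing a
  \<open>W\<close> on its left; \<open>der_KA_E\<close> cancels everything after it.\<close>

lemma der_KA_lower:
  assumes "2 \<le> a"
  shows "der_fun KA (polylog_word (a # as) bs) f = f (polylog_word ((a - 1) # as) bs)"
proof -
  obtain n where n: "a - 1 = Suc n" using assms by (cases "a - 1") auto
  then have a: "a - Suc (Suc 0) = n" by simp
  have "der_fun KA (polylog_word (a # as) bs) f
      = der_fun KA (replicate (Suc n) LW @ LE # block_word LE as) (\<lambda>u. f (block_word LD bs @ u))"
    unfolding polylog_word_def block_word_simps n replicate_Suc append_Cons
    by (subst der_prefix(1)[OF no_E_block_D]) auto
  then show ?thesis
    unfolding der_KA_W_E der_KA_E by (simp add: polylog_word_def a)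
qed

lemma der_KC_lower:
  assumes "2 \<le> a"
  shows "der_fun KC (polylog_word (a # as) bs) f = 0"
proof -
  obtain n where n: "a - 1 = Suc n" using assms by (cases "a - 1") auto
  have "der_fun KC (polylog_word (a # as) bs) f
      = der_fun KC (LW # replicate n LW @ LE # block_word LE as) (\<lambda>u. f (block_word LD bs @ u))"
    unfolding polylog_word_def block_word_simps n replicate_Suc append_Cons
    by (subst der_prefix(2)[OF no_E_block_D]) auto
  also have "\<dots> = 0" by (rule der_KC_no_D) (use no_D_block_E in auto)
  finally show ?thesis .
qed

lemma polylog_word_junction:
  "polylog_word (1 # as) (bs @ [b]) = (block_word LD bs @ replicate (b - 1) LW) @ LD # LE # block_word LE as"
  by (simp add: polylog_word_def)

text \<open>At the junction of \<open>D\<close> and \<open>E\<close> the letter \<open>E\<close>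
  absorbs the \<open>D\<close>, so the exponent \<open>b\<close> passes from the last
  \<open>D\<close> block to the first \<open>E\<close> block.\<close>

lemma der_KA_junction:
  "der_fun KA (polylog_word (1 # as) (bs @ [b])) f = f (polylog_word (b # as) bs)"
proof -
  let ?p = "block_word LD bs @ replicate (b - 1) LW"
  have "der_fun KA (polylog_word (1 # as) (bs @ [b])) f
      = der_fun KA (LD # LE # block_word LE as) (\<lambda>u. f (?p @ u))"
    unfolding polylog_word_junction
    by (rule der_prefix(1)) (use no_E_block_D in \<open>auto simp: set_replicate_conv_if\<close>)
  also have "\<dots> = f (?p @ LE # block_word LE as) + der_fun KA (LE # block_word LE as) (\<lambda>u. f (?p @ LD # u))"
    by (simp add: KA_def UNIV_letter)
  finally show ?thesis unfolding der_KA_E by (simp add: polylog_word_def)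
qed

text \<open>\<open>KC\<close> sees just the junction; the pair \<open>D E\<close> collects the
  single letter \<open>D\<close> with sign plus and \<open>E\<close> with sign minus.\<close>

lemma der_KC_junction:
  "der_fun KC (polylog_word (1 # as) (bs @ [b])) f
    = f (polylog_word as (bs @ [b])) - f (polylog_word (b # as) bs)"
proof -
  let ?p = "block_word LD bs @ replicate (b - 1) LW"
  have "der_fun KC (polylog_word (1 # as) (bs @ [b])) f
      = der_fun KC (LD # LE # block_word LE as) (\<lambda>u. f (?p @ u))"
    unfolding polylog_word_junction
    by (rule der_prefix(2)) (use no_E_block_D in \<open>auto simp: set_replicate_conv_if\<close>)
  also have "\<dots> = f (?p @ LD # block_word LE as) - f (?p @ LE # block_word LE as)
      + der_fun KC (LE # block_word LE as) (\<lambda>u. f (?p @ LD # u))"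
    by (simp add: KC_def UNIV_letter)
  also have "der_fun KC (LE # block_word LE as) (\<lambda>u. f (?p @ LD # u)) = 0"
    by (rule der_KC_no_D) (use no_D_block_E in auto)
  finally show ?thesis by (simp add: polylog_word_def)
qed

lemma der_start:
  "der_fun KA (polylog_word (1 # as) []) f = 0" "der_fun KC (polylog_word (1 # as) []) f = 0"
  "der_fun KA (polylog_word [] bs) f = 0" "der_fun KC (polylog_word [] bs) f = 0"
proof -
  show "der_fun KA (polylog_word (1 # as) []) f = 0"
    using der_KA_E[of as f] by (simp add: polylog_word_def del: der_fun.simps)
  show "der_fun KC (polylog_word (1 # as) []) f = 0"
    by (rule der_KC_no_D) (use no_D_block_E in \<open>auto simp: polylog_word_def\<close>)
  show "der_fun KA (polylog_word [] bs) f = 0" "der_fun KC (polylog_word [] bs) f = 0"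
    by (rule der_no_E der_KC_no_E, use no_E_block_D in \<open>auto simp: polylog_word_def\<close>)+
qed

lemma polylog_word_ends: "as \<noteq> [] \<or> bs \<noteq> [] \<Longrightarrow> polylog_word as bs \<noteq> replicate n LW"
proof
  assume *: "as \<noteq> [] \<or> bs \<noteq> []" "polylog_word as bs = replicate n LW"
  have "c \<in> set (block_word c cs)" if "cs \<noteq> []" for c cs using that by (cases cs) auto
  then have "LD \<in> set (polylog_word as bs) \<or> LE \<in> set (polylog_word as bs)"
    using *(1) by (auto simp: polylog_word_def)
  then show False unfolding *(2) by (auto simp: set_replicate_conv_if split: if_splits)
qed

section \<open>Functionals whose integral is a power series without logarithms\<close>

context connection
begin

definition has_coefs :: "('v braid_lie env \<Rightarrow> complex) \<Rightarrow> (('n \<Rightarrow> nat) \<Rightarrow> complex) \<Rightarrow> bool" where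
  "has_coefs \<phi> c \<longleftrightarrow> \<phi> \<in> graded_dual \<and> (\<forall>\<kappa>. coef \<phi> \<kappa> = (\<lambda>e. if \<kappa> = (\<lambda>_. 0) then c e else 0))"

lemma has_coefs_add: "has_coefs \<phi> c \<Longrightarrow> has_coefs \<psi> c' \<Longrightarrow> has_coefs (\<phi> + \<psi>) (\<lambda>e. c e + c' e)"
  by (auto simp: has_coefs_def coef_add graded_dual_add fun_eq_iff)

lemma has_coefs_scaleC: "has_coefs \<phi> c \<Longrightarrow> has_coefs (a *\<^sub>C \<phi>) (\<lambda>e. a * c e)"
  by (auto simp: has_coefs_def coef_scaleC graded_dual_scaleC fun_eq_iff)

lemma has_coefs_diff:
  assumes "has_coefs \<phi> c" "has_coefs \<psi> c'"
  shows "has_coefs (\<phi> - \<psi>) (\<lambda>e. c e - c' e)"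
proof -
  have "\<phi> - \<psi> = \<phi> + (- 1) *\<^sub>C \<psi>" by (simp only: minus_one_scaleC diff_conv_add_uminus)
  then show ?thesis
    using has_coefs_add[OF assms(1) has_coefs_scaleC[OF assms(2), of "- 1"]] by simp
qed

lemma has_coefs_0: "has_coefs 0 (\<lambda>_. 0)"
  using has_coefs_scaleC[of counit _ 0] graded_dual_0
  by (auto simp: has_coefs_def coef_def degs_def)

lemma coef_at_degree:
  assumes "\<And>d. d \<noteq> D \<Longrightarrow> \<phi> (sol d e \<kappa>) = 0" "\<phi> \<in> graded_dual"
  shows "coef \<phi> \<kappa> e = \<phi> (sol D e \<kappa>)"
proof -
  have "coef \<phi> \<kappa> e = (\<Sum>d\<in>insert D (degs \<phi>). \<phi> (sol d e \<kappa>))"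
    by (rule coef_superset) (auto simp: finite_degs assms(2))
  also have "\<dots> = (\<Sum>d\<in>{D}. \<phi> (sol d e \<kappa>))"
    by (rule sum.mono_neutral_right) (auto simp: finite_degs assms)
  finally show ?thesis by simp
qed

text \<open>The summed Euler equation determines the coefficients away from \<open>e = 0\<close>:
  the deviation \<open>h\<close> solves the homogeneous equation, so \<open>log_degree_0\<close>
  applies. \<open>init\<close> and \<open>c0\<close> settle \<open>e = 0\<close>.\<close>

lemma has_coefsI:
  assumes hom: "homogeneous D \<phi>" and init: "\<And>\<kappa>. \<phi> (Z \<kappa>) = 0" and c0: "c (\<lambda>_. 0) = 0"
    and step: "\<And>k \<kappa> e. (\<Sum>(x, m)\<leftarrow>letters k. geom_opt m (coef (contract x \<phi>) \<kappa>) e)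
      = (if \<kappa> = (\<lambda>_. 0) then of_nat (e k) * c e else 0)"
  shows "has_coefs \<phi> c"
proof -
  have gd: "\<phi> \<in> graded_dual" using hom by (rule homogeneous_graded_dual)
  note lin = graded_dual_clinear[OF gd]
  have coef: "coef \<phi> \<kappa> e = \<phi> (sol D e \<kappa>)" for \<kappa> e
    by (rule coef_at_degree[OF _ gd]) (use hom sol_env_deg in \<open>auto simp: homogeneous_def\<close>)
  have "coef \<phi> \<kappa> e = (if \<kappa> = (\<lambda>_. 0) then c e else 0)" for \<kappa> e
  proof (cases "mdeg e = 0")
    case True
    have "coef \<phi> \<kappa> e = 0" unfolding coef sol_at_0[OF True] by (auto simp: init clinear_0[OF lin])
    moreover have "c e = 0" using True c0 by (simp add: mdeg_eq_0)
    ultimately show ?thesis by simp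
  next
    case False
    define h where "h \<kappa> = coef \<phi> \<kappa> e - (if \<kappa> = (\<lambda>_. 0) then c e else 0)" for \<kappa>
    have up: "\<kappa>(k := Suc (\<kappa> k)) \<noteq> (\<lambda>_. 0)" for k and \<kappa> :: "'n \<Rightarrow> nat"
      by (metis fun_upd_same nat.distinct(1))
    have "h \<kappa> = 0" for \<kappa>
    proof (rule log_degree_0[of "mdeg e" D])
      fix \<kappa> :: "'n \<Rightarrow> nat"
      show "h \<kappa> = 0" if "D < mdeg \<kappa>"
        using that clinear_0[OF lin] by (auto simp: h_def coef sol_log_degree)
      have "of_nat (mdeg e) *\<^sub>C h \<kappa> + log_euler h \<kappa>
          = (\<Sum>k\<in>UNIV. (of_nat (e k) * coef \<phi> \<kappa> e + of_nat (Suc (\<kappa> k)) * coef \<phi> (\<kappa>(k := Suc (\<kappa> k))) e)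
             - of_nat (e k) * (if \<kappa> = (\<lambda>_. 0) then c e else 0))"
        unfolding of_nat_mdeg_scaleC log_euler_def sum.distrib[symmetric]
        by (rule sum.cong) (simp_all add: h_def up right_diff_distrib del: of_nat_Suc)
      also have "\<dots> = 0"
        unfolding coef_euler[OF gd] step by (intro sum.neutral) simp
      finally show "of_nat (mdeg e) *\<^sub>C h \<kappa> + log_euler h \<kappa> = 0" .
    qed (use False in simp)
    then have "h \<kappa> = 0" .
    then show ?thesis unfolding h_def by (rule eq_iff_diff_eq_0[THEN iffD2])
  qed
  then show ?thesis using gd by (auto simp: has_coefs_def)
qed

lemma has_coefs_counit: "has_coefs counit (\<lambda>e. if mdeg e = 0 then 1 else 0)"
proof -
  have "coef counit \<kappa> e = (if \<kappa> = (\<lambda>_. 0) then if mdeg e = 0 then 1 else 0 else 0)" for \<kappa> e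
  proof -
    have "coef counit \<kappa> e = counit (sol 0 e \<kappa>)"
      by (rule coef_at_degree[OF _ counit_graded_dual])
        (use counit_env_deg[OF _ sol_env_deg] in auto)
    then show ?thesis by (auto simp: mdeg_eq_0 counit_1 clinear_0[OF counit_clinear])
  qed
  then show ?thesis by (auto simp: has_coefs_def counit_graded_dual)
qed

lemma formal_int_has_coefs:
  assumes "has_coefs \<phi> c"
  shows "formal_int \<phi> = logpoly_of (pseries c)"
proof (intro ext)
  fix \<kappa> x
  have "coef \<phi> \<kappa> = (\<lambda>e. if \<kappa> = (\<lambda>_. 0) then c e else 0)" and gd: "\<phi> \<in> graded_dual" for \<kappa>
    using assms by (simp_all add: has_coefs_def)
  then have "pseries (coef \<phi> \<kappa>) x = (if \<kappa> = (\<lambda>_. 0) then pseries c x else 0)" for \<kappa> by simp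
  then show "formal_int \<phi> \<kappa> x = logpoly_of (pseries c) \<kappa> x"
    by (simp add: formal_int_def logpoly_of_def gd)
qed

lemma poly_growth_has_coefs: "has_coefs \<phi> c \<Longrightarrow> poly_growth c"
  using poly_growth_coef[of \<phi> "\<lambda>_. 0"] by (simp add: has_coefs_def)

end

lemma geom_opt_0: "geom_opt m (\<lambda>e. 0 :: complex) e = 0"
  by (simp add: geom_opt_def geom_by_def shift_by_def split: option.split)

lemma geom_opt_if: "geom_opt m (\<lambda>e. if P then c e else (0::complex)) e = (if P then geom_opt m c e else 0)"
  by (simp add: geom_opt_0)

lemma sum_reverse_upto:
  fixes F :: "nat \<Rightarrow> complex"
  assumes "n \<le> N"
  shows "(\<Sum>r = 1..N. if r \<le> n then F (n - r) else 0) = (\<Sum>k<n. F k)"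
proof -
  have "(\<Sum>r = 1..N. if r \<le> n then F (n - r) else 0) = (\<Sum>r = 1..n. F (n - r))"
    by (rule sum.mono_neutral_cong_right) (use assms in auto)
  also have "\<dots> = (\<Sum>k<n. F k)"
    by (rule sum.reindex_bij_witness[where i = "\<lambda>k. n - k" and j = "\<lambda>r. n - r"]) auto
  finally show ?thesis .
qed

section \<open>Coefficients of polylogarithms in two variables\<close>

context two_points
begin

text \<open>On coefficients, multiplication by m / (m - 1) is minus a partial sum in the direction
  of m: along a coordinate axis or along the diagonal.\<close>

lemma geom_expo:
  fixes F :: "nat \<Rightarrow> nat \<Rightarrow> complex"
  shows "geom_opt (Some expo1) (\<lambda>e. F (e i1) (e i2)) e = - (\<Sum>k<e i1. F k (e i2))"
    and "geom_opt (Some expo2) (\<lambda>e. F (e i1) (e i2)) e = - (\<Sum>k<e i2. F (e i1) k)"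
    and "geom_opt (Some expo12) (\<lambda>e. if e i1 = e i2 then G (e i1) else 0) e
      = (if e i1 = e i2 then - (\<Sum>k<e i1. G k) else (0::complex))"
proof -
  have le: "e i1 \<le> mdeg e" "e i2 \<le> mdeg e" by (simp_all add: le_mdeg)
  have 1: "(\<lambda>k. r * expo1 k) \<le> e \<longleftrightarrow> r \<le> e i1" "(\<lambda>k. r * expo2 k) \<le> e \<longleftrightarrow> r \<le> e i2"
    "(\<lambda>k. r * expo12 k) \<le> e \<longleftrightarrow> r \<le> e i1 \<and> r \<le> e i2" for r
    unfolding le_fun_def all_n by (simp_all add: expo1_def expo2_def expo12_def neq)
  show "geom_opt (Some expo1) (\<lambda>e. F (e i1) (e i2)) e = - (\<Sum>k<e i1. F k (e i2))"
    using sum_reverse_upto[OF le(1), of "\<lambda>k. F k (e i2)"]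
    by (simp add: geom_opt_def geom_by_def shift_by_def 1) (simp add: expo1_def neq cong: if_cong)
  show "geom_opt (Some expo2) (\<lambda>e. F (e i1) (e i2)) e = - (\<Sum>k<e i2. F (e i1) k)"
    using sum_reverse_upto[OF le(2), of "\<lambda>k. F (e i1) k"]
    by (simp add: geom_opt_def geom_by_def shift_by_def 1) (simp add: expo2_def neq cong: if_cong)
  have "(if r \<le> e i1 \<and> r \<le> e i2 then if e i1 - r = e i2 - r then G (e i1 - r) else 0 else 0)
      = (if e i1 = e i2 then if r \<le> e i1 then G (e i1 - r) else 0 else (0::complex))" for r
    by auto
  moreover have "geom_opt (Some expo12) (\<lambda>e. if e i1 = e i2 then G (e i1) else 0) e
      = - (\<Sum>r = 1..mdeg e. if r \<le> e i1 \<and> r \<le> e i2 then if e i1 - r = e i2 - r then G (e i1 - r) else 0 else 0)"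
    unfolding geom_opt_def geom_by_def shift_by_def option.case 1 by (simp only: expo12_def mult_1_right)
  ultimately have "geom_opt (Some expo12) (\<lambda>e. if e i1 = e i2 then G (e i1) else 0) e
      = - (\<Sum>r = 1..mdeg e. if e i1 = e i2 then if r \<le> e i1 then G (e i1 - r) else 0 else 0)"
    by (simp only:)
  then show "geom_opt (Some expo12) (\<lambda>e. if e i1 = e i2 then G (e i1) else 0) e
      = (if e i1 = e i2 then - (\<Sum>k<e i1. G k) else (0::complex))"
    using sum_reverse_upto[OF le(1), of G] by (cases "e i1 = e i2") simp_all
qed

text \<open>Up to sign the coefficient of x_1^(e i1) x_2^(e i2) in a polylogarithm. As z_1 = x_1
  x_2, the exponent of x_1 is the largest index attached to z_1 and that of x_2 the largest index of
  all; fixing the former decouples the two nested sums.\<close>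

definition carr :: "nat list \<Rightarrow> nat list \<Rightarrow> ('n \<Rightarrow> nat) \<Rightarrow> complex" where
  "carr as bs e = (- 1) ^ (length as + length bs) * (nested as 0 (e i1) * nested bs (e i1) (e i2))"

lemma carr_one_right:
  "of_nat (e i2) * carr as (1 # bs) e = geom_opt (Some expo2) (carr as bs) e"
proof -
  let ?s = "(- 1) ^ (length as + length bs) :: complex"
  have "geom_opt (Some expo2) (carr as bs) e = - (\<Sum>k<e i2. ?s * (nested as 0 (e i1) * nested bs (e i1) k))"
    using geom_expo(2)[of "\<lambda>i j. ?s * (nested as 0 i * nested bs i j)" e] by (simp only: carr_def[abs_def])
  also have "\<dots> = - (?s * (nested as 0 (e i1) * (of_nat (e i2) * nested (1 # bs) (e i1) (e i2))))"
    unfolding nested_one by (simp only: sum_distrib_left)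
  also have "\<dots> = of_nat (e i2) * carr as (1 # bs) e"
    by (simp add: carr_def del: nested.simps(2))
  finally show ?thesis ..
qed

text \<open>With no \<open>D\<close> block the coefficients live on the diagonal
  \<open>e i1 = e i2\<close>, where both Euler equations read alike; the form of x_1 x_2 serves
  both.\<close>

lemma carr_one_both:
  "of_nat (e i1) * carr (1 # as) [] e = geom_opt (Some expo12) (carr as []) e"
  "of_nat (e i2) * carr (1 # as) [] e = geom_opt (Some expo12) (carr as []) e"
proof -
  let ?s = "(- 1) ^ length as :: complex"
  have "carr as [] = (\<lambda>e. if e i1 = e i2 then ?s * nested as 0 (e i1) else 0)"
    by (auto simp: carr_def)
  then have "geom_opt (Some expo12) (carr as []) e = (if e i1 = e i2 then - (\<Sum>k<e i1. ?s * nested as 0 k) else 0)"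
    using geom_expo(3)[of "\<lambda>i. ?s * nested as 0 i" e] by (simp only:)
  also have "(\<Sum>k<e i1. ?s * nested as 0 k) = ?s * (of_nat (e i1) * nested (1 # as) 0 (e i1))"
    unfolding nested_one by (simp only: sum_distrib_left)
  finally have eq: "geom_opt (Some expo12) (carr as []) e
    = (if e i1 = e i2 then - (?s * (of_nat (e i1) * nested (1 # as) 0 (e i1))) else 0)" .
  show "of_nat (e i1) * carr (1 # as) [] e = geom_opt (Some expo12) (carr as []) e"
    "of_nat (e i2) * carr (1 # as) [] e = geom_opt (Some expo12) (carr as []) e"
    unfolding eq by (simp_all add: carr_def del: nested.simps(2) One_nat_def)
qed

lemma carr_junction:
  "of_nat (e i1) * carr (1 # as) (bs @ [b]) e = carr (b # as) bs e
    + geom_opt (Some expo1) (\<lambda>e. carr as (bs @ [b]) e - carr (b # as) bs e) e"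
proof -
  let ?s = "(- 1) ^ (length as + length bs + 1) :: complex"
  let ?H = "nested as 0" and ?N = "\<lambda>k. nested (bs @ [b]) k (e i2)" and ?M = "\<lambda>k. nested (b # as) 0 k * nested bs k (e i2)"
  have eq: "carr as (bs @ [b]) e - carr (b # as) bs e
     = ?s * (nested as 0 (e i1) * nested (bs @ [b]) (e i1) (e i2) - nested (b # as) 0 (e i1) * nested bs (e i1) (e i2))" for e
    by (simp add: carr_def right_diff_distrib del: nested.simps(2))
  have "geom_opt (Some expo1) (\<lambda>e. carr as (bs @ [b]) e - carr (b # as) bs e) e
      = - (\<Sum>k<e i1. ?s * (?H k * ?N k - ?M k))"
    unfolding eq
    using geom_expo(1)[of "\<lambda>i j. ?s * (nested as 0 i * nested (bs @ [b]) i j - nested (b # as) 0 i * nested bs i j)" e] .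
  also have "\<dots> = - (?s * ((\<Sum>k<e i1. ?H k * ?N k) - (\<Sum>k<e i1. ?M k)))"
    by (simp only: sum_distrib_left[symmetric] sum_subtractf)
  also have "(\<Sum>k<e i1. ?H k * ?N k) - (\<Sum>k<e i1. ?M k)
      = of_nat (e i1) * nested (1 # as) 0 (e i1) * ?N (e i1) + ?M (e i1)"
    unfolding nested_one using nested_junction[where as = as and bs = bs and b = b and i = "e i1" and j = "e i2"]
    by (simp only: diff_eq_eq mult.assoc)
  finally show ?thesis
    by (simp add: carr_def algebra_simps del: nested.simps(2))
qed

lemma carr_lower:
  "2 \<le> b \<Longrightarrow> of_nat (e i2) * carr as (b # bs) e = carr as ((b - 1) # bs) e"
  "2 \<le> a \<Longrightarrow> of_nat (e i1) * carr (a # as) bs e = carr ((a - 1) # as) bs e"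
  "2 \<le> a \<Longrightarrow> of_nat (e i2) * carr (a # as) [] e = carr ((a - 1) # as) [] e"
proof -
  show "of_nat (e i2) * carr as (b # bs) e = carr as ((b - 1) # bs) e" if "2 \<le> b"
    unfolding carr_def nested_lower[OF that, symmetric] by simp
  show *: "of_nat (e i1) * carr (a # as) bs e = carr ((a - 1) # as) bs e" if "2 \<le> a" for bs
    unfolding carr_def nested_lower[OF that, symmetric] by simp
  show "of_nat (e i2) * carr (a # as) [] e = carr ((a - 1) # as) [] e" if "2 \<le> a"
    using *[OF that, of "[]"] by (cases "e i1 = e i2") (auto simp: carr_def simp del: nested.simps(2))
qed

text \<open>\<open>XA\<close> annihilates powers of \<open>W\<close>, so
  \<open>init2 \<kappa>\<close> applied to the series \<open>1\<close> is a multiple of a power of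
  \<open>W\<close>, and a nonempty polylogarithm word is none.\<close>

lemma wc_init2:
  assumes "as \<noteq> [] \<or> bs \<noteq> []"
  shows "r5.wc (polylog_word as bs) (init2 \<kappa>) = 0"
proof -
  have W: "app (lmul LW ^ l) (delta []) = delta (replicate l LW)" for l
    by (induction l) (simp_all add: app_lmul_delta)
  have pow: "r5.act (u ^ l) = r5.act u ^ l" for u l
    by (induction l) (simp_all add: r5.act_1 r5.act_mult)
  have com: "der KA * lmul LW = lmul LW * der KA"
    using relations5_endo by (simp add: relations5_def bracket_endo_def)
  have A: "app (der KA) (delta (replicate l LW)) = 0" for l
  proof (induction l)
    case 0
    show ?case by (simp add: app_der_delta_Nil)
  next
    case (Suc l)
    have "app (der KA) (delta (replicate (Suc l) LW)) = app (der KA * lmul LW) (delta (replicate l LW))"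
      by (simp add: app_lmul_delta)
    also have "\<dots> = app (lmul LW) (app (der KA) (delta (replicate l LW)))"
      by (simp add: com)
    finally show ?case unfolding Suc.IH clinear_0[OF clinear_app] .
  qed
  then have "app (der KA ^ Suc k) (delta (replicate l LW)) = 0" for k l
    by (simp add: power_Suc2 clinear_0[OF clinear_app] del: power_Suc)
  then have "app (der KA ^ k) (delta (replicate l LW)) (polylog_word as bs) = 0" for k l
    using polylog_word_ends[OF assms, of l] by (cases k) (auto simp: delta_def)
  then show ?thesis
    by (simp add: r5.wc_def init2_def clinear_scaleC[OF r5.act_linear] r5.act_mult pow r5.act_emb rep5_gens W)
qed

text \<open>Induction on the length of the word. Stripping the first letter gives the contractions
  for the equation in x_2, and the derivations supply the remaining ones for x_1. The contractions
  are zero or combinations of shorter polylogarithm words, so \<open>has_coefsI\<close> applies with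
  the recursions of \<open>carr\<close>.\<close>

theorem has_coefs2:
  assumes "\<forall>a\<in>set (as @ bs). 1 \<le> a"
  shows "two.has_coefs (r5.wc (polylog_word as bs)) (carr as bs)"
  using assms
proof (induction "length (polylog_word as bs)" arbitrary: as bs rule: less_induct)
  case less
  show ?case
  proof (cases "as = [] \<and> bs = []")
    case True
    then show ?thesis
      using two.has_coefs_counit
      by (simp add: polylog_word_def r5.wc_Nil carr_def[abs_def] mdeg_n if_distrib[of "\<lambda>x. x * _"] cong: if_cong)
        (simp add: if_if_eq_conj)
  next
    case False
    let ?w = "polylog_word as bs"
    have pos: "1 \<le> a" if "a \<in> set as \<or> a \<in> set bs" for a using less.prems that by auto
    have IH: "two.has_coefs (r5.wc (polylog_word as' bs')) (carr as' bs')"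
      if "length (polylog_word as' bs') < length ?w" "\<forall>a\<in>set (as' @ bs'). 1 \<le> a" for as' bs'
      using less.hyps that by blast
    have conA: "contract XA (r5.wc ?w) u = der_fun KA ?w (app (r5.act u) (delta []))"
      and conC: "contract XC (r5.wc ?w) u = der_fun KC ?w (app (r5.act u) (delta []))" for u
      by (simp_all add: r5.contract_wc rep5_gens app_der)
    have nil: "contract XA (r5.wc (polylog_word [] bs)) = 0" "contract XC (r5.wc (polylog_word [] bs)) = 0"
      by (auto simp: fun_eq_iff r5.contract_wc rep5_gens app_der der_start)
    have conlow: "contract XA (r5.wc (polylog_word (a # as') bs)) = r5.wc (polylog_word ((a - 1) # as') bs)"
      "contract XC (r5.wc (polylog_word (a # as') bs)) = 0" if "2 \<le> a" for a as'
      using that by (auto simp: fun_eq_iff r5.contract_wc rep5_gens app_der der_KA_lower der_KC_lower r5.wc_def)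
    have conj: "contract XA (r5.wc (polylog_word (1 # as') (bs' @ [b]))) = r5.wc (polylog_word (b # as') bs')"
      "contract XC (r5.wc (polylog_word (1 # as') (bs' @ [b])))
        = r5.wc (polylog_word as' (bs' @ [b])) - r5.wc (polylog_word (b # as') bs')" for as' bs' b
      by (auto simp: fun_eq_iff r5.contract_wc rep5_gens app_der der_KA_junction der_KC_junction r5.wc_def
          simp del: polylog_word_junction One_nat_def)
    have constart: "contract XA (r5.wc (polylog_word (1 # as') [])) = 0" "contract XC (r5.wc (polylog_word (1 # as') [])) = 0" for as'
      by (auto simp: fun_eq_iff r5.contract_wc rep5_gens app_der der_start simp del: One_nat_def)
    note conl = r5.contract_wc_lmul[OF rep5_gens(3)] r5.contract_wc_lmul[OF rep5_gens(4)] r5.contract_wc_lmul[OF rep5_gens(5)]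
    \<comment> \<open>the coefficients of the contractions with \<open>W, D, E\<close>, which strip the first letter\<close>
    have "\<exists>cW cD cE. two.has_coefs (contract XW (r5.wc ?w)) cW \<and> two.has_coefs (contract XD (r5.wc ?w)) cD
        \<and> two.has_coefs (contract XE (r5.wc ?w)) cE \<and> (bs \<noteq> [] \<longrightarrow> cE = (\<lambda>_. 0))
        \<and> (as = [] \<or> bs \<noteq> [] \<or> (\<exists>a as'. as = a # as' \<and> 2 \<le> a) \<longrightarrow> cE = (\<lambda>_. 0))
        \<and> (\<forall>as'. as = 1 # as' \<and> bs = [] \<longrightarrow> cE = carr as' [])
        \<and> (\<forall>e. cW e + geom_opt (Some expo2) cD e + geom_opt (Some expo12) cE e = of_nat (e i2) * carr as bs e)"
    proof (cases bs)
      case (Cons b bs')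
      show ?thesis
      proof (cases "b = 1")
        case True
        have w: "?w = LD # polylog_word as bs'" by (simp add: Cons True polylog_word_def)
        have "two.has_coefs (r5.wc (polylog_word as bs')) (carr as bs')"
          by (rule IH) (use pos Cons w in auto)
        moreover have "geom_opt (Some expo2) (carr as bs') e = of_nat (e i2) * carr as bs e" for e
          unfolding Cons True carr_one_right ..
        ultimately show ?thesis
          unfolding w conl using two.has_coefs_0
          by (intro exI[of _ "\<lambda>_. 0"] exI[of _ "carr as bs'"]) (auto simp: geom_opt_0 Cons)
      next
        case False
        then have b: "2 \<le> b" using pos[of b] Cons by simp
        then obtain n where n: "b - 1 = Suc n" by (cases "b - 1") auto
        have w: "?w = LW # polylog_word as ((b - 1) # bs')" using n by (simp add: Cons polylog_word_def)
        have "two.has_coefs (r5.wc (polylog_word as ((b - 1) # bs'))) (carr as ((b - 1) # bs'))"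
          by (rule IH) (use pos Cons w b in auto)
        moreover have "carr as ((b - 1) # bs') e = of_nat (e i2) * carr as bs e" for e
          unfolding Cons carr_lower(1)[OF b] ..
        ultimately show ?thesis
          unfolding w conl using two.has_coefs_0
          by (intro exI[of _ "carr as ((b - 1) # bs')"] exI[of _ "\<lambda>_. 0"]) (auto simp: geom_opt_0 Cons)
      qed
    next
      case Nil
      then obtain a as' where as: "as = a # as'" using False by (cases as) auto
      show ?thesis
      proof (cases "a = 1")
        case True
        have w: "?w = LE # polylog_word as' []" by (simp add: as Nil True polylog_word_def)
        have "two.has_coefs (r5.wc (polylog_word as' [])) (carr as' [])"
          by (rule IH) (use pos as w in auto)
        moreover have "geom_opt (Some expo12) (carr as' []) e = of_nat (e i2) * carr as bs e" for e
          unfolding as True Nil carr_one_both(2) ..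
        ultimately show ?thesis
          unfolding w conl using two.has_coefs_0
          by (intro exI[of _ "\<lambda>_. 0"] exI[of _ "carr as' []"]) (auto simp: geom_opt_0 Nil as True)
      next
        case False
        then have a: "2 \<le> a" using pos[of a] as by simp
        then obtain n where n: "a - 1 = Suc n" by (cases "a - 1") auto
        have w: "?w = LW # polylog_word ((a - 1) # as') []" using n by (simp add: as Nil polylog_word_def)
        have "two.has_coefs (r5.wc (polylog_word ((a - 1) # as') [])) (carr ((a - 1) # as') [])"
          by (rule IH) (use pos as w a in auto)
        moreover have "carr ((a - 1) # as') [] e = of_nat (e i2) * carr as bs e" for e
          unfolding as Nil carr_lower(3)[OF a] ..
        ultimately show ?thesis
          unfolding w conl using two.has_coefs_0
          by (intro exI[of _ "carr ((a - 1) # as') []"] exI[of _ "\<lambda>_. 0"]) (use False in \<open>auto simp: geom_opt_0 Nil as\<close>)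
      qed
    qed
    then obtain cW cD cE where c: "two.has_coefs (contract XW (r5.wc ?w)) cW" "two.has_coefs (contract XD (r5.wc ?w)) cD"
      "two.has_coefs (contract XE (r5.wc ?w)) cE" and cE0: "bs \<noteq> [] \<Longrightarrow> cE = (\<lambda>_. 0)"
      "as = [] \<or> (\<exists>a as'. as = a # as' \<and> 2 \<le> a) \<Longrightarrow> cE = (\<lambda>_. 0)" "\<And>as'. as = 1 # as' \<Longrightarrow> bs = [] \<Longrightarrow> cE = carr as' []"
      and e2: "cW e + geom_opt (Some expo2) cD e + geom_opt (Some expo12) cE e = of_nat (e i2) * carr as bs e" for e
      by blast
    \<comment> \<open>The equation in x_1 reuses \<open>cE\<close>, because the form of
      \<open>XE\<close> occurs in both components. The cases: no \<open>E\<close> block, a first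
      \<open>E\<close> block of exponent at least 2, and exponent 1 at the start of the word or
      after a \<open>D\<close> block.\<close>
    have "\<exists>cA cC. two.has_coefs (contract XA (r5.wc ?w)) cA \<and> two.has_coefs (contract XC (r5.wc ?w)) cC
        \<and> (\<forall>e. cA e + geom_opt (Some expo1) cC e + geom_opt (Some expo12) cE e = of_nat (e i1) * carr as bs e)"
    proof (cases as)
      case Nil
      then show ?thesis
        using two.has_coefs_0 nil cE0(2) by (intro exI[of _ "\<lambda>_. 0"]) (auto simp: geom_opt_0 carr_def)
    next
      case (Cons a as')
      show ?thesis
      proof (cases "a = 1")
        case False
        then have a: "2 \<le> a" using pos[of a] Cons by simp
        have "length (polylog_word ((a - 1) # as') bs) < length ?w" using a by (simp add: Cons polylog_word_def)
        then have "two.has_coefs (r5.wc (polylog_word ((a - 1) # as') bs)) (carr ((a - 1) # as') bs)"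
          by (rule IH) (use pos Cons a in auto)
        moreover have "carr ((a - 1) # as') bs e = of_nat (e i1) * carr as bs e" for e
          unfolding Cons carr_lower(2)[OF a] ..
        ultimately show ?thesis
          using two.has_coefs_0 conlow[OF a, of as'] cE0(2) Cons a
          by (intro exI[of _ "carr ((a - 1) # as') bs"] exI[of _ "\<lambda>_. 0"]) (auto simp: geom_opt_0)
      next
        case True
        show ?thesis
        proof (cases bs rule: rev_cases)
          case Nil
          have "geom_opt (Some expo12) cE e = of_nat (e i1) * carr as bs e" for e
            using cE0(3)[of as'] Cons True Nil carr_one_both(1)[of e as'] by simp
          then show ?thesis
            using two.has_coefs_0 constart[of as'] Cons True Nil
            by (intro exI[of _ "\<lambda>_. 0"]) (auto simp: geom_opt_0)
        next
          case (snoc bs' b)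
          have IH1: "two.has_coefs (r5.wc (polylog_word (b # as') bs')) (carr (b # as') bs')"
            by (rule IH) (use pos Cons True snoc in \<open>auto simp: polylog_word_def\<close>)
          have IH2: "two.has_coefs (r5.wc (polylog_word as' bs)) (carr as' bs)"
            by (rule IH) (use pos Cons True in \<open>auto simp: polylog_word_def\<close>)
          have "carr (b # as') bs' e + geom_opt (Some expo1) (\<lambda>e. carr as' bs e - carr (b # as') bs' e) e
            = of_nat (e i1) * carr as bs e" for e
            unfolding Cons True snoc carr_junction ..
          then show ?thesis
            using IH1 two.has_coefs_diff[OF IH2 IH1] conj[of as' bs' b] Cons True snoc cE0(1)
            by (intro exI[of _ "carr (b # as') bs'"] exI[of _ "\<lambda>e. carr as' bs e - carr (b # as') bs' e"])
              (auto simp: geom_opt_0)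
        qed
      qed
    qed
    then obtain cA cC where cA: "two.has_coefs (contract XA (r5.wc ?w)) cA" "two.has_coefs (contract XC (r5.wc ?w)) cC"
      and e1: "cA e + geom_opt (Some expo1) cC e + geom_opt (Some expo12) cE e = of_nat (e i1) * carr as bs e" for e
      by blast
    show ?thesis
    proof (rule two.has_coefsI[OF r5.wc_homogeneous wc_init2])
      show "as \<noteq> [] \<or> bs \<noteq> []" using False by blast
      show "carr as bs (\<lambda>_. 0) = 0" using False by (auto simp: carr_def nested_0)
      fix k and \<kappa> e :: "'n \<Rightarrow> nat"
      have co: "two.coef (contract XA (r5.wc ?w)) \<kappa> = (\<lambda>e. if \<kappa> = (\<lambda>_. 0) then cA e else 0)"
        "two.coef (contract XC (r5.wc ?w)) \<kappa> = (\<lambda>e. if \<kappa> = (\<lambda>_. 0) then cC e else 0)"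
        "two.coef (contract XW (r5.wc ?w)) \<kappa> = (\<lambda>e. if \<kappa> = (\<lambda>_. 0) then cW e else 0)"
        "two.coef (contract XD (r5.wc ?w)) \<kappa> = (\<lambda>e. if \<kappa> = (\<lambda>_. 0) then cD e else 0)"
        "two.coef (contract XE (r5.wc ?w)) \<kappa> = (\<lambda>e. if \<kappa> = (\<lambda>_. 0) then cE e else 0)"
        for \<kappa>
        using c cA by (simp_all add: two.has_coefs_def)
      have none: "geom_opt None c = c" for c :: "('n \<Rightarrow> nat) \<Rightarrow> complex" by (simp add: geom_opt_def)
      show "(\<Sum>(x, m)\<leftarrow>letters2 k. geom_opt m (two.coef (contract x (r5.wc ?w)) \<kappa>) e)
        = (if \<kappa> = (\<lambda>_. 0) then of_nat (e k) * carr as bs e else 0)"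
        using n_cases[of k] e1[of e] e2[of e]
        by (auto simp: letters2_def co geom_opt_if geom_opt_0 none neq add.assoc)
    qed
  qed
qed

end


section \<open>Coefficients of polylogarithms in one variable\<close>

context one_point
begin

lemma mdeg_n: "mdeg e = e i0"
  by (simp add: mdeg_def UNIV_n)

lemma geom_expo:
  fixes F :: "nat \<Rightarrow> complex"
  shows "geom_opt (Some expo) (\<lambda>e. F (e i0)) e = - (\<Sum>k<e i0. F k)"
proof -
  have 1: "(\<lambda>k. r * expo k) \<le> e \<longleftrightarrow> r \<le> e i0" for r
    unfolding le_fun_def using n_eq by (metis expo_def mult_1_right)
  show ?thesis
    unfolding geom_opt_def geom_by_def shift_by_def option.case 1
    using sum_reverse_upto[of "e i0" "mdeg e" F] by (simp add: expo_def mdeg_n)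
qed

definition carr :: "nat list \<Rightarrow> ('n \<Rightarrow> nat) \<Rightarrow> complex" where
  "carr as e = (- 1) ^ length as * nested as 0 (e i0)"

lemma wc_init1:
  assumes "as \<noteq> []"
  shows "r4.wc (block_word LD as) (init1 \<kappa>) = 0"
proof -
  have W: "app (lmul LW ^ l) (delta []) = delta (replicate l LW)" for l
    by (induction l) (simp_all add: app_lmul_delta)
  have pow: "r4.act (u ^ l) = r4.act u ^ l" for u l
    by (induction l) (simp_all add: r4.act_1 r4.act_mult)
  have "block_word LD as \<noteq> replicate l LW" for l
    using polylog_word_ends[of "[]" as l] assms by (simp add: polylog_word_def)
  then have "app (lmul LW ^ l) (delta []) (block_word LD as) = 0" for l
    unfolding W by (simp add: delta_def)
  then show ?thesis
    by (simp add: r4.wc_def init1_def clinear_scaleC[OF r4.act_linear] pow r4.act_emb rep4_gens)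
qed

theorem has_coefs1:
  assumes "\<forall>a\<in>set as. 1 \<le> a"
  shows "one.has_coefs (r4.wc (block_word LD as)) (carr as)"
  using assms
proof (induction "length (block_word LD as)" arbitrary: as rule: less_induct)
  case less
  show ?case
  proof (cases as)
    case Nil
    then show ?thesis
      using one.has_coefs_counit
      by (simp add: r4.wc_Nil carr_def[abs_def] mdeg_n eq_commute[of 0] cong: if_cong)
  next
    case as: (Cons a as')
    let ?w = "block_word LD as"
    note conl = r4.contract_wc_lmul[OF rep4_gens(1)] r4.contract_wc_lmul[OF rep4_gens(2)]
    have "\<exists>cW cD. one.has_coefs (contract YW (r4.wc ?w)) cW \<and> one.has_coefs (contract YD (r4.wc ?w)) cD
        \<and> (\<forall>e. cW e + geom_opt (Some expo) cD e = of_nat (e i0) * carr as e)"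
    proof (cases "a = 1")
      case True
      have w: "?w = LD # block_word LD as'" by (simp add: as True)
      have "one.has_coefs (r4.wc (block_word LD as')) (carr as')"
        by (rule less.hyps) (use less.prems as w in auto)
      moreover have "geom_opt (Some expo) (carr as') e = of_nat (e i0) * carr as e" for e
      proof -
        have "geom_opt (Some expo) (carr as') e = - (\<Sum>k<e i0. (- 1) ^ length as' * nested as' 0 k)"
          using geom_expo[of "\<lambda>i. (- 1) ^ length as' * nested as' 0 i" e] by (simp only: carr_def[abs_def])
        also have "(\<Sum>k<e i0. (- 1) ^ length as' * nested as' 0 k)
            = (- 1) ^ length as' * (of_nat (e i0) * nested (1 # as') 0 (e i0))"
          unfolding nested_one by (simp only: sum_distrib_left)
        finally have eq: "geom_opt (Some expo) (carr as') e
          = - ((- 1) ^ length as' * (of_nat (e i0) * nested (1 # as') 0 (e i0)))" .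
        show ?thesis unfolding eq by (simp add: carr_def as True del: nested.simps(2))
      qed
      ultimately show ?thesis
        unfolding w conl using one.has_coefs_0
        by (intro exI[of _ "\<lambda>_. 0"] exI[of _ "carr as'"]) auto
    next
      case False
      then have a: "2 \<le> a" using less.prems as by auto
      then obtain n where n: "a - 1 = Suc n" by (cases "a - 1") auto
      have w: "?w = LW # block_word LD ((a - 1) # as')" using n by (simp add: as)
      have "one.has_coefs (r4.wc (block_word LD ((a - 1) # as'))) (carr ((a - 1) # as'))"
        by (rule less.hyps) (use less.prems as w a in auto)
      moreover have "carr ((a - 1) # as') e = of_nat (e i0) * carr as e" for e
        unfolding as carr_def nested_lower[OF a, symmetric] by simp
      ultimately show ?thesis
        unfolding w conl using one.has_coefs_0
        by (intro exI[of _ "carr ((a - 1) # as')"] exI[of _ "\<lambda>_. 0"]) (auto simp: geom_opt_0)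
    qed
    then obtain cW cD where c: "one.has_coefs (contract YW (r4.wc ?w)) cW" "one.has_coefs (contract YD (r4.wc ?w)) cD"
      and e: "cW e + geom_opt (Some expo) cD e = of_nat (e i0) * carr as e" for e
      by blast
    show ?thesis
    proof (rule one.has_coefsI[OF r4.wc_homogeneous wc_init1])
      show "as \<noteq> []" using as by simp
      show "carr as (\<lambda>_. 0) = 0" using as by (auto simp: carr_def nested_0)
      fix k and \<kappa> e :: "'n \<Rightarrow> nat"
      have co: "one.coef (contract YW (r4.wc ?w)) \<kappa> = (\<lambda>e. if \<kappa> = (\<lambda>_. 0) then cW e else 0)"
        "one.coef (contract YD (r4.wc ?w)) \<kappa> = (\<lambda>e. if \<kappa> = (\<lambda>_. 0) then cD e else 0)"
        for \<kappa>
        using c by (simp_all add: one.has_coefs_def)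
      have none: "geom_opt None c = c" for c :: "('n \<Rightarrow> nat) \<Rightarrow> complex" by (simp add: geom_opt_def)
      show "(\<Sum>(x, m)\<leftarrow>letters1 k. geom_opt m (one.coef (contract x (r4.wc ?w)) \<kappa>) e)
        = (if \<kappa> = (\<lambda>_. 0) then of_nat (e k) * carr as e else 0)"
        using n_eq[of k] e[of e]
        by (auto simp: letters1_def co geom_opt_if geom_opt_0 none)
    qed
  qed
qed

end

section \<open>Polylogarithms as power series\<close>

text \<open>The weights are nonnegative, so at the point of absolute values the slices are the sums
  of norms; their summability there gives absolute summability at \<open>x\<close>, which permits
  grouping by degree.\<close>

lemma infsum_group_by_exponent:
  fixes wt :: "'k \<Rightarrow> real" and ex :: "'k \<Rightarrow> 'n::finite \<Rightarrow> nat"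
  assumes nonneg: "\<And>k. k \<in> X \<Longrightarrow> 0 \<le> wt k" and fin: "\<And>e. finite {k\<in>X. ex k = e}"
    and C: "\<And>e. C e = (\<Sum>k | k \<in> X \<and> ex k = e. complex_of_real (wt k))"
    and growth: "poly_growth C" and x: "x \<in> polydisc"
  shows "(\<Sum>\<^sub>\<infinity>k\<in>X. complex_of_real (wt k) * monom_at x (ex k)) = pseries C x"
proof -
  define F where "F y k = complex_of_real (wt k) * monom_at y (ex k)" for y k
  define B where "B d = {k\<in>X. mdeg (ex k) = d}" for d
  have B: "B d = (\<Union>e\<in>{e. mdeg e = d}. {k\<in>X. ex k = e})" for d by (auto simp: B_def)
  have finB: "finite (B d)" for d unfolding B by (rule finite_UN_I[OF finite_degree_slice fin])
  have sumB: "sum (F y) (B d) = slice C d y" for y d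
  proof -
    have "sum (F y) (B d) = (\<Sum>e | mdeg e = d. \<Sum>k | k \<in> B d \<and> ex k = e. F y k)"
      by (rule sum.group[symmetric]) (auto simp: finB, auto simp: B_def)
    also have "\<dots> = slice C d y"
      unfolding slice_def C sum_distrib_right
      by (intro sum.cong) (auto simp: F_def B_def)
    finally show ?thesis .
  qed
  define y :: "complex ^ 'n" where "y = (\<chi> i. complex_of_real (norm (x $ i)))"
  have y: "y \<in> polydisc" using x by (simp add: polydisc_def y_def)
  have normF: "complex_of_real (norm (F x k)) = F y k" if "k \<in> X" for k
    using nonneg[OF that] by (simp add: F_def norm_mult monom_at_def prod_norm[symmetric] norm_power y_def)
  have "(\<Sum>k\<in>B d. norm (F x k)) = norm (slice C d y)" for d
  proof -
    have "complex_of_real (\<Sum>k\<in>B d. norm (F x k)) = slice C d y"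
      unfolding sumB[symmetric] of_real_sum by (rule sum.cong) (auto simp: normF B_def)
    then have "norm (slice C d y) = norm (complex_of_real (\<Sum>k\<in>B d. norm (F x k)))" by simp
    then show ?thesis by (simp only: norm_of_real) (simp add: sum_nonneg)
  qed
  then have outer: "(\<lambda>d. norm (infsum (\<lambda>k. norm (F x k)) (B d))) summable_on UNIV"
    using summable_slice_norm[OF growth y] by (simp add: finB norm_summable_imp_summable_on)
  have "(\<lambda>z. norm (case z of (d, k) \<Rightarrow> F x k)) summable_on (SIGMA d:UNIV. B d)"
    by (rule Infinite_Sum.abs_summable_on_Sigma_iff[THEN iffD2])
      (use outer finB in \<open>auto simp: summable_on_finite\<close>)
  then have summ: "(\<lambda>(d, k). F x k) summable_on (SIGMA d:UNIV. B d)" by (rule abs_summable_summable)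
  have bij: "bij_betw snd (SIGMA d:UNIV. B d) X"
    by (rule bij_betw_byWitness[where f' = "\<lambda>k. (mdeg (ex k), k)"]) (auto simp: B_def)
  have eq: "(\<lambda>z. F x (snd z)) = (\<lambda>(d, k). F x k)" by auto
  have "(\<Sum>\<^sub>\<infinity>k\<in>X. F x k) = infsum (\<lambda>(d, k). F x k) (SIGMA d:UNIV. B d)"
    using infsum_reindex_bij_betw[OF bij, of "F x"] unfolding eq by simp
  also have "\<dots> = (\<Sum>\<^sub>\<infinity>d. infsum (F x) (B d))"
    by (rule infsum_Sigma'_banach[OF summ, symmetric])
  also have "\<dots> = (\<Sum>\<^sub>\<infinity>d. slice C d x)" by (simp add: finB sumB)
  also have "\<dots> = (\<Sum>d. slice C d x)"
    using has_sum_imp_sums[OF has_sum_infsum[OF norm_summable_imp_summable_on[OF summable_slice_norm[OF growth x]]]]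
    by (simp add: sums_iff)
  finally show ?thesis by (simp add: F_def pseries_def)
qed

text \<open>Strictly decreasing lists from \<open>j\<close> that stay above \<open>i\<close>. The
  appended \<open>i\<close> covers the empty list, where it forces \<open>i = j\<close>.\<close>

definition chains :: "nat \<Rightarrow> nat \<Rightarrow> nat \<Rightarrow> nat list set" where
  "chains q i j = {ks. length ks = q \<and> sorted_wrt (>) (ks @ [i]) \<and> (ks @ [i]) ! 0 = j}"

lemma chains_0: "chains 0 i j = (if i = j then {[]} else {})"
  by (auto simp: chains_def)

lemma chains_Suc: "chains (Suc q) i j = (\<Union>k<j. (#) j ` chains q i k)"
proof -
  have "ks \<in> chains (Suc q) i j \<longleftrightarrow> (\<exists>k<j. \<exists>l\<in>chains q i k. ks = j # l)" for ks
  proof (cases ks)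
    case (Cons a l)
    have "(\<forall>y\<in>set l \<union> {i}. y < a) \<longleftrightarrow> (l @ [i]) ! 0 < a" if "sorted_wrt (>) (l @ [i])"
      using that by (cases l) auto
    then show ?thesis by (auto simp: chains_def Cons)
  qed (auto simp: chains_def)
  then show ?thesis by blast
qed

lemma finite_chains: "finite (chains q i j)"
  by (induction q arbitrary: j) (simp_all add: chains_0 chains_Suc)

primrec chain_weight :: "nat list \<Rightarrow> nat list \<Rightarrow> real" where
  "chain_weight [] ks = 1"
| "chain_weight (b # bs) ks = chain_weight bs (tl ks) / real (hd ks) ^ b"

lemma chain_weight_nonneg: "0 \<le> chain_weight bs ks"
  by (induction bs arbitrary: ks) simp_all

lemma chain_weight_append:
  "length ks = length bs \<Longrightarrow> chain_weight (bs @ as) (ks @ ls) = chain_weight bs ks * chain_weight as ls"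
  by (induction ks bs rule: list_induct2) simp_all

lemma chain_weight_prod:
  "length ks = length bs \<Longrightarrow> chain_weight bs ks = (\<Prod>i<length bs. 1 / real (ks ! i) ^ (bs ! i))"
  by (induction ks bs rule: list_induct2) (simp_all add: prod.lessThan_Suc_shift del: prod.lessThan_Suc)

lemma nested_chains: "nested bs i j = (\<Sum>ks\<in>chains (length bs) i j. complex_of_real (chain_weight bs ks))"
proof (induction bs arbitrary: j)
  case (Cons b bs)
  have "(\<Sum>ks\<in>chains (Suc (length bs)) i j. complex_of_real (chain_weight (b # bs) ks))
     = (\<Sum>k<j. \<Sum>ks\<in>(#) j ` chains (length bs) i k. complex_of_real (chain_weight (b # bs) ks))"
    unfolding chains_Suc by (rule sum.UNION_disjoint) (auto simp: finite_chains, auto simp: chains_def)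
  also have "\<dots> = (\<Sum>k<j. \<Sum>ks\<in>chains (length bs) i k. complex_of_real (chain_weight bs ks) / of_nat j ^ b)"
    by (simp add: sum.reindex)
  finally show ?case by (simp add: Cons.IH sum_divide_distrib)
qed (simp add: chains_0)

text \<open>Once the entry at the cut is fixed the two parts vary independently; in the
  polylogarithm this entry is the exponent of x_1.\<close>

lemma chains_split:
  "bij_betw (\<lambda>(ks, ls). ks @ ls) (chains q i j \<times> chains p 0 i)
    {L. length L = q + p \<and> sorted_wrt (>) (L @ [0]) \<and> (L @ [0]) ! q = i \<and> (L @ [0]) ! 0 = j}"
proof (rule bij_betw_byWitness[where f' = "\<lambda>L. (take q L, drop q L)"])
  let ?T = "{L. length L = q + p \<and> sorted_wrt (>) (L @ [0]) \<and> (L @ [0]) ! q = i \<and> (L @ [0]) ! 0 = j}"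
  show "\<forall>a\<in>chains q i j \<times> chains p 0 i. (\<lambda>L. (take q L, drop q L)) ((\<lambda>(ks, ls). ks @ ls) a) = a"
    by (auto simp: chains_def)
  show "\<forall>L\<in>?T. (\<lambda>(ks, ls). ks @ ls) (take q L, drop q L) = L" by auto
  show "(\<lambda>(ks, ls). ks @ ls) ` (chains q i j \<times> chains p 0 i) \<subseteq> ?T"
  proof clarify
    fix ks ls assume *: "ks \<in> chains q i j" "ls \<in> chains p 0 i"
    then have ks: "length ks = q" "sorted_wrt (>) (ks @ [i])" "(ks @ [i]) ! 0 = j"
      and ls: "length ls = p" "sorted_wrt (>) (ls @ [0])" "(ls @ [0]) ! 0 = i"
      by (simp_all add: chains_def)
    have "\<forall>y\<in>set (ls @ [0]). y \<le> i"
      using ls by (cases ls) auto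
    then have "sorted_wrt (>) (ks @ ls @ [0])"
      using ks(2) ls(2) by (auto simp: sorted_wrt_append) (metis le_less_trans)
    moreover have "((ks @ ls) @ [0]) ! q = i" using ks(1) ls(3) by (simp add: nth_append)
    moreover have "((ks @ ls) @ [0]) ! 0 = j" using ks(3) ls(3) by (cases ks) auto
    ultimately show "length (ks @ ls) = q + p \<and> sorted_wrt (>) ((ks @ ls) @ [0])
        \<and> ((ks @ ls) @ [0]) ! q = i \<and> ((ks @ ls) @ [0]) ! 0 = j"
      using ks(1) ls(1) by simp
  qed
  show "(\<lambda>L. (take q L, drop q L)) ` ?T \<subseteq> chains q i j \<times> chains p 0 i"
  proof clarify
    fix L :: "nat list" assume L: "length L = q + p" "sorted_wrt (>) (L @ [0])"
    define ks ls where "ks = take q L" and "ls = drop q L"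
    have len: "length ks = q" "length ls = p" and L': "L = ks @ ls" using L(1) by (simp_all add: ks_def ls_def)
    have q: "(L @ [0]) ! q = (ls @ [0]) ! 0" unfolding L' by (simp add: nth_append len)
    have "(ls @ [0]) ! 0 \<in> set (ls @ [0])" by (rule nth_mem) simp
    then have "sorted_wrt (>) (ks @ [(ls @ [0]) ! 0])" "sorted_wrt (>) (ls @ [0])"
      using L(2) unfolding L' append_assoc sorted_wrt_append[of _ ks] by (auto simp: sorted_wrt_append)
    moreover have "(ks @ [(ls @ [0]) ! 0]) ! 0 = (L @ [0]) ! 0" unfolding L' by (cases ks) auto
    ultimately show "take q L \<in> chains q ((L @ [0]) ! q) ((L @ [0]) ! 0) \<and> drop q L \<in> chains p 0 ((L @ [0]) ! q)"
      unfolding q by (simp add: chains_def len ks_def[symmetric] ls_def[symmetric])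
  qed
qed

lemma sorted_wrt_rev_less: "sorted_wrt (<) (rev L) \<and> (\<forall>k\<in>set L. 0 < k) \<longleftrightarrow> sorted_wrt (>) (L @ [0 :: nat])"
  by (auto simp: sorted_wrt_rev sorted_wrt_append)

text \<open>Lists run from the last index to the first, opposite to \<open>polylog\<close>; reversal
  turns increasing positive lists into lists decreasing to an appended 0.\<close>

lemma polylog_eq_pseries:
  fixes \<kappa> :: "'n::{finite,linorder} list"
  assumes len: "length \<kappa> = length cs"
    and y: "\<And>L. length L = length cs \<Longrightarrow> (\<Prod>i<length cs. y_ratio \<kappa> (length cs - 1 - i) x ^ (L ! i)) = monom_at x (ex L)"
    and fin: "\<And>e. finite {L. length L = length cs \<and> sorted_wrt (>) (L @ [0]) \<and> ex L = e}"
    and C: "\<And>e. C e = (\<Sum>L | length L = length cs \<and> sorted_wrt (>) (L @ [0]) \<and> ex L = e. complex_of_real (chain_weight cs L))"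
    and growth: "poly_growth C" and x: "x \<in> polydisc"
  shows "polylog (rev cs) \<kappa> x = pseries C x"
proof -
  define X where "X = {L. length L = length cs \<and> sorted_wrt (>) (L @ [0 :: nat])}"
  let ?X0 = "{ks. length ks = length (rev cs) \<and> sorted_wrt (<) ks \<and> (\<forall>k\<in>set ks. 0 < k)}"
  let ?t = "\<lambda>ks. \<Prod>i<length (rev cs). y_ratio \<kappa> i x ^ (ks ! i) / of_nat (ks ! i) ^ (rev cs ! i)"
  have bij: "bij_betw rev X ?X0"
    by (rule bij_betw_byWitness[where f' = rev]) (auto simp: X_def sorted_wrt_rev_less[symmetric])
  have t: "?t (rev L) = complex_of_real (chain_weight cs L) * monom_at x (ex L)" if "L \<in> X" for L
  proof -
    have L: "length L = length cs" using that by (simp add: X_def)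
    have "?t (rev L) = (\<Prod>i<length cs. y_ratio \<kappa> (length cs - 1 - i) x ^ (L ! i) * (1 / of_nat (L ! i) ^ (cs ! i)))"
      by (rule prod.reindex_bij_witness[where i = "\<lambda>i. length cs - 1 - i" and j = "\<lambda>i. length cs - 1 - i"])
        (auto simp: rev_nth L)
    also have "\<dots> = monom_at x (ex L) * complex_of_real (chain_weight cs L)"
      unfolding prod.distrib y[OF L] chain_weight_prod[OF L] by simp
    finally show ?thesis by (simp only: mult.commute)
  qed
  have "polylog (rev cs) \<kappa> x = (\<Sum>\<^sub>\<infinity>L\<in>X. ?t (rev L))"
    unfolding polylog_def by (rule infsum_reindex_bij_betw[OF bij, symmetric])
  also have "\<dots> = (\<Sum>\<^sub>\<infinity>L\<in>X. complex_of_real (chain_weight cs L) * monom_at x (ex L))"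
    by (rule infsum_cong) (rule t)
  also have "\<dots> = pseries C x"
    by (rule infsum_group_by_exponent) (use fin C growth x in \<open>auto simp: X_def chain_weight_nonneg conj_assoc\<close>)
  finally show ?thesis .
qed

context connection
begin

lemma formal_polylog_eqI:
  fixes \<kappa> :: "'m::{finite,linorder} list"
  assumes iter: "(iter_int :: ('m pt braid_lie env \<Rightarrow> complex) \<Rightarrow> _) = I"
    and diff: "\<And>\<phi> \<psi>. \<phi> \<in> graded_dual \<Longrightarrow> \<psi> \<in> graded_dual \<Longrightarrow> I \<phi> = I \<psi> \<Longrightarrow> \<phi> = \<psi>"
    and "\<phi> \<in> graded_dual" "I \<phi> = logpoly_of f" and "\<And>x. x \<in> polydisc \<Longrightarrow> polylog a \<kappa> x = f x"
  shows "formal_polylog a \<kappa> = \<phi>"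
proof -
  have "logpoly_of (polylog a \<kappa>) = logpoly_of f"
    using assms(5) by (auto simp: logpoly_of_def fun_eq_iff)
  then show ?thesis
    unfolding formal_polylog_def iter using assms(2-4) by (intro the_equality) auto
qed

lemma formal_int_eqD:
  assumes inj: "\<And>\<phi>. \<phi> \<in> graded_dual \<Longrightarrow> formal_int \<phi> = 0 \<Longrightarrow> \<phi> = 0"
    and "\<phi> \<in> graded_dual" "\<psi> \<in> graded_dual" "formal_int \<phi> = formal_int \<psi>"
  shows "\<phi> = \<psi>"
proof -
  have "formal_int (\<phi> + (- 1) *\<^sub>C \<psi>) = formal_int \<phi> + (- 1) *\<^sub>C formal_int \<psi>"
    by (simp only: formal_int_add formal_int_scaleC graded_dual_scaleC assms(2,3))
  also have "\<dots> = 0" unfolding assms(4) minus_one_scaleC by (rule right_minus)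
  finally have "\<phi> + (- 1) *\<^sub>C \<psi> = 0"
    by (rule inj[rotated]) (intro graded_dual_add graded_dual_scaleC assms)
  then have "\<phi> - \<psi> = 0" by (simp only: minus_one_scaleC diff_conv_add_uminus)
  then show ?thesis by (simp only: right_minus_eq)
qed

end

lemma mem_k_space:
  "x \<in> k_space \<longleftrightarrow> (\<forall>a \<kappa>. polylog_index a \<kappa> \<longrightarrow> formal_polylog a \<kappa> (emb x) = 0)"
proof
  assume "x \<in> k_space"
  then show "\<forall>a \<kappa>. polylog_index a \<kappa> \<longrightarrow> formal_polylog a \<kappa> (emb x) = 0"
    unfolding k_space_def polylog_perp_def polylog_space_def by (auto intro: cvec.span_base)
next
  assume *: "\<forall>a \<kappa>. polylog_index a \<kappa> \<longrightarrow> formal_polylog a \<kappa> (emb x) = 0"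
  have "polylog_space \<subseteq> {l. l (emb x) = 0}"
    unfolding polylog_space_def
    by (rule cvec.span_minimal) (use * in \<open>auto simp: cvec.subspace_def scaleC_fun_def scaleC_complex_def\<close>)
  then show "x \<in> k_space" by (auto simp: k_space_def polylog_perp_def)
qed

lemma sorted_two_values:
  assumes "sorted \<kappa>" "set \<kappa> \<subseteq> {i, j}" "i < j"
  shows "\<exists>p q. \<kappa> = replicate p i @ replicate q j"
  using assms(1,2)
proof (induction \<kappa>)
  case (Cons k \<kappa>)
  then obtain p q where pq: "\<kappa> = replicate p i @ replicate q j" by auto
  show ?case
  proof (cases "k = i")
    case True
    then show ?thesis using pq by (intro exI[of _ "Suc p"] exI[of _ q]) simp
  next
    case False
    then have "k = j" "p = 0" using Cons.prems assms(3) pq by (auto simp: set_replicate_conv_if split: if_splits)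
    then show ?thesis using pq by (intro exI[of _ 0] exI[of _ "Suc q"]) simp
  qed
qed simp

lemma append_of_lengths: "length cs = q + p \<Longrightarrow> \<exists>bs as. cs = bs @ as \<and> length bs = q \<and> length as = p"
  by (intro exI[of _ "take q cs"] exI[of _ "drop q cs"]) auto

section \<open>Formal polylogarithms as word functionals in two variables\<close>

context two_points
begin

lemma polylog_pseries2:
  assumes pos: "\<forall>a\<in>set (as @ bs). 1 \<le> a" and x: "x \<in> polydisc"
  shows "polylog (rev (bs @ as)) (replicate (length as) i1 @ replicate (length bs) i2) x
    = pseries (\<lambda>e. (- 1) ^ (length as + length bs) * carr as bs e) x"
proof -
  let ?p = "length as" and ?q = "length bs"
  let ?\<kappa> = "replicate ?p i1 @ replicate ?q i2"
  \<comment> \<open>The entry after the \<open>bs\<close> block is the largest index attached to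
    \<open>i1\<close>, the first entry the largest of all. The appended 0 is the exponent when the
    respective list is empty.\<close>
  define ex where "ex L = (\<lambda>k. (L @ [0]) ! (if k = i1 then ?q else 0))" for L :: "nat list"
  have ex: "ex L = e \<longleftrightarrow> (L @ [0]) ! ?q = e i1 \<and> (L @ [0]) ! 0 = e i2" for L and e :: "'n \<Rightarrow> nat"
    unfolding fun_eq_iff all_n by (simp add: ex_def neq)
  have fib: "{L. length L = length (bs @ as) \<and> sorted_wrt (>) (L @ [0]) \<and> ex L = e}
      = {L. length L = ?q + ?p \<and> sorted_wrt (>) (L @ [0]) \<and> (L @ [0]) ! ?q = e i1 \<and> (L @ [0]) ! 0 = e i2}" for e
    by (simp add: ex)
  note bij = chains_split[of ?q "e i1" "e i2" ?p for e]
  show ?thesis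
  proof (rule polylog_eq_pseries[where ex = ex])
    show "length ?\<kappa> = length (bs @ as)" by simp
    show "poly_growth (\<lambda>e. (- 1) ^ (?p + ?q) * carr as bs e)"
      by (rule poly_growth_cmult[OF two.poly_growth_has_coefs[OF has_coefs2[OF pos]]])
    show "finite {L. length L = length (bs @ as) \<and> sorted_wrt (>) (L @ [0]) \<and> ex L = e}" for e
      unfolding fib using bij_betw_finite[OF bij[of e]] finite_chains by simp
    show "(- 1) ^ (?p + ?q) * carr as bs e
      = (\<Sum>L | length L = length (bs @ as) \<and> sorted_wrt (>) (L @ [0]) \<and> ex L = e. complex_of_real (chain_weight (bs @ as) L))" for e
    proof -
      have "(\<Sum>L | length L = length (bs @ as) \<and> sorted_wrt (>) (L @ [0]) \<and> ex L = e. complex_of_real (chain_weight (bs @ as) L))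
        = (\<Sum>(ks, ls)\<in>chains ?q (e i1) (e i2) \<times> chains ?p 0 (e i1). complex_of_real (chain_weight (bs @ as) (ks @ ls)))"
        unfolding fib sum.reindex_bij_betw[OF bij[of e], symmetric] by (simp add: split_beta)
      also have "\<dots> = (\<Sum>(ks, ls)\<in>chains ?q (e i1) (e i2) \<times> chains ?p 0 (e i1).
          complex_of_real (chain_weight bs ks) * complex_of_real (chain_weight as ls))"
        by (rule sum.cong) (auto simp: chain_weight_append chains_def)
      also have "\<dots> = nested bs (e i1) (e i2) * nested as 0 (e i1)"
        unfolding nested_chains sum_product sum.cartesian_product ..
      also have "\<dots> = (- 1) ^ (?p + ?q) * carr as bs e"
        by (simp add: carr_def mult.assoc[symmetric] power_add[symmetric] flip: mult_2)
      finally show ?thesis ..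
    qed
    show "(\<Prod>i<length (bs @ as). y_ratio ?\<kappa> (length (bs @ as) - 1 - i) x ^ (L ! i)) = monom_at x (ex L)"
      if L: "length L = length (bs @ as)" for L
    proof -
      have iv: "{i1..<i1} = {}" "{i2..<i2} = {}" "{i1..<i2} = {i1}"
        using n_cases less by (auto simp: set_eq_iff)
      \<comment> \<open>Equal consecutive values of \<kappa> give an empty product. In reversed
        order the last ratio is at 0 and the jump from \<open>i1\<close> to \<open>i2\<close> at
        \<open>?q\<close>; for \<open>?q = 0\<close> both coincide and give x_1 x_2.\<close>
      have "y_ratio ?\<kappa> (?q + ?p - 1 - i) x ^ (L ! i)
        = (if i = ?q then x $ i1 ^ (L ! i) else 1) * (if i = 0 then x $ i2 ^ (L ! i) else 1)" if "i < ?q + ?p" for i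
      proof (cases "i = 0")
        case True
        then show ?thesis using that
          by (cases "length bs") (auto simp: y_ratio_def nth_append zco_eq power_mult_distrib simp del: replicate_Suc)
      next
        case False
        then show ?thesis using that iv
          by (auto simp: y_ratio_def nth_append)
      qed
      then have "(\<Prod>i<?q + ?p. y_ratio ?\<kappa> (?q + ?p - 1 - i) x ^ (L ! i))
        = (\<Prod>i<?q + ?p. (if i = ?q then x $ i1 ^ (L ! i) else 1) * (if i = 0 then x $ i2 ^ (L ! i) else 1))"
        by (intro prod.cong) auto
      also have "\<dots> = monom_at x (ex L)"
        unfolding prod.distrib monom_at_n using L
        by (auto simp: prod.delta ex_def nth_append neq)
      finally show ?thesis by simp
    qed
  qed (rule x)
qed

lemma formal_polylog2:
  assumes pos: "\<forall>a\<in>set (as @ bs). 1 \<le> a"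
  shows "formal_polylog (rev (bs @ as)) (replicate (length as) i1 @ replicate (length bs) i2)
    = ((- 1) ^ (length as + length bs)) *\<^sub>C r5.wc (polylog_word as bs)"
proof -
  let ?c = "(- 1) ^ (length as + length bs) :: complex"
  have co: "two.has_coefs (?c *\<^sub>C r5.wc (polylog_word as bs)) (\<lambda>e. ?c * carr as bs e)"
    by (rule two.has_coefs_scaleC[OF has_coefs2[OF pos]])
  show ?thesis
  proof (rule two.formal_polylog_eqI[OF iter_int2])
    show "\<phi> = \<psi>" if "\<phi> \<in> graded_dual" "\<psi> \<in> graded_dual" "two.formal_int \<phi> = two.formal_int \<psi>" for \<phi> \<psi>
      using formal_int2_injective that by (rule two.formal_int_eqD)
  qed (use co two.formal_int_has_coefs[OF co] polylog_pseries2[OF pos] in \<open>simp_all only: two.has_coefs_def\<close>)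
qed

text \<open>A nondecreasing list with two values is a run of \<open>i1\<close> followed by a run of
  \<open>i2\<close>, so polylogarithm indices are pairs \<open>as\<close>, \<open>bs\<close>; the
  sign in \<open>formal_polylog2\<close> does not affect vanishing.\<close>

theorem mem_k_space2:
  "x \<in> (k_space :: 'n pt braid_lie set) \<longleftrightarrow>
    (\<forall>as bs. (\<forall>a\<in>set (as @ bs). 1 \<le> a) \<longrightarrow> r5.wc (polylog_word as bs) (emb x) = 0)"
proof -
  have wc: "formal_polylog (rev (bs @ as)) (replicate (length as) i1 @ replicate (length bs) i2) (emb x) = 0
      \<longleftrightarrow> r5.wc (polylog_word as bs) (emb x) = 0" if "\<forall>a\<in>set (as @ bs). 1 \<le> a" for as bs
    unfolding formal_polylog2[OF that] by (simp add: scaleC_fun_def scaleC_complex_def)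
  show ?thesis unfolding mem_k_space
  proof (intro iffI allI impI)
    fix as bs :: "nat list"
    assume "\<forall>a \<kappa>. polylog_index a \<kappa> \<longrightarrow> formal_polylog a (\<kappa> :: 'n list) (emb x) = 0" "\<forall>a\<in>set (as @ bs). 1 \<le> a"
    moreover from this have "polylog_index (rev (bs @ as)) (replicate (length as) i1 @ replicate (length bs) i2)"
      using less by (auto simp: polylog_index_def sorted_append sorted_replicate)
    ultimately show "r5.wc (polylog_word as bs) (emb x) = 0" using wc[of as bs] by blast
  next
    fix a :: "nat list" and \<kappa> :: "'n list"
    assume *: "\<forall>as bs. (\<forall>a\<in>set (as @ bs). 1 \<le> a) \<longrightarrow> r5.wc (polylog_word as bs) (emb x) = 0" "polylog_index a \<kappa>"
    have "sorted \<kappa>" "set \<kappa> \<subseteq> {i1, i2}" using *(2) n_cases by (auto simp: polylog_index_def)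
    then obtain p q where pq: "\<kappa> = replicate p i1 @ replicate q i2"
      using sorted_two_values less by blast
    then have "length (rev a) = q + p" using *(2) by (simp add: polylog_index_def)
    then obtain bs as where as: "rev a = bs @ as" "length bs = q" "length as = p"
      using append_of_lengths by blast
    then have a: "a = rev (bs @ as)" using rev_rev_ident[of a] by (simp only:)
    have "\<forall>a\<in>set (as @ bs). 1 \<le> a" using *(2) by (auto simp: polylog_index_def a)
    then show "formal_polylog a \<kappa> (emb x) = 0"
      using wc[of as bs] *(1) unfolding a pq as(2,3)[symmetric] by blast
  qed
qed

end

section \<open>Formal polylogarithms as word functionals in one variable\<close>

context one_point
begin

lemma formal_polylog1:
  assumes pos: "\<forall>a\<in>set as. 1 \<le> a"
  shows "formal_polylog (rev as) (replicate (length as) i0) = ((- 1) ^ length as) *\<^sub>C r4.wc (block_word LD as)"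
proof -
  let ?p = "length as"
  let ?c = "(- 1) ^ ?p :: complex"
  have co: "one.has_coefs (?c *\<^sub>C r4.wc (block_word LD as)) (\<lambda>e. ?c * carr as e)"
    by (rule one.has_coefs_scaleC[OF has_coefs1[OF pos]])
  have eq: "polylog (rev as) (replicate ?p i0) x = pseries (\<lambda>e. ?c * carr as e) x" if x: "x \<in> polydisc" for x
  proof -
    define ex where "ex L = (\<lambda>k :: 'n. (L @ [0]) ! 0)" for L :: "nat list"
    have fib: "{L. length L = length as \<and> sorted_wrt (>) (L @ [0]) \<and> ex L = e} = chains ?p 0 (e i0)" for e
    proof -
      have "(\<forall>k::'n. Q k) \<longleftrightarrow> Q i0" for Q
        using UNIV_n by (metis UNIV_I singletonD)
      then show ?thesis by (simp add: chains_def fun_eq_iff ex_def)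
    qed
    show ?thesis
    proof (rule polylog_eq_pseries[where ex = ex])
      show "poly_growth (\<lambda>e. ?c * carr as e)" using co by (rule one.poly_growth_has_coefs)
      show "finite {L. length L = length as \<and> sorted_wrt (>) (L @ [0]) \<and> ex L = e}" for e
        unfolding fib by (rule finite_chains)
      show "?c * carr as e = (\<Sum>L | length L = length as \<and> sorted_wrt (>) (L @ [0]) \<and> ex L = e. complex_of_real (chain_weight as L))" for e
        unfolding fib nested_chains[symmetric] by (simp add: carr_def mult.assoc[symmetric] flip: power_add mult_2)
      show "(\<Prod>i<length as. y_ratio (replicate ?p i0) (length as - 1 - i) x ^ (L ! i)) = monom_at x (ex L)"
        if L: "length L = length as" for L
      proof -
        have "y_ratio (replicate ?p i0) (?p - 1 - i) x ^ (L ! i) = (if i = 0 then x $ i0 ^ (L ! i) else 1)" if "i < ?p" for i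
          using that by (auto simp: y_ratio_def zco_eq)
        then have "(\<Prod>i<?p. y_ratio (replicate ?p i0) (?p - 1 - i) x ^ (L ! i)) = (\<Prod>i<?p. if i = 0 then x $ i0 ^ (L ! i) else 1)"
          by (intro prod.cong) auto
        then show ?thesis using L by (auto simp: prod.delta ex_def nth_append monom_at_def UNIV_n)
      qed
    qed (use x in simp_all)
  qed
  show ?thesis
  proof (rule one.formal_polylog_eqI[OF iter_int1])
    show "\<phi> = \<psi>" if "\<phi> \<in> graded_dual" "\<psi> \<in> graded_dual" "one.formal_int \<phi> = one.formal_int \<psi>" for \<phi> \<psi>
      using formal_int1_injective that by (rule one.formal_int_eqD)
  qed (use co one.formal_int_has_coefs[OF co] eq in \<open>simp_all only: one.has_coefs_def\<close>)
qed

theorem mem_k_space1: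
  "x \<in> (k_space :: 'n pt braid_lie set) \<longleftrightarrow>
    (\<forall>as. (\<forall>a\<in>set as. 1 \<le> a) \<longrightarrow> r4.wc (block_word LD as) (emb x) = 0)"
proof -
  have wc: "formal_polylog (rev as) (replicate (length as) i0) (emb x) = 0
      \<longleftrightarrow> r4.wc (block_word LD as) (emb x) = 0" if "\<forall>a\<in>set as. 1 \<le> a" for as
    unfolding formal_polylog1[OF that] by (simp add: scaleC_fun_def scaleC_complex_def)
  show ?thesis unfolding mem_k_space
  proof (intro iffI allI impI)
    fix as :: "nat list"
    assume "\<forall>a \<kappa>. polylog_index a \<kappa> \<longrightarrow> formal_polylog a (\<kappa> :: 'n list) (emb x) = 0" "\<forall>a\<in>set as. 1 \<le> a"
    then show "r4.wc (block_word LD as) (emb x) = 0"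
      by (subst wc[symmetric]) (auto simp: polylog_index_def sorted_replicate)
  next
    fix a :: "nat list" and \<kappa> :: "'n list"
    assume *: "\<forall>as. (\<forall>a\<in>set as. 1 \<le> a) \<longrightarrow> r4.wc (block_word LD as) (emb x) = 0" "polylog_index a \<kappa>"
    have \<kappa>: "\<kappa> = replicate (length (rev a)) i0"
      using *(2) n_eq by (auto simp: polylog_index_def intro!: replicate_eqI)
    have "\<forall>b\<in>set (rev a). 1 \<le> b" using *(2) by (simp add: polylog_index_def)
    then show "formal_polylog a \<kappa> (emb x) = 0"
      using wc[of "rev a"] *(1) unfolding \<kappa> rev_rev_ident by blast
  qed
qed

end

section \<open>Linear functions on finitely supported series\<close>

abbreviation fin :: "word_series \<Rightarrow> bool" where "fin f \<equiv> finite {w. f w \<noteq> 0}"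

text \<open>Linear extension of \<open>R\<close> from words to finitely supported series. For
  infinite support the sum is 0 by convention, hence the \<open>fin\<close> conditions in the
  linearity laws.\<close>

definition fext :: "(letter list \<Rightarrow> 'g::cvector) \<Rightarrow> word_series \<Rightarrow> 'g" where
  "fext R f = (\<Sum>w | f w \<noteq> 0. f w *\<^sub>C R w)"

lemma fext_superset: "finite S \<Longrightarrow> {w. f w \<noteq> 0} \<subseteq> S \<Longrightarrow> fext R f = (\<Sum>w\<in>S. f w *\<^sub>C R w)"
  unfolding fext_def by (rule sum.mono_neutral_left) auto

lemma fin_add: "fin f \<Longrightarrow> fin g \<Longrightarrow> fin (f + g)"
  and fin_diff: "fin f \<Longrightarrow> fin g \<Longrightarrow> fin (f - g)"
  and fin_scaleC: "fin f \<Longrightarrow> fin (c *\<^sub>C f)"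
  and fin_delta: "fin (delta v)"
proof -
  show "fin f \<Longrightarrow> fin g \<Longrightarrow> fin (f + g)" "fin f \<Longrightarrow> fin g \<Longrightarrow> fin (f - g)"
    by (rule finite_subset[of _ "{w. f w \<noteq> 0} \<union> {w. g w \<noteq> 0}"]; auto)+
  show "fin f \<Longrightarrow> fin (c *\<^sub>C f)"
    by (rule finite_subset[of _ "{w. f w \<noteq> 0}"]) auto
  show "fin (delta v)"
    by (rule finite_subset[of _ "{v}"]) (auto simp: delta_def)
qed

lemma fext_add:
  assumes "fin f" "fin g"
  shows "fext R (f + g) = fext R f + fext R g"
proof -
  let ?S = "{w. f w \<noteq> 0} \<union> {w. g w \<noteq> 0}"
  have "finite ?S" using assms by simp
  then have "fext R f = (\<Sum>w\<in>?S. f w *\<^sub>C R w)" "fext R g = (\<Sum>w\<in>?S. g w *\<^sub>C R w)"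
    "fext R (f + g) = (\<Sum>w\<in>?S. (f + g) w *\<^sub>C R w)"
    by (rule fext_superset; auto)+
  then show ?thesis by (simp add: scaleC_add_left sum.distrib)
qed

lemma fext_scaleC:
  assumes "fin f"
  shows "fext R (c *\<^sub>C f) = c *\<^sub>C fext R f"
proof -
  have "fext R (c *\<^sub>C f) = (\<Sum>w | f w \<noteq> 0. (c *\<^sub>C f) w *\<^sub>C R w)"
    by (rule fext_superset[OF assms]) auto
  then show ?thesis by (simp add: fext_def cvec.scale_sum_right scaleC_scaleC)
qed

lemma fext_diff: "fin f \<Longrightarrow> fin g \<Longrightarrow> fext R (f - g) = fext R f - fext R g"
  using fext_add[of f "(- 1) *\<^sub>C g" R] fext_scaleC[of g R "- 1"] fin_scaleC[of g "- 1"]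
  by (simp only: minus_one_scaleC diff_conv_add_uminus)

lemma fext_delta: "fext R (delta v) = R v"
  using fext_superset[of "{v}" "delta v" R] by (auto simp: delta_def scaleC_one split: if_splits)

lemma fext_cong: "(\<And>w. f w \<noteq> 0 \<Longrightarrow> R w = R' w) \<Longrightarrow> fext R f = fext R' f"
  unfolding fext_def by (rule sum.cong) auto

lemma fext_eq_0: "(\<And>w. f w \<noteq> 0 \<Longrightarrow> R w = 0) \<Longrightarrow> fext R f = 0"
  unfolding fext_def by (rule sum.neutral) auto

lemma fext_clinear: "clinear h \<Longrightarrow> fext (\<lambda>w. h (R w)) f = h (fext R f)"
  unfolding fext_def by (simp add: clinear_sum clinear_scaleC)

lemma fext_minus_right: "fext (\<lambda>w. R w - R' w) f = fext R f - fext R' f"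
  unfolding fext_def by (simp add: cvec.scale_right_diff_distrib sum_subtractf)

lemma lmul_support: "{w. app (lmul c) f w \<noteq> 0} = (#) c ` {w. f w \<noteq> 0}"
proof (rule set_eqI)
  fix w show "w \<in> {w. app (lmul c) f w \<noteq> 0} \<longleftrightarrow> w \<in> (#) c ` {w. f w \<noteq> 0}"
    by (cases w) auto
qed

lemma fin_lmul: "fin f \<Longrightarrow> fin (app (lmul c) f)"
  unfolding lmul_support by simp

lemma fext_lmul: "fext R (app (lmul c) f) = fext (\<lambda>w. R (c # w)) f"
  unfolding fext_def lmul_support by (simp add: sum.reindex)


section \<open>Lie polynomials in letters\<close>

primrec word_letters :: "'l lie_word \<Rightarrow> 'l list" where
  "word_letters (Letter l) = [l]"
| "word_letters (Word_Br v w) = word_letters v @ word_letters w"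

lemma set_word_letters: "set (word_letters w) = set_lie_word w"
  by (induction w) auto

text \<open>\<open>L\<close> holds the letters that are present: all three for five points,
  \<open>W\<close> and \<open>D\<close> for four. Acting on the series \<open>1\<close> expands Lie
  words into noncommutative polynomials.\<close>

locale letter_rep =
  fixes val :: "letter \<Rightarrow> 'g::lie_algebra" and rho :: "'g \<Rightarrow> endo" and L :: "letter set"
  assumes hom: "lie_hom rho" and rho_val: "\<And>l. l \<in> L \<Longrightarrow> rho (val l) = lmul l"
begin

lemmas rho_linear = lie_hom_clinear[OF hom]

lemma rho_bracket: "rho (bracket x y) = rho x * rho y - rho y * rho x"
  using lie_hom_bracket[OF hom] by (simp add: bracket_endo_def)

definition ser :: "'g \<Rightarrow> word_series" where
  "ser x = app (rho x) (delta [])"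

lemma clinear_rho_at: "clinear (\<lambda>x. app (rho x) f)"
  by (rule clinear_compose[OF clinear_app_at rho_linear])

lemma clinear_ser: "clinear ser"
  unfolding ser_def by (rule clinear_rho_at)

lemma ser_bracket: "ser (bracket x y) = app (rho x) (ser y) - app (rho y) (ser x)"
  by (simp add: ser_def rho_bracket)

lemma ser_val: "l \<in> L \<Longrightarrow> ser (val l) = delta [l]"
  by (simp add: ser_def rho_val app_lmul_delta)

lemma fin_rho_eval: "set_lie_word w \<subseteq> L \<Longrightarrow> fin f \<Longrightarrow> fin (app (rho (eval_word val w)) f)"
proof (induction w arbitrary: f)
  case (Letter l)
  then show ?case by (simp add: rho_val fin_lmul)
next
  case (Word_Br v w)
  show ?case
    unfolding eval_word.simps rho_bracket app_simps
    by (intro fin_diff Word_Br.IH Word_Br.prems(2)) (use Word_Br.prems(1) in auto)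
qed

lemma rho_eval_Nil: "set_lie_word w \<subseteq> L \<Longrightarrow> app (rho (eval_word val w)) f [] = 0"
  by (induction w arbitrary: f) (simp_all add: rho_val rho_bracket)

text \<open>Expanding brackets merely permutes letters. Counts are tracked, beyond the set of
  letters, so that the Dynkin eigenvalue can be read off any word of the support.\<close>

lemma rho_eval_support:
  assumes "set_lie_word w \<subseteq> L" "app (rho (eval_word val w)) f u \<noteq> 0"
  shows "\<exists>p q. u = p @ q \<and> (\<forall>c. count_list p c = count_list (word_letters w) c) \<and> f q \<noteq> 0"
  using assms
proof (induction w arbitrary: f u)
  case (Letter l)
  then obtain q where "u = [l] @ q" "f q \<noteq> 0"
    by (cases u) (auto simp: rho_val split: if_splits)
  then show ?case by (intro exI[of _ "[l]"] exI[of _ q]) simp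
next
  case (Word_Br v w)
  have sub: "set_lie_word v \<subseteq> L" "set_lie_word w \<subseteq> L" using Word_Br.prems(1) by auto
  have "app (rho (eval_word val v)) (app (rho (eval_word val w)) f) u \<noteq> 0
      \<or> app (rho (eval_word val w)) (app (rho (eval_word val v)) f) u \<noteq> 0"
    using Word_Br.prems by (auto simp: rho_bracket)
  then show ?case
  proof
    assume "app (rho (eval_word val v)) (app (rho (eval_word val w)) f) u \<noteq> 0"
    from Word_Br.IH(1)[OF sub(1) this] obtain p q where 1: "u = p @ q"
      "\<forall>c. count_list p c = count_list (word_letters v) c" "app (rho (eval_word val w)) f q \<noteq> 0" by blast
    from Word_Br.IH(2)[OF sub(2) 1(3)] obtain p' q' where "q = p' @ q'"
      "\<forall>c. count_list p' c = count_list (word_letters w) c" "f q' \<noteq> 0" by blast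
    then show ?thesis using 1 by (intro exI[of _ "p @ p'"] exI[of _ q']) simp
  next
    assume "app (rho (eval_word val w)) (app (rho (eval_word val v)) f) u \<noteq> 0"
    from Word_Br.IH(2)[OF sub(2) this] obtain p q where 1: "u = p @ q"
      "\<forall>c. count_list p c = count_list (word_letters w) c" "app (rho (eval_word val v)) f q \<noteq> 0" by blast
    from Word_Br.IH(1)[OF sub(1) 1(3)] obtain p' q' where "q = p' @ q'"
      "\<forall>c. count_list p' c = count_list (word_letters v) c" "f q' \<noteq> 0" by blast
    then show ?thesis using 1 by (intro exI[of _ "p @ p'"] exI[of _ q']) simp
  qed
qed

lemma count_list_set_eq:
  assumes "\<forall>c. count_list p c = count_list (word_letters w) c"
  shows "set p = set_lie_word w"
  unfolding set_word_letters[symmetric] using assms by (metis count_list_0_iff subsetI subset_antisym)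

text \<open>Lie words sorted by the set of letters that occur; sets unite under brackets, which
  takes the place of a multigrading.\<close>

definition words :: "(letter set \<Rightarrow> bool) \<Rightarrow> 'g set" where
  "words P = cvec.span {eval_word val w | w. set_lie_word w \<subseteq> L \<and> P (set_lie_word w)}"

lemma subspace_words: "cvec.subspace (words P)"
  by (simp add: words_def)

lemma eval_words: "set_lie_word w \<subseteq> L \<Longrightarrow> P (set_lie_word w) \<Longrightarrow> eval_word val w \<in> words P"
  unfolding words_def by (rule cvec.span_base) auto

lemma words_mono: "(\<And>A. P A \<Longrightarrow> Q A) \<Longrightarrow> words P \<subseteq> words Q"
  unfolding words_def by (rule cvec.span_mono) auto

lemma words_split:
  assumes "x \<in> words P" "\<And>A. P A \<Longrightarrow> Q A \<or> Q' A"
  obtains y z where "x = y + z" "y \<in> words Q" "z \<in> words Q'"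
proof -
  let ?S = "\<lambda>Q. {eval_word val w | w. set_lie_word w \<subseteq> L \<and> Q (set_lie_word w)}"
  have "x \<in> cvec.span (?S Q \<union> ?S Q')"
    using assms(1) unfolding words_def by (rule set_mp[OF cvec.span_mono, rotated]) (use assms(2) in auto)
  then show ?thesis using that unfolding cvec.span_Un words_def by auto
qed

lemma rho_words_support:
  assumes "x \<in> words P" "app (rho x) f u \<noteq> 0"
  shows "\<exists>p q. u = p @ q \<and> P (set p) \<and> f q \<noteq> 0"
proof (rule ccontr)
  assume *: "\<not> ?thesis"
  have "app (rho x) f u = 0"
    using assms(1) unfolding words_def
  proof (rule clinear_zero_on_span[OF clinear_compose[OF clinear_fun_apply clinear_rho_at], rotated])
    fix y assume "y \<in> {eval_word val w |w. set_lie_word w \<subseteq> L \<and> P (set_lie_word w)}"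
    then obtain w where w: "y = eval_word val w" "set_lie_word w \<subseteq> L" "P (set_lie_word w)" by blast
    show "app (rho y) f u = 0"
      using rho_eval_support[OF w(2), of f u] count_list_set_eq[of _ w] w * by metis
  qed
  with assms(2) show False by simp
qed

lemma ser_words_support: "x \<in> words P \<Longrightarrow> ser x u \<noteq> 0 \<Longrightarrow> P (set u)"
  using rho_words_support[of x P "delta []" u] by (auto simp: ser_def delta_def split: if_splits)

lemma fin_rho_words:
  assumes "x \<in> words P" "fin f"
  shows "fin (app (rho x) f)"
proof -
  have "cvec.subspace {x. fin (app (rho x) f)}"
  proof (rule cvec.subspaceI)
    show "0 \<in> {x. fin (app (rho x) f)}" by (simp add: clinear_0[OF rho_linear])
    show "x + y \<in> {x. fin (app (rho x) f)}" if "x \<in> {x. fin (app (rho x) f)}" "y \<in> {x. fin (app (rho x) f)}" for x y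
      using that fin_add[of "app (rho x) f" "app (rho y) f"] by (simp add: clinear_add[OF rho_linear])
    show "c *\<^sub>C x \<in> {x. fin (app (rho x) f)}" if "x \<in> {x. fin (app (rho x) f)}" for c x
      using that fin_scaleC[of "app (rho x) f" c] by (simp add: clinear_scaleC[OF rho_linear])
  qed
  then have "words P \<subseteq> {x. fin (app (rho x) f)}"
    unfolding words_def by (rule cvec.span_minimal[rotated]) (use fin_rho_eval assms(2) in auto)
  then show ?thesis using assms(1) by blast
qed

lemma fin_ser_words: "x \<in> words P \<Longrightarrow> fin (ser x)"
  unfolding ser_def by (rule fin_rho_words[OF _ fin_delta])

text \<open>Reduces a reconstruction formula modulo \<open>S\<close> to spanning elements;
  finiteness of supports is carried along for the additivity of \<open>fext\<close>.\<close>

lemma fext_ser_id: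
  assumes "x \<in> cvec.span B" "cvec.subspace S"
    and "\<And>b. b \<in> B \<Longrightarrow> fin (ser b)" "\<And>b. b \<in> B \<Longrightarrow> fext R (ser b) - b \<in> S"
  shows "fext R (ser x) - x \<in> S"
proof -
  let ?G = "{x. fin (ser x) \<and> fext R (ser x) - x \<in> S}"
  have "cvec.subspace ?G"
  proof (rule cvec.subspaceI)
    show "0 \<in> ?G" using cvec.subspace_0[OF assms(2)] by (simp add: clinear_0[OF clinear_ser] fext_def)
    show "x + y \<in> ?G" if "x \<in> ?G" "y \<in> ?G" for x y
    proof -
      have eq: "fext R (ser (x + y)) - (x + y) = (fext R (ser x) - x) + (fext R (ser y) - y)"
        using that by (simp add: clinear_add[OF clinear_ser] fext_add)
      have "fext R (ser (x + y)) - (x + y) \<in> S"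
        unfolding eq by (rule cvec.subspace_add[OF assms(2)]) (use that in auto)
      moreover have "fin (ser (x + y))"
        unfolding clinear_add[OF clinear_ser] by (rule fin_add) (use that in auto)
      ultimately show ?thesis by blast
    qed
    show "c *\<^sub>C x \<in> ?G" if "x \<in> ?G" for c x
    proof -
      have eq: "fext R (ser (c *\<^sub>C x)) - c *\<^sub>C x = c *\<^sub>C (fext R (ser x) - x)"
        using that by (simp add: clinear_scaleC[OF clinear_ser] fext_scaleC cvec.scale_right_diff_distrib)
      have "fext R (ser (c *\<^sub>C x)) - c *\<^sub>C x \<in> S"
        unfolding eq by (rule cvec.subspace_scale[OF assms(2)]) (use that in auto)
      moreover have "fin (ser (c *\<^sub>C x))"
        unfolding clinear_scaleC[OF clinear_ser] by (rule fin_scaleC) (use that in auto)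
      ultimately show ?thesis by blast
    qed
  qed
  then have "cvec.span B \<subseteq> ?G"
    by (rule cvec.span_minimal[rotated]) (use assms(3,4) in auto)
  then show ?thesis using assms(1) by blast
qed

text \<open>The Dynkin operator started at the letter \<open>c\<close>: on a Lie polynomial it counts the letters \<open>c\<close>.\<close>
primrec dyn :: "letter \<Rightarrow> letter list \<Rightarrow> 'g" where
  "dyn c [] = 0"
| "dyn c (l # w) = (if w = [] then if l = c then val l else 0 else bracket (val l) (dyn c w))"

text \<open>\<open>dyn c\<close> turns left multiplication by a letter into the adjoint action of
  its value, except in front of the empty word, which \<open>f [] = 0\<close> excludes; hence Lie
  polynomials act by brackets too.\<close>

lemma dyn_rho:
  "set_lie_word w \<subseteq> L \<Longrightarrow> fin f \<Longrightarrow> f [] = 0 \<Longrightarrow>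
    fext (dyn c) (app (rho (eval_word val w)) f) = bracket (eval_word val w) (fext (dyn c) f)"
proof (induction w arbitrary: f)
  case (Letter l)
  have "fext (dyn c) (app (rho (val l)) f) = fext (\<lambda>v. bracket (val l) (dyn c v)) f"
    using Letter by (auto simp: rho_val fext_lmul intro: fext_cong)
  then show ?case by (simp add: fext_clinear[OF bracket_clinear_right])
next
  case (Word_Br v w)
  then show ?case
    by (simp add: rho_bracket fext_diff[unfolded fun_diff_def] fext_diff fin_rho_eval rho_eval_Nil bracket_bracket_left)
qed

text \<open>The Dynkin-Specht-Wever argument with a marked letter: both orders of a bracket
  contribute, and the counts of \<open>c\<close> add up.\<close>

lemma dyn_ser:
  "set_lie_word w \<subseteq> L \<Longrightarrow>
    fext (dyn c) (ser (eval_word val w)) = of_nat (count_list (word_letters w) c) *\<^sub>C eval_word val w"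
proof (induction w)
  case (Letter l)
  then show ?case by (simp add: ser_val fext_delta scaleC_one)
next
  case (Word_Br v w)
  have 0: "ser (eval_word val u) [] = 0" "fin (ser (eval_word val u))" if "set_lie_word u \<subseteq> L" for u
    using that by (simp_all add: ser_def rho_eval_Nil fin_rho_eval fin_delta)
  have "fext (dyn c) (ser (eval_word val (Word_Br v w)))
    = fext (dyn c) (app (rho (eval_word val v)) (ser (eval_word val w)))
      - fext (dyn c) (app (rho (eval_word val w)) (ser (eval_word val v)))"
    unfolding eval_word.simps ser_bracket using Word_Br.prems
    by (intro fext_diff fin_rho_eval 0) auto
  also have "\<dots> = bracket (eval_word val v) (of_nat (count_list (word_letters w) c) *\<^sub>C eval_word val w)
      - bracket (eval_word val w) (of_nat (count_list (word_letters v) c) *\<^sub>C eval_word val v)"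
    using Word_Br by (simp add: dyn_rho 0)
  also have "\<dots> = (of_nat (count_list (word_letters v) c) + of_nat (count_list (word_letters w) c))
      *\<^sub>C bracket (eval_word val v) (eval_word val w)"
    using bracket_anti[of "eval_word val w" "eval_word val v"]
    by (simp add: bracket_scaleC_right scaleC_add_left cvec.scale_minus_right add.commute)
  finally show ?case by simp
qed

lemma dyn_snoc: "l \<noteq> c \<Longrightarrow> dyn c (w @ [l]) = 0"
  by (induction w) auto

text \<open>\<open>dyn c\<close> kills words that do not end in \<open>c\<close>, so it sees nothing
  of \<open>ser x\<close>; yet dividing by the positive count of \<open>c\<close> it reconstructs
  \<open>x\<close>.\<close>

lemma words_eq_0:
  assumes x: "x \<in> words (\<lambda>A. c \<in> A)" and 0: "\<And>w. ser x (w @ [c]) = 0"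
  shows "x = 0"
proof -
  let ?R = "\<lambda>u. (1 / of_nat (count_list u c)) *\<^sub>C dyn c u"
  have "fext ?R (ser x) - x \<in> {0}"
    using x unfolding words_def
  proof (rule fext_ser_id)
    fix b assume "b \<in> {eval_word val w |w. set_lie_word w \<subseteq> L \<and> c \<in> set_lie_word w}"
    then obtain w where b: "b = eval_word val w" and w: "set_lie_word w \<subseteq> L" "c \<in> set_lie_word w" by blast
    show "fin (ser b)" unfolding b ser_def by (rule fin_rho_eval[OF w(1) fin_delta])
    let ?n = "count_list (word_letters w) c"
    have n: "?n \<noteq> 0" using w(2) by (simp add: count_list_0_iff set_word_letters)
    have "count_list u c = ?n" if "ser (eval_word val w) u \<noteq> 0" for u
      using rho_eval_support[OF w(1), of "delta []" u] that by (auto simp: ser_def delta_def split: if_splits)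
    then have "fext ?R (ser (eval_word val w)) = fext (\<lambda>u. (1 / of_nat ?n) *\<^sub>C dyn c u) (ser (eval_word val w))"
      by (intro fext_cong) simp
    also have "\<dots> = (1 / of_nat ?n) *\<^sub>C fext (dyn c) (ser (eval_word val w))"
      by (rule fext_clinear) (simp add: clinear_iff scaleC_add_right scaleC_scaleC mult.commute)
    also have "\<dots> = eval_word val w" using n by (simp add: dyn_ser[OF w(1)] scaleC_scaleC scaleC_one)
    finally show "fext ?R (ser b) - b \<in> {0}" by (simp add: b)
  qed (simp add: cvec.subspace_def)
  moreover have "fext ?R (ser x) = 0"
  proof (rule fext_eq_0)
    fix u assume u: "ser x u \<noteq> 0"
    show "?R u = 0"
    proof (cases u rule: rev_cases)
      case (snoc v l)
      then have "l \<noteq> c" using u 0 by auto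
      then show ?thesis by (simp add: snoc dyn_snoc)
    qed simp
  qed
  ultimately show ?thesis by simp
qed

lemma words_W: "LW \<in> L \<Longrightarrow> words (\<lambda>A. A \<subseteq> {LW}) \<subseteq> cvec.span {val LW}"
  unfolding words_def
proof (rule cvec.span_minimal[OF _ cvec.subspace_span], clarify)
  fix w :: "letter lie_word" assume "set_lie_word w \<subseteq> {LW}"
  then show "eval_word val w \<in> cvec.span {val LW}"
  proof (induction w)
    case (Letter l)
    then show ?case by (auto intro: cvec.span_base)
  next
    case (Word_Br v w)
    then obtain s t where "eval_word val v = s *\<^sub>C val LW" "eval_word val w = t *\<^sub>C val LW"
      by (auto simp: cvec.span_singleton)
    then show ?case by (simp add: bracket_scaleC_left bracket_scaleC_right bracket_self cvec.span_zero)
  qed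
qed

lemma words_bracket:
  assumes "x \<in> words P" "y \<in> words Q" "\<And>A B. P A \<Longrightarrow> Q B \<Longrightarrow> S (A \<union> B)"
  shows "bracket x y \<in> words S"
proof -
  have "bracket (eval_word val v) z \<in> words S" if v: "set_lie_word v \<subseteq> L" "P (set_lie_word v)" and z: "z \<in> words Q" for v z
    using z unfolding words_def[of Q]
  proof (rule clinear_span_mem[OF bracket_clinear_right subspace_words, rotated])
    fix u assume "u \<in> {eval_word val w |w. set_lie_word w \<subseteq> L \<and> Q (set_lie_word w)}"
    then obtain w where "u = eval_word val w" "set_lie_word w \<subseteq> L" "Q (set_lie_word w)" by blast
    then show "bracket (eval_word val v) u \<in> words S"
      using eval_words[of "Word_Br v w" S] v assms(3) by simp
  qed
  then show ?thesis
    using assms(1) unfolding words_def[of P]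
    by (intro clinear_span_mem[OF bracket_clinear_left subspace_words, of _ y S x]) (use assms(2) in auto)
qed

end

section \<open>The ideal of words in both letters\<close>

lemma clinear_funpow: "clinear f \<Longrightarrow> clinear (f ^^ k)" for f :: "'a::cvector \<Rightarrow> 'a"
  by (induction k) (simp_all add: clinear_iff)

locale free_letter_rep = letter_rep val rho UNIV for val :: "letter \<Rightarrow> 'g::lie_algebra" and rho
begin

text \<open>Such a \<open>U\<close> is stable under brackets with every Lie word in \<open>W\<close>
  and \<open>c\<close>, and a Lie word containing \<open>c\<close> is up to sign an iterated bracket
  of this kind, ending at the letter \<open>c\<close>.\<close>

lemma word_closure:
  assumes U: "cvec.subspace U" "val c \<in> U"
    and ad: "\<And>u. u \<in> U \<Longrightarrow> bracket (val LW) u \<in> U" "\<And>u. u \<in> U \<Longrightarrow> bracket (val c) u \<in> U"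
    and w: "set_lie_word w \<subseteq> {LW, c}" "c \<in> set_lie_word w"
  shows "eval_word val w \<in> U"
proof -
  have M: "bracket (eval_word val v) u \<in> U" if "set_lie_word v \<subseteq> {LW, c}" "u \<in> U" for u v
    using that
  proof (induction v arbitrary: u)
    case (Letter l)
    then show ?case using ad by auto
  next
    case (Word_Br v w)
    then show ?case
      by (simp add: bracket_bracket_left) (intro cvec.subspace_diff[OF U(1)], auto)
  qed
  show ?thesis
    using w
  proof (induction w)
    case (Letter l)
    then show ?case using U by simp
  next
    case (Word_Br v w)
    show ?case
    proof (cases "c \<in> set_lie_word w")
      case True
      then show ?thesis using M Word_Br by simp
    next
      case False
      then have "- bracket (eval_word val w) (eval_word val v) \<in> U"
        using M Word_Br by (intro cvec.subspace_neg[OF U(1)]) auto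
      then show ?thesis using bracket_anti[of "eval_word val v" "eval_word val w"] by simp
    qed
  qed
qed

abbreviation lam :: "'g set" where "lam \<equiv> words (\<lambda>A. LD \<in> A \<and> LE \<in> A)"

definition adE :: "nat \<Rightarrow> 'g" where "adE j = (bracket (val LW) ^^ j) (val LE)"

definition right_normed_DE :: "nat list \<Rightarrow> 'g" where
  "right_normed_DE js = foldl (\<lambda>y j. bracket y (adE j)) (val LD) js"

definition lam_gen :: "letter list \<Rightarrow> nat list \<Rightarrow> 'g" where
  "lam_gen ls js = foldr (\<lambda>l. bracket (val l)) ls (right_normed_DE js)"

lemma adE_simps: "adE 0 = val LE" "adE (Suc j) = bracket (val LW) (adE j)"
  by (simp_all add: adE_def)

lemma right_normed_DE_simps:
  "right_normed_DE [] = val LD" "right_normed_DE (js @ [j]) = bracket (right_normed_DE js) (adE j)"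
  by (simp_all add: right_normed_DE_def)

lemma lam_gen_simps: "lam_gen [] js = right_normed_DE js" "lam_gen (l # ls) js = bracket (val l) (lam_gen ls js)"
  by (simp_all add: lam_gen_def)

lemma val_words: "P {l} \<Longrightarrow> val l \<in> words P"
  using eval_words[of "Letter l" P] by simp

lemma adE_words: "adE j \<in> words (\<lambda>A. LE \<in> A \<and> LD \<notin> A)"
proof (induction j)
  case 0
  show ?case by (simp add: adE_simps val_words)
next
  case (Suc j)
  have "val LW \<in> words (\<lambda>A. A = {LW})" by (rule val_words) simp
  from words_bracket[OF this Suc] show ?case by (simp add: adE_simps)
qed

lemma right_normed_DE_words:
  "right_normed_DE js \<in> words (\<lambda>A. LD \<in> A)" "js \<noteq> [] \<Longrightarrow> right_normed_DE js \<in> lam"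
proof (induction js rule: rev_induct)
  case Nil
  {
    case 1 show ?case by (simp add: right_normed_DE_simps val_words)
  next
    case 2 then show ?case by simp
  }
next
  case (snoc j js)
  {
    case 1 from words_bracket[OF snoc(1) adE_words] show ?case by (simp add: right_normed_DE_simps)
  next
    case 2 from words_bracket[OF snoc(1) adE_words] show ?case by (simp add: right_normed_DE_simps)
  }
qed

lemma lam_ideal: "m \<in> words (\<lambda>_. True) \<Longrightarrow> x \<in> lam \<Longrightarrow> bracket m x \<in> lam"
  by (rule words_bracket[where P = "\<lambda>_. True" and Q = "\<lambda>A. LD \<in> A \<and> LE \<in> A"]) auto

lemma lam_gen_lam: "js \<noteq> [] \<Longrightarrow> lam_gen ls js \<in> lam"
  by (induction ls) (auto simp: lam_gen_simps right_normed_DE_words intro: lam_ideal val_words)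

abbreviation lam_gens :: "'g set" where
  "lam_gens \<equiv> {lam_gen ls js | ls js. set ls \<subseteq> {LW, LD} \<and> js \<noteq> []}"

abbreviation lam_brackets :: "'g set" where
  "lam_brackets \<equiv> {bracket x y | x y. x \<in> lam \<and> y \<in> lam}"

abbreviation lam_span :: "'g set" where
  "lam_span \<equiv> cvec.span (lam_gens \<union> lam_brackets)"

lemma lam_genI: "set ls \<subseteq> {LW, LD} \<Longrightarrow> js \<noteq> [] \<Longrightarrow> lam_gen ls js \<in> lam_span"
  by (rule cvec.span_base) blast

lemma lam_bracketI: "x \<in> lam \<Longrightarrow> y \<in> lam \<Longrightarrow> bracket x y \<in> lam_span"
  by (rule cvec.span_base) blast

lemma lam_span_ad:
  assumes m: "m \<in> words (\<lambda>_. True)"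
    and gens: "\<And>ls js. set ls \<subseteq> {LW, LD} \<Longrightarrow> js \<noteq> [] \<Longrightarrow> bracket m (lam_gen ls js) \<in> lam_span"
    and s: "s \<in> lam_span"
  shows "bracket m s \<in> lam_span"
  using s
proof (rule clinear_span_mem[OF bracket_clinear_right cvec.subspace_span, rotated])
  fix x assume "x \<in> lam_gens \<union> lam_brackets"
  then show "bracket m x \<in> lam_span"
  proof
    assume "x \<in> lam_brackets"
    then obtain y z where "x = bracket y z" "y \<in> lam" "z \<in> lam" by blast
    then show ?thesis
      using lam_ideal[OF m] unfolding bracket_bracket[of m]
      by (auto intro!: cvec.span_add lam_bracketI simp: bracket_bracket[of m])
  qed (use gens in auto)
qed

lemma lam_span_ad_WD: "l \<in> {LW, LD} \<Longrightarrow> s \<in> lam_span \<Longrightarrow> bracket (val l) s \<in> lam_span"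
  by (erule lam_span_ad[rotated 2]) (use lam_genI[of "l # _"] val_words in \<open>auto simp: lam_gen_simps\<close>)

lemma lam_span_ad_E: "s \<in> lam_span \<Longrightarrow> bracket (adE a) s \<in> lam_span"
proof (erule lam_span_ad[rotated 2])
  show "adE a \<in> words (\<lambda>_. True)" for a using adE_words words_mono[of _ "\<lambda>_. True"] by blast
  fix ls and js :: "nat list" assume *: "set ls \<subseteq> {LW, LD}" "js \<noteq> []"
  show "bracket (adE a) (lam_gen ls js) \<in> lam_span"
    using *(1)
  proof (induction ls arbitrary: a)
    case Nil
    have "- lam_gen [] (js @ [a]) \<in> lam_span" by (intro cvec.span_neg lam_genI) auto
    then show ?case using bracket_anti[of "adE a" "right_normed_DE js"] by (simp add: lam_gen_simps right_normed_DE_simps)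
  next
    case (Cons l ls)
    have IH: "bracket (adE b) (lam_gen ls js) \<in> lam_span" for b using Cons by simp
    have "bracket (bracket (adE a) (val l)) (lam_gen ls js) \<in> lam_span"
    proof (cases "l = LW")
      case True
      have "- bracket (adE (Suc a)) (lam_gen ls js) \<in> lam_span" by (intro cvec.span_neg IH)
      then show ?thesis
        unfolding True bracket_anti[of "adE a" "val LW"] adE_simps by (simp add: bracket_minus_left)
    next
      case False
      then have "l = LD" using Cons.prems by auto
      moreover have "bracket (adE a) (val LD) \<in> lam"
        using words_bracket[OF adE_words val_words[of "\<lambda>A. LD \<in> A"]] by simp
      ultimately show ?thesis using lam_gen_lam[OF *(2)] by (auto intro: lam_bracketI)
    qed
    moreover have "bracket (val l) (bracket (adE a) (lam_gen ls js)) \<in> lam_span"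
      using Cons.prems by (intro lam_span_ad_WD IH) auto
    ultimately show ?case
      unfolding lam_gen_simps bracket_bracket[of "adE a"] by (rule cvec.span_add)
  qed
qed

lemma lam_span_ad_word: "s \<in> lam_span \<Longrightarrow> bracket (eval_word val w) s \<in> lam_span"
proof (induction w arbitrary: s)
  case (Letter l)
  then show ?case using lam_span_ad_WD[of l s] lam_span_ad_E[of s 0] by (cases l) (auto simp: adE_simps)
next
  case (Word_Br v w)
  then show ?case by (simp add: bracket_bracket_left cvec.span_diff)
qed

lemma right_normed_E_word:
  assumes "set_lie_word v \<subseteq> {LW, LE}" "LE \<in> set_lie_word v"
  shows "bracket (right_normed_DE js) (eval_word val v) \<in> lam_span"
proof -
  let ?W = "\<lambda>k. bracket (val LW) ^^ k"
  have lin: "clinear (\<lambda>v. bracket (right_normed_DE js) (?W k v))" for k js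
    by (rule clinear_compose[OF bracket_clinear_right clinear_funpow[OF bracket_clinear_right]])
  let ?U = "{v. \<forall>k js. bracket (right_normed_DE js) (?W k v) \<in> lam_span}"
  have UW: "bracket (val LW) v \<in> ?U" if "v \<in> ?U" for v
  proof -
    have "?W k (bracket (val LW) v) = ?W (Suc k) v" for k by (simp only: funpow_swap1 funpow.simps o_apply)
    then show ?thesis using that by (simp del: funpow.simps)
  qed
  have UE: "bracket (right_normed_DE js) (?W k (bracket (adE a) v)) \<in> lam_span" if "v \<in> ?U" for a v k js
    using that
  proof (induction k arbitrary: a v)
    case 0
    have "bracket (bracket (right_normed_DE js) (adE a)) v \<in> lam_span"
      using 0[unfolded mem_Collect_eq, rule_format, of "js @ [a]" 0] by (simp add: right_normed_DE_simps)
    moreover have "bracket (adE a) (bracket (right_normed_DE js) v) \<in> lam_span"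
      using 0[unfolded mem_Collect_eq, rule_format, of js 0] by (intro lam_span_ad_E) simp
    ultimately show ?case by (simp add: bracket_bracket[of "right_normed_DE js"] cvec.span_add)
  next
    case (Suc k)
    have "?W (Suc k) (bracket (adE a) v) = ?W k (bracket (adE (Suc a)) v + bracket (adE a) (bracket (val LW) v))"
      unfolding adE_simps bracket_bracket[of "val LW" "adE a" v, symmetric]
      by (simp only: funpow_swap1 funpow.simps o_apply)
    then have "bracket (right_normed_DE js) (?W (Suc k) (bracket (adE a) v))
      = bracket (right_normed_DE js) (?W k (bracket (adE (Suc a)) v))
        + bracket (right_normed_DE js) (?W k (bracket (adE a) (bracket (val LW) v)))"
      by (simp only: clinear_add[OF lin])
    then show ?case using Suc.IH Suc.prems UW by (simp only: cvec.span_add)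
  qed
  have "eval_word val v \<in> ?U"
  proof (rule word_closure[OF _ _ _ _ assms])
    show "cvec.subspace ?U"
      by (rule cvec.subspaceI)
        (auto simp: clinear_0[OF lin] clinear_add[OF lin] clinear_scaleC[OF lin]
          intro: cvec.span_zero cvec.span_add cvec.span_scale)
    have "lam_gen [] (js @ [k]) \<in> lam_span" for js k by (intro lam_genI) auto
    then show "val LE \<in> ?U" by (simp add: lam_gen_simps right_normed_DE_simps adE_def)
    show "bracket (val LW) u \<in> ?U" if "u \<in> ?U" for u using that by (rule UW)
    show "bracket (val LE) u \<in> ?U" if "u \<in> ?U" for u using UE[OF that, where a = 0] by (simp add: adE_simps)
  qed
  then have "bracket (right_normed_DE js) (?W 0 (eval_word val v)) \<in> lam_span" by blast
  then show ?thesis by simp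
qed

lemma bracket_D_E_word:
  assumes u: "set_lie_word u \<subseteq> {LW, LD}" "LD \<in> set_lie_word u"
    and v: "set_lie_word v \<subseteq> {LW, LE}" "LE \<in> set_lie_word v"
  shows "bracket (eval_word val u) (eval_word val v) \<in> lam_span"
proof -
  let ?U = "{x. (\<forall>s\<in>lam_span. bracket x s \<in> lam_span) \<and>
    (\<forall>v. set_lie_word v \<subseteq> {LW, LE} \<longrightarrow> LE \<in> set_lie_word v \<longrightarrow> bracket x (eval_word val v) \<in> lam_span)}"
  have D: "bracket (val LD) (eval_word val v) \<in> lam_span"
    if "set_lie_word v \<subseteq> {LW, LE}" "LE \<in> set_lie_word v" for v
    using right_normed_E_word[OF that, of "[]"] by (simp add: right_normed_DE_simps)
  have "eval_word val u \<in> ?U"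
  proof (rule word_closure[OF _ _ _ _ u])
    show "cvec.subspace ?U"
      by (rule cvec.subspaceI)
        (auto simp: bracket_add_left bracket_scaleC_left intro: cvec.span_zero cvec.span_add cvec.span_scale)
    show "val LD \<in> ?U" using D lam_span_ad_WD by auto
    show "bracket (val LW) x \<in> ?U" if "x \<in> ?U" for x
    proof -
      have "bracket x (bracket (val LW) (eval_word val v)) \<in> lam_span"
        if "set_lie_word v \<subseteq> {LW, LE}" "LE \<in> set_lie_word v" for v
      proof -
        have "\<forall>v. set_lie_word v \<subseteq> {LW, LE} \<longrightarrow> LE \<in> set_lie_word v \<longrightarrow> bracket x (eval_word val v) \<in> lam_span"
          using \<open>x \<in> ?U\<close> by blast
        from this[rule_format, of "Word_Br (Letter LW) v"] show ?thesis using that by simp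
      qed
      then show ?thesis
        using that by (auto simp: bracket_bracket_left intro!: cvec.span_diff lam_span_ad_WD)
    qed
    show "bracket (val LD) x \<in> ?U" if "x \<in> ?U" for x
      using that D by (auto simp: bracket_bracket_left intro!: cvec.span_diff lam_span_ad_WD)
  qed
  then show ?thesis using v by blast
qed

lemma lam_subset_span: "lam \<subseteq> lam_span"
proof -
  have sub: "LE \<notin> A \<Longrightarrow> A \<subseteq> {LW, LD}" "LD \<notin> A \<Longrightarrow> A \<subseteq> {LW, LE}" for A
    using UNIV_letter by auto
  have "eval_word val w \<in> lam_span" if "LD \<in> set_lie_word w" "LE \<in> set_lie_word w" for w
    using that
  proof (induction w)
    case (Word_Br v w)
    have swap: "bracket x y \<in> lam_span" if "bracket y x \<in> lam_span" for x y
      using cvec.span_neg[OF that] bracket_anti[of x y] by simp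
    consider "LD \<in> set_lie_word w \<and> LE \<in> set_lie_word w" | "LD \<in> set_lie_word v \<and> LE \<in> set_lie_word v"
      | "LD \<in> set_lie_word v \<and> LE \<notin> set_lie_word v \<and> LE \<in> set_lie_word w \<and> LD \<notin> set_lie_word w"
      | "LD \<in> set_lie_word w \<and> LE \<notin> set_lie_word w \<and> LE \<in> set_lie_word v \<and> LD \<notin> set_lie_word v"
      using Word_Br.prems by auto
    then show ?case
    proof cases
      case 1 then show ?thesis using Word_Br.IH(2) lam_span_ad_word by simp
    next
      case 2 then show ?thesis using Word_Br.IH(1) lam_span_ad_word by (simp add: swap)
    next
      case 3 then show ?thesis using sub by (simp add: bracket_D_E_word)
    next
      case 4 then show ?thesis using sub by (simp add: swap[OF bracket_D_E_word])
    qed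
  qed auto
  then show ?thesis
    unfolding words_def by (intro cvec.span_minimal cvec.subspace_span) auto
qed

text \<open>\<open>dual_word\<close> recovers the coefficients of the generators \<open>lam_gen\<close> of \<open>\<lambda>\<close> modulo \<open>[\<lambda>, \<lambda>]\<close>;
  \<open>right_word w y\<close> lets the word \<open>w\<close> act on \<open>y\<close> so that \<open>adE j\<close> followed by \<open>w\<close> sends \<open>y\<close> to
  the action of \<open>w\<close> on \<open>[y, adE j]\<close>.\<close>
primrec right_word :: "letter list \<Rightarrow> 'g \<Rightarrow> 'g" where
  "right_word [] y = y"
| "right_word (l # w) y = (case l of LW \<Rightarrow> bracket (val LW) (right_word w y) - right_word w (bracket (val LW) y)
    | LE \<Rightarrow> right_word w (bracket y (val LE)) | LD \<Rightarrow> 0)"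

primrec dual_word :: "letter list \<Rightarrow> 'g" where
  "dual_word [] = 0"
| "dual_word (l # w) = (case l of LW \<Rightarrow> bracket (val LW) (dual_word w)
    | LD \<Rightarrow> if LD \<in> set w then bracket (val LD) (dual_word w) else right_word w (val LD) | LE \<Rightarrow> 0)"

lemma right_word_diff: "right_word w (x - y) = right_word w x - right_word w y"
  by (induction w arbitrary: x y)
    (auto simp: bracket_diff_right bracket_diff_left split: letter.split)

lemma right_word_snoc_W: "right_word (w @ [LW]) y = 0"
  by (induction w arbitrary: y) (auto split: letter.split)

lemma dual_word_snoc_W: "dual_word (w @ [LW]) = 0"
  by (induction w) (auto simp: right_word_snoc_W split: letter.split)

lemma dual_word_E_D: "LE \<in> set u \<Longrightarrow> LD \<in> set v \<Longrightarrow> dual_word (u @ v) = 0"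
  by (induction u) (auto split: letter.split)

lemma dual_word_nonzero:
  "dual_word u \<noteq> 0 \<Longrightarrow> LD \<in> set u \<Longrightarrow> LE \<in> set u \<Longrightarrow>
    \<exists>p q. u = p @ LD # q @ [LE] \<and> set p \<subseteq> {LW, LD} \<and> set q \<subseteq> {LW, LE}"
proof (induction u)
  case (Cons l u)
  show ?case
  proof (cases "LD \<in> set u \<and> l \<noteq> LE")
    case True
    then have "dual_word u \<noteq> 0" "LE \<in> set u" using Cons.prems by (cases l; auto)+
    then obtain p q where "u = p @ LD # q @ [LE]" "set p \<subseteq> {LW, LD}" "set q \<subseteq> {LW, LE}"
      using Cons.IH True by blast
    then show ?thesis using True by (intro exI[of _ "l # p"] exI[of _ q]) (cases l; simp)
  next
    case False
    then have l: "l = LD" "LD \<notin> set u" and 0: "right_word u (val LD) \<noteq> 0" and "u \<noteq> []"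
      using Cons.prems by (cases l; auto)+
    then obtain q c where u: "u = q @ [c]" by (cases u rule: rev_cases) auto
    have "c = LE" using 0 l(2) right_word_snoc_W by (cases c) (auto simp: u)
    moreover have "set q \<subseteq> {LW, LE}" using l(2) UNIV_letter by (auto simp: u)
    ultimately show ?thesis using u l by (intro exI[of _ "[]"] exI[of _ q]) simp
  qed
qed simp

lemma right_word_adE:
  "fin f \<Longrightarrow> fext (\<lambda>w. right_word w y) (app (rho (adE j)) f) = fext (\<lambda>w. right_word w (bracket y (adE j))) f"
proof (induction j arbitrary: y f)
  case 0
  show ?case by (simp add: adE_simps rho_val fext_lmul)
next
  case (Suc j)
  let ?s = "\<lambda>y f. fext (\<lambda>w. right_word w y) f" and ?W = "bracket (val LW)"
  have W: "?s y (app (lmul LW) f) = ?W (?s y f) - ?s (?W y) f" for y f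
    by (simp add: fext_lmul fext_minus_right fext_clinear[OF bracket_clinear_right])
  have "?s y (app (rho (adE (Suc j))) f)
      = ?s y (app (lmul LW) (app (rho (adE j)) f)) - ?s y (app (rho (adE j)) (app (lmul LW) f))"
    unfolding adE_simps rho_bracket app_simps rho_val[OF UNIV_I]
    using Suc.prems fin_rho_words[OF adE_words] by (intro fext_diff fin_lmul) (auto intro: fin_lmul)
  also have "\<dots> = ?s (?W (bracket y (adE j))) f - ?s (bracket (?W y) (adE j)) f"
    using Suc by (simp add: W Suc.IH fin_lmul)
  also have "\<dots> = ?s (bracket y (adE (Suc j))) f"
    unfolding fext_minus_right[symmetric] right_word_diff[symmetric] adE_simps
    by (simp add: bracket_bracket[of "val LW" y])
  finally show ?case .
qed

lemma dual_word_right_normed: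
  "fin f \<Longrightarrow> (\<And>w. f w \<noteq> 0 \<Longrightarrow> LD \<notin> set w) \<Longrightarrow>
    fext dual_word (app (rho (right_normed_DE js)) f) = fext (\<lambda>w. right_word w (right_normed_DE js)) f"
proof (induction js arbitrary: f rule: rev_induct)
  case Nil
  show ?case
    unfolding right_normed_DE_simps rho_val[OF UNIV_I] fext_lmul by (rule fext_cong) (simp add: Nil)
next
  case (snoc j js)
  let ?y = "right_normed_DE js"
  note y = right_normed_DE_words(1)[of js]
  have fE: "fin (app (rho (adE j)) f)" by (rule fin_rho_words[OF adE_words snoc.prems(1)])
  have fy: "fin (app (rho ?y) f)" by (rule fin_rho_words[OF y snoc.prems(1)])
  have noD: "LD \<notin> set w" if "app (rho (adE j)) f w \<noteq> 0" for w
    using rho_words_support[OF adE_words that] snoc.prems(2) by auto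
  have "fext dual_word (app (rho (adE j)) (app (rho ?y) f)) = 0"
  proof (rule fext_eq_0)
    fix w assume "app (rho (adE j)) (app (rho ?y) f) w \<noteq> 0"
    from rho_words_support[OF adE_words this] obtain p q where pq: "w = p @ q" "LE \<in> set p" "app (rho ?y) f q \<noteq> 0"
      by blast
    from rho_words_support[OF y pq(3)] have "LD \<in> set q" by auto
    then show "dual_word w = 0" using pq dual_word_E_D by simp
  qed
  then have "fext dual_word (app (rho (right_normed_DE (js @ [j]))) f)
      = fext dual_word (app (rho ?y) (app (rho (adE j)) f))"
    unfolding right_normed_DE_simps rho_bracket app_simps
    by (simp only: fext_diff[OF fin_rho_words[OF y fE] fin_rho_words[OF adE_words fy]]) simp
  also have "\<dots> = fext (\<lambda>w. right_word w ?y) (app (rho (adE j)) f)" by (rule snoc.IH[OF fE noD])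
  also have "\<dots> = fext (\<lambda>w. right_word w (right_normed_DE (js @ [j]))) f"
    unfolding right_normed_DE_simps by (rule right_word_adE[OF snoc.prems(1)])
  finally show ?case .
qed

lemma dual_word_lam_gen:
  assumes "js \<noteq> []"
  shows "set ls \<subseteq> {LW, LD} \<Longrightarrow> fext dual_word (ser (lam_gen ls js)) = lam_gen ls js"
proof (induction ls)
  case Nil
  show ?case
    unfolding lam_gen_simps ser_def
    by (subst dual_word_right_normed[OF fin_delta]) (simp add: delta_def split: if_splits, simp add: fext_delta)
next
  case (Cons l ls)
  let ?z = "lam_gen ls js"
  note z = lam_gen_lam[OF assms, of ls]
  have "fext dual_word (app (rho ?z) (delta [l])) = 0"
  proof (rule fext_eq_0)
    fix w assume "app (rho ?z) (delta [l]) w \<noteq> 0"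
    from rho_words_support[OF z this] obtain p where "w = p @ [l]" "LE \<in> set p"
      by (auto simp: delta_def split: if_splits)
    then show "dual_word w = 0"
      using Cons.prems dual_word_snoc_W dual_word_E_D[of p "[LD]"] by auto
  qed
  then have "fext dual_word (ser (lam_gen (l # ls) js)) = fext dual_word (app (lmul l) (ser ?z))"
    unfolding lam_gen_simps ser_bracket rho_val[OF UNIV_I] ser_val[OF UNIV_I]
    by (simp only: fext_diff[OF fin_lmul[OF fin_ser_words[OF z]] fin_rho_words[OF z fin_delta]]) simp
  also have "\<dots> = fext (\<lambda>w. bracket (val l) (dual_word w)) (ser ?z)"
    unfolding fext_lmul using Cons.prems ser_words_support[OF z] by (intro fext_cong) auto
  also have "\<dots> = bracket (val l) (fext dual_word (ser ?z))" by (rule fext_clinear[OF bracket_clinear_right])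
  finally show ?case using Cons by (simp add: lam_gen_simps)
qed

lemma ser_lam_bracket:
  assumes "x \<in> lam" "y \<in> lam" "ser (bracket x y) w \<noteq> 0"
  shows "\<exists>p q. w = p @ q \<and> LE \<in> set p \<and> LD \<in> set q"
proof -
  have "app (rho x) (ser y) w \<noteq> 0 \<or> app (rho y) (ser x) w \<noteq> 0"
    using assms(3) unfolding ser_bracket by auto
  then show ?thesis
    using rho_words_support[OF assms(1), of "ser y" w] rho_words_support[OF assms(2), of "ser x" w]
      ser_words_support[OF assms(1)] ser_words_support[OF assms(2)] by blast
qed

theorem lam_in_bracket_space:
  assumes g: "g \<in> lam"
    and 0: "\<And>p q. set p \<subseteq> {LW, LD} \<Longrightarrow> set q \<subseteq> {LW, LE} \<Longrightarrow> ser g (p @ LD # q @ [LE]) = 0"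
  shows "g \<in> bracket_space lam lam"
proof -
  have sub: "cvec.subspace (bracket_space lam lam)" by (simp add: bracket_space_def)
  have "g \<in> lam_span" using g lam_subset_span by blast
  then have "fext dual_word (ser g) - g \<in> bracket_space lam lam"
  proof (rule fext_ser_id[OF _ sub])
    fix b assume b: "b \<in> lam_gens \<union> lam_brackets"
    have "b \<in> lam" using b lam_gen_lam lam_ideal words_mono[of _ "\<lambda>_. True"] by blast
    then show "fin (ser b)" by (rule fin_ser_words)
    show "fext dual_word (ser b) - b \<in> bracket_space lam lam"
      using b
    proof
      assume "b \<in> lam_gens"
      then show ?thesis using dual_word_lam_gen cvec.subspace_0[OF sub] by auto
    next
      assume b: "b \<in> lam_brackets"
      then have "fext dual_word (ser b) = 0"
        using ser_lam_bracket dual_word_E_D by (intro fext_eq_0) blast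
      moreover have "b \<in> bracket_space lam lam"
        unfolding bracket_space_def using b by (rule cvec.span_base)
      ultimately show ?thesis using cvec.subspace_neg[OF sub] by simp
    qed
  qed
  moreover have "fext dual_word (ser g) = 0"
  proof (rule fext_eq_0, rule ccontr)
    fix u assume u: "ser g u \<noteq> 0" "dual_word u \<noteq> 0"
    then have "LD \<in> set u" "LE \<in> set u" using ser_words_support[OF g] by auto
    then show False using dual_word_nonzero[OF u(2)] 0 u(1) by blast
  qed
  ultimately have "- g \<in> bracket_space lam lam" by simp
  from cvec.subspace_neg[OF sub this] show ?thesis by simp
qed

end

section \<open>The joint kernel of the formal polylogarithms\<close>

lemma block_wordI:
  assumes "set w \<subseteq> {LW, c}" "c \<noteq> LW"
  shows "\<exists>as. (\<forall>a\<in>set as. 1 \<le> a) \<and> w @ [c] = block_word c as"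
  using assms(1)
proof (induction w)
  case Nil
  show ?case by (intro exI[of _ "[1]"]) simp
next
  case (Cons x w)
  then obtain as where as: "\<forall>a\<in>set as. 1 \<le> a" "w @ [c] = block_word c as" by auto
  show ?case
  proof (cases "x = c")
    case True
    then show ?thesis using as by (intro exI[of _ "1 # as"]) simp
  next
    case False
    then have x: "x = LW" using Cons.prems by simp
    obtain a as' where a: "as = a # as'" using as(2) by (cases as) auto
    then obtain n where "a = Suc n" using as(1) by (cases a) auto
    then show ?thesis using as x a by (intro exI[of _ "Suc a # as'"]) simp
  qed
qed

lemma block_word_neq_W: "block_word c as \<noteq> [LW]" if "c \<noteq> LW"
proof
  assume *: "block_word c as = [LW]"
  then have "as \<noteq> []" by auto
  then have "c \<in> set (block_word c as)" by (cases as) auto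
  then show False using that * by simp
qed

context one_point
begin

theorem k_space1: "(k_space :: 'n pt braid_lie set) = cvec.span {gen Beta Omega}"
proof -
  define val where "val l = (case l of LW \<Rightarrow> YW | LD \<Rightarrow> YD | LE \<Rightarrow> 0)" for l
  interpret letter_rep val "braid_lift edge4" "{LW, LD}"
  proof
    show "lie_hom (braid_lift edge4)" by (rule lie_hom_braid_lift[OF r4.rel])
    show "l \<in> {LW, LD} \<Longrightarrow> braid_lift edge4 (val l) = lmul l" for l
      using rep4_gens by (auto simp: val_def)
  qed
  have wc: "r4.wc w (emb x) = ser x w" for w x
    by (simp add: r4.wc_def r4.act_emb ser_def)
  have all: "x \<in> words (\<lambda>A. A \<subseteq> {LW, LD})" for x
  proof (induction x rule: braid_lie_induct)
    case (gen a b)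
    have "val LW \<in> words (\<lambda>A. A \<subseteq> {LW, LD})" "val LD \<in> words (\<lambda>A. A \<subseteq> {LW, LD})"
      using eval_words[of "Letter LW" "\<lambda>A. A \<subseteq> {LW, LD}"] eval_words[of "Letter LD" "\<lambda>A. A \<subseteq> {LW, LD}"] by simp_all
    then have "{YW, YD} \<subseteq> words (\<lambda>A. A \<subseteq> {LW, LD})" by (simp add: val_def)
    then show ?case
      by (rule set_mp[OF cvec.span_minimal[OF _ subspace_words] gen_span_four[OF UNIV_pt4]]) simp
  next
    case (bracket x y)
    then show ?case by (rule words_bracket) auto
  qed (simp_all add: cvec.subspace_add[OF subspace_words] cvec.subspace_scale[OF subspace_words])
  have "x \<in> cvec.span {YW}" if x: "\<And>as. \<forall>a\<in>set as. 1 \<le> a \<Longrightarrow> ser x (block_word LD as) = 0" for x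
  proof -
    obtain y z where yz: "x = y + z" and y: "y \<in> words (\<lambda>A. A \<subseteq> {LW})"
      and z: "z \<in> words (\<lambda>A. LD \<in> A \<and> A \<subseteq> {LW, LD})"
      by (rule words_split[OF all[of x], where Q = "\<lambda>A. A \<subseteq> {LW}" and Q' = "\<lambda>A. LD \<in> A \<and> A \<subseteq> {LW, LD}"]) auto
    have "z = 0"
    proof (rule words_eq_0[where c = LD])
      show "z \<in> words (\<lambda>A. LD \<in> A)" by (rule set_mp[OF words_mono z]) simp
      fix w
      show "ser z (w @ [LD]) = 0"
      proof (cases "set w \<subseteq> {LW, LD}")
        case True
        obtain as where "\<forall>a\<in>set as. 1 \<le> a" "w @ [LD] = block_word LD as"
          using block_wordI[OF True] by auto
        then have "ser x (w @ [LD]) = 0" using x by simp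
        moreover have "ser y (w @ [LD]) = 0" using ser_words_support[OF y, of "w @ [LD]"] by auto
        ultimately show ?thesis by (simp add: yz clinear_add[OF clinear_ser])
      next
        case False
        then show ?thesis using ser_words_support[OF z, of "w @ [LD]"] by auto
      qed
    qed
    then show ?thesis using y words_W yz by (auto simp: val_def)
  qed
  moreover have "ser x (block_word LD as) = 0" if "x \<in> cvec.span {YW}" for x as
    using that
  proof (rule clinear_zero_on_span[OF clinear_compose[OF clinear_fun_apply clinear_ser], rotated])
    have "ser (val LW) = delta [LW]" by (rule ser_val) simp
    then show "ser y (block_word LD as) = 0" if "y \<in> {YW}" for y
      using that block_word_neq_W[of LD as] by (simp add: val_def delta_def)
  qed
  ultimately show ?thesis
    unfolding gen_rows4(1) by (auto simp: mem_k_space1 wc)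
qed

end

context two_points
begin

definition letter_pt :: "letter \<Rightarrow> 'n pt" where
  "letter_pt l = (case l of LW \<Rightarrow> Omega | LD \<Rightarrow> Pt i2 | LE \<Rightarrow> Pt i1)"

abbreviation val5 :: "letter \<Rightarrow> 'n pt braid_lie" where "val5 l \<equiv> gen (letter_pt l) Beta"

abbreviation rep5 :: "'n pt braid_lie \<Rightarrow> endo" where
  "rep5 \<equiv> braid_lift (edge5 i1 i2 (der KA) (der KC) (lmul LW) (lmul LD) (lmul LE))"

lemma val5: "val5 LW = XW" "val5 LD = XD" "val5 LE = XE"
  by (simp_all add: letter_pt_def gen_sym[of Omega])

sublocale fr: free_letter_rep val5 rep5
proof
  show "lie_hom rep5" by (rule lie_hom_braid_lift[OF r5.rel])
  show "rep5 (val5 l) = lmul l" for l by (cases l) (simp_all only: val5 rep5_gens)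
qed

lemma wc_ser: "r5.wc w (emb x) = fr.ser x w"
  by (simp add: r5.wc_def r5.act_emb fr.ser_def)

lemma lambda_ideal_eq: "lambda_ideal i1 i2 = fr.lam"
proof -
  have ev: "eval_word (\<lambda>v. gen v Beta) (map_lie_word letter_pt w) = eval_word val5 w" for w
    by (induction w) simp_all
  have ex: "\<exists>w. v = map_lie_word letter_pt w" if "set_lie_word v \<subseteq> {Pt i1, Pt i2, Omega}" for v
    using that
  proof (induction v)
    case (Letter p)
    then have "p = letter_pt LE \<or> p = letter_pt LD \<or> p = letter_pt LW" by (auto simp: letter_pt_def)
    then show ?case by (metis lie_word.simps(9))
  next
    case (Word_Br v w)
    then obtain v' w' where "v = map_lie_word letter_pt v'" "w = map_lie_word letter_pt w'" by auto
    then show ?case by (intro exI[of _ "Word_Br v' w'"]) simp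
  qed
  have rng: "set_lie_word (map_lie_word letter_pt w) \<subseteq> {Pt i1, Pt i2, Omega}" for w
    by (auto simp: lie_word.set_map letter_pt_def split: letter.split)
  have pt: "letter_pt l = Pt i1 \<longleftrightarrow> l = LE" "letter_pt l = Pt i2 \<longleftrightarrow> l = LD" for l
    by (cases l; simp add: letter_pt_def neq)+
  have mem: "Pt i1 \<in> set_lie_word (map_lie_word letter_pt w) \<longleftrightarrow> LE \<in> set_lie_word w"
    "Pt i2 \<in> set_lie_word (map_lie_word letter_pt w) \<longleftrightarrow> LD \<in> set_lie_word w" for w
    by (simp_all add: lie_word.set_map image_iff eq_commute[of "Pt _"] pt)
  have "{eval_word (\<lambda>v. gen v Beta) w |w. set_lie_word w \<subseteq> {Pt i1, Pt i2, Omega} \<and>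
      Pt i1 \<in> set_lie_word w \<and> Pt i2 \<in> set_lie_word w}
    = {eval_word val5 w |w. set_lie_word w \<subseteq> UNIV \<and> LD \<in> set_lie_word w \<and> LE \<in> set_lie_word w}"
    (is "?L = ?R")
  proof (intro subset_antisym subsetI)
    fix x assume "x \<in> ?L"
    then obtain v where v: "x = eval_word (\<lambda>v. gen v Beta) v" "set_lie_word v \<subseteq> {Pt i1, Pt i2, Omega}"
      "Pt i1 \<in> set_lie_word v" "Pt i2 \<in> set_lie_word v" by blast
    obtain w where "v = map_lie_word letter_pt w" using ex[OF v(2)] by blast
    then show "x \<in> ?R" using v ev mem by blast
  next
    fix x assume "x \<in> ?R"
    then obtain w where "x = eval_word val5 w" "LD \<in> set_lie_word w" "LE \<in> set_lie_word w" by blast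
    then show "x \<in> ?L" using ev[of w, symmetric] rng mem by blast
  qed
  then show ?thesis unfolding lambda_ideal_def fr.words_def by (simp only:)
qed

abbreviation (input) "PA \<equiv> gen Alpha' (Pt' i1)"
abbreviation (input) "PC \<equiv> gen (Pt' i1) (Pt' i2)"

lemma dist4: "distinct [Alpha', Pt' i1, Pt' i2, Omega' :: 'n pt']"
  by (simp add: neq)

lemma lie_hom_sect: "lie_hom (sect :: 'n pt' braid_lie \<Rightarrow> 'n pt braid_lie)"
  and sect_gens: "sect PA = XA" "sect PC = XC"
proof -
  let ?P = "\<lambda>s :: 'n pt' braid_lie \<Rightarrow> 'n pt braid_lie. lie_hom s \<and> (\<forall>i. i \<noteq> Max UNIV \<longrightarrow> s (gen Alpha' (Pt' i)) = gen Alpha (Pt i)) \<and>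
     (\<forall>i j. i < j \<longrightarrow> s (gen (Pt' i) (Pt' j)) = gen (Pt i) (Pt j))"
  let ?s = "braid_lift (edge_four Alpha' (Pt' i1) (Pt' i2) Omega' XA XC)"
  have max: "Max UNIV = i2" using less by (simp add: UNIV_n)
  have gens: "?s PA = XA" "?s PC = XC" by (rule braid_lift_edge_four[OF UNIV_pt4 dist4])+
  have hom: "lie_hom ?s" by (rule lie_hom_braid_lift[OF braid_relations_edge_four[OF UNIV_pt4 dist4]])
  have pairs: "i = i1 \<and> j = i2" if "i < j" for i j
    using that n_cases[of i] n_cases[of j] less by auto
  have P: "?P ?s"
  proof (intro conjI allI impI hom)
    show "?s (gen Alpha' (Pt' i)) = gen Alpha (Pt i)" if "i \<noteq> Max UNIV" for i
      using that n_cases[of i] gens max by auto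
    show "?s (gen (Pt' i) (Pt' j)) = gen (Pt i) (Pt j)" if "i < j" for i j
      using pairs[OF that] gens by simp
  qed
  have "sect = ?s"
    unfolding sect_def
  proof (rule the_equality[where P = ?P, OF P])
    fix s :: "'n pt' braid_lie \<Rightarrow> 'n pt braid_lie" assume s: "?P s"
    show "s = ?s"
      by (rule lie_hom_eq_four[OF UNIV_pt4 dist4]) (use s hom gens max less neq in auto)
  qed
  then show "lie_hom (sect :: 'n pt' braid_lie \<Rightarrow> 'n pt braid_lie)" "sect PA = XA" "sect PC = XC"
    using hom gens by simp_all
qed

lemmas sect_linear = lie_hom_clinear[OF lie_hom_sect]

abbreviation proj5 :: "'n pt braid_lie \<Rightarrow> 'n pt' braid_lie" where
  "proj5 \<equiv> braid_lift (edge5 i1 i2 PA PC 0 0 0)"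

lemma proj5:
  shows lie_hom_proj5: "lie_hom proj5" and proj5_sect: "proj5 (sect z) = z"
    and proj5_words: "x \<in> fr.words P \<Longrightarrow> proj5 x = 0"
proof -
  have rel: "braid_relations (edge5 i1 i2 PA PC 0 0 0)"
    by (rule braid_relations_edge5) (simp add: relations5_def)
  show hom: "lie_hom proj5" by (rule lie_hom_braid_lift[OF rel])
  have gens: "proj5 XA = PA" "proj5 XC = PC" "proj5 XW = 0" "proj5 XD = 0" "proj5 XE = 0"
    by (simp_all add: braid_lift_gen[OF rel] edge5_def doubleton_eq_iff neq)
  have "lie_hom (\<lambda>z. proj5 (sect z))"
    using hom lie_hom_sect clinear_compose[of proj5 sect] by (simp add: lie_hom_def)
  moreover have "lie_hom (\<lambda>z :: 'n pt' braid_lie. z)" by (simp add: lie_hom_def clinear_iff)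
  ultimately have "(\<lambda>z. proj5 (sect z)) = (\<lambda>z. z)"
    by (rule lie_hom_eq_four[OF UNIV_pt4 dist4]) (simp_all add: sect_gens gens)
  then show "proj5 (sect z) = z" by metis
  have "proj5 (val5 l) = 0" for l by (cases l) (simp_all only: val5 gens)
  then have "proj5 (eval_word val5 w) = 0" for w
    by (induction w) (simp_all add: lie_hom_bracket[OF hom])
  then show "x \<in> fr.words P \<Longrightarrow> proj5 x = 0"
    unfolding fr.words_def by (elim clinear_zero_on_span[OF lie_hom_clinear[OF hom], rotated]) auto
qed

lemma ser_sect: "fr.ser (sect z) = 0"
proof (induction z rule: braid_lie_induct)
  case (gen a b)
  show ?case
  proof (rule clinear_zero_on_span[OF clinear_compose[OF fr.clinear_ser sect_linear] _ gen_span_four[OF UNIV_pt4 dist4]])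
    show "fr.ser (sect y) = 0" if "y \<in> {PA, PC}" for y
      using that by (auto simp: sect_gens fr.ser_def rep5_gens app_der_delta_Nil)
  qed
next
  case (bracket x y)
  then show ?case
    by (simp only: lie_hom_bracket[OF lie_hom_sect] fr.ser_bracket clinear_0[OF clinear_app]) simp
qed (simp_all only: clinear_add[OF sect_linear] clinear_scaleC[OF sect_linear] clinear_add[OF fr.clinear_ser]
    clinear_scaleC[OF fr.clinear_ser] add_0 cvec.scale_zero_right)

abbreviation all_words :: "'n pt braid_lie set" where "all_words \<equiv> fr.words (\<lambda>_. True)"

lemma all_words_bracket: "x \<in> all_words \<Longrightarrow> y \<in> all_words \<Longrightarrow> bracket x y \<in> all_words"
  by (rule fr.words_bracket[where P = "\<lambda>_. True" and Q = "\<lambda>_. True"])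

lemma all_words_derivation:
  assumes m: "\<And>l. bracket m (val5 l) \<in> all_words" and y: "y \<in> all_words"
  shows "bracket m y \<in> all_words"
  using y unfolding fr.words_def[of "\<lambda>_. True"]
proof (rule clinear_span_mem[OF bracket_clinear_right cvec.subspace_span, rotated])
  have "bracket m (eval_word val5 w) \<in> all_words" for w
  proof (induction w)
    case (Letter l)
    show ?case using m by simp
  next
    case (Word_Br v w)
    have "eval_word val5 u \<in> all_words" for u by (rule fr.eval_words) auto
    then show ?case
      using Word_Br cvec.subspace_add[OF fr.subspace_words] all_words_bracket
      by (simp add: bracket_bracket[of m])
  qed
  then show "bracket m z \<in> cvec.span {eval_word val5 w |w. set_lie_word w \<subseteq> UNIV \<and> True}"
    if "z \<in> {eval_word val5 w |w. set_lie_word w \<subseteq> UNIV \<and> True}" for z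
    using that unfolding fr.words_def by auto
qed

lemma val5_words: "XW \<in> all_words" "XD \<in> all_words" "XE \<in> all_words"
  using fr.val_words[of "\<lambda>_. True" LW] fr.val_words[of "\<lambda>_. True" LD] fr.val_words[of "\<lambda>_. True" LE]
  by (simp_all add: val5)

lemma sect_all_words: "y \<in> all_words \<Longrightarrow> bracket (sect z) y \<in> all_words"
proof (induction z arbitrary: y rule: braid_lie_induct)
  case (gen a b)
  note rels = relations5_gen[unfolded relations5_def]
  have ED: "bracket XE XD \<in> all_words" "bracket XD XE \<in> all_words" "bracket (XD + XW) XE \<in> all_words"
    by (intro all_words_bracket val5_words cvec.subspace_add[OF fr.subspace_words])+
  have "bracket XA (val5 l) \<in> all_words" "bracket XC (val5 l) \<in> all_words" for l
    using rels ED cvec.subspace_0[OF fr.subspace_words] by (cases l; simp only: val5)+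
  then have "bracket (sect x) y \<in> all_words" if "x \<in> {PA, PC}" for x
    using that all_words_derivation[OF _ gen] by (auto simp: sect_gens)
  then show ?case
    by (rule clinear_span_mem[OF clinear_compose[OF bracket_clinear_left sect_linear] fr.subspace_words _ gen_span_four[OF UNIV_pt4 dist4]])
next
  case (add x z)
  then show ?case
    by (simp add: clinear_add[OF sect_linear] bracket_add_left cvec.subspace_add[OF fr.subspace_words])
next
  case (scale c x)
  then show ?case
    by (simp add: clinear_scaleC[OF sect_linear] bracket_scaleC_left cvec.subspace_scale[OF fr.subspace_words])
next
  case (bracket x z)
  then show ?case
    by (simp add: lie_hom_bracket[OF lie_hom_sect] bracket_bracket_left cvec.subspace_diff[OF fr.subspace_words])
qed

lemma words_plus_sect: "\<exists>y\<in>all_words. \<exists>z. x = y + sect z"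
proof (induction x rule: braid_lie_induct)
  case (gen a b)
  let ?G = "{x. \<exists>y\<in>all_words. \<exists>z. x = y + sect z}"
  note sub = fr.subspace_words
  have "cvec.subspace ?G"
  proof (rule cvec.subspaceI)
    show "0 \<in> ?G" using cvec.subspace_0[OF sub] clinear_0[OF sect_linear] by force
    show "x + x' \<in> ?G" if xx: "x \<in> ?G" "x' \<in> ?G" for x x'
    proof -
      obtain y z y' z' where "x = y + sect z" "y \<in> all_words" "x' = y' + sect z'" "y' \<in> all_words"
        using xx by blast
      then have "y + y' \<in> all_words" "x + x' = (y + y') + sect (z + z')"
        by (simp_all add: clinear_add[OF sect_linear] cvec.subspace_add[OF sub])
      then show ?thesis by blast
    qed
    show "c *\<^sub>C x \<in> ?G" if xx: "x \<in> ?G" for c x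
    proof -
      obtain y z where "x = y + sect z" "y \<in> all_words" using xx by blast
      then have "c *\<^sub>C y \<in> all_words" "c *\<^sub>C x = c *\<^sub>C y + sect (c *\<^sub>C z)"
        by (simp_all add: clinear_scaleC[OF sect_linear] scaleC_add_right cvec.subspace_scale[OF sub])
      then show ?thesis by blast
    qed
  qed
  moreover have "x \<in> ?G" if "x \<in> all_words" for x
  proof -
    have "x = x + sect 0" by (simp add: clinear_0[OF sect_linear])
    then show ?thesis using that by blast
  qed
  moreover have "x \<in> ?G" if "x = sect z" for x z
  proof -
    have "x = 0 + sect z" using that by simp
    then show ?thesis using cvec.subspace_0[OF sub] by blast
  qed
  ultimately have "cvec.span {XA, XC, XW, XD, XE} \<subseteq> ?G"
    using val5_words sect_gens[symmetric] by (intro cvec.span_minimal) auto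
  then show ?case using gen_span5[of a b] by blast
next
  case (add x x')
  then obtain y z y' z' where "x = y + sect z" "y \<in> all_words" "x' = y' + sect z'" "y' \<in> all_words" by blast
  then have "y + y' \<in> all_words" "x + x' = (y + y') + sect (z + z')"
    by (simp_all add: clinear_add[OF sect_linear] cvec.subspace_add[OF fr.subspace_words])
  then show ?case by blast
next
  case (scale c x)
  then obtain y z where "x = y + sect z" "y \<in> all_words" by blast
  then have "c *\<^sub>C y \<in> all_words" "c *\<^sub>C x = c *\<^sub>C y + sect (c *\<^sub>C z)"
    by (simp_all add: clinear_scaleC[OF sect_linear] scaleC_add_right cvec.subspace_scale[OF fr.subspace_words])
  then show ?case by blast
next
  case (bracket x x')
  then obtain y z y' z' where x: "x = y + sect z" "x' = y' + sect z'" and y: "y \<in> all_words" "y' \<in> all_words" by blast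
  let ?y = "bracket y y' + (bracket (sect z) y' - bracket (sect z') y)"
  have "?y \<in> all_words"
    by (intro cvec.subspace_add[OF fr.subspace_words] cvec.subspace_diff[OF fr.subspace_words]
        all_words_bracket sect_all_words y)
  moreover have "bracket x x' = ?y + sect (bracket z z')"
    using bracket_anti[of y "sect z'"]
    by (simp add: x bracket_add_left bracket_add_right lie_hom_bracket[OF lie_hom_sect])
  ultimately show ?case by blast
qed

lemma ser_polylog_word:
  shows "fr.ser (t *\<^sub>C XW) (polylog_word as bs) = 0"
    and "x \<in> bracket_space fr.lam fr.lam \<Longrightarrow> fr.ser x (polylog_word as bs) = 0"
proof -
  have "fr.ser XW = delta [LW]" using fr.ser_val[of LW] by (simp add: val5)
  moreover have "polylog_word as bs \<noteq> [LW]"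
    using polylog_word_ends[of as bs 1] by (cases "as = [] \<and> bs = []") (auto simp: polylog_word_def)
  ultimately show "fr.ser (t *\<^sub>C XW) (polylog_word as bs) = 0"
    by (simp add: clinear_scaleC[OF fr.clinear_ser] delta_def)
  have split: "\<not> (polylog_word as bs = p @ q \<and> LE \<in> set p \<and> LD \<in> set q)" for p q
    using no_E_block_D[of bs] no_D_block_E[of as] by (auto simp: polylog_word_def append_eq_append_conv2)
  show "fr.ser x (polylog_word as bs) = 0" if "x \<in> bracket_space fr.lam fr.lam"
    using that unfolding bracket_space_def
  proof (rule clinear_zero_on_span[OF clinear_compose[OF clinear_fun_apply fr.clinear_ser], rotated])
    show "fr.ser y (polylog_word as bs) = 0" if "y \<in> fr.lam_brackets" for y
      using that fr.ser_lam_bracket split by blast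
  qed
qed

lemma words_annihilated:
  assumes y: "y \<in> all_words"
    and 0: "\<And>as bs. \<forall>a\<in>set (as @ bs). 1 \<le> a \<Longrightarrow> fr.ser y (polylog_word as bs) = 0"
  obtains t b where "y = t *\<^sub>C XW + b" "b \<in> bracket_space fr.lam fr.lam"
proof -
  obtain y3 r where y3: "y = y3 + r" "y3 \<in> fr.lam" and r: "r \<in> fr.words (\<lambda>A. \<not> (LD \<in> A \<and> LE \<in> A))"
    by (rule fr.words_split[OF y, where Q = "\<lambda>A. LD \<in> A \<and> LE \<in> A" and Q' = "\<lambda>A. \<not> (LD \<in> A \<and> LE \<in> A)"]) auto
  obtain y1 r' where y1: "r = y1 + r'" "y1 \<in> fr.words (\<lambda>A. LD \<in> A \<and> LE \<notin> A)" and r': "r' \<in> fr.words (\<lambda>A. LD \<notin> A)"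
    by (rule fr.words_split[OF r, where Q = "\<lambda>A. LD \<in> A \<and> LE \<notin> A" and Q' = "\<lambda>A. LD \<notin> A"]) auto
  obtain y2 y0 where y2: "r' = y2 + y0" "y2 \<in> fr.words (\<lambda>A. LE \<in> A \<and> LD \<notin> A)"
    and y0: "y0 \<in> fr.words (\<lambda>A. A \<subseteq> {LW})"
    by (rule fr.words_split[OF r', where Q = "\<lambda>A. LE \<in> A \<and> LD \<notin> A" and Q' = "\<lambda>A. A \<subseteq> {LW}"]) (use UNIV_letter in auto)
  have ser: "fr.ser y w = fr.ser y3 w + (fr.ser y1 w + (fr.ser y2 w + fr.ser y0 w))" for w
    unfolding y3(1) y1(1) y2(1) by (simp add: clinear_add[OF fr.clinear_ser])
  note supp = fr.ser_words_support[OF y3(2)] fr.ser_words_support[OF y1(2)]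
    fr.ser_words_support[OF y2(2)] fr.ser_words_support[OF y0]
  have sub: "LE \<notin> A \<Longrightarrow> A \<subseteq> {LW, LD}" "LD \<notin> A \<Longrightarrow> A \<subseteq> {LW, LE}" for A
    using UNIV_letter by auto
  have "y1 = 0"
  proof (rule fr.words_eq_0[where c = LD])
    show "y1 \<in> fr.words (\<lambda>A. LD \<in> A)" by (rule set_mp[OF fr.words_mono y1(2)]) simp
    fix w
    show "fr.ser y1 (w @ [LD]) = 0"
    proof (cases "LE \<in> set w")
      case False
      then obtain bs where "\<forall>b\<in>set bs. 1 \<le> b" "w @ [LD] = block_word LD bs"
        using block_wordI[OF sub(1)] by blast
      then have "fr.ser y (w @ [LD]) = 0" using 0[of "[]" bs] by (simp add: polylog_word_def)
      moreover have "fr.ser y3 (w @ [LD]) = 0" "fr.ser y2 (w @ [LD]) = 0" "fr.ser y0 (w @ [LD]) = 0"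
        using supp[of "w @ [LD]"] False by auto
      ultimately show ?thesis by (simp add: ser)
    qed (use supp(2)[of "w @ [LD]"] in auto)
  qed
  moreover have "y2 = 0"
  proof (rule fr.words_eq_0[where c = LE])
    show "y2 \<in> fr.words (\<lambda>A. LE \<in> A)" by (rule set_mp[OF fr.words_mono y2(2)]) simp
    fix w
    show "fr.ser y2 (w @ [LE]) = 0"
    proof (cases "LD \<in> set w")
      case False
      then obtain as where "\<forall>a\<in>set as. 1 \<le> a" "w @ [LE] = block_word LE as"
        using block_wordI[OF sub(2)] by blast
      then have "fr.ser y (w @ [LE]) = 0" using 0[of as "[]"] by (simp add: polylog_word_def)
      moreover have "fr.ser y3 (w @ [LE]) = 0" "fr.ser y1 (w @ [LE]) = 0" "fr.ser y0 (w @ [LE]) = 0"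
        using supp[of "w @ [LE]"] False by auto
      ultimately show ?thesis by (simp add: ser)
    qed (use supp(3)[of "w @ [LE]"] in auto)
  qed
  moreover have "y3 \<in> bracket_space fr.lam fr.lam"
  proof (rule fr.lam_in_bracket_space[OF y3(2)])
    fix p q assume "set p \<subseteq> {LW, LD}" "set q \<subseteq> {LW, LE}"
    then obtain as bs where "\<forall>b\<in>set bs. 1 \<le> b" "p @ [LD] = block_word LD bs"
      "\<forall>a\<in>set as. 1 \<le> a" "q @ [LE] = block_word LE as"
      using block_wordI[of p LD] block_wordI[of q LE] by auto
    then have w: "p @ LD # q @ [LE] = polylog_word as bs" and "fr.ser y (polylog_word as bs) = 0"
      using 0[of as bs] by (auto simp: polylog_word_def append_eq_Cons_conv)
    then have "fr.ser y (p @ LD # q @ [LE]) = 0" by simp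
    moreover have "fr.ser y1 (p @ LD # q @ [LE]) = 0" "fr.ser y2 (p @ LD # q @ [LE]) = 0" "fr.ser y0 (p @ LD # q @ [LE]) = 0"
      using supp[of "p @ LD # q @ [LE]"] by auto
    ultimately show "fr.ser y3 (p @ LD # q @ [LE]) = 0" by (simp add: ser)
  qed
  moreover obtain t where "y0 = t *\<^sub>C XW"
    using y0 fr.words_W by (auto simp: val5 cvec.span_singleton)
  ultimately show ?thesis using that[of t y3] y3(1) y1(1) y2(1) by (simp add: add.commute)
qed

theorem k_space2:
  "is_direct_sum3 (k_space :: 'n pt braid_lie set) (cvec.span {gen Beta Omega})
    (bracket_space (lambda_ideal i1 i2) (lambda_ideal i1 i2)) (range (sect :: 'n pt' braid_lie \<Rightarrow> 'n pt braid_lie))"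
  unfolding is_direct_sum3_def lambda_ideal_eq
proof (intro conjI ballI impI)
  let ?B = "bracket_space fr.lam fr.lam"
  show "cvec.subspace (cvec.span {XW})" "cvec.subspace ?B"
    by (simp_all add: bracket_space_def)
  show "cvec.subspace (range (sect :: 'n pt' braid_lie \<Rightarrow> 'n pt braid_lie))"
    by (rule cvec.subspaceI)
      (auto simp flip: clinear_0[OF sect_linear] clinear_add[OF sect_linear] clinear_scaleC[OF sect_linear])
  show "k_space = {a + b + c |a b c. a \<in> cvec.span {XW} \<and> b \<in> ?B \<and> c \<in> range sect}"
  proof (intro set_eqI iffI)
    fix x assume x: "x \<in> (k_space :: 'n pt braid_lie set)"
    obtain y z where yz: "x = y + sect z" and y: "y \<in> all_words" using words_plus_sect by blast
    have "fr.ser y w = fr.ser x w" for w by (simp add: yz clinear_add[OF fr.clinear_ser] ser_sect)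
    then have "\<forall>a\<in>set (as @ bs). 1 \<le> a \<Longrightarrow> fr.ser y (polylog_word as bs) = 0" for as bs
      using x unfolding mem_k_space2 wc_ser by simp
    then obtain t b where "y = t *\<^sub>C XW + b" "b \<in> ?B" using words_annihilated[OF y] by blast
    then show "x \<in> {a + b + c |a b c. a \<in> cvec.span {XW} \<and> b \<in> ?B \<and> c \<in> range sect}"
      unfolding yz cvec.span_singleton by blast
  next
    fix x assume "x \<in> {a + b + c |a b c. a \<in> cvec.span {XW} \<and> b \<in> ?B \<and> c \<in> range sect}"
    then obtain t b z where "x = t *\<^sub>C XW + b + sect z" "b \<in> ?B" unfolding cvec.span_singleton by blast
    then have "fr.ser x (polylog_word as bs) = 0" for as bs
      by (simp add: clinear_add[OF fr.clinear_ser] ser_sect ser_polylog_word)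
    then show "x \<in> k_space" unfolding mem_k_space2 wc_ser by blast
  qed
  fix a b c assume a: "a \<in> cvec.span {XW}" and b: "b \<in> ?B" and c: "c \<in> range sect" and 0: "a + b + c = 0"
  obtain t where t: "a = t *\<^sub>C XW" using a by (auto simp: cvec.span_singleton)
  obtain z where z: "c = sect z" using c by blast
  note pl = lie_hom_clinear[OF lie_hom_proj5]
  have "fr.lam_brackets \<subseteq> fr.lam"
    using fr.words_bracket[where P = "\<lambda>A. LD \<in> A \<and> LE \<in> A" and Q = "\<lambda>A. LD \<in> A \<and> LE \<in> A"
        and S = "\<lambda>A. LD \<in> A \<and> LE \<in> A"] by auto
  from cvec.span_minimal[OF this fr.subspace_words] have lam: "b \<in> fr.lam"
    using b unfolding bracket_space_def by (rule set_mp)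
  have "proj5 (a + b + c) = z"
    using proj5_words[OF val5_words(1)] proj5_words[OF lam]
    by (simp add: t z clinear_add[OF pl] clinear_scaleC[OF pl] proj5_sect)
  then have z0: "z = 0" unfolding 0 by (simp add: clinear_0[OF pl])
  then show c0: "c = 0" by (simp add: z clinear_0[OF sect_linear])
  have "fr.ser XW = delta [LW]" using fr.ser_val[of LW] by (simp add: val5)
  moreover have "fr.ser b [LW] = 0" using fr.ser_words_support[OF lam, of "[LW]"] by auto
  moreover have "fr.ser (a + b + c) [LW] = 0" unfolding 0 by (simp add: clinear_0[OF fr.clinear_ser])
  ultimately have "t = 0"
    by (simp add: t c0 clinear_add[OF fr.clinear_ser] clinear_scaleC[OF fr.clinear_ser] clinear_0[OF fr.clinear_ser] delta_def)
  then show "a = 0" by (simp add: t)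
  then show "b = 0" using 0 c0 by simp
qed

end

theorem theorem2p3:
  fixes i1 i2 :: "'b::{finite,linorder}"
  assumes "CARD('a::{finite,linorder}) = 1"
    and "(UNIV :: 'b set) = {i1, i2}" and "i1 < i2"
  shows "(k_space :: 'a pt braid_lie set) = cvec.span {gen Beta Omega} \<and>
    is_direct_sum3 (k_space :: 'b pt braid_lie set)
      (cvec.span {gen Beta Omega})
      (bracket_space (lambda_ideal i1 i2) (lambda_ideal i1 i2))
      (range (sect :: 'b pt' braid_lie \<Rightarrow> 'b pt braid_lie))"
proof -
  obtain i0 :: 'a where i0: "(UNIV :: 'a set) = {i0}" using assms(1) by (rule card_1_singletonE)
  interpret one: one_point i0 by unfold_locales (rule i0)
  interpret two: two_points i1 i2 by unfold_locales (rule assms)+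
  show ?thesis using one.k_space1 two.k_space2 by blast
qed

end
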